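(* For all $\ell,R>0$ and $p\in\mathbb{N}$ there is some $n\in\mathbb{N}$ such that the diagonal infinite-volume correlation function $(z_1,\ldots,z_n)\mapsto\rho_n(z_1,\ldots,z_n;z_1,\ldots,z_n)$ has $p\ell^2/R$ as its smallest period with respect to simultaneous translations $x_j\mapsto x_j+\theta$ of all points along the cylinder axis.
   Context: Setting. $\mathcal{Z}=\mathbb{R}\times[0,2\pi R]$ is a cylinder of radius $R$, with points $z=x+iy$ and measure $dx\,dy$. Laughlin's function. For $N\in\mathbb{N}$, $$\Psi_N(z_1,\ldots,z_N)=\kappa_N\prod_{j<k}\bigl(e^{z_k/R}-e^{z_j/R}\bigr)^p\exp\Bigl(-\frac{1}{2\ell^2}\sum_k x_k^2\Bigr),$$ with $\kappa_N>0$ a normalizing constant. Finite-volume correlation functions. On the whole cylinder, $$\rho_n^{N,\mathcal{Z}}(z_1,\ldots,z_n;z'_1,\ldots,z'_n)=\frac{N!}{(N-n)!\,\|\Psi_N\|^2}\int_{\mathcal{Z}^{N-n}}\Psi_N(z_1,\ldots,z_n,z_{n+1},\ldots)\,\overline{\Psi_N(z'_1,\ldots,z'_n,z_{n+1},\ldots)}\,\prod_{j>n}dx_j\,dy_j .$$ Infinite-volume correlation functions. $\rho_n$ denotes the bulk limit of $\rho_n^{N,\mathcal{Z}}$ as $N\to\infty$: $\rho_n^{N,\mathcal{Z}}$ converges to $\rho_n$ uniformly at points whose $x$-coordinates have distance at least $d\to\infty$ from $0$ and from $pN\ell^2/R$. This limit exists, is unique, and is independent of the choice of domain of integration. *)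

theory Defs
  imports "HOL-Analysis.Analysis"
begin

definition cyl :: "real \<Rightarrow> complex set" where
  "cyl R = {z. 0 \<le> Im z \<and> Im z \<le> 2 * pi * R}"

definition cyl_measure :: "real \<Rightarrow> complex measure" where
  "cyl_measure R = restrict_space lborel (cyl R)"

text \<open>Laughlin's function for N particles (configurations indexed by 0..N-1),
  without the normalising constant kappa_N, which cancels in all correlation functions.\<close>
definition laughlin :: "real \<Rightarrow> real \<Rightarrow> nat \<Rightarrow> nat \<Rightarrow> (nat \<Rightarrow> complex) \<Rightarrow> complex" where
  "laughlin l R p N z =
     (\<Prod>k<N. \<Prod>j<k. (exp (z k / of_real R) - exp (z j / of_real R)) ^ p)
     * of_real (exp (- (1 / (2 * l\<^sup>2)) * (\<Sum>k<N. (Re (z k))\<^sup>2)))"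

definition laughlin_norm2 :: "real \<Rightarrow> real \<Rightarrow> nat \<Rightarrow> nat \<Rightarrow> real" where
  "laughlin_norm2 l R p N =
     integral\<^sup>L (PiM {..<N} (\<lambda>_. cyl_measure R)) (\<lambda>w. (cmod (laughlin l R p N w))\<^sup>2)"

definition rho_fin ::
  "real \<Rightarrow> real \<Rightarrow> nat \<Rightarrow> nat \<Rightarrow> nat \<Rightarrow> (nat \<Rightarrow> complex) \<Rightarrow> (nat \<Rightarrow> complex) \<Rightarrow> complex" where
  "rho_fin l R p N n z z' =
     of_real (fact N / (fact (N - n) * laughlin_norm2 l R p N)) *
     integral\<^sup>L (PiM {n..<N} (\<lambda>_. cyl_measure R))
       (\<lambda>w. laughlin l R p N (\<lambda>i. if i < n then z i else w i)
            * cnj (laughlin l R p N (\<lambda>i. if i < n then z' i else w i)))"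

definition bulk_configs :: "real \<Rightarrow> real \<Rightarrow> nat \<Rightarrow> nat \<Rightarrow> nat \<Rightarrow> real \<Rightarrow> (nat \<Rightarrow> complex) set" where
  "bulk_configs l R p N n d =
     {z. \<forall>j<n. z j \<in> cyl R \<and> d \<le> Re (z j) \<and> Re (z j) \<le> real p * real N * l\<^sup>2 / R - d}"

definition is_bulk_limit ::
  "real \<Rightarrow> real \<Rightarrow> nat \<Rightarrow> nat \<Rightarrow> ((nat \<Rightarrow> complex) \<Rightarrow> (nat \<Rightarrow> complex) \<Rightarrow> complex) \<Rightarrow> bool" where
  "is_bulk_limit l R p n f \<longleftrightarrow>
     (\<forall>\<epsilon>>0. \<exists>d N0. \<forall>N\<ge>N0. \<forall>z\<in>bulk_configs l R p N n d. \<forall>z'\<in>bulk_configs l R p N n d.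
        cmod (rho_fin l R p N n z z' - f z z') < \<epsilon>)"

definition cyl_configs :: "real \<Rightarrow> nat \<Rightarrow> (nat \<Rightarrow> complex) set" where
  "cyl_configs R n = {z. \<forall>j<n. z j \<in> cyl R}"

definition shift_x :: "real \<Rightarrow> (nat \<Rightarrow> complex) \<Rightarrow> (nat \<Rightarrow> complex)" where
  "shift_x \<theta> z = (\<lambda>j. z j + of_real \<theta>)"

definition is_period_on :: "(nat \<Rightarrow> complex) set \<Rightarrow> ((nat \<Rightarrow> complex) \<Rightarrow> complex) \<Rightarrow> real \<Rightarrow> bool" where
  "is_period_on C g \<theta> \<longleftrightarrow> (\<forall>z\<in>C. g (shift_x \<theta> z) = g z)"

definition smallest_period_on :: "(nat \<Rightarrow> complex) set \<Rightarrow> ((nat \<Rightarrow> complex) \<Rightarrow> complex) \<Rightarrow> real \<Rightarrow> bool" where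
  "smallest_period_on C g P \<longleftrightarrow>
     P > 0 \<and> is_period_on C g P \<and> (\<forall>\<theta>. 0 < \<theta> \<and> \<theta> < P \<longrightarrow> \<not> is_period_on C g \<theta>)"

end

theory Submission
 imports Defs "HOL-Probability.Probability" "HOL-Computational_Algebra.Polynomial"
  "HOL-Combinatorics.Multiset_Permutations"
begin

text \<open>
Expanding the Vandermonde power in lowest Landau level orbitals, centred at the multiples of
\<open>l^2 / R\<close>, turns the squared Laughlin function into a weight on multisets \<open>M\<close> of \<open>N\<close> occupied
orbitals. There is a renewal at \<open>i\<close> if the first \<open>p * i\<close> orbitals carry \<open>i\<close> particles with the
smallest possible total momentum \<open>0 + p + ... + p * (i - 1)\<close>; at a renewal the weight factorises.
Particle fluctuations are controlled by the energy of the associated one-dimensional Coulomb system.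
So the renewal theorem applies to the partition functions, renewals have positive density, and
correlations between renewals depend only on relative positions. This gives the bulk limit and its period.

For the symmetry breaking, multiply over all particles the phases
\<open>exp (- 2 \<pi> i ramp ((x / per - y) / L))\<close>. Between two renewals near the ends of the ramp both the
number of particles and the total momentum are fixed, so for large \<open>L\<close> the expectation is close
to a constant times \<open>exp (2 \<pi> i y)\<close>, which is not invariant under translations by a fraction
of \<open>per\<close>. The product is a function of finitely many, but not of a fixed number of particles; it becomes an
\<open>n\<close>-point observable by averaging the remaining factors over filler particles in a long window.
\<close>

section \<open>The renewal theorem\<close>

text \<open>The squared amplitudes give a genuine probability law on orbital configurations, but for
  general \<open>R\<close> no single configuration need dominate, so renewals cannot be found
  perturbatively. They come from a soft argument: the energy estimate yields
  \<open>Z (i + j) \<le> C * Z i * Z j\<close> next to the easy supermultiplicativity, so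
  \<open>Z n / r ^ n\<close> stays between positive constants, which forces a finite mean distance
  between renewals. The period is \<open>p\<close> orbital spacings, the room of one particle.
  Observables that depend on the \<open>x\<close> coordinates alone are diagonal in the orbitals,
  because integration over \<open>y\<close> separates angular momenta; a product over particles thus
  becomes a product over occupied orbitals. Off-diagonal products of amplitudes have no sign, so
  they are carried along as weights of multisets of pairs and bounded by diagonal ones. In the
  symmetry breaking the parameters are chosen in the order ramp length \<open>L\<close>, number of
  points \<open>n\<close>, filler window \<open>q\<close>, each depending on the earlier ones; this
  is why \<open>n\<close> is not explicit.\<close>

lemma renewal_shift_limsup:
 fixes w f :: "nat => real" and r :: "nat => nat"
 assumes ren: "!!n. n \<ge> 1 ==> w n = (\<Sum>i=1..n. f i * w (n - i))"
  and f0: "!!i. f i \<ge> 0" and f1: "f 1 > 0"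
  and fsum: "(\<lambda>J. \<Sum>i=1..J. f i) \<longlonglongrightarrow> 1" and fle: "!!J. (\<Sum>i=1..J. f i) \<le> 1"
  and bd: "!!n. \<bar>w n\<bar> \<le> 1"
  and up: "!!e. e > 0 ==> eventually (\<lambda>n. w n \<le> \<eta> + e) sequentially"
  and r: "filterlim r at_top sequentially" and lim: "(\<lambda>k. w (r k)) \<longlonglongrightarrow> \<eta>"
 shows "(\<lambda>k. w (r k - 1)) \<longlonglongrightarrow> \<eta>"
proof (rule LIMSEQ_I)
 fix e :: real assume e: "e > 0"
 have eta: "\<bar>\<eta>\<bar> \<le> 1"
  using tendsto_rabs[OF lim] bd by (intro LIMSEQ_le_const2) auto
 \<comment> \<open>The final estimate is \<open>f 1 * (\<eta> - w (r k - 1)) \<le> 5 * d\<close>,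
   which has to be below \<open>f 1 * e\<close>.\<close>
 define d where "d = f 1 * e / 8"
 have d: "d > 0" using e f1 by (simp add: d_def)
 from fsum have "eventually (\<lambda>J. \<bar>(\<Sum>i=1..J. f i) - 1\<bar> < d) sequentially"
  using d by (auto simp: tendsto_iff dist_real_def)
 then obtain J0 where J0: "!!J. J \<ge> J0 ==> \<bar>(\<Sum>i=1..J. f i) - 1\<bar> < d"
  by (auto simp: eventually_sequentially)
 define J where "J = max J0 1"
 have J: "\<bar>(\<Sum>i=1..J. f i) - 1\<bar> < d" "J \<ge> 1" using J0 by (auto simp: J_def)
 from up[OF d] obtain N0 where N0: "!!n. n \<ge> N0 ==> w n \<le> \<eta> + d"
  by (auto simp: eventually_sequentially)
 \<comment> \<open>\<open>w n\<close> is an average of earlier values, and the recent ones are at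
   most \<open>\<eta> + d\<close>. If \<open>w n\<close> is close to the upper limit
   \<open>\<eta>\<close>, then so is \<open>w (n - 1)\<close>, since it enters with weight
   \<open>f 1 > 0\<close>. The errors are the excess over \<open>\<eta>\<close>, the mass missing
   from \<open>{1..J}\<close> and the terms beyond \<open>J\<close>.\<close>
 have key: "w n \<le> f 1 * w (n - 1) + (1 - f 1) * \<eta> + 4 * d" if n: "n \<ge> N0 + J + 1" for n
 proof -
  have split: "{1..n} = insert 1 ({2..J} \<union> {J<..n})" using n J by auto
  have disj: "{2..J} \<inter> {J<..n} = {}" and nin: "1 \<notin> {2..J} \<union> {J<..n}" using J by auto
  have f1le: "f 1 \<le> 1" using fle[of 1] by simp
  have sJ: "(\<Sum>i=1..J. f i) = f 1 + (\<Sum>i=2..J. f i)"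
   using J by (subst sum.atLeast_Suc_atMost) (auto simp: numeral_2_eq_2)
  have sn: "(\<Sum>i=1..n. f i) = f 1 + (\<Sum>i=2..J. f i) + (\<Sum>i\<in>{J<..n}. f i)"
   unfolding split using nin disj by simp (simp add: sum.union_disjoint)
  have tail: "(\<Sum>i\<in>{J<..n}. f i) \<le> d"
   using sn sJ fle[of n] J by linarith
  have mid: "(\<Sum>i=2..J. f i) \<ge> 1 - f 1 - d" "(\<Sum>i=2..J. f i) \<le> 1 - f 1"
   using sJ J fle[of J] by linarith+
  have "w n = (\<Sum>i=1..n. f i * w (n - i))" using n by (intro ren) auto
  also have "... = f 1 * w (n - 1) + (\<Sum>i=2..J. f i * w (n - i)) + (\<Sum>i\<in>{J<..n}. f i * w (n - i))"
   unfolding split using nin disj by simp (simp add: sum.union_disjoint)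
  also have "(\<Sum>i=2..J. f i * w (n - i)) \<le> (\<Sum>i=2..J. f i * (\<eta> + d))"
   using n by (intro sum_mono mult_left_mono N0 f0) auto
  also have "... = (\<Sum>i=2..J. f i) * (\<eta> + d)" by (simp add: sum_distrib_right)
  also have "... \<le> (1 - f 1) * \<eta> + 2 * d"
  proof -
   define s where "s = (\<Sum>i=2..J. f i)"
   have s: "s \<ge> 1 - f 1 - d" "s \<le> 1 - f 1" using mid by (auto simp: s_def)
   have "(s - (1 - f 1)) * \<eta> \<le> \<bar>s - (1 - f 1)\<bar> * \<bar>\<eta>\<bar>"
    by (metis abs_ge_self abs_mult)
   also have "... \<le> d * 1" using s eta d by (intro mult_mono) auto
   finally have 1: "s * \<eta> \<le> (1 - f 1) * \<eta> + d" by (simp add: algebra_simps)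
   have "s * d \<le> 1 * d" using s f1 d by (intro mult_right_mono) auto
   thus ?thesis using 1 by (simp add: s_def algebra_simps)
  qed
  also have "(\<Sum>i\<in>{J<..n}. f i * w (n - i)) \<le> (\<Sum>i\<in>{J<..n}. f i * 1)"
   using bd by (intro sum_mono mult_left_mono f0) (auto simp: abs_le_iff)
  also have "... \<le> d" using tail by simp
  finally show ?thesis using d by linarith
 qed
 have "eventually (\<lambda>k. \<bar>w (r k) - \<eta>\<bar> < d) sequentially"
  using lim d by (auto simp: tendsto_iff dist_real_def)
 moreover have "eventually (\<lambda>k. r k \<ge> N0 + J + 1) sequentially"
  using r by (auto simp: filterlim_at_top)
 ultimately have "eventually (\<lambda>k. \<bar>w (r k - 1) - \<eta>\<bar> < e) sequentially"
 proof eventually_elim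
  case (elim k)
  have "f 1 * (\<eta> - w (r k - 1)) \<le> 5 * d"
   using key[OF elim(2)] elim(1) by (simp add: algebra_simps abs_less_iff)
  also have "... < f 1 * e" using e f1 by (simp add: d_def)
  finally have "\<eta> - w (r k - 1) < e" using f1 by simp
  moreover have "w (r k - 1) \<le> \<eta> + d" using elim(2) by (intro N0) auto
  moreover have "d < e"
  proof -
   have "f 1 \<le> 1" using fle[of 1] by simp
   hence "f 1 * e \<le> 1 * e" using e by (intro mult_right_mono) auto
   thus ?thesis using e by (simp add: d_def)
  qed
  ultimately show ?case by (auto simp: abs_less_iff)
 qed
 thus "\<exists>no. \<forall>n\<ge>no. norm (w (r n - 1) - \<eta>) < e" by (simp add: eventually_sequentially)
qed

text \<open>Along a subsequence realising the limsup \<open>\<eta>\<close>, all backward shifts also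
  tend to \<open>\<eta>\<close>, by iterating the previous lemma. The convolution with the tails
  \<open>\<rho>\<close> is conserved, and Tannery's theorem passes to the limit in it, which
  determines \<open>\<eta>\<close>.\<close>

lemma renewal_limsup_value:
 fixes w f :: "nat => real"
 assumes ren: "!!n. n \<ge> 1 ==> w n = (\<Sum>i=1..n. f i * w (n - i))"
  and f0: "!!i. f i \<ge> 0" and f1: "f 1 > 0"
  and fsum: "(\<lambda>J. \<Sum>i=1..J. f i) \<longlonglongrightarrow> 1" and fle: "!!J. (\<Sum>i=1..J. f i) \<le> 1"
  and bd: "!!n. \<bar>w n\<bar> \<le> 1"
  and rho: "!!j. \<rho> j = 1 - (\<Sum>i=1..j. f i)" and srho: "summable \<rho>"
  and conv: "!!n. (\<Sum>j\<le>n. \<rho> j * w (n - j)) = b"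
 obtains \<eta> where "\<eta> * suminf \<rho> = b" "!!e. e > 0 ==> eventually (\<lambda>n. w n \<le> \<eta> + e) sequentially"
proof -
 define L where "L = limsup (\<lambda>n. ereal (w n))"
 have "L \<le> 1" unfolding L_def
  using bd by (intro Limsup_bounded) (auto simp: abs_le_iff one_ereal_def)
 moreover have "L \<ge> -1" unfolding L_def
  by (rule order_trans[OF Liminf_bounded Liminf_le_Limsup])
    (use bd in \<open>auto simp: abs_le_iff one_ereal_def minus_le_iff intro!: always_eventually\<close>)
 ultimately obtain \<eta> where \<eta>: "L = ereal \<eta>"
  by (cases L) (auto simp: one_ereal_def)
 have up: "eventually (\<lambda>n. w n \<le> \<eta> + e) sequentially" if "e > 0" for e
 proof -
  have "limsup (\<lambda>n. ereal (w n)) < ereal (\<eta> + e)" using \<eta> that by (simp add: L_def)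
  from Limsup_lessD[OF this] show ?thesis by eventually_elim auto
 qed
 obtain r where r: "strict_mono r" "((\<lambda>n. ereal (w n)) \<circ> r) \<longlonglongrightarrow> L"
  using limsup_subseq_lim[of "\<lambda>n. ereal (w n)"] by (auto simp: L_def)
 have lim0: "(\<lambda>k. w (r k)) \<longlonglongrightarrow> \<eta>" using r(2) \<eta> by (simp add: o_def)
 have rt: "filterlim (\<lambda>k. r k - j) at_top sequentially" for j
 proof -
  have "filterlim r at_top sequentially" using r(1) by (rule filterlim_subseq)
  hence *: "\<forall>\<^sub>F k in sequentially. Z + j \<le> r k" for Z by (simp add: filterlim_at_top)
  show ?thesis unfolding filterlim_at_top
  proof
   fix Z show "\<forall>\<^sub>F k in sequentially. Z \<le> r k - j" using *[of Z] by eventually_elim auto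
  qed
 qed
 have rt0: "\<forall>\<^sub>F n in sequentially. k \<le> r n" for k
  using rt[of 0] by (simp add: filterlim_at_top)
 have lim: "(\<lambda>k. w (r k - j)) \<longlonglongrightarrow> \<eta>" for j
 proof (induction j)
  case (Suc j)
  have "(\<lambda>k. w (r k - j - 1)) \<longlonglongrightarrow> \<eta>"
   by (rule renewal_shift_limsup[OF ren f0 f1 fsum fle bd up rt Suc])
  thus ?case by simp
 qed (use lim0 in simp)
 have rho0: "\<rho> j \<ge> 0" for j using fle[of j] rho by simp
 have "(\<lambda>k. \<Sum>j. (if j \<le> r k then \<rho> j * w (r k - j) else 0)) \<longlonglongrightarrow> (\<Sum>j. \<rho> j * \<eta>)"
 proof (rule tannerys_theorem[where M = \<rho>, THEN conjunct2, THEN conjunct2])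
  show "((\<lambda>n. if k \<le> r n then \<rho> k * w (r n - k) else 0) \<longlongrightarrow> \<rho> k * \<eta>) sequentially" for k
  proof (rule Lim_transform_eventually[OF tendsto_mult_left[OF lim[of k]]])
   show "\<forall>\<^sub>F x in sequentially. \<rho> k * w (r x - k) = (if k \<le> r x then \<rho> k * w (r x - k) else 0)"
    using rt0[of k] by eventually_elim auto
  qed
  show "\<forall>\<^sub>F (k, n) in sequentially \<times>\<^sub>F sequentially. norm (if k \<le> r n then \<rho> k * w (r n - k) else 0) \<le> \<rho> k"
   using bd rho0 by (intro always_eventually) (auto simp: abs_mult mult_left_le)
 qed (use srho in auto)
 moreover have "(\<Sum>j. (if j \<le> r k then \<rho> j * w (r k - j) else 0)) = b" for k
 proof -
  have "(\<Sum>j. (if j \<le> r k then \<rho> j * w (r k - j) else 0)) = (\<Sum>j\<le>r k. \<rho> j * w (r k - j))"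
   by (subst suminf_finite[of "{..r k}"]) auto
  thus ?thesis using conv by simp
 qed
 ultimately have "(\<Sum>j. \<rho> j * \<eta>) = b" by (simp add: LIMSEQ_const_iff)
 hence "\<eta> * suminf \<rho> = b" using suminf_mult[OF srho, of \<eta>] by (simp add: mult.commute)
 thus thesis using up that by blast
qed

text \<open>The lower bound on \<open>u\<close> replaces the usual probabilistic input: the identity
  \<open>conv\<close> and \<open>u \<ge> c\<close> show that the tails \<open>\<rho>\<close> are
  nonnegative with sum at most \<open>1 / c\<close>, that is, \<open>f\<close> is a probability
  vector with finite mean. Aperiodicity is \<open>f 1 > 0\<close>.\<close>

lemma renewal_theorem_bounded_below:
 fixes u f :: "nat => real"
 assumes u0: "u 0 = 1" and ren: "!!n. n \<ge> 1 ==> u n = (\<Sum>i=1..n. f i * u (n - i))"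
  and f0: "!!i. f i \<ge> 0" and f1: "f 1 > 0"
  and c: "c > 0" and lo: "!!n. c \<le> u n" and hi: "!!n. u n \<le> 1"
 obtains v where "v > 0" "u \<longlonglongrightarrow> v"
proof -
 define \<rho> where "\<rho> j = 1 - (\<Sum>i=1..j. f i)" for j
 have conv: "(\<Sum>j\<le>n. \<rho> j * u (n - j)) = 1" for n
 proof (induction n)
  case (Suc n)
  have "(\<Sum>j\<le>Suc n. \<rho> j * u (Suc n - j)) = u (Suc n) + (\<Sum>j\<le>n. \<rho> (Suc j) * u (n - j))"
   by (subst sum.atMost_Suc_shift) (simp add: \<rho>_def)
  also have "(\<Sum>j\<le>n. \<rho> (Suc j) * u (n - j)) = (\<Sum>j\<le>n. \<rho> j * u (n - j)) - (\<Sum>j\<le>n. f (Suc j) * u (n - j))"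
   by (simp add: \<rho>_def sum_subtractf[symmetric] algebra_simps)
  also have "(\<Sum>j\<le>n. f (Suc j) * u (n - j)) = u (Suc n)"
  proof -
   have "u (Suc n) = (\<Sum>i=Suc 0..Suc n. f i * u (Suc n - i))" using ren[of "Suc n"] by simp
   also have "... = (\<Sum>i=0..n. f (Suc i) * u (n - i))"
    by (subst sum.shift_bounds_cl_Suc_ivl) simp
   finally show ?thesis by (simp add: atMost_atLeast0)
  qed
  finally show ?case using Suc by simp
 qed (simp add: \<rho>_def u0)
 have dec: "\<rho> j \<le> \<rho> i" if "i \<le> j" for i j
  unfolding \<rho>_def using that f0 by (auto intro!: sum_mono2)
 \<comment> \<open>The tails decrease. Were one negative, every later term of the convolution would
   be at most \<open>- a\<close>, against at most \<open>J\<close> from the first \<open>J\<close>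
   terms, and the sum could not remain 1.\<close>
 have rho0: "\<rho> J \<ge> 0" for J
 proof (rule ccontr)
  assume neg: "\<not> \<rho> J \<ge> 0"
  define a where "a = - \<rho> J * c"
  have a: "a > 0" using neg c by (simp add: a_def mult_neg_pos)
  obtain n :: nat where n: "real n * a > J + 1" using a by (metis reals_Archimedean3)
  have "1 = (\<Sum>j\<le>J+n. \<rho> j * u (J + n - j))" using conv[of "J + n"] by simp
  also have "... \<le> (\<Sum>j\<le>J+n. if j < J then 1 else - a)"
  proof (rule sum_mono)
   fix j assume "j \<in> {..J+n}"
   have r1: "\<rho> j \<le> 1" using dec[of 0 j] by (simp add: \<rho>_def)
   show "\<rho> j * u (J + n - j) \<le> (if j < J then 1 else - a)"
   proof (cases "j < J")
    case True
    have "u (J + n - j) \<ge> 0" using lo[of "J + n - j"] c by linarith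
    hence "\<rho> j * u (J + n - j) \<le> 1 * u (J + n - j)" using r1 by (intro mult_right_mono) auto
    also have "... \<le> 1" using hi by simp
    finally have "\<rho> j * u (J + n - j) \<le> 1" .
    thus ?thesis using True by simp
   next
    case False
    have "\<rho> j \<le> \<rho> J" using False dec by auto
    hence "\<rho> j * u (J + n - j) \<le> \<rho> J * u (J + n - j)"
     using lo[of "J + n - j"] c by (intro mult_right_mono) auto
    also have "... \<le> \<rho> J * c" using neg lo by (intro mult_left_mono_neg) auto
    finally show ?thesis using False by (simp add: a_def)
   qed
  qed
  also have "... \<le> real J - real n * a"
  proof -
   have eq: "{..J+n} = {..<J} \<union> {J..J+n}" by auto
   have "(\<Sum>j\<le>J+n. if j < J then 1 else - a) = (\<Sum>j<J. 1) + (\<Sum>j=J..J+n. - a)"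
    by (subst eq, subst sum.union_disjoint) auto
   also have "... = real J - real (n + 1) * a" by (simp add: of_nat_diff)
   finally show ?thesis using a by (simp add: algebra_simps)
  qed
  finally show False using n by linarith
 qed
 have part: "(\<Sum>j\<le>n. \<rho> j) \<le> 1 / c" for n
 proof -
  have "(\<Sum>j\<le>n. \<rho> j) * c \<le> (\<Sum>j\<le>n. \<rho> j * u (n - j))"
   unfolding sum_distrib_right using lo rho0 by (intro sum_mono mult_left_mono) auto
  thus ?thesis using conv[of n] c by (simp add: field_simps)
 qed
 have srho: "summable \<rho>"
 proof (rule bounded_imp_summable[where B = "1/c"])
  show "0 \<le> \<rho> n" for n by (rule rho0)
  show "(\<Sum>k\<le>n. \<rho> k) \<le> 1 / c" for n by (rule part)
 qed
 hence "\<rho> \<longlonglongrightarrow> 0" by (rule summable_LIMSEQ_zero)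
 hence fsum: "(\<lambda>J. \<Sum>i=1..J. f i) \<longlonglongrightarrow> 1"
  using tendsto_diff[OF tendsto_const[of 1], of \<rho> 0] by (simp add: \<rho>_def)
 have fle: "(\<Sum>i=1..J. f i) \<le> 1" for J using rho0[of J] by (simp add: \<rho>_def)
 have mu: "suminf \<rho> \<ge> 1"
  using sum_le_suminf[OF srho, of "{0}"] rho0 by (simp add: \<rho>_def)
 have bd: "\<bar>u n\<bar> \<le> 1" for n using lo[of n] hi[of n] c by (simp add: abs_le_iff)
 obtain e1 where e1: "e1 * suminf \<rho> = 1" "!!e. e > 0 ==> eventually (\<lambda>n. u n \<le> e1 + e) sequentially"
  using renewal_limsup_value[OF ren f0 f1 fsum fle bd \<rho>_def srho conv] by blast
 \<comment> \<open>The recursion is linear, so the limsup lemma applied to \<open>- u\<close>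
   computes the liminf of \<open>u\<close>; both values are
   \<open>1 / suminf \<rho>\<close>.\<close>
 have ren': "- u n = (\<Sum>i=1..n. f i * - u (n - i))" if "n \<ge> 1" for n
  using ren[OF that] by (simp add: sum_negf)
 have bd': "\<bar>- u n\<bar> \<le> 1" for n using bd[of n] by simp
 have conv': "(\<Sum>j\<le>n. \<rho> j * - u (n - j)) = -1" for n
  using conv[of n] by (simp add: sum_negf)
 obtain e2 where e2: "e2 * suminf \<rho> = -1" "!!e. e > 0 ==> eventually (\<lambda>n. - u n \<le> e2 + e) sequentially"
 proof (rule renewal_limsup_value[where w = "\<lambda>n. - u n" and f = f and \<rho> = \<rho> and b = "-1"])
  show "- u n = (\<Sum>i=1..n. f i * - u (n - i))" if "1 \<le> n" for n using that by (rule ren')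
  show "(\<Sum>j\<le>n. \<rho> j * - u (n - j)) = -1" for n by (rule conv')
  show "\<bar>- u n\<bar> \<le> 1" for n by (rule bd')
  show "\<rho> j = 1 - sum f {1..j}" for j by (rule \<rho>_def)
 qed (use f0 f1 fsum fle srho that in auto)
 have "(e1 + e2) * suminf \<rho> = 0" using e1(1) e2(1) by (simp add: algebra_simps)
 hence e12: "e2 = - e1" using mu by auto
 have "u \<longlonglongrightarrow> e1"
 proof (rule LIMSEQ_I)
  fix e :: real assume "e > 0"
  hence "e / 2 > 0" by simp
  from e1(2)[OF this] e2(2)[OF this]
  have "eventually (\<lambda>n. norm (u n - e1) < e) sequentially"
   by eventually_elim (use \<open>e > 0\<close> e12 in auto)
  thus "\<exists>no. \<forall>n\<ge>no. norm (u n - e1) < e" by (simp add: eventually_sequentially)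
 qed
 moreover have "e1 > 0" using e1(1) mu by (metis less_le_trans mult_nonpos_nonneg not_less zero_less_one less_imp_le)
 ultimately show thesis using that by blast
qed

section \<open>Coefficients of the Vandermonde power\<close>

definition nlists :: "nat => nat => nat list set" where
 "nlists N Q = {xs. set xs \<subseteq> {..<Q} & length xs = N}"

definition monom_at :: "(nat => complex) => nat list => complex" where
 "monom_at Z xs = (\<Prod>i<length xs. Z i ^ (xs ! i))"

definition vandermonde_pow :: "nat => nat => (nat => complex) => complex" where
 "vandermonde_pow p N Z = (\<Prod>k<N. \<Prod>j<k. (Z k - Z j) ^ p)"

definition tri :: "nat => nat => nat" where
 "tri p N = (\<Sum>j<N. p * j)"

text \<open>The third component numbers the \<open>p\<close> copies of the factor belonging to a
  pair of indices.\<close>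

definition factors :: "nat => nat => (nat \<times> nat \<times> nat) set" where
 "factors p N = (SIGMA k:{..<N}. {..<k} \<times> {..<p})"

definition score :: "nat => nat => (nat \<times> nat \<times> nat) set => nat list" where
 "score p N X = map (\<lambda>i. card {e \<in> X. fst e = i} + card {e \<in> factors p N - X. fst (snd e) = i}) [0..<N]"

text \<open>Expanding the product means choosing, in each factor, one of its two variables; \<open>X\<close> is the
 set of factors in which the variable with the larger index is chosen.\<close>
definition vcoeff :: "nat => nat list => int" where
 "vcoeff p xs = (\<Sum>X | X \<subseteq> factors p (length xs) & score p (length xs) X = xs.
   (-1) ^ card (factors p (length xs) - X))"

lemma finite_nlists [simp]: "finite (nlists N Q)"
 unfolding nlists_def by (rule finite_lists_length_eq) simp

lemma finite_factors [simp]: "finite (factors p N)"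
 unfolding factors_def by simp

lemma card_factors: "card (factors p N) = tri p N"
 unfolding factors_def tri_def by (subst card_SigmaI) (auto simp: card_cartesian_product mult.commute)

lemma length_score [simp]: "length (score p N X) = N"
 by (simp add: score_def)

lemma sum_list_score:
 assumes "X \<subseteq> factors p N"
 shows "sum_list (score p N X) = tri p N"
proof -
 have fX: "finite X" using finite_subset[OF assms(1) finite_factors] .
 have 1: "(\<Sum>i<N. card {e \<in> X. fst e = i}) = card X"
 proof -
  have "card X = card (\<Union>i<N. {e \<in> X. fst e = i})"
   using assms by (intro arg_cong[where f=card]) (auto simp: factors_def)
  also have "... = (\<Sum>i<N. card {e \<in> X. fst e = i})" using fX by (subst card_UN_disjoint) auto
  finally show ?thesis by simp
 qed
 have 2: "(\<Sum>i<N. card {e \<in> factors p N - X. fst (snd e) = i}) = card (factors p N - X)"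
 proof -
  have "card (factors p N - X) = card (\<Union>i<N. {e \<in> factors p N - X. fst (snd e) = i})"
   by (intro arg_cong[where f=card]) (auto simp: factors_def)
  also have "... = (\<Sum>i<N. card {e \<in> factors p N - X. fst (snd e) = i})" by (subst card_UN_disjoint) auto
  finally show ?thesis by simp
 qed
 have "sum_list (score p N X) = card X + card (factors p N - X)"
  unfolding score_def by (simp add: sum_list_distinct_conv_sum_set sum.distrib atLeast0LessThan 1[symmetric] 2[symmetric])
 also have "... = card (factors p N)"
  using assms fX by (metis card_Diff_subset card_mono finite_factors le_add_diff_inverse)
 finally show ?thesis by (simp add: card_factors)
qed

text \<open>A variable occurs in exactly \<open>p * (N - 1)\<close> factors. The injection sends a
  factor to its other index and its copy number. This confines the occupied orbitals to
  \<open>{..<p * N}\<close>.\<close>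

lemma score_le:
 assumes "X \<subseteq> factors p N" "x \<in> set (score p N X)"
 shows "x \<le> p * (N - 1)" "N \<ge> 1"
proof -
 from assms obtain i where i: "i < N"
  "x = card {e \<in> X. fst e = i} + card {e \<in> factors p N - X. fst (snd e) = i}"
  by (auto simp: score_def)
 let ?A = "{e \<in> X. fst e = i}" and ?B = "{e \<in> factors p N - X. fst (snd e) = i}"
 have fX: "finite X" using finite_subset[OF assms(1) finite_factors] .
 have dis: "?A \<inter> ?B = {}" by auto
 have "x = card (?A \<union> ?B)" using i fX by (subst card_Un_disjoint[OF _ _ dis]) auto
 also have "... \<le> card (({..<N} - {i}) \<times> {..<p})"
 proof (rule card_inj_on_le[where f = "\<lambda>e. (if fst e = i then fst (snd e) else fst e, snd (snd e))"])
  show "inj_on (\<lambda>e. (if fst e = i then fst (snd e) else fst e, snd (snd e))) (?A \<union> ?B)"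
   using assms(1) by (auto simp: inj_on_def factors_def split: if_splits)
 next
  show "(\<lambda>e. (if fst e = i then fst (snd e) else fst e, snd (snd e))) ` (?A \<union> ?B) \<subseteq> ({..<N} - {i}) \<times> {..<p}"
   using assms(1) i by (auto simp: factors_def)
 qed auto
 also have "... = p * (N - 1)" using i by (simp add: card_cartesian_product)
 finally show "x \<le> p * (N - 1)" .
 show "N \<ge> 1" using i by simp
qed

lemma score_in_nlists:
 assumes "X \<subseteq> factors p N" "p \<ge> 1"
 shows "score p N X \<in> nlists N (p * N)"
proof -
 have "x < p * N" if "x \<in> set (score p N X)" for x
 proof -
  have "x \<le> p * (N - 1)" "N \<ge> 1" using score_le[OF assms(1) that] by auto
  moreover have "p * (N - 1) < p * N" using assms(2) \<open>N \<ge> 1\<close> by simp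
  ultimately show ?thesis by linarith
 qed
 thus ?thesis by (auto simp: nlists_def)
qed

lemma vcoeff_nonzeroD:
 assumes "vcoeff p xs \<noteq> 0"
 shows "sum_list xs = tri p (length xs)" "x \<in> set xs ==> x \<le> p * (length xs - 1)"
  "p \<ge> 1 ==> xs \<in> nlists (length xs) (p * length xs)"
proof -
 from assms obtain X where "X \<subseteq> factors p (length xs)" "score p (length xs) X = xs"
  unfolding vcoeff_def by (metis (mono_tags, lifting) mem_Collect_eq sum.not_neutral_contains_not_neutral)
 thus "sum_list xs = tri p (length xs)" "x \<in> set xs ==> x \<le> p * (length xs - 1)"
  "p \<ge> 1 ==> xs \<in> nlists (length xs) (p * length xs)"
  using sum_list_score score_le score_in_nlists by metis+
qed

lemma vandermonde_pow_expand:
 assumes "p \<ge> 1"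
 shows "vandermonde_pow p N Z = (\<Sum>xs\<in>nlists N (p * N). of_int (vcoeff p xs) * monom_at Z xs)"
proof -
 let ?E = "factors p N"
 have "vandermonde_pow p N Z = (\<Prod>e\<in>?E. Z (fst e) + (- Z (fst (snd e))))"
 proof -
  have "(\<Prod>j<k. (Z k - Z j) ^ p) = (\<Prod>y\<in>{..<k} \<times> {..<p}. Z k + (- Z (fst y)))" for k
  proof -
   have "(\<Prod>y\<in>{..<k} \<times> {..<p}. Z k + (- Z (fst y))) = (\<Prod>j<k. \<Prod>q<p. Z k + (- Z j))"
    by (simp only: prod.cartesian_product case_prod_unfold)
   thus ?thesis by simp
  qed
  hence "vandermonde_pow p N Z = (\<Prod>k<N. \<Prod>y\<in>{..<k} \<times> {..<p}. Z k + (- Z (fst y)))"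
   unfolding vandermonde_pow_def by simp
  also have "... = (\<Prod>(k, y)\<in>?E. Z k + (- Z (fst y)))"
   unfolding factors_def by (rule prod.Sigma) auto
  finally show ?thesis by (simp only: case_prod_unfold)
 qed
 also have "... = (\<Sum>X\<in>Pow ?E. (\<Prod>e\<in>X. Z (fst e)) * (\<Prod>e\<in>?E - X. - Z (fst (snd e))))"
  by (rule prod_add) simp
 also have "... = (\<Sum>X\<in>Pow ?E. (-1) ^ card (?E - X) * monom_at Z (score p N X))"
 proof (rule sum.cong[OF refl])
  fix X assume X: "X \<in> Pow ?E"
  hence fX: "finite X" using finite_subset[OF _ finite_factors] by blast
  have 1: "(\<Prod>e\<in>X. Z (fst e)) = (\<Prod>i<N. Z i ^ card {e \<in> X. fst e = i})"
  proof -
   have "(\<Prod>e\<in>X. Z (fst e)) = (\<Prod>i<N. \<Prod>e\<in>{e \<in> X. fst e = i}. Z (fst e))"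
    by (rule prod.group[symmetric]) (use X fX in \<open>auto simp: factors_def\<close>)
   also have "... = (\<Prod>i<N. \<Prod>e\<in>{e \<in> X. fst e = i}. Z i)" by (intro prod.cong) auto
   finally show ?thesis by simp
  qed
  have 2: "(\<Prod>e\<in>?E - X. - Z (fst (snd e))) = (-1) ^ card (?E - X) * (\<Prod>i<N. Z i ^ card {e \<in> ?E - X. fst (snd e) = i})"
  proof -
   have "(\<Prod>e\<in>?E - X. Z (fst (snd e))) = (\<Prod>i<N. \<Prod>e\<in>{e \<in> ?E - X. fst (snd e) = i}. Z (fst (snd e)))"
    by (rule prod.group[symmetric]) (auto simp: factors_def)
   also have "... = (\<Prod>i<N. \<Prod>e\<in>{e \<in> ?E - X. fst (snd e) = i}. Z i)" by (intro prod.cong) auto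
   finally have "(\<Prod>e\<in>?E - X. Z (fst (snd e))) = (\<Prod>i<N. Z i ^ card {e \<in> ?E - X. fst (snd e) = i})" by simp
   thus ?thesis by (simp add: prod_uminus)
  qed
  show "(\<Prod>e\<in>X. Z (fst e)) * (\<Prod>e\<in>?E - X. - Z (fst (snd e))) = (-1) ^ card (?E - X) * monom_at Z (score p N X)"
   unfolding 1 2 monom_at_def by (simp add: score_def power_add prod.distrib)
 qed
 also have "... = (\<Sum>xs\<in>nlists N (p * N). \<Sum>X\<in>{X \<in> Pow ?E. score p N X = xs}. (-1) ^ card (?E - X) * monom_at Z (score p N X))"
  by (rule sum.group[symmetric]) (use score_in_nlists assms in auto)
 also have "... = (\<Sum>xs\<in>nlists N (p * N). of_int (vcoeff p xs) * monom_at Z xs)"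
 proof (rule sum.cong[OF refl])
  fix xs assume "xs \<in> nlists N (p * N)"
  hence l: "length xs = N" by (simp add: nlists_def)
  show "(\<Sum>X\<in>{X \<in> Pow ?E. score p N X = xs}. (-1) ^ card (?E - X) * monom_at Z (score p N X)) = of_int (vcoeff p xs) * monom_at Z xs"
   unfolding vcoeff_def l of_int_sum sum_distrib_right by (intro sum.cong) auto
 qed
 finally show ?thesis .
qed

lemma nlists_Suc: "nlists (Suc N) Q = (\<lambda>(x, xs). x # xs) ` ({..<Q} \<times> nlists N Q)"
 by (auto simp: nlists_def length_Suc_conv image_iff)

lemma sum_nlists_Suc:
 "(\<Sum>xs\<in>nlists (Suc N) Q. f xs) = (\<Sum>x<Q. \<Sum>xs\<in>nlists N Q. f (x # xs))"
 unfolding nlists_Suc by (subst sum.reindex) (auto simp: inj_on_def sum.cartesian_product case_prod_unfold)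

lemma monom_at_Cons: "monom_at Z (x # xs) = Z 0 ^ x * monom_at (\<lambda>i. Z (Suc i)) xs"
 unfolding monom_at_def by (simp add: prod.lessThan_Suc_shift del: prod.lessThan_Suc)

text \<open>Induction on the number of variables: with all but the first fixed, the sum is a
  polynomial in one variable that vanishes identically.\<close>

lemma monomials_independent:
 assumes "!!Z. (\<Sum>xs\<in>nlists N Q. c xs * monom_at Z xs) = 0" "xs \<in> nlists N Q"
 shows "c xs = (0::complex)"
 using assms
proof (induction N arbitrary: c xs)
 case 0
 have "nlists 0 Q = {[]}" by (auto simp: nlists_def)
 thus ?case using 0 by (simp add: monom_at_def)
next
 case (Suc N)
 from Suc.prems(2) obtain x ys where x: "xs = x # ys" "x < Q" "ys \<in> nlists N Q"
  by (auto simp: nlists_Suc)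
 have "(\<Sum>ys\<in>nlists N Q. c (x # ys) * monom_at Z ys) = 0" for Z
 proof -
  obtain n where n: "Q = Suc n" using x by (cases Q) auto
  have "(\<Sum>i\<le>n. (\<Sum>ys\<in>nlists N Q. c (i # ys) * monom_at Z ys) * t ^ i) = 0" for t
  proof -
   have "0 = (\<Sum>xs\<in>nlists (Suc N) Q. c xs * monom_at (case_nat t Z) xs)" using Suc.prems(1) by simp
   also have "... = (\<Sum>i<Q. \<Sum>ys\<in>nlists N Q. c (i # ys) * monom_at (case_nat t Z) (i # ys))"
    by (rule sum_nlists_Suc)
   also have "... = (\<Sum>i\<le>n. (\<Sum>ys\<in>nlists N Q. c (i # ys) * monom_at Z ys) * t ^ i)"
    unfolding n lessThan_Suc_atMost sum_distrib_right by (intro sum.cong) (auto simp: monom_at_Cons)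
   finally show ?thesis by simp
  qed
  hence "\<forall>i\<le>n. (\<Sum>ys\<in>nlists N Q. c (i # ys) * monom_at Z ys) = 0"
   using polyfun_eq_0[of "\<lambda>i. \<Sum>ys\<in>nlists N Q. c (i # ys) * monom_at Z ys" n] by blast
  thus ?thesis using x n by auto
 qed
 from Suc.IH[OF this x(3)] show ?case using x by simp
qed

text \<open>A permutation changes each of the two powers by the same sign, so their product is
  invariant for even and odd \<open>p\<close> alike. Treating products of two avoids tracking the
  sign.\<close>

lemma vandermonde_pow_permute:
 assumes f: "f permutes {..<N}"
 shows "vandermonde_pow p N (Z \<circ> f) * vandermonde_pow p N (Z' \<circ> f) = vandermonde_pow p N Z * vandermonde_pow p N Z'"
proof -
 define s where "s i j = ((Z i - Z j) * (Z' i - Z' j)) ^ p" for i j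
 \<comment> \<open>The combined factor of a pair is symmetric, so the pair may be sorted again after
   the permutation; this is what \<open>?h\<close> does.\<close>
 have sym: "s i j = s j i" for i j
  unfolding s_def by (simp add: algebra_simps)
 define E where "E = (SIGMA k:{..<N}. {..<k})"
 have eq: "vandermonde_pow p N (Z \<circ> g) * vandermonde_pow p N (Z' \<circ> g) = (\<Prod>(k, j)\<in>E. s (g k) (g j))" for g
  unfolding vandermonde_pow_def E_def
  by (subst prod.Sigma[symmetric]) (auto simp: prod.distrib[symmetric] s_def power_mult_distrib)
 have smm: "s (max a b) (min a b) = s a b" for a b by (simp add: max_def min_def sym)
 let ?h = "\<lambda>g (k, j). (max (g k) (g j), min (g k) (g j))"
 let ?f' = "inv f"
 have f': "?f' permutes {..<N}" using f by (rule permutes_inv)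
 have bnd: "f k < N" "?f' k < N" if "k < N" for k using that permutes_in_image[OF f] permutes_in_image[OF f'] by auto
 have inj: "f a = f b \<longleftrightarrow> a = b" "?f' a = ?f' b \<longleftrightarrow> a = b" for a b
  by (rule inj_eq[OF permutes_inj[OF f]], rule inj_eq[OF permutes_inj[OF f']])
 have "(\<Prod>(k, j)\<in>E. s (f k) (f j)) = (\<Prod>(k, j)\<in>E. s k j)"
 proof (rule prod.reindex_bij_witness[where i = "?h ?f'" and j = "?h f"])
  fix a assume "a \<in> E"
  then obtain k j where a: "a = (k, j)" "j < k" "k < N" by (auto simp: E_def)
  hence ne: "f j \<noteq> f k" "?f' j \<noteq> ?f' k" using inj by auto
  show "?h ?f' (?h f a) = a"
   using a by (auto simp: max_def min_def permutes_inverses[OF f])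
  show "?h f (?h ?f' a) = a"
   using a by (auto simp: max_def min_def permutes_inverses[OF f])
  show "?h f a \<in> E" "?h ?f' a \<in> E" using a bnd[of k] bnd[of j] ne by (auto simp: E_def)
  show "(case ?h f a of (k, j) => s k j) = (case a of (k, j) => s (f k) (f j))"
   using a by (simp add: smm)
 qed
 thus ?thesis using eq[of f] eq[of id] by simp
qed

lemma monom_at_permute:
 assumes f: "f permutes {..<length xs}"
 shows "monom_at (Z \<circ> f) (permute_list f xs) = monom_at Z xs"
proof -
 have "monom_at (Z \<circ> f) (permute_list f xs) = (\<Prod>i<length xs. Z (f i) ^ (xs ! f i))"
  unfolding monom_at_def using f by (intro prod.cong) (auto simp: permute_list_nth)
 also have "... = monom_at Z xs" unfolding monom_at_def
  using prod.permute[OF f, of "\<lambda>i. Z i ^ (xs ! i)"] by (simp add: o_def)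
 finally show ?thesis .
qed

lemma bij_betw_permute_nlists:
 assumes f: "f permutes {..<N}"
 shows "bij_betw (permute_list f) (nlists N Q) (nlists N Q)"
proof (rule bij_betw_byWitness[where f' = "permute_list (inv f)"])
 have f': "inv f permutes {..<N}" using f by (rule permutes_inv)
 show "\<forall>a\<in>nlists N Q. permute_list (inv f) (permute_list f a) = a"
  using f f' by (auto simp: nlists_def permute_list_compose[symmetric] permutes_inv_o[OF f])
 show "\<forall>a\<in>nlists N Q. permute_list f (permute_list (inv f) a) = a"
  using f f' by (auto simp: nlists_def permute_list_compose[symmetric] permutes_inv_o[OF f])
 show "permute_list f ` nlists N Q \<subseteq> nlists N Q" "permute_list (inv f) ` nlists N Q \<subseteq> nlists N Q"
  using f f' by (auto simp: nlists_def set_permute_list)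
qed

text \<open>Makes the product of two coefficients a function of the multiset of pairs of exponents,
  which is what \<open>pair_coeff\<close> relies on.\<close>

lemma vcoeff_permute:
 assumes p: "p \<ge> 1" and f: "f permutes {..<N}" and l: "length xs = N" "length ys = N"
 shows "vcoeff p (permute_list f xs) * vcoeff p (permute_list f ys) = vcoeff p xs * vcoeff p ys"
proof (cases "xs \<in> nlists N (p * N) & ys \<in> nlists N (p * N)")
 case False
 have "vcoeff p zs = 0 & vcoeff p (permute_list f zs) = 0" if "zs \<notin> nlists N (p * N)" "length zs = N" for zs
  using that vcoeff_nonzeroD(3)[OF _ p, of zs] vcoeff_nonzeroD(3)[OF _ p, of "permute_list f zs"] f
  by (auto simp: nlists_def set_permute_list)
 thus ?thesis using False l by auto
next
 case True
 let ?L = "nlists N (p * N)"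
 define b where "b xs = (of_int (vcoeff p xs) :: complex)" for xs
 have V: "vandermonde_pow p N Z = (\<Sum>xs\<in>?L. b xs * monom_at Z xs)" for Z
  unfolding b_def by (rule vandermonde_pow_expand[OF p])
 have Vf: "vandermonde_pow p N (Z \<circ> f) = (\<Sum>xs\<in>?L. b (permute_list f xs) * monom_at Z xs)" for Z
 proof -
  have "vandermonde_pow p N (Z \<circ> f) = (\<Sum>xs\<in>?L. b (permute_list f xs) * monom_at (Z \<circ> f) (permute_list f xs))"
   unfolding V by (rule sum.reindex_bij_betw[OF bij_betw_permute_nlists[OF f], symmetric])
  also have "... = (\<Sum>xs\<in>?L. b (permute_list f xs) * monom_at Z xs)"
   using f by (intro sum.cong refl) (auto simp: monom_at_permute nlists_def)
  finally show ?thesis .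
 qed
 \<comment> \<open>Coefficients are compared in two rounds: here in \<open>Z\<close> for fixed
   \<open>Z'\<close>, below in the remaining variables.\<close>
 have 1: "b (permute_list f xs) * vandermonde_pow p N (Z' \<circ> f) - b xs * vandermonde_pow p N Z' = 0" for Z'
 proof (rule monomials_independent[where N = N and Q = "p * N" and xs = xs
   and c = "\<lambda>xs. b (permute_list f xs) * vandermonde_pow p N (Z' \<circ> f) - b xs * vandermonde_pow p N Z'"])
  fix Z
  have "(\<Sum>xs\<in>?L. (b (permute_list f xs) * vandermonde_pow p N (Z' \<circ> f) - b xs * vandermonde_pow p N Z') * monom_at Z xs)
   = vandermonde_pow p N (Z \<circ> f) * vandermonde_pow p N (Z' \<circ> f) - vandermonde_pow p N Z * vandermonde_pow p N Z'"
   unfolding Vf[of Z] V[of Z] sum_distrib_right left_diff_distrib sum_subtractf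
   by (simp only: mult_ac)
  thus "(\<Sum>xs\<in>?L. (b (permute_list f xs) * vandermonde_pow p N (Z' \<circ> f) - b xs * vandermonde_pow p N Z') * monom_at Z xs) = 0"
   by (simp add: vandermonde_pow_permute[OF f])
 qed (use True in simp)
 have "b (permute_list f xs) * b (permute_list f ys) - b xs * b ys = 0"
 proof (rule monomials_independent[where N = N and Q = "p * N" and xs = ys
   and c = "\<lambda>ys. b (permute_list f xs) * b (permute_list f ys) - b xs * b ys"])
  fix Z
  show "(\<Sum>ys\<in>?L. (b (permute_list f xs) * b (permute_list f ys) - b xs * b ys) * monom_at Z ys) = 0"
   using 1[of Z] unfolding Vf[of Z] V[of Z] sum_distrib_left left_diff_distrib sum_subtractf
   by (simp only: mult_ac)
 qed (use True in simp)
 hence "(of_int (vcoeff p (permute_list f xs) * vcoeff p (permute_list f ys)) :: complex) = of_int (vcoeff p xs * vcoeff p ys)"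
  by (simp add: b_def)
 thus ?thesis by (simp only: of_int_eq_iff)
qed

lemma tri_add: "tri p (a + c) = tri p a + tri p c + p * a * c"
 by (induction c) (auto simp: tri_def algebra_simps)

lemma prod_lessThan_add:
 "(\<Prod>k<a + c. f k) = (\<Prod>k<a. f k) * (\<Prod>k<c. f (a + k :: nat) :: 'a :: comm_monoid_mult)"
 by (induction c) (auto simp: mult_ac)

lemma vandermonde_pow_add:
 "vandermonde_pow p (a + c) W = vandermonde_pow p a W * (\<Prod>j<c. \<Prod>i<a. (W (a + j) - W i) ^ p) * vandermonde_pow p c (\<lambda>j. W (a + j))"
 unfolding vandermonde_pow_def by (simp add: prod_lessThan_add prod.distrib mult_ac)

lemma vandermonde_pow_scale:
 "vandermonde_pow p a (\<lambda>i. t * Z i) = t ^ tri p a * vandermonde_pow p a Z"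
proof -
 have "vandermonde_pow p a (\<lambda>i. t * Z i) = (\<Prod>k<a. \<Prod>j<k. t ^ p * (Z k - Z j) ^ p)"
  unfolding vandermonde_pow_def by (simp add: right_diff_distrib[symmetric] power_mult_distrib)
 also have "... = (\<Prod>k<a. t ^ (p * k)) * vandermonde_pow p a Z"
  unfolding vandermonde_pow_def by (simp add: prod.distrib power_mult)
 finally show ?thesis by (simp add: tri_def power_sum)
qed

lemma vandermonde_pow_cong: "(!!i. i < a ==> W i = W' i) ==> vandermonde_pow p a W = vandermonde_pow p a W'"
 unfolding vandermonde_pow_def by (intro prod.cong) auto

lemma monom_at_append:
 "monom_at Z (xs @ ys) = monom_at Z xs * monom_at (\<lambda>j. Z (length xs + j)) ys"
 unfolding monom_at_def by (simp add: prod_lessThan_add nth_append)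

lemma monom_at_scale: "monom_at (\<lambda>i. t * Z i) xs = t ^ sum_list xs * monom_at Z xs"
proof (induction xs arbitrary: Z)
 case (Cons x xs)
 show ?case unfolding monom_at_Cons Cons by (simp add: power_mult_distrib power_add mult_ac)
qed (simp add: monom_at_def)

lemma monom_at_cong: "(!!i. i < length xs ==> Z i = Z' i) ==> monom_at Z xs = monom_at Z' xs"
 unfolding monom_at_def by (intro prod.cong) auto

lemma monom_at_shift: "monom_at Z (map (\<lambda>y. y + s) ys) = (\<Prod>j<length ys. Z j) ^ s * monom_at Z ys"
 unfolding monom_at_def by (simp add: power_add prod.distrib prod_power_distrib mult.commute)

text \<open>Scaling the first \<open>a\<close> variables by \<open>t\<close>, the lowest order in \<open>t\<close> of the Vandermonde power
 factorises.\<close>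
lemma vandermonde_pow_lowest_order:
 assumes p: "p \<ge> 1"
 shows "(\<Sum>ms\<in>nlists (a + c) (p * (a + c)). (if sum_list (take a ms) = tri p a then of_int (vcoeff p ms) else 0) * monom_at Z ms)
   = vandermonde_pow p a Z * (\<Prod>j<c. Z (a + j)) ^ (p * a) * vandermonde_pow p c (\<lambda>j. Z (a + j))"
proof -
 let ?L = "nlists (a + c) (p * (a + c))"
 define b where "b ms = (of_int (vcoeff p ms) * monom_at Z ms :: complex)" for ms
 define PA where "PA = (\<Sum>ms\<in>?L. monom (b ms) (sum_list (take a ms)))"
 define PH where "PH = [: vandermonde_pow p a Z * vandermonde_pow p c (\<lambda>j. Z (a + j)) :] *
   (\<Prod>j<c. \<Prod>i<a. [: Z (a + j), - Z i :] ^ p)"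
 have "poly PA t = poly (monom 1 (tri p a) * PH) t" for t
 proof -
  let ?W = "\<lambda>i. if i < a then t * Z i else Z i"
  have "poly PA t = (\<Sum>ms\<in>?L. of_int (vcoeff p ms) * monom_at ?W ms)"
  proof -
   have "t ^ sum_list (take a ms) * monom_at Z ms = monom_at ?W ms" if "ms \<in> ?L" for ms
   proof -
    define xs where "xs = take a ms"
    define ys where "ys = drop a ms"
    have ms: "ms = xs @ ys" and l: "length xs = a" using that by (auto simp: xs_def ys_def nlists_def)
    have "monom_at ?W ms = monom_at (\<lambda>i. t * Z i) xs * monom_at (\<lambda>j. Z (a + j)) ys"
     unfolding ms monom_at_append l by (intro arg_cong2[where f = "(*)"] monom_at_cong) (auto simp: l)
    also have "... = t ^ sum_list xs * (monom_at Z xs * monom_at (\<lambda>j. Z (a + j)) ys)"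
     by (simp add: monom_at_scale)
    also have "monom_at Z xs * monom_at (\<lambda>j. Z (a + j)) ys = monom_at Z ms"
     unfolding ms monom_at_append l ..
    finally show ?thesis by (simp add: xs_def)
   qed
   thus ?thesis
    unfolding PA_def b_def poly_sum poly_monom by (intro sum.cong) (auto simp: mult_ac)
  qed
  also have "... = vandermonde_pow p (a + c) ?W" by (rule vandermonde_pow_expand[OF p, symmetric])
  also have "... = vandermonde_pow p a (\<lambda>i. t * Z i) * (\<Prod>j<c. \<Prod>i<a. (Z (a + j) - t * Z i) ^ p) * vandermonde_pow p c (\<lambda>j. Z (a + j))"
   unfolding vandermonde_pow_add
   by (intro arg_cong2[where f = "(*)"] prod.cong vandermonde_pow_cong) auto
  also have "... = poly (monom 1 (tri p a) * PH) t"
   by (simp add: vandermonde_pow_scale PH_def poly_monom poly_prod)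
  finally show ?thesis .
 qed
 hence "PA = monom 1 (tri p a) * PH" by (subst poly_eq_poly_eq_iff[symmetric]) auto
 hence "coeff PA (tri p a) = coeff PH 0" by (simp add: coeff_monom_mult)
 also have "... = poly PH 0" by (simp add: poly_0_coeff_0)
 also have "... = vandermonde_pow p a Z * (\<Prod>j<c. Z (a + j)) ^ (p * a) * vandermonde_pow p c (\<lambda>j. Z (a + j))"
  unfolding PH_def poly_mult poly_prod by (simp add: power_mult[symmetric] prod_power_distrib mult_ac)
 also have "coeff PA (tri p a) = (\<Sum>ms\<in>?L. (if sum_list (take a ms) = tri p a then of_int (vcoeff p ms) else 0) * monom_at Z ms)"
  unfolding PA_def coeff_sum b_def by (intro sum.cong) auto
 finally show ?thesis .
qed

text \<open>The algebraic source of the factorisation at a renewal. If \<open>xs\<close> has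
  momentum \<open>tri p (length xs)\<close>, the coefficient belongs to the lowest order in
  \<open>t\<close>, where each cross factor reduces to the variable with the larger index. Each of
  the later variables thereby gains the power \<open>p * length xs\<close>, which is the shift of
  \<open>ys\<close>.\<close>

lemma vcoeff_append_shift:
 assumes p: "p \<ge> 1" and s: "sum_list xs = tri p (length xs)"
 shows "vcoeff p (xs @ map (\<lambda>y. y + p * length xs) ys) = vcoeff p xs * vcoeff p ys"
proof -
 define a c where "a = length xs" and "c = length ys"
 let ?L = "nlists (a + c) (p * (a + c))"
 define sh where "sh = map (\<lambda>y. y + p * a)"
 \<comment> \<open>The coefficients of the factorised side, written as a function on all lists of
   length \<open>a + c\<close> so that both sides can be compared by independence of
   monomials.\<close>
 define g where "g ms = (if \<forall>y\<in>set (drop a ms). y \<ge> p * a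
   then of_int (vcoeff p (take a ms) * vcoeff p (map (\<lambda>y. y - p * a) (drop a ms))) else (0::complex))" for ms
 have inv: "map (\<lambda>y. y - p * a) (sh zs) = zs" for zs by (simp add: sh_def o_def)
 have g: "g (us @ sh vs) = of_int (vcoeff p us * vcoeff p vs)" if "length us = a" for us vs
  using that inv[of vs] by (auto simp: g_def sh_def)
 have mem: "us @ sh vs \<in> ?L" if "us \<in> nlists a (p * a)" "vs \<in> nlists c (p * c)" for us vs
  using that p by (fastforce simp: nlists_def sh_def algebra_simps)
 have rhs: "vandermonde_pow p a Z * (\<Prod>j<c. Z (a + j)) ^ (p * a) * vandermonde_pow p c (\<lambda>j. Z (a + j))
   = (\<Sum>ms\<in>?L. g ms * monom_at Z ms)" for Z
 proof -
  let ?P = "nlists a (p * a) \<times> nlists c (p * c)"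
  have "vandermonde_pow p a Z * (\<Prod>j<c. Z (a + j)) ^ (p * a) * vandermonde_pow p c (\<lambda>j. Z (a + j))
   = (\<Sum>(us, vs)\<in>?P. (of_int (vcoeff p us) * monom_at Z us) *
     ((\<Prod>j<c. Z (a + j)) ^ (p * a) * (of_int (vcoeff p vs) * monom_at (\<lambda>j. Z (a + j)) vs)))"
  proof -
   have "(\<Sum>u\<in>A. f u) * K * (\<Sum>v\<in>B. h v) = (\<Sum>(u, v)\<in>A \<times> B. f u * (K * h v))"
    for A B and f h :: "nat list => complex" and K
   proof -
    have "(\<Sum>u\<in>A. f u) * K * (\<Sum>v\<in>B. h v) = (\<Sum>u\<in>A. f u) * (\<Sum>v\<in>B. K * h v)"
     by (simp add: sum_distrib_left mult.assoc)
    thus ?thesis by (simp only: sum_product sum.cartesian_product)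
   qed
   thus ?thesis unfolding vandermonde_pow_expand[OF p] .
  qed
  also have "... = (\<Sum>(us, vs)\<in>?P. g (us @ sh vs) * monom_at Z (us @ sh vs))"
  proof (intro sum.cong refl)
   fix x assume "x \<in> ?P"
   then obtain us vs where x: "x = (us, vs)" and l: "length us = a" "length vs = c"
    by (auto simp: nlists_def)
   have "monom_at Z (us @ sh vs) = monom_at Z us * ((\<Prod>j<c. Z (a + j)) ^ (p * a) * monom_at (\<lambda>j. Z (a + j)) vs)"
    unfolding monom_at_append sh_def monom_at_shift l ..
   thus "(case x of (us, vs) => of_int (vcoeff p us) * monom_at Z us *
     ((\<Prod>j<c. Z (a + j)) ^ (p * a) * (of_int (vcoeff p vs) * monom_at (\<lambda>j. Z (a + j)) vs))) =
    (case x of (us, vs) => g (us @ sh vs) * monom_at Z (us @ sh vs))"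
    using l by (simp add: x g)
  qed
  also have "... = (\<Sum>ms\<in>(\<lambda>(us, vs). us @ sh vs) ` ?P. g ms * monom_at Z ms)"
  proof -
   have inj: "inj_on (\<lambda>(us, vs). us @ sh vs) ?P"
    by (auto simp: inj_on_def nlists_def) (metis inv)
   show ?thesis by (subst sum.reindex[OF inj]) (auto simp: case_prod_unfold)
  qed
  also have "... = (\<Sum>ms\<in>?L. g ms * monom_at Z ms)"
  proof (rule sum.mono_neutral_left)
   show "(\<lambda>(us, vs). us @ sh vs) ` ?P \<subseteq> ?L" using mem by auto
   show "\<forall>ms\<in>?L - (\<lambda>(us, vs). us @ sh vs) ` ?P. g ms * monom_at Z ms = 0"
   proof
    fix ms assume ms: "ms \<in> ?L - (\<lambda>(us, vs). us @ sh vs) ` ?P"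
    have "g ms = 0"
    proof (rule ccontr)
     assume nz: "g ms \<noteq> 0"
     let ?u = "take a ms" and ?v = "map (\<lambda>y. y - p * a) (drop a ms)"
     have ge: "\<forall>y\<in>set (drop a ms). y \<ge> p * a" and "vcoeff p ?u \<noteq> 0" "vcoeff p ?v \<noteq> 0"
      using nz by (auto simp: g_def split: if_splits)
     hence "?u \<in> nlists (length ?u) (p * length ?u)" "?v \<in> nlists (length ?v) (p * length ?v)"
      using vcoeff_nonzeroD(3) p by blast+
     moreover have "length ?u = a" "length ?v = c" using ms by (auto simp: nlists_def)
     ultimately have uv: "(?u, ?v) \<in> ?P" by simp
     have "sh ?v = drop a ms" unfolding sh_def using ge by (auto intro!: map_idI simp: o_def)
     hence "ms = ?u @ sh ?v" by simp
     thus False using ms uv by (metis (no_types, lifting) DiffD2 case_prod_conv image_eqI)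
    qed
    thus "g ms * monom_at Z ms = 0" by simp
   qed
  qed simp
  finally show ?thesis .
 qed
 define ms where "ms = xs @ sh ys"
 have take: "take a ms = xs" by (simp add: ms_def a_def)
 have gms: "g ms = of_int (vcoeff p xs * vcoeff p ys)" unfolding ms_def by (rule g) (simp add: a_def)
 show ?thesis
 proof (cases "ms \<in> ?L")
  case True
  define k where "k = (\<lambda>ms. (if sum_list (take a ms) = tri p a then of_int (vcoeff p ms) else 0) - g ms)"
  have "k ms = 0"
  proof (rule monomials_independent[where N = "a + c" and Q = "p * (a + c)"])
   show "(\<Sum>xs\<in>?L. k xs * monom_at Z xs) = 0" for Z
    using vandermonde_pow_lowest_order[OF p, where a = a and c = c and Z = Z] rhs[of Z]
    by (simp add: k_def left_diff_distrib sum_subtractf)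
  qed (rule True)
  hence "(of_int (vcoeff p ms) :: complex) = of_int (vcoeff p xs * vcoeff p ys)"
   unfolding k_def take gms using s by (simp add: a_def)
  thus ?thesis unfolding of_int_eq_iff by (simp add: ms_def sh_def a_def)
 next
  case False
  have "length ms = a + c" by (simp add: ms_def sh_def a_def c_def)
  hence "vcoeff p ms = 0" using False vcoeff_nonzeroD(3)[OF _ p, of ms] by auto
  moreover have "vcoeff p xs * vcoeff p ys = 0"
   using False mem[of xs ys] vcoeff_nonzeroD(3)[OF _ p, of xs] vcoeff_nonzeroD(3)[OF _ p, of ys]
   by (auto simp: ms_def a_def c_def)
  ultimately show ?thesis by (simp add: ms_def sh_def a_def)
 qed
qed

section \<open>Weights of orbital configurations\<close>

text \<open>The two components are the orbitals of one particle in the wave function and in its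
  complex conjugate. By \<open>vcoeff_permute\<close> the enumeration chosen by \<open>SOME\<close>
  does not affect the value.\<close>

definition pair_coeff :: "nat => (nat \<times> nat) multiset => real" where
 "pair_coeff p A = (let ps = (SOME ps. mset ps = A) in of_int (vcoeff p (map fst ps) * vcoeff p (map snd ps)))"

lemma pair_coeff_mset:
 assumes p: "p \<ge> 1"
 shows "pair_coeff p (mset ps) = of_int (vcoeff p (map fst ps) * vcoeff p (map snd ps))"
proof -
 define qs where "qs = (SOME qs. mset qs = mset ps)"
 have "mset qs = mset ps" unfolding qs_def by (rule someI_ex) blast
 then obtain f where f: "f permutes {..<length ps}" "permute_list f ps = qs"
  by (rule mset_eq_permutation)
 have "vcoeff p (map fst qs) * vcoeff p (map snd qs) = vcoeff p (map fst ps) * vcoeff p (map snd ps)"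
  using vcoeff_permute[OF p, of f "length ps" "map fst ps" "map snd ps"] f
   permute_list_map[OF f(1), of fst] permute_list_map[OF f(1), of snd] by simp
 thus ?thesis unfolding pair_coeff_def qs_def[symmetric] Let_def by simp
qed

lemma pair_coeff_nonzeroD:
 assumes p: "p \<ge> 1" and nz: "pair_coeff p A \<noteq> 0"
 shows "sum_mset (image_mset fst A) = tri p (size A)" (is ?g1) "sum_mset (image_mset snd A) = tri p (size A)"
  "(x, y) \<in># A ==> x < p * size A & y < p * size A"
proof -
 obtain ps where ps: "mset ps = A" using ex_mset by blast
 hence "vcoeff p (map fst ps) \<noteq> 0" "vcoeff p (map snd ps) \<noteq> 0"
  using nz pair_coeff_mset[OF p, of ps] by auto
 note * = vcoeff_nonzeroD[OF this(1)] vcoeff_nonzeroD[OF this(2)]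
 show ?g1 "sum_mset (image_mset snd A) = tri p (size A)"
  using *(1) *(4) ps by (auto simp: sum_mset_sum_list[symmetric])
 show "(x, y) \<in># A ==> x < p * size A & y < p * size A"
  using *(3)[OF p] *(6)[OF p] ps by (force simp: nlists_def)
qed

definition shift_pairs :: "nat => (nat \<times> nat) multiset => (nat \<times> nat) multiset" where
 "shift_pairs s A = image_mset (\<lambda>(x, y). (x + s, y + s)) A"

lemma size_shift_pairs [simp]: "size (shift_pairs s A) = size A"
 by (simp add: shift_pairs_def)

lemma sum_shift_pairs:
 "sum_mset (image_mset fst (shift_pairs s A)) = sum_mset (image_mset fst A) + s * size A"
 "sum_mset (image_mset snd (shift_pairs s A)) = sum_mset (image_mset snd A) + s * size A"
 by (induction A) (auto simp: shift_pairs_def)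

lemma pair_coeff_split:
 assumes p: "p \<ge> 1" and s: "sum_mset (image_mset fst A) = tri p (size A)" "sum_mset (image_mset snd A) = tri p (size A)"
 shows "pair_coeff p (A + shift_pairs (p * size A) C) = pair_coeff p A * pair_coeff p C"
proof -
 obtain ps where ps: "mset ps = A" using ex_mset by blast
 obtain qs where qs: "mset qs = C" using ex_mset by blast
 let ?sh = "map (\<lambda>(x, y). (x + p * size A, y + p * size A)) qs"
 have l: "length ps = size A" using ps by auto
 have "mset (ps @ ?sh) = A + shift_pairs (p * size A) C"
  by (simp add: ps qs shift_pairs_def)
 moreover have e: "map fst (ps @ ?sh) = map fst ps @ map (\<lambda>y. y + p * length (map fst ps)) (map fst qs)"
  "map snd (ps @ ?sh) = map snd ps @ map (\<lambda>y. y + p * length (map snd ps)) (map snd qs)"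
  by (auto simp: l case_prod_unfold)
 moreover have "sum_list (map fst ps) = tri p (length (map fst ps))" "sum_list (map snd ps) = tri p (length (map snd ps))"
  using s ps by (auto simp: sum_mset_sum_list[symmetric])
 ultimately show ?thesis
  using pair_coeff_mset[OF p, of "ps @ ?sh", unfolded e] pair_coeff_mset[OF p, of ps] pair_coeff_mset[OF p, of qs]
   vcoeff_append_shift[OF p, of "map fst ps" "map fst qs"] vcoeff_append_shift[OF p, of "map snd ps" "map snd qs"]
  by (simp add: ps qs del: map_map)
qed

text \<open>The Gaussian factors of the two orbital configurations, normalised by the configuration
 \<open>0, p, 2p, ...\<close>.\<close>
definition pair_weight :: "real => nat => (nat \<times> nat) multiset => real" where
 "pair_weight g p A = pair_coeff p A *
   exp (g * ((\<Sum>(x, y)\<in>#A. ((real x)^2 + (real y)^2) / 2) - (\<Sum>j<size A. (real (p * j))^2)))"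

lemma sum_shift_squares:
 "(\<Sum>(x, y)\<in>#shift_pairs s C. ((real x)^2 + (real y)^2) / 2) = (\<Sum>(x, y)\<in>#C. ((real x)^2 + (real y)^2) / 2)
   + real s * (sum_mset (image_mset fst C) + sum_mset (image_mset snd C)) + (real s)^2 * size C"
 by (induction C) (auto simp: shift_pairs_def algebra_simps power2_eq_square add_divide_distrib)

lemma sum_arith_squares:
 "(\<Sum>j<a + c. (real (p * j))^2) = (\<Sum>j<a. (real (p * j))^2) + (\<Sum>j<c. (real (p * j))^2)
   + 2 * real (p * a) * tri p c + (real (p * a))^2 * c"
 by (induction c) (auto simp: tri_def algebra_simps power2_eq_square)

text \<open>Shifting \<open>C\<close> adds to its sum of squares a term linear in its momenta. Where
  \<open>pair_coeff p C\<close> is nonzero, these momenta are \<open>tri p (size C)\<close>, so the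
  same amount is added in the reference configuration and the Gaussian factors split as
  well.\<close>

lemma pair_weight_split:
 assumes p: "p \<ge> 1" and s: "sum_mset (image_mset fst A) = tri p (size A)" "sum_mset (image_mset snd A) = tri p (size A)"
 shows "pair_weight g p (A + shift_pairs (p * size A) C) = pair_weight g p A * pair_weight g p C"
proof (cases "pair_coeff p C = 0")
 case True
 thus ?thesis by (simp add: pair_weight_def pair_coeff_split[OF p s])
next
 case False
 note C = pair_coeff_nonzeroD[OF p False]
 define S where "S n = (\<Sum>j<n. (real (p * j))^2)" for n
 have S: "S (size A + size C) = S (size A) + S (size C) + 2 * real (p * size A) * tri p (size C) + (real (p * size A))^2 * size C"
  unfolding S_def by (rule sum_arith_squares)
 show ?thesis unfolding pair_weight_def pair_coeff_split[OF p s] S_def[symmetric]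
  by (simp add: sum_shift_squares S C(1,2) algebra_simps exp_add[symmetric] del: of_nat_mult)
qed

text \<open>The momentum condition may be imposed on the right piece instead: the total momentum is
  fixed, so if the left piece violates the condition, both sides vanish.\<close>

lemma pair_weight_split_right:
 assumes p: "p \<ge> 1" and s: "sum_mset (image_mset fst C) = tri p (size C)" "sum_mset (image_mset snd C) = tri p (size C)"
 shows "pair_weight g p (A + shift_pairs (p * size A) C) = pair_weight g p A * pair_weight g p C"
proof (cases "sum_mset (image_mset fst A) = tri p (size A) & sum_mset (image_mset snd A) = tri p (size A)")
 case True
 thus ?thesis using pair_weight_split[OF p] by blast
next
 case False
 have "pair_coeff p A = 0" using pair_coeff_nonzeroD[OF p, of A] False by blast
 moreover have "pair_coeff p (A + shift_pairs (p * size A) C) = 0"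
 proof (rule ccontr)
  assume "pair_coeff p (A + shift_pairs (p * size A) C) \<noteq> 0"
  from pair_coeff_nonzeroD(1,2)[OF p this] show False
   using False s by (simp add: sum_shift_pairs tri_add)
 qed
 ultimately show ?thesis by (simp add: pair_weight_def)
qed

text \<open>A multiset \<open>M\<close> of size \<open>r\<close> is enumerated by
  \<open>fact r / mfact M\<close> lists, which is why weights of multisets carry the factor
  \<open>1 / mfact M\<close>.\<close>

definition mfact :: "nat multiset => real" where
 "mfact M = (\<Prod>x\<in>set_mset M. fact (count M x))"

lemma mfact_pos [simp]: "mfact M > 0"
 unfolding mfact_def by (intro prod_pos) simp

lemma mfact_union:
 assumes "set_mset A \<inter> set_mset B = {}"
 shows "mfact (A + B) = mfact A * mfact B"
proof -
 have "mfact (A + B) = (\<Prod>x\<in>set_mset A. fact (count A x + count B x)) * (\<Prod>x\<in>set_mset B. fact (count A x + count B x))"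
  unfolding mfact_def set_mset_union count_union by (rule prod.union_disjoint) (use assms in auto)
 also have "(\<Prod>x\<in>set_mset A. fact (count A x + count B x)) = mfact A"
  unfolding mfact_def using assms by (intro prod.cong) (auto simp: disjoint_iff not_in_iff)
 also have "(\<Prod>x\<in>set_mset B. fact (count A x + count B x)) = mfact B"
  unfolding mfact_def
 proof (intro prod.cong refl)
  fix x assume "x \<in># B"
  hence "count A x = 0" using assms by (auto simp: not_in_iff[symmetric])
  thus "fact (count A x + count B x) = fact (count B x)" by simp
 qed
 finally show ?thesis .
qed

definition shift_mset :: "nat => nat multiset => nat multiset" where
 "shift_mset s M = image_mset (\<lambda>x. x + s) M"

lemma count_shift_mset: "count (shift_mset s M) (x + s) = count M x"
 unfolding shift_mset_def by (induction M) auto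

lemma mfact_shift [simp]: "mfact (shift_mset s M) = mfact M"
proof -
 have "mfact (shift_mset s M) = (\<Prod>x\<in>(\<lambda>x. x + s) ` set_mset M. fact (count (shift_mset s M) x))"
  by (simp add: mfact_def shift_mset_def)
 also have "... = (\<Prod>x\<in>set_mset M. fact (count (shift_mset s M) (x + s)))"
  by (subst prod.reindex) (auto simp: inj_on_def)
 also have "... = mfact M"
  unfolding mfact_def by (simp add: count_shift_mset)
 finally show ?thesis .
qed

definition diag :: "nat multiset => (nat \<times> nat) multiset" where
 "diag M = image_mset (\<lambda>x. (x, x)) M"

lemma size_diag [simp]: "size (diag M) = size M" by (simp add: diag_def)
lemma diag_union: "diag (A + B) = diag A + diag B" by (simp add: diag_def)
lemma sum_diag [simp]: "sum_mset (image_mset fst (diag M)) = sum_mset M" "sum_mset (image_mset snd (diag M)) = sum_mset M"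
 by (simp_all add: diag_def multiset.map_comp o_def)
lemma diag_shift: "diag (shift_mset s M) = shift_pairs s (diag M)"
 by (simp add: diag_def shift_mset_def shift_pairs_def multiset.map_comp o_def)
lemma size_shift_mset [simp]: "size (shift_mset s M) = size M" by (simp add: shift_mset_def)
lemma shift_pairs_union: "shift_pairs s (A + B) = shift_pairs s A + shift_pairs s B" by (simp add: shift_pairs_def)
lemma shift_pairs_shift: "shift_pairs s (shift_pairs t A) = shift_pairs (s + t) A"
 by (simp add: shift_pairs_def multiset.map_comp o_def case_prod_unfold add_ac)

definition cfg :: "nat => nat => nat multiset set" where
 "cfg Q N = {M. set_mset M \<subseteq> {..<Q} & size M = N}"

lemma finite_cfg [simp]: "finite (cfg Q N)"
proof -
 have "cfg Q N \<subseteq> mset ` nlists N Q"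
 proof
  fix M assume "M \<in> cfg Q N"
  moreover obtain xs where "mset xs = M" using ex_mset by blast
  ultimately show "M \<in> mset ` nlists N Q" by (auto simp: cfg_def nlists_def)
 qed
 thus ?thesis by (rule finite_subset) simp
qed

text \<open>\<open>K\<close> holds the pairs of orbitals of the observed particles. \<open>M\<close>
  holds the orbitals of the particles integrated out, which agree in the wave function and its
  conjugate by orthogonality and therefore enter through \<open>diag\<close>.\<close>

definition corr_weight :: "real => nat => (nat \<times> nat) multiset => nat multiset => real" where
 "corr_weight g p K M = pair_weight g p (K + diag M) / mfact M"

definition corr_sum :: "real => nat => nat => (nat \<times> nat) multiset => real" where
 "corr_sum g p N K = (\<Sum>M\<in>cfg (p * N) (N - size K). corr_weight g p K M)"

definition part_fun :: "real => nat => nat => real" where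
 "part_fun g p N = corr_sum g p N {#}"

definition ren_left :: "nat => nat => nat multiset => bool" where
 "ren_left p i M \<longleftrightarrow> size (filter_mset (\<lambda>x. x < p * i) M) = i & sum_mset (filter_mset (\<lambda>x. x < p * i) M) = tri p i"

text \<open>At a cut to the right of the observed particles, \<open>M\<close> alone does not show
  the full number on the left. The renewal condition is therefore stated through the particles to
  the right, whose momentum is that of \<open>p * j, p * (j + 1), ..., p * (N - 1)\<close>.\<close>

definition ren_right :: "nat => nat => nat => nat multiset => bool" where
 "ren_right p N j M \<longleftrightarrow> size (filter_mset (\<lambda>x. \<not> x < p * j) M) = N - j &
   sum_mset (filter_mset (\<lambda>x. \<not> x < p * j) M) = tri p (N - j) + p * j * (N - j)"

lemma filter_mset_all: "(!!x. x \<in># A ==> P x) ==> filter_mset P A = A"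
 by (induction A) auto

lemma filter_mset_none: "(!!x. x \<in># A ==> \<not> P x) ==> filter_mset P A = {#}"
 by (induction A) auto

lemma shift_unshift: "(!!x. x \<in># A ==> s \<le> x) ==> shift_mset s (image_mset (\<lambda>x. x - s) A) = A"
 by (induction A) (auto simp: shift_mset_def)

lemma unshift_shift: "image_mset (\<lambda>x. x - s) (shift_mset s A) = A"
 by (simp add: shift_mset_def multiset.map_comp o_def)

lemma sum_shift_mset: "sum_mset (shift_mset s A) = sum_mset A + s * size A"
 by (induction A) (auto simp: shift_mset_def)

lemma set_shift_mset: "set_mset (shift_mset s A) = (\<lambda>x. x + s) ` set_mset A"
 by (simp add: shift_mset_def)

definition conf_weight :: "real => nat => nat multiset => real" where
 "conf_weight g p M = corr_weight g p {#} M"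

lemma part_fun_eq: "part_fun g p N = (\<Sum>M\<in>cfg (p * N) N. conf_weight g p M)"
 by (simp add: part_fun_def corr_sum_def conf_weight_def)

lemma conf_weight_nonneg [simp]: "p \<ge> 1 ==> conf_weight g p M \<ge> 0"
proof -
 assume p: "p \<ge> 1"
 obtain xs where "mset xs = M" using ex_mset by blast
 hence d: "diag M = mset (map (\<lambda>x. (x, x)) xs)" by (simp add: diag_def)
 have "pair_coeff p (diag M) \<ge> 0"
  unfolding d pair_coeff_mset[OF p] by (simp add: o_def)
 thus ?thesis
  by (simp add: conf_weight_def corr_weight_def pair_weight_def less_imp_le[OF mfact_pos])
qed

lemma conf_weight_nonzeroD:
 assumes "p \<ge> 1" "conf_weight g p M \<noteq> 0"
 shows "sum_mset M = tri p (size M)" "set_mset M \<subseteq> {..<p * size M}"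
proof -
 have nz: "pair_coeff p (diag M) \<noteq> 0" using assms(2) by (auto simp: conf_weight_def corr_weight_def pair_weight_def)
 note * = pair_coeff_nonzeroD[OF assms(1) nz]
 show "sum_mset M = tri p (size M)" using *(1) by simp
 show "set_mset M \<subseteq> {..<p * size M}" using *(3) by (auto simp: diag_def)
qed

text \<open>Cutting \<open>M\<close> at \<open>p * i\<close> and \<open>p * j\<close> is a bijection
  onto triples of configurations of smaller systems, and the weight is multiplicative. The observed
  pairs lie in the middle piece. The predicate \<open>P\<close> on the left piece serves the
  decomposition by the first renewal.\<close>

lemma corr_sum_renewal_split:
 assumes p: "p \<ge> 1" and ij: "i \<le> j" "j \<le> N"
  and K: "!!x y. (x, y) \<in># K ==> x < p * (j - i) & y < p * (j - i)" and sK: "size K \<le> j - i"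
 shows "(\<Sum>M | M \<in> cfg (p * N) (N - size K) & ren_left p i M & ren_right p N j M & P (filter_mset (\<lambda>x. x < p * i) M).
    corr_weight g p (shift_pairs (p * i) K) M)
   = (\<Sum>M | M \<in> cfg (p * i) i & P M. conf_weight g p M) * corr_sum g p (j - i) K * part_fun g p (N - j)"
proof -
 define C1 where "C1 = {M \<in> cfg (p * i) i. P M & sum_mset M = tri p i}"
 define C2 where "C2 = cfg (p * (j - i)) (j - i - size K)"
 define C3 where "C3 = {M \<in> cfg (p * (N - j)) (N - j). sum_mset M = tri p (N - j)}"
 define S where "S = {M \<in> cfg (p * N) (N - size K). ren_left p i M & ren_right p N j M & P (filter_mset (\<lambda>x. x < p * i) M)}"
 let ?lo = "filter_mset (\<lambda>x. x < p * i)" and ?mid = "filter_mset (\<lambda>x. \<not> x < p * i & x < p * j)"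
  and ?hi = "filter_mset (\<lambda>x. \<not> x < p * j)"
 define h where "h = (\<lambda>(M1, M2, M3). M1 + shift_mset (p * i) M2 + shift_mset (p * j) M3)"
 define h' where "h' M = (?lo M,
   image_mset (\<lambda>x. x - p * i) (?mid M),
   image_mset (\<lambda>x. x - p * j) (?hi M))" for M
 have pij: "p * i \<le> p * j" "p * j \<le> p * N" "p * i + p * (j - i) = p * j" "p * j + p * (N - j) = p * N"
  using ij by (simp_all flip: distrib_left)
 \<comment> \<open>The momentum condition in \<open>C1\<close> and \<open>C3\<close> excludes only
   configurations of weight 0; it is what makes the gluing map land in the renewal sets.\<close>
 have eq1: "(\<Sum>M | M \<in> cfg (p * i) i & P M. conf_weight g p M) = (\<Sum>M\<in>C1. conf_weight g p M)"
 proof (rule sum.mono_neutral_right)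
  show "finite {M \<in> cfg (p * i) i. P M}" by simp
  show "C1 \<subseteq> {M \<in> cfg (p * i) i. P M}" by (auto simp: C1_def)
  show "\<forall>M\<in>{M \<in> cfg (p * i) i. P M} - C1. conf_weight g p M = 0"
   using conf_weight_nonzeroD(1)[OF p, of g] by (auto simp: C1_def cfg_def)
 qed
 have eq3: "part_fun g p (N - j) = (\<Sum>M\<in>C3. conf_weight g p M)"
  unfolding part_fun_eq
 proof (rule sum.mono_neutral_right)
  show "C3 \<subseteq> cfg (p * (N - j)) (N - j)" by (auto simp: C3_def)
  show "\<forall>M\<in>cfg (p * (N - j)) (N - j) - C3. conf_weight g p M = 0"
   using conf_weight_nonzeroD(1)[OF p, of g] by (auto simp: C3_def cfg_def)
 qed simp
 have fil: "?lo (h (M1, M2, M3)) = M1"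
    "?mid (h (M1, M2, M3)) = shift_mset (p * i) M2"
    "?hi (h (M1, M2, M3)) = shift_mset (p * j) M3"
  if "M1 \<in> C1" "M2 \<in> C2" "M3 \<in> C3" for M1 M2 M3
 proof -
  have r1: "x < p * i" if "x \<in># M1" for x using that \<open>M1 \<in> C1\<close> by (auto simp: C1_def cfg_def)
  have r2: "p * i \<le> x & x < p * j" if "x \<in># shift_mset (p * i) M2" for x
   using that \<open>M2 \<in> C2\<close> pij by (fastforce simp: C2_def cfg_def set_shift_mset)
  have r3: "p * j \<le> x" if "x \<in># shift_mset (p * j) M3" for x
   using that by (auto simp: set_shift_mset)
  have "?lo M1 = M1" "?lo (shift_mset (p * i) M2) = {#}"
   "?lo (shift_mset (p * j) M3) = {#}"
   "?mid M1 = {#}"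
   "?mid (shift_mset (p * i) M2) = shift_mset (p * i) M2"
   "?mid (shift_mset (p * j) M3) = {#}"
   "?hi M1 = {#}" "?hi (shift_mset (p * i) M2) = {#}"
   "?hi (shift_mset (p * j) M3) = shift_mset (p * j) M3"
   by (rule filter_mset_all filter_mset_none, use r1 r2 r3 pij in \<open>meson leD less_le_trans le_trans\<close>)+
  thus "?lo (h (M1, M2, M3)) = M1"
    "?mid (h (M1, M2, M3)) = shift_mset (p * i) M2"
    "?hi (h (M1, M2, M3)) = shift_mset (p * j) M3"
   by (simp_all only: h_def case_prod_conv filter_union_mset add_0_left add_0_right)
 qed
 have sizes: "i + (j - i - size K) + (N - j) = N - size K" using ij sK by simp
 have "(\<Sum>M\<in>S. corr_weight g p (shift_pairs (p * i) K) M) = (\<Sum>(M1, M2, M3)\<in>C1 \<times> C2 \<times> C3. conf_weight g p M1 * (corr_weight g p K M2 * conf_weight g p M3))"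
 proof (rule sum.reindex_bij_witness[where i = h and j = h'])
  fix M assume M: "M \<in> S"
  hence Mc: "set_mset M \<subseteq> {..<p * N}" "size M = N - size K" by (auto simp: S_def cfg_def)
  let ?M1 = "?lo M" and ?M2 = "?mid M"
   and ?M3 = "?hi M"
  have sh: "shift_mset (p * i) (image_mset (\<lambda>x. x - p * i) ?M2) = ?M2"
    "shift_mset (p * j) (image_mset (\<lambda>x. x - p * j) ?M3) = ?M3"
   by (rule shift_unshift; auto)+
  have lt: "!!x. x < p * i ==> x < p * j" using pij(1) by linarith
  have parts: "?M1 + ?M2 + ?M3 = M"
   by (intro multiset_eqI) (auto dest: lt)
  show hh: "h (h' M) = M" unfolding h'_def h_def case_prod_conv sh by (rule parts)
  have s1: "size ?M1 = i" "sum_mset ?M1 = tri p i" "size ?M3 = N - j" "sum_mset ?M3 = tri p (N - j) + p * j * (N - j)" "P ?M1"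
   using M by (auto simp: S_def ren_left_def ren_right_def)
  have "size ?M1 + size ?M2 + size ?M3 = N - size K" using arg_cong[OF parts, of size] Mc by simp
  hence s2: "size ?M2 = j - i - size K" using s1 sizes by linarith
  have "sum_mset (image_mset (\<lambda>x. x - p * j) ?M3) + p * j * (N - j) = sum_mset ?M3"
   using arg_cong[OF sh(2), of sum_mset] s1(3) by (simp add: sum_shift_mset)
  hence s3: "sum_mset (image_mset (\<lambda>x. x - p * j) ?M3) = tri p (N - j)" using s1 by simp
  show h'M: "h' M \<in> C1 \<times> C2 \<times> C3"
  proof -
   have "?M1 \<in> C1" using s1 by (auto simp: C1_def cfg_def)
   moreover have "image_mset (\<lambda>x. x - p * i) ?M2 \<in> C2"
   proof -
    have "x - p * i < p * (j - i)" if "x \<in># ?M2" for x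
    proof -
     have "p * i \<le> x" "x < p * j" using that by auto
     thus ?thesis using pij(3) by linarith
    qed
    thus ?thesis using s2 by (auto simp: C2_def cfg_def simp del: diff_mult_distrib2 set_mset_filter)
   qed
   moreover have "image_mset (\<lambda>x. x - p * j) ?M3 \<in> C3"
   proof -
    have "x - p * j < p * (N - j)" if "x \<in># ?M3" for x
    proof -
     have "p * j \<le> x" "x < p * N" using that Mc(1) by auto
     thus ?thesis using pij(4) by linarith
    qed
    thus ?thesis using s1 s3 by (auto simp: C3_def cfg_def simp del: diff_mult_distrib2 set_mset_filter)
   qed
   ultimately show ?thesis by (simp add: h'_def)
  qed
  obtain M1 M2 M3 where e: "h' M = (M1, M2, M3)" by (cases "h' M")
  have m: "M1 \<in> C1" "M2 \<in> C2" "M3 \<in> C3" using h'M e by auto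
  have Me: "M = M1 + shift_mset (p * i) M2 + shift_mset (p * j) M3" using hh e by (simp add: h_def)
  have sz: "size M1 = i" "size M2 = j - i - size K" "size M3 = N - j" "sum_mset M1 = tri p i" "sum_mset M3 = tri p (N - j)"
   using m by (auto simp: C1_def C2_def C3_def cfg_def)
  have szK: "size (K + diag M2) = j - i" using sz sK by simp
  \<comment> \<open>Nested so that the left split applies at \<open>M1\<close> and the right split
    at \<open>M3\<close>; nothing is known about the momenta of the middle piece.\<close>
  have d: "shift_pairs (p * i) K + diag M = diag M1 + shift_pairs (p * size (diag M1)) ((K + diag M2) + shift_pairs (p * size (K + diag M2)) (diag M3))"
   unfolding Me szK by (simp add: diag_union diag_shift shift_pairs_union shift_pairs_shift pij(3) sz)
  have w: "pair_weight g p (shift_pairs (p * i) K + diag M) = pair_weight g p (diag M1) * (pair_weight g p (K + diag M2) * pair_weight g p (diag M3))"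
   unfolding d by (subst pair_weight_split[OF p], simp add: sz, simp add: sz, subst pair_weight_split_right[OF p]) (simp_all add: sz)
  have r: "x < p * i" if "x \<in># M1" for x using that m(1) by (auto simp: C1_def cfg_def)
  have r2: "x < p * j" if "x \<in># M1 + shift_mset (p * i) M2" for x
   using that m(1,2) pij by (fastforce simp: C1_def C2_def cfg_def set_shift_mset)
  have mf: "mfact M = mfact M1 * mfact M2 * mfact M3"
   unfolding Me
   by (subst mfact_union, use r2 in \<open>force simp: set_shift_mset\<close>, subst mfact_union, use r in \<open>force simp: set_shift_mset\<close>) simp
  have "corr_weight g p (shift_pairs (p * i) K) M = conf_weight g p M1 * (corr_weight g p K M2 * conf_weight g p M3)"
   unfolding conf_weight_def corr_weight_def w mf by simp
  thus "(case h' M of (M1, M2, M3) => conf_weight g p M1 * (corr_weight g p K M2 * conf_weight g p M3)) =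
     corr_weight g p (shift_pairs (p * i) K) M" using e by simp
 next
  fix b assume "b \<in> C1 \<times> C2 \<times> C3"
  then obtain M1 M2 M3 where b: "b = (M1, M2, M3)" and m: "M1 \<in> C1" "M2 \<in> C2" "M3 \<in> C3" by auto
  note f = fil[OF m]
  show "h' (h b) = b" unfolding b h'_def f by (simp add: unshift_shift)
  have sz: "size M1 = i" "size M2 = j - i - size K" "size M3 = N - j" "sum_mset M1 = tri p i" "sum_mset M3 = tri p (N - j)" "P M1"
   using m by (auto simp: C1_def C2_def C3_def cfg_def)
  have "set_mset (h b) \<subseteq> {..<p * N}"
   using m pij by (fastforce simp: b h_def C1_def C2_def C3_def cfg_def set_shift_mset)
  moreover have "size (h b) = N - size K" using sz sizes by (simp add: b h_def)
  ultimately show "h b \<in> S"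
   using sz unfolding S_def ren_left_def ren_right_def b f by (simp add: cfg_def f sum_shift_mset)
 qed
 also have "... = (\<Sum>M\<in>C1. conf_weight g p M) * corr_sum g p (j - i) K * (\<Sum>M\<in>C3. conf_weight g p M)"
 proof -
  have "(\<Sum>(M1, M2, M3)\<in>C1 \<times> C2 \<times> C3. conf_weight g p M1 * (corr_weight g p K M2 * conf_weight g p M3))
   = (\<Sum>M1\<in>C1. \<Sum>M2\<in>C2. \<Sum>M3\<in>C3. conf_weight g p M1 * (corr_weight g p K M2 * conf_weight g p M3))"
   by (simp add: sum.cartesian_product)
  also have "... = (\<Sum>M\<in>C1. conf_weight g p M) * ((\<Sum>M\<in>C2. corr_weight g p K M) * (\<Sum>M\<in>C3. conf_weight g p M))"
   by (simp only: sum_distrib_left[symmetric] sum_distrib_right[symmetric])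
  finally show ?thesis unfolding corr_sum_def C2_def by (simp add: mult.assoc)
 qed
 finally show ?thesis unfolding S_def[symmetric] eq1 eq3 .
qed

lemma corr_sum_empty: "corr_sum g p N {#} = part_fun g p N"
 by (simp add: part_fun_def)

text \<open>Where the weight is nonzero, total number and total momentum are fixed, so the
  conditions on the two sides of the cut are complementary by \<open>tri_add\<close>.\<close>

lemma ren_right_iff_left:
 assumes "p \<ge> 1" "conf_weight g p M \<noteq> 0" "size M = N" "j \<le> N"
 shows "ren_right p N j M \<longleftrightarrow> ren_left p j M"
proof -
 let ?A = "filter_mset (\<lambda>x. x < p * j) M" and ?B = "filter_mset (\<lambda>x. \<not> x < p * j) M"
 have M: "M = ?A + ?B" by (rule multiset_partition)
 have "size M = size ?A + size ?B" "sum_mset M = sum_mset ?A + sum_mset ?B"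
  by (metis M size_union, metis M sum_mset.union)
 moreover have "sum_mset M = tri p N" using conf_weight_nonzeroD(1)[OF assms(1,2)] assms(3) by simp
 moreover have "tri p N = tri p j + tri p (N - j) + p * j * (N - j)" using tri_add[of p j "N - j"] assms(4) by simp
 ultimately show ?thesis unfolding ren_left_def ren_right_def using assms(3,4) by linarith
qed

section \<open>Renewals\<close>

lemma renewal_split_pred:
 assumes p: "p \<ge> 1" and ij: "i \<le> j" "j \<le> N"
 shows "(\<Sum>M | M \<in> cfg (p * N) N & ren_left p i M & ren_left p j M & P (filter_mset (\<lambda>x. x < p * i) M). conf_weight g p M)
   = (\<Sum>M | M \<in> cfg (p * i) i & P M. conf_weight g p M) * part_fun g p (j - i) * part_fun g p (N - j)"
proof -
 have "(\<Sum>M | M \<in> cfg (p * N) N & ren_left p i M & ren_left p j M & P (filter_mset (\<lambda>x. x < p * i) M). conf_weight g p M)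
  = (\<Sum>M | M \<in> cfg (p * N) N & ren_left p i M & ren_right p N j M & P (filter_mset (\<lambda>x. x < p * i) M). conf_weight g p M)"
 proof (rule sum.mono_neutral_cong)
  have "conf_weight g p M = 0 \<or> ren_right p N j M = ren_left p j M" if "M \<in> cfg (p * N) N" for M
   using ren_right_iff_left[OF p _ _ ij(2)] that by (auto simp: cfg_def)
  thus "!!M. M \<in> {M \<in> cfg (p * N) N. ren_left p i M & ren_right p N j M & P (filter_mset (\<lambda>x. x < p * i) M)} -
    {M \<in> cfg (p * N) N. ren_left p i M & ren_left p j M & P (filter_mset (\<lambda>x. x < p * i) M)} ==> conf_weight g p M = 0"
   "!!M. M \<in> {M \<in> cfg (p * N) N. ren_left p i M & ren_left p j M & P (filter_mset (\<lambda>x. x < p * i) M)} -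
    {M \<in> cfg (p * N) N. ren_left p i M & ren_right p N j M & P (filter_mset (\<lambda>x. x < p * i) M)} ==> conf_weight g p M = 0"
   by blast+
 qed auto
 also have "... = (\<Sum>M | M \<in> cfg (p * i) i & P M. conf_weight g p M) * part_fun g p (j - i) * part_fun g p (N - j)"
  using corr_sum_renewal_split[OF p ij, where K = "{#}" and P = P and g = g]
  by (simp add: corr_sum_empty conf_weight_def shift_pairs_def)
 finally show ?thesis .
qed

lemma sum_two_renewals:
 assumes p: "p \<ge> 1" and ij: "i \<le> j" "j \<le> N"
 shows "(\<Sum>M | M \<in> cfg (p * N) N & ren_left p i M & ren_left p j M. conf_weight g p M)
   = part_fun g p i * part_fun g p (j - i) * part_fun g p (N - j)"
 using renewal_split_pred[OF p ij, where P = "\<lambda>_. True" and g = g] by (simp add: part_fun_eq)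

lemma cfg_0: "cfg Q 0 = {{#}}"
 by (auto simp: cfg_def)

lemma part_fun_0: "p \<ge> 1 ==> part_fun g p 0 = 1"
proof -
 assume p: "p \<ge> 1"
 have "pair_coeff p {#} = 1" using pair_coeff_mset[OF p, of "[]"] by (simp add: vcoeff_def factors_def score_def)
 thus ?thesis by (simp add: part_fun_eq cfg_0 conf_weight_def corr_weight_def pair_weight_def mfact_def diag_def)
qed

text \<open>A single particle has momentum 0. The value yields monotonicity of the partition
  function and aperiodicity of the renewal sequence.\<close>

lemma part_fun_1: "p \<ge> 1 ==> part_fun g p 1 = 1"
proof -
 assume p: "p \<ge> 1"
 have "pair_coeff p {#(0, 0)#} = 1"
 proof -
  have f: "factors p (Suc 0) = {}" by (auto simp: factors_def)
  have "{X. X \<subseteq> factors p (Suc 0) & score p (Suc 0) X = [0]} = {{}}" by (auto simp: f score_def)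
  hence "vcoeff p [0] = 1" by (simp add: vcoeff_def f)
  thus ?thesis using pair_coeff_mset[OF p, of "[(0, 0)]"] by simp
 qed
 hence w: "conf_weight g p {#0#} = 1"
  by (simp add: conf_weight_def corr_weight_def pair_weight_def mfact_def diag_def)
 have "part_fun g p 1 = (\<Sum>M\<in>{{#0#}}. conf_weight g p M)"
  unfolding part_fun_eq
 proof (rule sum.mono_neutral_right)
  show "{{#0#}} \<subseteq> cfg (p * 1) 1" using p by (auto simp: cfg_def)
  show "\<forall>M\<in>cfg (p * 1) 1 - {{#0#}}. conf_weight g p M = 0"
  proof
   fix M assume M: "M \<in> cfg (p * 1) 1 - {{#0#}}"
   then obtain x where x: "M = {#x#}" using size_1_singleton_mset[of M] by (auto simp: cfg_def)
   with M have "x \<noteq> 0" by auto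
   thus "conf_weight g p M = 0"
    using conf_weight_nonzeroD(1)[OF p, of g M] x by (auto simp: tri_def)
  qed
 qed simp
 thus ?thesis using w by simp
qed

lemma sum_one_renewal:
 assumes p: "p \<ge> 1" and i: "i \<le> N"
 shows "(\<Sum>M | M \<in> cfg (p * N) N & ren_left p i M. conf_weight g p M) = part_fun g p i * part_fun g p (N - i)"
 using sum_two_renewals[OF p _ i, of i g] part_fun_0[OF p, of g] by simp

lemma part_fun_nonneg: "p \<ge> 1 ==> part_fun g p N \<ge> 0"
 unfolding part_fun_eq by (intro sum_nonneg) simp

lemma part_fun_supermult:
 assumes p: "p \<ge> 1" and i: "i \<le> N"
 shows "part_fun g p i * part_fun g p (N - i) \<le> part_fun g p N"
 unfolding sum_one_renewal[OF assms, symmetric] part_fun_eq[of g p N]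
 by (rule sum_mono2) (use p in auto)

lemma part_fun_mono_Suc: "p \<ge> 1 ==> part_fun g p N \<le> part_fun g p (Suc N)"
 using part_fun_supermult[of p 1 "Suc N" g] part_fun_1[of p g] by simp

lemma part_fun_mono: "p \<ge> 1 ==> M \<le> N ==> part_fun g p M \<le> part_fun g p N"
 by (rule lift_Suc_mono_le[where f = "part_fun g p"]) (use part_fun_mono_Suc in auto)

lemma part_fun_ge_1: "p \<ge> 1 ==> part_fun g p N \<ge> 1"
 using part_fun_mono[of p 0 N g] part_fun_0[of p g] by simp

text \<open>The weight of configurations without an interior renewal; after division by the
  exponential growth it is the waiting-time distribution of the renewal equation.\<close>

definition irreducible_sum :: "real => nat => nat => real" where
 "irreducible_sum g p N = (\<Sum>M | M \<in> cfg (p * N) N & (\<forall>i. 0 < i & i < N \<longrightarrow> \<not> ren_left p i M). conf_weight g p M)"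

lemma irreducible_sum_nonneg: "p \<ge> 1 ==> irreducible_sum g p N \<ge> 0"
 unfolding irreducible_sum_def by (intro sum_nonneg) simp

lemma irreducible_sum_1: "p \<ge> 1 ==> irreducible_sum g p 1 = 1"
proof -
 assume p: "p \<ge> 1"
 have "irreducible_sum g p 1 = part_fun g p 1" unfolding irreducible_sum_def part_fun_eq by (intro sum.cong) auto
 thus ?thesis using part_fun_1[OF p] by simp
qed

lemma ren_left_filter:
 assumes "i' \<le> i" shows "ren_left p i' (filter_mset (\<lambda>x. x < p * i) M) \<longleftrightarrow> ren_left p i' M"
proof -
 have "p * i' \<le> p * i" using assms by simp
 hence "x < p * i' \<longleftrightarrow> x < p * i' & x < p * i" for x by linarith
 hence "filter_mset (\<lambda>x. x < p * i') (filter_mset (\<lambda>x. x < p * i) M) = filter_mset (\<lambda>x. x < p * i') M"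
  unfolding filter_filter_mset by (intro filter_mset_cong refl) blast
 thus ?thesis by (simp add: ren_left_def)
qed

text \<open>Decomposition by the first renewal: what precedes it is irreducible, what follows is
  arbitrary. The end \<open>N\<close> is itself a renewal for every configuration of nonzero weight,
  so a first renewal exists.\<close>

lemma part_fun_renewal:
 assumes p: "p \<ge> 1" and N: "N \<ge> 1"
 shows "part_fun g p N = (\<Sum>i=1..N. irreducible_sum g p i * part_fun g p (N - i))"
proof -
 define first where "first M = (LEAST i. 0 < i & ren_left p i M)" for M
 define S where "S = {M \<in> cfg (p * N) N. conf_weight g p M \<noteq> 0}"
 have renN: "ren_left p N M" if "M \<in> S" for M
 proof -
  have "filter_mset (\<lambda>x. x < p * N) M = M" using that by (intro filter_mset_all) (auto simp: S_def cfg_def)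
  thus ?thesis using that conf_weight_nonzeroD(1)[OF p, of g M] by (simp add: ren_left_def S_def cfg_def)
 qed
 have fst: "0 < first M & ren_left p (first M) M" "first M \<le> N" if "M \<in> S" for M
 proof -
  have N': "0 < N & ren_left p N M" using N renN[OF that] by simp
  show "0 < first M & ren_left p (first M) M" unfolding first_def by (rule LeastI[of "\<lambda>i. 0 < i & ren_left p i M", OF N'])
  show "first M \<le> N" unfolding first_def by (rule Least_le[of "\<lambda>i. 0 < i & ren_left p i M", OF N'])
 qed
 have firstI: "first M = i" if "0 < i" "ren_left p i M" "\<forall>i'. 0 < i' & i' < i \<longrightarrow> \<not> ren_left p i' M" for M i
  unfolding first_def using that by (intro Least_equality) (auto simp: not_less[symmetric])
 have "part_fun g p N = (\<Sum>M\<in>S. conf_weight g p M)"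
  unfolding part_fun_eq S_def by (rule sum.mono_neutral_right) auto
 also have "... = (\<Sum>i=1..N. \<Sum>M\<in>{M \<in> S. first M = i}. conf_weight g p M)"
  by (rule sum.group[symmetric]) (use fst in \<open>fastforce simp: S_def\<close>)+
 also have "... = (\<Sum>i=1..N. irreducible_sum g p i * part_fun g p (N - i))"
 proof (rule sum.cong[OF refl])
  fix i assume i: "i \<in> {1..N}"
  define P where "P M \<longleftrightarrow> (\<forall>i'. 0 < i' & i' < i \<longrightarrow> \<not> ren_left p i' M)" for M
  have Pf: "P (filter_mset (\<lambda>x. x < p * i) M) \<longleftrightarrow> P M" for M
   unfolding P_def using ren_left_filter[of _ i p M] by (metis less_imp_le)
  have firstI': "first M = i" if "0 < i" "ren_left p i M" "P M" for M
   using firstI[of i M] that by (simp add: P_def)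
  have "(\<Sum>M\<in>{M \<in> S. first M = i}. conf_weight g p M)
   = (\<Sum>M | M \<in> cfg (p * N) N & ren_left p i M & ren_left p i M & P (filter_mset (\<lambda>x. x < p * i) M). conf_weight g p M)"
  proof (rule sum.mono_neutral_left)
   show "{M \<in> S. first M = i} \<subseteq> {M \<in> cfg (p * N) N. ren_left p i M & ren_left p i M & P (filter_mset (\<lambda>x. x < p * i) M)}"
   proof
    fix M assume M: "M \<in> {M \<in> S. first M = i}"
    have "P M" unfolding P_def
    proof (intro allI impI notI)
     fix i' assume i': "0 < i' & i' < i" "ren_left p i' M"
     hence "first M \<le> i'" unfolding first_def by (intro Least_le) auto
     thus False using M i' by auto
    qed
    thus "M \<in> {M \<in> cfg (p * N) N. ren_left p i M & ren_left p i M & P (filter_mset (\<lambda>x. x < p * i) M)}"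
     using M fst[of M] by (auto simp: Pf S_def)
   qed
   show "\<forall>M\<in>{M \<in> cfg (p * N) N. ren_left p i M & ren_left p i M & P (filter_mset (\<lambda>x. x < p * i) M)} - {M \<in> S. first M = i}. conf_weight g p M = 0"
    using i firstI' by (auto simp: S_def Pf)
  qed simp
  also have "... = irreducible_sum g p i * part_fun g p 0 * part_fun g p (N - i)"
   using renewal_split_pred[OF p, of i i N g P] i by (simp add: irreducible_sum_def P_def)
  finally show "(\<Sum>M\<in>{M \<in> S. first M = i}. conf_weight g p M) = irreducible_sum g p i * part_fun g p (N - i)"
   by (simp add: part_fun_0[OF p])
 qed
 finally show ?thesis .
qed

section \<open>Integration over the cylinder\<close>

lemma sigma_finite_cyl: "sigma_finite_measure (cyl_measure R)"
 unfolding cyl_measure_def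
proof (rule sigma_finite_measure_restrict_space)
 show "sigma_finite_measure (lborel :: complex measure)" by (rule lborel.sigma_finite_measure_axioms)
 have "closed (cyl R)" unfolding cyl_def
  by (intro closed_Collect_conj closed_Collect_le continuous_intros)
 thus "cyl R \<in> sets lborel" by simp
qed

lemma sets_cyl [measurable]: "cyl R \<in> sets borel"
proof -
 have "closed (cyl R)" unfolding cyl_def
  by (intro closed_Collect_conj closed_Collect_le continuous_intros)
 thus ?thesis by simp
qed

lemma space_cyl_measure [simp]: "space (cyl_measure R) = cyl R"
 by (simp add: cyl_measure_def space_restrict_space)

lemma measurable_cyl_measure: "f \<in> borel_measurable borel ==> f \<in> borel_measurable (cyl_measure R)"
 unfolding cyl_measure_def by (intro measurable_restrict_space1) simp

lemma measurable_cyl_id [measurable]: "(\<lambda>z. z) \<in> cyl_measure R \<rightarrow>\<^sub>M borel"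
 by (rule measurable_cyl_measure) simp

lemma measurable_Re_borel [measurable]: "Re \<in> borel_measurable borel"
 by (intro borel_measurable_continuous_onI continuous_intros)

lemma measurable_Re_cyl [measurable]: "Re \<in> borel_measurable (cyl_measure R)"
 by (rule measurable_cyl_measure) simp

abbreviation cylN :: "real => nat set => (nat => complex) measure" where
 "cylN R I \<equiv> PiM I (\<lambda>_. cyl_measure R)"

lemma measurable_component_cyl [measurable]:
 "i \<in> I ==> (\<lambda>w. w i) \<in> cylN R I \<rightarrow>\<^sub>M borel"
 using measurable_compose[where f = "\<lambda>w. w i" and g = "\<lambda>z. z", OF measurable_component_singleton measurable_cyl_id] .

lemma product_sigma_finite_cyl: "product_sigma_finite (\<lambda>_. cyl_measure R)"
 unfolding product_sigma_finite_def using sigma_finite_cyl by blast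

lemma measurable_translate_cyl [measurable]: "(\<lambda>z. z + of_real s) \<in> cyl_measure R \<rightarrow>\<^sub>M cyl_measure R"
 unfolding cyl_measure_def
 by (rule measurable_restrict_space3) (auto simp: cyl_def)

lemma distr_translate_cyl: "distr (cyl_measure R) (cyl_measure R) (\<lambda>z. z + of_real s) = cyl_measure R"
proof (rule measure_eqI)
 fix A assume "A \<in> sets (distr (cyl_measure R) (cyl_measure R) (\<lambda>z. z + complex_of_real s))"
 hence A: "A \<in> sets (cyl_measure R)" by simp
 hence A': "A \<in> sets borel" "A \<subseteq> cyl R"
  by (auto simp: cyl_measure_def sets_restrict_space_iff)
 have eq: "(\<lambda>z. z + of_real s) -` A \<inter> cyl R = (+) (of_real s) -` A"
  using A'(2) by (auto simp: cyl_def add.commute)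
 have "emeasure (distr (cyl_measure R) (cyl_measure R) (\<lambda>z. z + of_real s)) A = emeasure (cyl_measure R) ((+) (of_real s) -` A)"
  using A by (subst emeasure_distr) (auto simp: eq)
 also have "... = emeasure lborel ((+) (of_real s) -` A)"
  unfolding cyl_measure_def by (subst emeasure_restrict_space) (use A'(2) in \<open>auto simp: cyl_def\<close>)
 also have "... = emeasure (distr lborel borel ((+) (of_real s))) A"
  using A' by (subst emeasure_distr) auto
 also have "... = emeasure lborel A" by (simp add: lborel_distr_plus)
 also have "... = emeasure (cyl_measure R) A"
  unfolding cyl_measure_def by (subst emeasure_restrict_space) (use A' in auto)
 finally show "emeasure (distr (cyl_measure R) (cyl_measure R) (\<lambda>z. z + of_real s)) A = emeasure (cyl_measure R) A" .
qed simp

lemma measurable_reindex_cyl: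
 assumes "!!j. j \<in> J ==> t j \<in> I"
 shows "(\<lambda>w. \<lambda>j\<in>J. w (t j) + of_real s) \<in> cylN R I \<rightarrow>\<^sub>M cylN R J"
proof (rule measurable_restrict)
 fix j assume "j \<in> J"
 hence "(\<lambda>w. w (t j)) \<in> cylN R I \<rightarrow>\<^sub>M cyl_measure R"
  using assms by (intro measurable_component_singleton)
 thus "(\<lambda>w. w (t j) + of_real s) \<in> cylN R I \<rightarrow>\<^sub>M cyl_measure R"
  by (rule measurable_compose) (rule measurable_translate_cyl)
qed

text \<open>Combines renumbering of the particles with a common axial translation, since both are
  needed for the product measure.\<close>

lemma distr_reindex_cyl:
 assumes fin: "finite I" "finite J" and t: "bij_betw t J I"
 shows "distr (cylN R I) (cylN R J) (\<lambda>w. \<lambda>j\<in>J. w (t j) + of_real s) = cylN R J"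
proof -
 let ?T = "\<lambda>w. \<lambda>j\<in>J. w (t j) + of_real s"
 interpret product_sigma_finite "\<lambda>_::nat. cyl_measure R" by (rule product_sigma_finite_cyl)
 have tJ: "!!j. j \<in> J ==> t j \<in> I" using t by (auto simp: bij_betw_def)
 show ?thesis
 proof (rule PiM_eqI[OF fin(2)])
  fix A :: "nat => complex set" assume A: "!!j. j \<in> J ==> A j \<in> sets (cyl_measure R)"
  define t' where "t' = the_inv_into J t"
  have t': "t' i \<in> J" "t (t' i) = i" if "i \<in> I" for i
   using t that unfolding t'_def by (auto simp: bij_betw_def f_the_inv_into_f the_inv_into_into)
  have t't: "t' (t j) = j" if "j \<in> J" for j
   using t that unfolding t'_def by (auto simp: bij_betw_def the_inv_into_f_f)
  let ?B = "\<lambda>i. (\<lambda>z. z + of_real s) -` A (t' i) \<inter> space (cyl_measure R)"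
  have B: "?B i \<in> sets (cyl_measure R)" if "i \<in> I" for i
   using measurable_sets[OF measurable_translate_cyl A[OF t'(1)[OF that]]] .
  have "?T -` (Pi\<^sub>E J A) \<inter> space (cylN R I) = Pi\<^sub>E I ?B"
  proof (intro set_eqI iffI)
   fix w assume w: "w \<in> ?T -` (Pi\<^sub>E J A) \<inter> space (cylN R I)"
   have "w i + of_real s \<in> A (t' i)" if "i \<in> I" for i
   proof -
    have "(\<lambda>j\<in>J. w (t j) + of_real s) (t' i) \<in> A (t' i)" using w t'(1)[OF that] by (auto simp: PiE_iff)
    thus ?thesis using t'[OF that] by simp
   qed
   thus "w \<in> Pi\<^sub>E I ?B" using w by (auto simp: space_PiM PiE_iff)
  next
   fix w assume w: "w \<in> Pi\<^sub>E I ?B"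
   have "w (t j) + of_real s \<in> A j" if "j \<in> J" for j
    using w tJ[OF that] t't[OF that] by (force simp: PiE_iff)
   thus "w \<in> ?T -` (Pi\<^sub>E J A) \<inter> space (cylN R I)"
    using w by (auto simp: space_PiM PiE_iff)
  qed
  hence "emeasure (distr (cylN R I) (cylN R J) ?T) (Pi\<^sub>E J A) = emeasure (cylN R I) (Pi\<^sub>E I ?B)"
   using A fin by (subst emeasure_distr[OF measurable_reindex_cyl[OF tJ]]) (auto intro!: sets_PiM_I_finite)
  also have "... = (\<Prod>i\<in>I. emeasure (cyl_measure R) (?B i))"
   using fin B by (subst emeasure_PiM) auto
  also have "... = (\<Prod>i\<in>I. emeasure (cyl_measure R) (A (t' i)))"
  proof (rule prod.cong[OF refl])
   fix i assume "i \<in> I"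
   hence "emeasure (distr (cyl_measure R) (cyl_measure R) (\<lambda>z. z + of_real s)) (A (t' i)) = emeasure (cyl_measure R) (?B i)"
    using A t' by (subst emeasure_distr) auto
   thus "emeasure (cyl_measure R) (?B i) = emeasure (cyl_measure R) (A (t' i))"
    by (simp add: distr_translate_cyl)
  qed
  also have "... = (\<Prod>j\<in>J. emeasure (cyl_measure R) (A j))"
   by (rule prod.reindex_bij_witness[where i = t and j = t']) (use t' t't tJ in auto)
  finally show "emeasure (distr (cylN R I) (cylN R J) ?T) (Pi\<^sub>E J A) = (\<Prod>j\<in>J. emeasure (cyl_measure R) (A j))" .
 qed simp
qed

lemma nn_integral_reindex_cyl:
 assumes fin: "finite I" "finite J" and t: "bij_betw t J I" and f: "f \<in> borel_measurable (cylN R J)"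
 shows "(\<integral>\<^sup>+w. f (\<lambda>j\<in>J. w (t j) + of_real s) \<partial>cylN R I) = (\<integral>\<^sup>+w. f w \<partial>cylN R J)"
proof -
 have tJ: "!!j. j \<in> J ==> t j \<in> I" using t by (auto simp: bij_betw_def)
 have "(\<integral>\<^sup>+w. f w \<partial>cylN R J) = (\<integral>\<^sup>+w. f w \<partial>distr (cylN R I) (cylN R J) (\<lambda>w. \<lambda>j\<in>J. w (t j) + of_real s))"
  by (simp add: distr_reindex_cyl[OF fin t])
 also have "... = (\<integral>\<^sup>+w. f (\<lambda>j\<in>J. w (t j) + of_real s) \<partial>cylN R I)"
  by (rule nn_integral_distr) (use measurable_reindex_cyl tJ f in auto)
 finally show ?thesis ..
qed

lemma nn_integral_cylN_split:
 assumes f: "f \<in> borel_measurable (cylN R {..<a})" and g: "g \<in> borel_measurable (cylN R {..<c})"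
 shows "(\<integral>\<^sup>+w. f (restrict w {..<a}) * g (\<lambda>j\<in>{..<c}. w (a + j)) \<partial>cylN R {..<a + c})
   = (\<integral>\<^sup>+w. f w \<partial>cylN R {..<a}) * (\<integral>\<^sup>+w. g w \<partial>cylN R {..<c})"
proof -
 interpret product_sigma_finite "\<lambda>_::nat. cyl_measure R" by (rule product_sigma_finite_cyl)
 have U: "{..<a} \<union> {a..<a + c} = {..<a + c}" by auto
 have bij: "bij_betw (\<lambda>j. a + j) {..<c} {a..<a + c}"
  by (rule bij_betw_byWitness[where f' = "\<lambda>i. i - a"]) auto
 have mg: "(\<lambda>w. g (\<lambda>j\<in>{..<c}. w (a + j))) \<in> borel_measurable (cylN R {a..<a + c})"
  by (rule measurable_compose[OF _ g]) (auto intro!: measurable_restrict)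
 have mg': "(\<lambda>w. g (\<lambda>j\<in>{..<c}. w (a + j))) \<in> borel_measurable (cylN R {..<a + c})"
  by (rule measurable_compose[OF _ g]) (auto intro!: measurable_restrict)
 have mf: "(\<lambda>w. f (restrict w {..<a})) \<in> borel_measurable (cylN R {..<a + c})"
  by (rule measurable_compose[OF _ f]) (auto intro!: measurable_restrict_subset)
 have "(\<integral>\<^sup>+w. f (restrict w {..<a}) * g (\<lambda>j\<in>{..<c}. w (a + j)) \<partial>cylN R {..<a + c})
  = (\<integral>\<^sup>+x. \<integral>\<^sup>+y. f (restrict (merge {..<a} {a..<a+c} (x, y)) {..<a}) * g (\<lambda>j\<in>{..<c}. merge {..<a} {a..<a+c} (x, y) (a + j))
    \<partial>cylN R {a..<a+c} \<partial>cylN R {..<a})"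
 proof -
  have dis: "{..<a} \<inter> {a..<a+c} = {}" by auto
  show ?thesis
   by (rule product_nn_integral_fold[OF dis, unfolded U]) (use mf mg' in auto)
 qed
 also have "... = (\<integral>\<^sup>+x. \<integral>\<^sup>+y. f x * g (\<lambda>j\<in>{..<c}. y (a + j)) \<partial>cylN R {a..<a+c} \<partial>cylN R {..<a})"
 proof (rule nn_integral_cong, rule nn_integral_cong)
  fix x y assume x: "x \<in> space (cylN R {..<a})" and y: "y \<in> space (cylN R {a..<a+c})"
  have "restrict (merge {..<a} {a..<a+c} (x, y)) {..<a} = x"
   using x by (auto simp: merge_def space_PiM PiE_def extensional_def fun_eq_iff)
  moreover have "(\<lambda>j\<in>{..<c}. merge {..<a} {a..<a+c} (x, y) (a + j)) = (\<lambda>j\<in>{..<c}. y (a + j))"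
   by (auto simp: merge_def fun_eq_iff)
  ultimately show "f (restrict (merge {..<a} {a..<a+c} (x, y)) {..<a}) * g (\<lambda>j\<in>{..<c}. merge {..<a} {a..<a+c} (x, y) (a + j)) = f x * g (\<lambda>j\<in>{..<c}. y (a + j))"
   by simp
 qed
 also have "... = (\<integral>\<^sup>+x. f x * (\<integral>\<^sup>+y. g (\<lambda>j\<in>{..<c}. y (a + j)) \<partial>cylN R {a..<a+c}) \<partial>cylN R {..<a})"
  by (intro nn_integral_cong nn_integral_cmult mg)
 also have "(\<integral>\<^sup>+y. g (\<lambda>j\<in>{..<c}. y (a + j)) \<partial>cylN R {a..<a+c}) = (\<integral>\<^sup>+w. g w \<partial>cylN R {..<c})"
  using nn_integral_reindex_cyl[OF _ _ bij g, where s = 0] by simp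
 also have "(\<integral>\<^sup>+x. f x * (\<integral>\<^sup>+w. g w \<partial>cylN R {..<c}) \<partial>cylN R {..<a}) = (\<integral>\<^sup>+w. f w \<partial>cylN R {..<a}) * (\<integral>\<^sup>+w. g w \<partial>cylN R {..<c})"
  by (intro nn_integral_multc f)
 finally show ?thesis .
qed

text \<open>Ensures that almost every configuration is sorted by exactly one permutation, which is
  used to reduce symmetric integrals to the ordered sector.\<close>

lemma AE_cylN_no_ties:
 assumes ij: "i \<noteq> j" "i \<in> I" "j \<in> I" and fin: "finite I"
 shows "AE w in cylN R I. Re (w i) \<noteq> Re (w j)"
proof -
 interpret product_sigma_finite "\<lambda>_::nat. cyl_measure R" by (rule product_sigma_finite_cyl)
 have slice: "(\<integral>\<^sup>+y. indicator {z. Re z = c} y \<partial>cyl_measure R) = 0" for c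
 proof -
  have eq: "{z. Re z = c} = {z. 1 \<bullet> z = c}" by (auto simp: inner_complex_def)
  have "{z. Re z = c} \<in> null_sets lborel"
   unfolding eq using negligible_hyperplane[of "1::complex" c]
   by (subst null_sets_completion_iff[symmetric]) (auto simp: negligible_iff_null_sets closed_hyperplane)
  hence n: "emeasure lborel {z. Re z = c} = 0" "{z. Re z = c} \<in> sets borel" by (auto simp: null_sets_def)
  have "(\<integral>\<^sup>+y. indicator {z. Re z = c} y \<partial>cyl_measure R) = (\<integral>\<^sup>+y. indicator {z. Re z = c} y * indicator (cyl R) y \<partial>lborel)"
   unfolding cyl_measure_def by (rule nn_integral_restrict_space) simp
  also have "... \<le> (\<integral>\<^sup>+y. indicator {z. Re z = c} y \<partial>lborel)"
   by (rule nn_integral_mono) (simp add: indicator_def)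
  also have "... = 0" using n by simp
  finally show ?thesis by simp
 qed
 define A where "A = {w \<in> space (cylN R I). Re (w i) = Re (w j)}"
 have A: "A \<in> sets (cylN R I)" unfolding A_def using ij by measurable
 have I: "insert i (I - {i}) = I" using ij by auto
 have "emeasure (cylN R I) A = (\<integral>\<^sup>+w. indicator A w \<partial>cylN R I)" using A by simp
 also have "... = (\<integral>\<^sup>+x. (\<integral>\<^sup>+y. indicator A (x(i := y)) \<partial>cyl_measure R) \<partial>cylN R (I - {i}))"
  by (rule product_nn_integral_insert[of "I - {i}" i "indicator A", unfolded I]) (use fin A in auto)
 also have "... \<le> (\<integral>\<^sup>+x. (\<integral>\<^sup>+y. indicator {z. Re z = Re (x j)} y \<partial>cyl_measure R) \<partial>cylN R (I - {i}))"
  using ij by (intro nn_integral_mono) (auto simp: indicator_def A_def)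
 also have "... = 0" by (simp add: slice)
 finally have "emeasure (cylN R I) A = 0" by simp
 hence "A \<in> null_sets (cylN R I)" using A by (simp add: null_sets_def)
 thus ?thesis by (rule AE_I'[where N = A]) (auto simp: A_def)
qed

section \<open>One-dimensional estimates\<close>

text \<open>Bounds the short-range part of the interaction by the confinement energy: if
 \<open>b - a\<close> is large compared to the displacements, then \<open>x b - x a\<close> is of order \<open>per * (b - a)\<close>; otherwise
 \<open>b - a\<close> is bounded by one of the displacements.\<close>
lemma ordered_pair_sum_bound:
 fixes x :: "nat => real"
 assumes R: "R > 0" and per: "per > 0"
  and ord: "!!i j. i \<le> j ==> j < t ==> x i \<le> x j"
 shows "(\<Sum>b<t. \<Sum>a<b. exp (- (x b - x a) / R))
   \<le> (1 / (1 - exp (- (per / (2 * R))))) * real t + (8 / per) * (\<Sum>a<t. \<bar>x a - per * (o' + real a)\<bar>)"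
proof -
 define y where "y a = x a - per * (o' + real a)" for a
 define q where "q = exp (- (per / (2 * R)))"
 have q: "0 < q" "q < 1" using R per by (auto simp: q_def)
 \<comment> \<open>If both displacements are at most a quarter of \<open>per * (b - a)\<close>, half
   of this distance remains as a gap, hence the ratio \<open>q\<close>. Otherwise the term, which is
   at most 1 by the ordering, is charged to a large displacement.\<close>
 have pt: "exp (- (x b - x a) / R) \<le> q ^ (b - a) + of_bool (real (b - a) < 4 / per * \<bar>y a\<bar>) + of_bool (real (b - a) < 4 / per * \<bar>y b\<bar>)"
  if ab: "a < b" "b < t" for a b
 proof (cases "real (b - a) < 4 / per * \<bar>y a\<bar> \<or> real (b - a) < 4 / per * \<bar>y b\<bar>")
  case True
  have "exp (- (x b - x a) / R) \<le> 1" using ord[of a b] ab R by (simp add: divide_le_0_iff)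
  moreover have "q ^ (b - a) \<ge> 0" using q by simp
  moreover have "of_bool (real (b - a) < 4 / per * \<bar>y a\<bar>) + of_bool (real (b - a) < 4 / per * \<bar>y b\<bar>) \<ge> (1::real)"
   using True by auto
  ultimately show ?thesis by linarith
 next
  case False
  hence "4 * \<bar>y a\<bar> \<le> per * real (b - a)" "4 * \<bar>y b\<bar> \<le> per * real (b - a)"
   using per by (auto simp: field_simps)
  moreover have "x b - x a = per * real (b - a) + (y b - y a)"
   using ab unfolding y_def by (simp add: of_nat_diff algebra_simps)
  ultimately have "x b - x a \<ge> per * real (b - a) / 2" by arith
  hence "- (x b - x a) / R \<le> - (per * real (b - a) / 2) / R"
   using R by (intro divide_right_mono) auto
  also have "... = real (b - a) * (- (per / (2 * R)))" by simp
  finally have "- (x b - x a) / R \<le> real (b - a) * (- (per / (2 * R)))" .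
  hence "exp (- (x b - x a) / R) \<le> q ^ (b - a)"
   unfolding q_def exp_of_nat_mult[symmetric] by simp
  thus ?thesis by (simp add: of_bool_def)
 qed
 \<comment> \<open>For a fixed particle at most \<open>c\<close> others have index distance in
   \<open>{1..}\<close> below \<open>c\<close>; each displacement is thus charged
   \<open>4 / per\<close> times itself, once for each of the two sides.\<close>
 have cnt: "(\<Sum>a\<in>A. of_bool (real (h a) < c)) \<le> c" if "finite A" "inj_on h A" "!!a. a \<in> A ==> h a \<ge> 1" "c \<ge> 0"
  for A :: "nat set" and h :: "nat => nat" and c :: real
 proof -
  have "(\<Sum>a\<in>A. of_bool (real (h a) < c)) = real (card {a \<in> A. real (h a) < c})"
   using that(1) by (simp add: of_bool_def sum.If_cases Int_def)
  also have "card {a \<in> A. real (h a) < c} \<le> card {1..nat \<lfloor>c\<rfloor>}"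
  proof (rule card_inj_on_le[where f = h])
   show "inj_on h {a \<in> A. real (h a) < c}" using that(2) by (rule inj_on_subset) auto
   show "h ` {a \<in> A. real (h a) < c} \<subseteq> {1..nat \<lfloor>c\<rfloor>}"
    using that(3) by (auto simp: le_nat_floor less_imp_le)
  qed simp
  also have "real (card {1..nat \<lfloor>c\<rfloor>}) \<le> c" using that(4) by simp
  finally show ?thesis by simp
 qed
 have swap: "(\<Sum>b<t. \<Sum>a<b. F a b) = (\<Sum>a<t. \<Sum>b\<in>{a<..<t}. F a b)" for F :: "nat => nat => real"
 proof -
  have "(\<Sum>b<t. \<Sum>a<b. F a b) = (\<Sum>(b, a)\<in>(SIGMA b:{..<t}. {..<b}). F a b)" by (simp add: sum.Sigma)
  also have "... = (\<Sum>(a, b)\<in>(SIGMA a:{..<t}. {a<..<t}). F a b)"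
   by (rule sum.reindex_bij_witness[where i = "\<lambda>(a, b). (b, a)" and j = "\<lambda>(b, a). (a, b)"]) auto
  also have "... = (\<Sum>a<t. \<Sum>b\<in>{a<..<t}. F a b)" by (simp add: sum.Sigma)
  finally show ?thesis .
 qed
 have "(\<Sum>b<t. \<Sum>a<b. exp (- (x b - x a) / R))
  \<le> (\<Sum>b<t. \<Sum>a<b. q ^ (b - a) + of_bool (real (b - a) < 4 / per * \<bar>y a\<bar>) + of_bool (real (b - a) < 4 / per * \<bar>y b\<bar>))"
  by (intro sum_mono pt) auto
 also have "... = (\<Sum>b<t. \<Sum>a<b. q ^ (b - a)) + (\<Sum>a<t. \<Sum>b\<in>{a<..<t}. of_bool (real (b - a) < 4 / per * \<bar>y a\<bar>))
   + (\<Sum>b<t. \<Sum>a<b. of_bool (real (b - a) < 4 / per * \<bar>y b\<bar>))"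
  by (simp only: sum.distrib swap[of "\<lambda>a b. of_bool (real (b - a) < 4 / per * \<bar>y a\<bar>)", symmetric])
 also have "(\<Sum>b<t. \<Sum>a<b. q ^ (b - a)) \<le> (\<Sum>b<t. 1 / (1 - q))"
 proof (rule sum_mono)
  fix b
  have "(\<Sum>a<b. q ^ (b - a)) = (\<Sum>k\<in>{1..b}. q ^ k)"
   by (rule sum.reindex_bij_witness[where i = "\<lambda>k. b - k" and j = "\<lambda>a. b - a"]) auto
  also have "... \<le> (\<Sum>k<Suc b. q ^ k)" using q by (intro sum_mono2) auto
  also have "... \<le> 1 / (1 - q)"
   using q by (subst sum_gp_strict) (auto simp: divide_right_mono)
  finally show "(\<Sum>a<b. q ^ (b - a)) \<le> 1 / (1 - q)" .
 qed
 also have "(\<Sum>b<t. 1 / (1 - q)) = 1 / (1 - q) * real t" by simp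
 also have "(\<Sum>a<t. \<Sum>b\<in>{a<..<t}. of_bool (real (b - a) < 4 / per * \<bar>y a\<bar>)) \<le> (\<Sum>a<t. 4 / per * \<bar>y a\<bar>)"
  using per by (intro sum_mono cnt) (auto simp: inj_on_def)
 also have "(\<Sum>b<t. \<Sum>a<b. of_bool (real (b - a) < 4 / per * \<bar>y b\<bar>)) \<le> (\<Sum>b<t. 4 / per * \<bar>y b\<bar>)"
  using per by (intro sum_mono cnt) (auto simp: inj_on_def)
 finally show ?thesis by (simp add: q_def y_def sum_distrib_left)
qed

definition cross_sum :: "real => nat => (nat => real) => nat => real" where
 "cross_sum R N x k = (\<Sum>a<k. \<Sum>b\<in>{k..<N}. exp (- (x b - x a) / R))"

text \<open>The cross interaction at a cut between two neighbours is the product of two one-sided sums; if it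
 is large, then so is their sum. Summing over the cuts of a block without good cuts bounds the
 length of the block by its internal interaction.\<close>
lemma bad_block_bound:
 fixes x :: "nat => real"
 assumes R: "R > 0" and K: "K > 0" and k12: "k1 < k2" "k2 \<le> N"
  and good: "cross_sum R N x k1 \<le> K^2" "cross_sum R N x k2 \<le> K^2"
  and bad: "!!k. k1 < k ==> k < k2 ==> cross_sum R N x k > K^2"
 shows "2 * K * (real (k2 - k1) - 1) \<le> 2 * (\<Sum>b<k2 - k1. \<Sum>a<b. exp (- (x (k1 + b) - x (k1 + a)) / R)) + real (k2 - k1) + 2 * K^2"
proof -
 define E where "E a b = exp (- (x b - x a) / R)" for a b
 have E0: "E a b \<ge> 0" for a b by (simp add: E_def)
 define W where "W = (\<Sum>(a, b)\<in>{(a, b). k1 \<le> a & a < b & b < k2}. E a b)"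
 have fin1: "finite {(a, b). k1 \<le> a & a < b & b < k2}"
  by (rule finite_subset[of _ "{..<k2} \<times> {..<k2}"]) auto
 have W: "W = (\<Sum>b<k2 - k1. \<Sum>a<b. E (k1 + a) (k1 + b))"
 proof -
  have "(\<Sum>b<k2 - k1. \<Sum>a<b. E (k1 + a) (k1 + b)) = (\<Sum>(b, a)\<in>(SIGMA b:{..<k2 - k1}. {..<b}). E (k1 + a) (k1 + b))"
   by (simp add: sum.Sigma)
  also have "... = W" unfolding W_def
   by (rule sum.reindex_bij_witness[where i = "\<lambda>(a, b). (b - k1, a - k1)" and j = "\<lambda>(b, a). (k1 + a, k1 + b)"]) auto
  finally show ?thesis ..
 qed
 define A B where "A k = (\<Sum>a<k. E a k)" and "B k = (\<Sum>b\<in>{k..<N}. E k b)" for k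
 \<comment> \<open>Every crossing exponential factorises through the position of particle
   \<open>k\<close>. The term \<open>b = k\<close> of \<open>B k\<close> equals 1, which later
   contributes the length of the block.\<close>
 have AB: "cross_sum R N x k = A k * B k" for k
  unfolding cross_sum_def A_def B_def sum_product
  by (intro sum.cong refl) (simp add: E_def exp_add[symmetric] add_divide_distrib[symmetric])
 have A0: "A k \<ge> 0" and B0: "B k \<ge> 0" for k using E0 by (auto simp: A_def B_def intro!: sum_nonneg)
 \<comment> \<open>The inequality of arithmetic and geometric means, applied to
   \<open>A k * B k > K^2\<close>.\<close>
 have low: "A k + B k \<ge> 2 * K" if "k1 < k" "k < k2" for k
 proof (rule ccontr)
  assume "\<not> A k + B k \<ge> 2 * K"
  hence "(A k + B k)^2 < (2 * K)^2" using A0[of k] B0[of k] by (intro power_strict_mono) auto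
  moreover have "4 * (A k * B k) \<le> (A k + B k)^2"
   using zero_le_power2[of "A k - B k"] by (simp add: power2_eq_square algebra_simps)
  ultimately show False using bad[OF that] by (simp add: AB power2_eq_square)
 qed
 have card: "real (card {k1<..<k2}) = real (k2 - k1) - 1" using k12 by simp
 have "2 * K * (real (k2 - k1) - 1) = (\<Sum>k\<in>{k1<..<k2}. 2 * K)" unfolding sum_constant card[symmetric] by simp
 also have "... \<le> (\<Sum>k\<in>{k1<..<k2}. A k + B k)" using low by (intro sum_mono) auto
 also have "... = (\<Sum>k\<in>{k1<..<k2}. A k) + (\<Sum>k\<in>{k1<..<k2}. B k)" by (rule sum.distrib)
 \<comment> \<open>Pairs inside the block are counted in \<open>W\<close>; pairs that start left of
   \<open>k1\<close> belong to the cross sum at the good cut \<open>k1\<close>. The sum of the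
   \<open>B k\<close> is treated in the same way with the good cut \<open>k2\<close>.\<close>
 also have "(\<Sum>k\<in>{k1<..<k2}. A k) \<le> W + K^2"
 proof -
  have "(\<Sum>k\<in>{k1<..<k2}. A k) = (\<Sum>(k, a)\<in>(SIGMA k:{k1<..<k2}. {..<k}). E a k)"
   unfolding A_def by (simp add: sum.Sigma)
  also have "... = (\<Sum>(a, k)\<in>{(a, k). k1 < k & k < k2 & a < k}. E a k)"
   by (rule sum.reindex_bij_witness[where i = "\<lambda>(a, b). (b, a)" and j = "\<lambda>(b, a). (a, b)"]) auto
  also have "... \<le> (\<Sum>(a, k)\<in>{(a, b). k1 \<le> a & a < b & b < k2} \<union> {..<k1} \<times> {k1..<N}. E a k)"
   using fin1 k12 E0 by (intro sum_mono2) auto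
  also have "... = W + (\<Sum>(a, k)\<in>{..<k1} \<times> {k1..<N}. E a k)"
   unfolding W_def using fin1 by (intro sum.union_disjoint) auto
  also have "(\<Sum>(a, k)\<in>{..<k1} \<times> {k1..<N}. E a k) = cross_sum R N x k1"
   unfolding cross_sum_def E_def by (simp add: sum.cartesian_product)
  finally show ?thesis using good(1) by simp
 qed
 also have "(\<Sum>k\<in>{k1<..<k2}. B k) \<le> real (k2 - k1) + W + K^2"
 proof -
  have "B k = 1 + (\<Sum>b\<in>{k<..<N}. E k b)" if "k < k2" for k
  proof -
   have "{k..<N} = insert k {k<..<N}" using that k12 by auto
   thus ?thesis by (simp add: B_def E_def)
  qed
  hence "(\<Sum>k\<in>{k1<..<k2}. B k) = (\<Sum>k\<in>{k1<..<k2}. 1 + (\<Sum>b\<in>{k<..<N}. E k b))"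
   by (intro sum.cong) auto
  also have "... = (real (k2 - k1) - 1) + (\<Sum>(k, b)\<in>(SIGMA k:{k1<..<k2}. {k<..<N}). E k b)"
   unfolding sum.distrib card[symmetric] by (simp add: sum.Sigma)
  also have "(\<Sum>(k, b)\<in>(SIGMA k:{k1<..<k2}. {k<..<N}). E k b) \<le> (\<Sum>(a, k)\<in>{(a, b). k1 \<le> a & a < b & b < k2} \<union> {..<k2} \<times> {k2..<N}. E a k)"
   using fin1 E0 by (intro sum_mono2) auto
  also have "... = W + (\<Sum>(a, k)\<in>{..<k2} \<times> {k2..<N}. E a k)"
   unfolding W_def using fin1 by (intro sum.union_disjoint) auto
  also have "(\<Sum>(a, k)\<in>{..<k2} \<times> {k2..<N}. E a k) = cross_sum R N x k2"
   unfolding cross_sum_def E_def by (simp add: sum.cartesian_product)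
  finally show ?thesis using good(2) by simp
 qed
 finally show ?thesis unfolding W E_def by simp
qed

text \<open>Takes the nearest good cuts on either side of particle \<open>a\<close>. They exist
  because the cuts at \<open>0\<close> and \<open>N\<close> have empty cross sums.\<close>

lemma exists_good_block:
 fixes x :: "nat => real"
 assumes "a < N"
 obtains k1 k2 where "k1 \<le> a" "a < k2" "k2 \<le> N" "cross_sum R N x k1 \<le> K^2" "cross_sum R N x k2 \<le> K^2"
  "!!k. k1 < k ==> k < k2 ==> cross_sum R N x k > K^2"
proof -
 let ?G = "\<lambda>k. cross_sum R N x k \<le> K^2"
 have G0: "?G 0" "?G N" by (simp_all add: cross_sum_def)
 define k1 where "k1 = (GREATEST k. k \<le> a & ?G k)"
 define k2 where "k2 = (LEAST k. a < k & ?G k)"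
 have g1: "k1 \<le> a & ?G k1" unfolding k1_def
  by (rule GreatestI_nat[of "\<lambda>k. k \<le> a & ?G k" 0 a]) (use G0 in auto)
 have g1': "k \<le> k1" if "k \<le> a" "?G k" for k unfolding k1_def
  by (rule Greatest_le_nat[of "\<lambda>k. k \<le> a & ?G k" k a]) (use that in auto)
 have g2: "a < k2 & ?G k2" unfolding k2_def
  by (rule LeastI[of "\<lambda>k. a < k & ?G k" N]) (use G0 assms in auto)
 have g2': "k2 \<le> k" if "a < k" "?G k" for k unfolding k2_def
  by (rule Least_le[of "\<lambda>k. a < k & ?G k" k]) (use that in auto)
 show thesis
 proof (rule that[of k1 k2])
  show "k2 \<le> N" using g2'[of N] G0 assms by auto
  show "cross_sum R N x k > K^2" if "k1 < k" "k < k2" for k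
   using g1'[of k] g2'[of k] that by (meson leD leI)
 qed (use g1 g2 in auto)
qed

section \<open>Product structure of the measure on the cylinder and Gaussian masses\<close>

lemma lborel_complex: "lborel = distr (lborel \<Otimes>\<^sub>M lborel) borel (\<lambda>(x, y). Complex x y)"
proof (rule lborel_eqI)
 have meas: "(\<lambda>(x, y). Complex x y) \<in> lborel \<Otimes>\<^sub>M lborel \<rightarrow>\<^sub>M (borel :: complex measure)"
 proof -
  have "(\<lambda>z. Complex (fst z) (snd z)) \<in> borel_measurable (borel \<Otimes>\<^sub>M borel)"
   unfolding borel_prod by (intro borel_measurable_continuous_onI) (auto intro!: continuous_intros simp: Complex_eq)
  thus ?thesis by (simp add: case_prod_unfold)
 qed
 fix a b :: complex assume ab: "!!e. e \<in> Basis ==> a \<bullet> e \<le> b \<bullet> e"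
 have ab': "Re a \<le> Re b" "Im a \<le> Im b" using ab[of 1] ab[of \<i>] by (auto simp: Basis_complex_def)
 have "(\<lambda>(x, y). Complex x y) -` box a b \<inter> space (lborel \<Otimes>\<^sub>M lborel) = {Re a<..<Re b} \<times> {Im a<..<Im b}"
  by (auto simp: box_def Basis_complex_def space_pair_measure)
 hence "emeasure (distr (lborel \<Otimes>\<^sub>M lborel) borel (\<lambda>(x, y). Complex x y)) (box a b)
   = emeasure (lborel \<Otimes>\<^sub>M lborel) ({Re a<..<Re b} \<times> {Im a<..<Im b})"
  by (subst emeasure_distr[OF meas]) auto
 also have "... = ennreal (Re b - Re a) * ennreal (Im b - Im a)"
  using ab' by (subst lborel.emeasure_pair_measure_Times) auto
 also have "... = ennreal (\<Prod>e\<in>Basis. (b - a) \<bullet> e)"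
 proof -
  have "(\<Prod>e\<in>Basis. (b - a) \<bullet> e) = (Re b - Re a) * (Im b - Im a)" by (simp add: Basis_complex_def)
  thus ?thesis using ab' by (simp only: ennreal_mult diff_ge_0_iff_ge)
 qed
 finally show "emeasure (distr (lborel \<Otimes>\<^sub>M lborel) borel (\<lambda>(x, y). Complex x y)) (box a b) = ennreal (\<Prod>e\<in>Basis. (b - a) \<bullet> e)" .
qed simp

lemma measurable_Complex_pair [measurable]: "(\<lambda>(x, y). Complex x y) \<in> lborel \<Otimes>\<^sub>M lborel \<rightarrow>\<^sub>M (borel :: complex measure)"
proof -
 have "(\<lambda>z. Complex (fst z) (snd z)) \<in> borel_measurable (borel \<Otimes>\<^sub>M borel)"
  unfolding borel_prod by (intro borel_measurable_continuous_onI) (auto intro!: continuous_intros simp: Complex_eq)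
 thus ?thesis by (simp add: case_prod_unfold)
qed

lemma nn_integral_cyl_Re:
 assumes f: "f \<in> borel_measurable borel" and R: "R > 0"
 shows "(\<integral>\<^sup>+z. f (Re z) \<partial>cyl_measure R) = ennreal (2 * pi * R) * (\<integral>\<^sup>+x. f x \<partial>lborel)"
proof -
 have m: "(\<lambda>z. f (Re z) * indicator (cyl R) z) \<in> borel_measurable borel"
  using f by measurable
 have "(\<integral>\<^sup>+z. f (Re z) \<partial>cyl_measure R) = (\<integral>\<^sup>+z. f (Re z) * indicator (cyl R) z \<partial>lborel)"
  unfolding cyl_measure_def by (rule nn_integral_restrict_space) simp
 also have "... = (\<integral>\<^sup>+z. f (Re z) * indicator (cyl R) z \<partial>distr (lborel \<Otimes>\<^sub>M lborel) borel (\<lambda>(x, y). Complex x y))"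
  by (subst lborel_complex) (rule refl)
 also have "... = (\<integral>\<^sup>+z. f (fst z) * indicator {0..2 * pi * R} (snd z) \<partial>(lborel \<Otimes>\<^sub>M lborel))"
  using m by (subst nn_integral_distr) (auto intro!: nn_integral_cong simp: cyl_def indicator_def)
 also have "... = (\<integral>\<^sup>+x. \<integral>\<^sup>+y. f x * indicator {0..2 * pi * R} y \<partial>lborel \<partial>lborel)"
  using f by (subst lborel.nn_integral_fst[symmetric]) auto
 also have "... = (\<integral>\<^sup>+x. ennreal (2 * pi * R) * f x \<partial>lborel)"
  using R by (intro nn_integral_cong) (simp add: nn_integral_cmult mult.commute)
 also have "... = ennreal (2 * pi * R) * (\<integral>\<^sup>+x. f x \<partial>lborel)"
  using f by (intro nn_integral_cmult) auto
 finally show ?thesis .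
qed

lemma nn_integral_gauss_exp_finite:
 fixes l :: real assumes "l > 0"
 shows "(\<integral>\<^sup>+x. ennreal (exp (- (x^2 / l^2) + L * \<bar>x\<bar>)) \<partial>lborel) < \<infinity>"
proof -
 have bound: "exp (- (x^2 / l^2) + L * \<bar>x\<bar>) \<le> exp (L^2 * l^2) * sqrt (2 * pi * l^2) * normal_density 0 l x" for x
 proof -
  have "L * \<bar>x\<bar> \<le> L^2 * l^2 + x^2 / (2 * l^2)"
  proof -
   have "0 \<le> (L * l - \<bar>x\<bar> / (2 * l))^2" by simp
   also have "... = L^2 * l^2 - L * \<bar>x\<bar> + x^2 / (4 * l^2)"
    using assms by (simp add: power2_eq_square field_simps)
   also have "... \<le> L^2 * l^2 - L * \<bar>x\<bar> + x^2 / (2 * l^2)"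
    using assms by (simp add: field_simps)
   finally show ?thesis by simp
  qed
  moreover have "x^2 / l^2 = x^2 / (2 * l^2) + x^2 / (2 * l^2)" by (simp add: field_simps)
  ultimately have "exp (- (x^2 / l^2) + L * \<bar>x\<bar>) \<le> exp (L^2 * l^2 - x^2 / (2 * l^2))"
   unfolding exp_le_cancel_iff by linarith
  also have "... = exp (L^2 * l^2) * sqrt (2 * pi * l^2) * normal_density 0 l x"
  proof -
   have "sqrt (2 * pi * l^2) * normal_density 0 l x = exp (- (x^2 / (2 * l^2)))"
    using assms by (simp add: normal_density_def)
   thus ?thesis by (simp add: mult.assoc mult_exp_exp)
  qed
  finally show ?thesis .
 qed
 have "(\<integral>\<^sup>+x. ennreal (exp (- (x^2 / l^2) + L * \<bar>x\<bar>)) \<partial>lborel)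
   \<le> (\<integral>\<^sup>+x. ennreal (exp (L^2 * l^2) * sqrt (2 * pi * l^2) * normal_density 0 l x) \<partial>lborel)"
  by (intro nn_integral_mono ennreal_leI bound)
 also have "... < \<infinity>"
  using integrable_normal_density[OF assms, of 0]
  by (subst nn_integral_eq_integral) (auto intro!: mult_nonneg_nonneg)
 finally show ?thesis .
qed

locale laughlin_cyl =
 fixes l R :: real and p :: nat
 assumes l: "l > 0" and R: "R > 0" and p: "p \<ge> 1"
begin

definition per :: real where "per = real p * l^2 / R"
text \<open>Completing the square in \<open>k * x / R - x^2 / (2 * l^2)\<close> leaves the constant
  \<open>gam / 2 * k^2\<close>, so \<open>gam\<close> is the coupling in the orbital
  weights.\<close>

definition gam :: real where "gam = l^2 / R^2"
definition gauss :: "real => real" where "gauss y = exp (- (y^2 / l^2))"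

lemma per_pos: "per > 0" using l R p by (simp add: per_def)
lemma gauss_pos [simp]: "gauss y > 0" by (simp add: gauss_def)
lemma gauss_measurable [measurable]: "gauss \<in> borel_measurable borel" unfolding gauss_def by measurable

text \<open>The one-particle weight when a displacement costs a factor of exponential rate
  \<open>L\<close>; \<open>cmass\<close> is the weight of a free particle.\<close>

definition mass :: "real => ennreal" where
 "mass L = (\<integral>\<^sup>+z. ennreal (gauss (Re z) * exp (L * \<bar>Re z\<bar>)) \<partial>cyl_measure R)"

lemma mass_finite: "mass L < \<infinity>"
proof -
 have "mass L = ennreal (2 * pi * R) * (\<integral>\<^sup>+x. ennreal (gauss x * exp (L * \<bar>x\<bar>)) \<partial>lborel)"
  unfolding mass_def by (rule nn_integral_cyl_Re) (use R in auto)
 also have "(\<integral>\<^sup>+x. ennreal (gauss x * exp (L * \<bar>x\<bar>)) \<partial>lborel) < \<infinity>"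
  using nn_integral_gauss_exp_finite[OF l, of L] by (simp add: gauss_def mult_exp_exp)
 thus ?thesis using calculation by (simp add: ennreal_mult_less_top)
qed

definition cmass :: real where "cmass = enn2real (mass 0)"

lemma mass_translate: "(\<integral>\<^sup>+z. ennreal (gauss (Re z - s) * exp (L * \<bar>Re z - s\<bar>)) \<partial>cyl_measure R) = mass L"
proof -
 have "mass L = (\<integral>\<^sup>+z. ennreal (gauss (Re z) * exp (L * \<bar>Re z\<bar>)) \<partial>distr (cyl_measure R) (cyl_measure R) (\<lambda>z. z + of_real (- s)))"
  by (simp only: distr_translate_cyl mass_def)
 also have "... = (\<integral>\<^sup>+z. ennreal (gauss (Re z - s) * exp (L * \<bar>Re z - s\<bar>)) \<partial>cyl_measure R)"
  using measurable_translate_cyl[of "- s" R] by (subst nn_integral_distr) auto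
 finally show ?thesis ..
qed

lemma cmass_pos: "cmass > 0"
proof -
 have "mass 0 \<noteq> 0"
 proof
  assume "mass 0 = 0"
  hence "ennreal (2 * pi * R) * (\<integral>\<^sup>+x. ennreal (gauss x) \<partial>lborel) = 0"
   using nn_integral_cyl_Re[of "\<lambda>x. ennreal (gauss x)" R] R by (simp add: mass_def)
  hence "(\<integral>\<^sup>+x. ennreal (gauss x) \<partial>lborel) = 0" using R by simp
  hence "AE x in lborel. ennreal (gauss x) = 0" by (subst (asm) nn_integral_0_iff_AE) auto
  hence "AE x in (lborel :: real measure). False" by eventually_elim (simp add: gauss_def)
  thus False by (subst (asm) AE_iff_measurable[where N = UNIV]) auto
 qed
 thus ?thesis unfolding cmass_def using mass_finite[of 0] by (simp add: enn2real_positive_iff zero_less_iff_neq_zero)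
qed

end

section \<open>The Laughlin density\<close>

lemma measurable_cylN_restrict_fun:
 assumes "f \<in> borel_measurable (cylN R J)" "!!j. j \<in> J ==> t j \<in> I"
 shows "(\<lambda>w. f (\<lambda>j\<in>J. w (t j))) \<in> borel_measurable (cylN R I)"
 by (rule measurable_compose[OF _ assms(1)]) (auto intro!: measurable_restrict measurable_component_singleton assms(2))

context laughlin_cyl begin

text \<open>The squared wave function after extracting the larger exponential from every Vandermonde
  factor and completing squares: particle \<open>a\<close> is confined near
  \<open>per * (s + a)\<close>, and the remaining interaction is close to 1 when the particles are
  ordered and far apart. The offset \<open>s\<close> lets a block of a longer chain be a
  \<open>Phi\<close> again.\<close>

definition Phi :: "nat => nat => (nat => complex) => real" where
 "Phi N s w = (\<Prod>a<N. gauss (Re (w a) - per * (real s + real a))) *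
   (\<Prod>b<N. \<Prod>a<b. cmod (1 - exp ((w a - w b) / of_real R)) ^ (2 * p))"

lemma Phi_nonneg [simp]: "Phi N s w \<ge> 0"
 unfolding Phi_def by (intro mult_nonneg_nonneg prod_nonneg) (auto simp: less_imp_le)

lemma Phi_cong: "(!!i. i < N ==> w i = w' i) ==> Phi N s w = Phi N s w'"
 unfolding Phi_def by (intro arg_cong2[where f = "(*)"] prod.cong) auto

lemma measurable_Phi [measurable]: "{..<N} \<subseteq> I ==> (\<lambda>w. Phi N s w) \<in> borel_measurable (cylN R I)"
proof -
 assume "{..<N} \<subseteq> I"
 hence [measurable]: "i < N ==> (\<lambda>w. w i) \<in> cylN R I \<rightarrow>\<^sub>M borel" for i
  by (intro measurable_component_cyl) auto
 have [measurable]: "b < N ==> a < b ==> (\<lambda>w. w a) \<in> cylN R I \<rightarrow>\<^sub>M borel" for a b by simp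
 show ?thesis unfolding Phi_def
  by (intro borel_measurable_times borel_measurable_prod borel_measurable_power measurable_compose[OF _ borel_measurable_norm]
    borel_measurable_diff borel_measurable_exp borel_measurable_divide measurable_const measurable_compose[OF _ gauss_measurable]
    measurable_compose[OF _ measurable_Re_borel]) auto
qed

lemma vandermonde_cmod2:
 "(cmod (vandermonde_pow p N (\<lambda>i. exp (w i / of_real R))))^2 =
   (\<Prod>b<N. exp (2 * real p * real b * Re (w b) / R) * (\<Prod>a<b. cmod (1 - exp ((w a - w b) / of_real R)) ^ (2 * p)))"
proof -
 have "(cmod (vandermonde_pow p N (\<lambda>i. exp (w i / of_real R))))^2 =
   (\<Prod>b<N. \<Prod>a<b. cmod (exp (w b / of_real R) - exp (w a / of_real R)) ^ (2 * p))"
  unfolding vandermonde_pow_def by (simp add: prod_norm[symmetric] norm_power prod_power_distrib power_mult[symmetric] mult.commute)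
 also have "... = (\<Prod>b<N. \<Prod>a<b. exp (2 * real p * Re (w b) / R) * cmod (1 - exp ((w a - w b) / of_real R)) ^ (2 * p))"
 proof (intro prod.cong refl)
  fix a b
  have "exp (w b / of_real R) - exp (w a / of_real R) = exp (w b / of_real R) * (1 - exp ((w a - w b) / of_real R))"
   by (simp add: right_diff_distrib exp_diff diff_divide_distrib)
  hence "cmod (exp (w b / of_real R) - exp (w a / of_real R)) = exp (Re (w b) / R) * cmod (1 - exp ((w a - w b) / of_real R))"
   by (simp add: norm_mult norm_exp_eq_Re)
  thus "cmod (exp (w b / of_real R) - exp (w a / of_real R)) ^ (2 * p) = exp (2 * real p * Re (w b) / R) * cmod (1 - exp ((w a - w b) / of_real R)) ^ (2 * p)"
   by (simp add: power_mult_distrib exp_of_nat_mult[symmetric])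
 qed
 also have "... = (\<Prod>b<N. exp (2 * real p * real b * Re (w b) / R) * (\<Prod>a<b. cmod (1 - exp ((w a - w b) / of_real R)) ^ (2 * p)))"
  by (simp add: prod.distrib exp_of_nat_mult[symmetric] mult_ac)
 finally show ?thesis .
qed

lemma Phi_alt:
 "Phi N s w = exp (- gam * (\<Sum>j<N. (real (p * (s + j)))^2)) *
   (cmod (vandermonde_pow p N (\<lambda>i. exp (w i / of_real R))))^2 *
   (\<Prod>i<N. exp (2 * real p * real s * Re (w i) / R - (Re (w i))^2 / l^2))"
proof -
 have g: "gauss (x - per * (real s + real a)) =
   exp (2 * real p * real a * x / R) * exp (2 * real p * real s * x / R - x^2 / l^2) * exp (- gam * (real (p * (s + a)))^2)" for x a
 proof -
  have "- ((x - per * (real s + real a))^2 / l^2) = 2 * real p * real a * x / R + (2 * real p * real s * x / R - x^2 / l^2) + - gam * (real (p * (s + a)))^2"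
   using l R by (simp add: per_def gam_def power2_eq_square field_simps)
  thus ?thesis by (simp only: gauss_def exp_add)
 qed
 show ?thesis unfolding Phi_def g vandermonde_cmod2
  by (simp add: prod.distrib exp_sum[symmetric] sum_distrib_left mult_ac)
qed

lemma laughlin_cmod2:
 "(cmod (laughlin l R p N w))^2 = exp (gam * (\<Sum>j<N. (real (p * j))^2)) * Phi N 0 w"
proof -
 have "laughlin l R p N w = vandermonde_pow p N (\<lambda>i. exp (w i / of_real R)) * of_real (exp (- (1 / (2 * l^2)) * (\<Sum>k<N. (Re (w k))^2)))"
  by (simp add: laughlin_def vandermonde_pow_def)
 hence "(cmod (laughlin l R p N w))^2 = (cmod (vandermonde_pow p N (\<lambda>i. exp (w i / of_real R))))^2 * (exp (- (1 / (2 * l^2)) * (\<Sum>k<N. (Re (w k))^2)))^2"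
  by (simp add: norm_mult power_mult_distrib)
 also have "(exp (- (1 / (2 * l^2)) * (\<Sum>k<N. (Re (w k))^2)))^2 = (\<Prod>k<N. exp (- ((Re (w k))^2 / l^2)))"
  by (simp add: exp_sum[symmetric] exp_double[symmetric] sum_negf sum_divide_distrib sum_distrib_left)
 finally show ?thesis unfolding Phi_alt by (simp add: exp_minus)
qed

text \<open>The form of the definition is tied to an order of the particles; the form in
  \<open>Phi_alt\<close> shows the symmetry.\<close>

lemma Phi_permute:
 assumes f: "f permutes {..<N}"
 shows "Phi N s (w \<circ> f) = Phi N s w"
proof -
 let ?Z = "\<lambda>i. exp (w i / of_real R)"
 have cnj: "cnj (vandermonde_pow p N Z) = vandermonde_pow p N (cnj \<circ> Z)" for Z
  by (simp add: vandermonde_pow_def)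
 have "of_real ((cmod (vandermonde_pow p N (?Z \<circ> f)))^2) = vandermonde_pow p N (?Z \<circ> f) * vandermonde_pow p N ((cnj \<circ> ?Z) \<circ> f)"
  unfolding complex_norm_square cnj by (simp add: o_assoc)
 also have "... = of_real ((cmod (vandermonde_pow p N ?Z))^2)"
  unfolding vandermonde_pow_permute[OF f] complex_norm_square cnj ..
 finally have "(cmod (vandermonde_pow p N (?Z \<circ> f)))^2 = (cmod (vandermonde_pow p N ?Z))^2"
  by (simp only: of_real_eq_iff)
 moreover have "(\<Prod>i<N. h (w (f i))) = (\<Prod>i<N. h (w i))" for h :: "complex => real"
  using prod.permute[OF f, of "\<lambda>i. h (w i)"] by (simp add: o_def)
 note this[of "\<lambda>z. exp (2 * real p * real s * Re z / R - (Re z)^2 / l^2)"]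
 ultimately show ?thesis unfolding Phi_alt by (simp add: o_def)
qed

lemma Phi_translate: "Phi N s w = Phi N 0 (\<lambda>i. w i + of_real (- per * real s))"
 unfolding Phi_def by (simp add: algebra_simps)

lemma Phi_split:
 "Phi (a + c) s w = Phi a s w * Phi c (s + a) (\<lambda>j. w (a + j)) *
   (\<Prod>b<c. \<Prod>i<a. cmod (1 - exp ((w i - w (a + b)) / of_real R)) ^ (2 * p))"
 unfolding Phi_def by (simp add: prod_lessThan_add prod.distrib mult_ac add.assoc)

definition ordered :: "nat => (nat => complex) set" where
 "ordered N = {w. \<forall>j<N. \<forall>i\<le>j. Re (w i) \<le> Re (w j)}"

lemma factor_le:
 "cmod (1 - exp ((z - z') / of_real R)) ^ (2 * p) \<le> exp (2 * real p * exp (- (Re z' - Re z) / R))"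
proof -
 have "cmod (1 - exp ((z - z') / of_real R)) \<le> 1 + exp (- (Re z' - Re z) / R)"
  using norm_triangle_ineq4[of 1 "exp ((z - z') / of_real R)"] by (simp add: norm_exp_eq_Re)
 also have "... \<le> exp (exp (- (Re z' - Re z) / R))" by (rule exp_ge_add_one_self)
 finally have "cmod (1 - exp ((z - z') / of_real R)) ^ (2 * p) \<le> exp (exp (- (Re z' - Re z) / R)) ^ (2 * p)"
  by (intro power_mono) auto
 thus ?thesis by (simp add: exp_of_nat_mult[symmetric])
qed

lemma interaction_le:
 fixes N :: nat
 shows "(\<Prod>b<N. \<Prod>a<b. cmod (1 - exp ((w a - w b) / of_real R)) ^ (2 * p))
  \<le> exp (2 * real p * (\<Sum>b<N. \<Sum>a<b. exp (- (Re (w b) - Re (w a)) / R)))"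
proof -
 have "(\<Prod>b<N. \<Prod>a<b. cmod (1 - exp ((w a - w b) / of_real R)) ^ (2 * p))
  \<le> (\<Prod>b<N. \<Prod>a<b. exp (2 * real p * exp (- (Re (w b) - Re (w a)) / R)))"
  by (intro prod_mono conjI prod_nonneg factor_le) auto
 also have "... = (\<Prod>b<N. exp (\<Sum>a<b. 2 * real p * exp (- (Re (w b) - Re (w a)) / R)))"
  by (intro prod.cong refl exp_sum[symmetric]) simp
 also have "... = exp (\<Sum>b<N. \<Sum>a<b. 2 * real p * exp (- (Re (w b) - Re (w a)) / R))"
  by (rule exp_sum[symmetric]) simp
 finally show ?thesis by (simp only: sum_distrib_left)
qed

lemma Phi_split_le:
 "Phi (a + c) s w \<le> Phi a s w * Phi c (s + a) (\<lambda>j. w (a + j)) *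
   exp (2 * real p * cross_sum R (a + c) (\<lambda>i. Re (w i)) a)"
proof -
 have "(\<Prod>b<c. \<Prod>i<a. cmod (1 - exp ((w i - w (a + b)) / of_real R)) ^ (2 * p))
  \<le> (\<Prod>b<c. \<Prod>i<a. exp (2 * real p * exp (- (Re (w (a + b)) - Re (w i)) / R)))"
  by (intro prod_mono conjI prod_nonneg factor_le) auto
 also have "... = exp (2 * real p * (\<Sum>b<c. \<Sum>i<a. exp (- (Re (w (a + b)) - Re (w i)) / R)))"
  by (simp add: exp_sum sum_distrib_left)
 also have "(\<Sum>b<c. \<Sum>i<a. exp (- (Re (w (a + b)) - Re (w i)) / R)) = cross_sum R (a + c) (\<lambda>i. Re (w i)) a"
 proof -
  have "(\<Sum>b<c. F (a + b)) = (\<Sum>b\<in>{a..<a + c}. F b)" for F :: "nat => real"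
   by (rule sum.reindex_bij_witness[where i = "\<lambda>b. b - a" and j = "\<lambda>b. a + b"]) auto
  thus ?thesis unfolding cross_sum_def by (subst sum.swap) simp
 qed
 finally show ?thesis unfolding Phi_split by (intro mult_left_mono mult_nonneg_nonneg) auto
qed

text \<open>A cut that is good in the full chain stays good after the particles before
  \<open>k1\<close> are removed, so a block can be detached at both of its ends.\<close>

lemma cross_sum_mono_suffix:
 assumes "k1 \<le> k2" "k2 \<le> N"
 shows "cross_sum R (N - k1) (\<lambda>i. x (k1 + i)) (k2 - k1) \<le> cross_sum R N x k2"
proof -
 define E where "E a b = exp (- (x b - x a) / R)" for a b
 have "cross_sum R (N - k1) (\<lambda>i. x (k1 + i)) (k2 - k1) = (\<Sum>a<k2 - k1. \<Sum>b\<in>{k2 - k1..<N - k1}. E (k1 + a) (k1 + b))"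
  by (simp add: cross_sum_def E_def)
 also have "... = (\<Sum>(a, b)\<in>{..<k2 - k1} \<times> {k2 - k1..<N - k1}. E (k1 + a) (k1 + b))"
  by (simp add: sum.cartesian_product)
 also have "... = (\<Sum>(a, b)\<in>{k1..<k2} \<times> {k2..<N}. E a b)"
  by (rule sum.reindex_bij_witness[where i = "\<lambda>(a, b). (a - k1, b - k1)" and j = "\<lambda>(a, b). (k1 + a, k1 + b)"])
   (use assms in auto)
 also have "... \<le> (\<Sum>(a, b)\<in>{..<k2} \<times> {k2..<N}. E a b)"
  by (intro sum_mono2) (auto simp: E_def)
 also have "... = cross_sum R N x k2" by (simp add: cross_sum_def E_def sum.cartesian_product)
 finally show ?thesis .
qed

definition disp :: "(nat => complex) => nat => real" where
 "disp w a = Re (w a) - per * real a"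

definition block_fun :: "real => real => nat => nat => (nat => complex) => real" where
 "block_fun \<eta> L k1 t w = (\<Prod>j<t. \<eta> * (gauss (disp w (k1 + j)) * exp (L * \<bar>disp w (k1 + j)\<bar>)))"

text \<open>Detaching the block of particle \<open>a\<close> at its two good cuts costs only a
  constant. Inside the block the interaction is paid for by displacements, and
  \<open>bad_block_bound\<close> turns the absence of good cuts into a small factor
  \<open>\<eta>\<close> per particle. The block then weighs at most half as much per particle as
  free particles do.\<close>

lemma block_bound:
 assumes lam: "lam \<ge> 0"
 obtains C \<eta> L where "C > 0" "\<eta> > 0" "ennreal \<eta> * mass L \<le> ennreal (cmass / 2)"
  "!!N a w. w \<in> ordered N ==> a < N ==> \<exists>k1 k2. k1 \<le> a & a < k2 & k2 \<le> N &
    Phi N 0 w * exp (lam * \<bar>disp w a\<bar>) \<le>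
    C * (Phi k1 0 w * (block_fun \<eta> L k1 (k2 - k1) w * Phi (N - k2) k2 (\<lambda>j. w (k2 + j))))"
proof -
 define C0 C1 where "C0 = 1 / (1 - exp (- (per / (2 * R))))" and "C1 = 8 / per"
 \<comment> \<open>The factor \<open>2 * real p + 1\<close>: \<open>2 * real p\<close> copies of
   \<open>W\<close> come from the interaction and one from half of \<open>bad_block_bound\<close>,
   whose remaining \<open>t / 2\<close> is the summand \<open>1 / 2\<close> of
   \<open>e0\<close>.\<close>
 define L where "L = (2 * real p + 1) * C1 + lam"
 define e0 where "e0 = (2 * real p + 1) * C0 + 1 / 2"
 define m where "m = enn2real (mass L)"
 have m: "m \<ge> 0" "ennreal m = mass L" using mass_finite[of L] by (auto simp: m_def)
 \<comment> \<open>Neither \<open>L\<close> nor \<open>e0\<close> depends on \<open>K\<close>, so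
   \<open>K\<close> can be made so large that \<open>exp (e0 - K) * mass L\<close> is at most
   \<open>cmass / 2\<close>.\<close>
 define K where "K = max 1 (e0 - ln (cmass / (2 * (m + 1))))"
 define \<eta> where "\<eta> = exp (e0 - K)"
 define C where "C = exp (4 * real p * K^2 + K^2 + K)"
 have K: "K > 0" by (simp add: K_def)
 have eta: "ennreal \<eta> * mass L \<le> ennreal (cmass / 2)"
 proof -
  have "\<eta> \<le> exp (ln (cmass / (2 * (m + 1))))" unfolding \<eta>_def by (simp add: K_def)
  also have "... = cmass / (2 * (m + 1))" using cmass_pos m by simp
  finally have "\<eta> * m \<le> cmass / (2 * (m + 1)) * m" using m by (intro mult_right_mono) auto
  also have "... \<le> cmass / 2" using m cmass_pos by (simp add: field_simps)
  finally have "ennreal (\<eta> * m) \<le> ennreal (cmass / 2)" by (rule ennreal_leI)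
  moreover have "\<eta> \<ge> 0" by (simp add: \<eta>_def)
  ultimately show ?thesis unfolding m(2)[symmetric] using m(1) by (simp only: ennreal_mult)
 qed
 have main: "\<exists>k1 k2. k1 \<le> a & a < k2 & k2 \<le> N &
    Phi N 0 w * exp (lam * \<bar>disp w a\<bar>) \<le>
    C * (Phi k1 0 w * (block_fun \<eta> L k1 (k2 - k1) w * Phi (N - k2) k2 (\<lambda>j. w (k2 + j))))"
  if w: "w \<in> ordered N" and a: "a < N" for N a w
 proof -
  define x where "x = (\<lambda>i. Re (w i))"
  obtain k1 k2 where k: "k1 \<le> a" "a < k2" "k2 \<le> N" "cross_sum R N x k1 \<le> K^2" "cross_sum R N x k2 \<le> K^2"
   "!!k. k1 < k ==> k < k2 ==> cross_sum R N x k > K^2"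
   using exists_good_block[OF a, of R x K] by blast
  define t where "t = k2 - k1"
  define W where "W = (\<Sum>b<t. \<Sum>a<b. exp (- (x (k1 + b) - x (k1 + a)) / R))"
  define Y where "Y = (\<Sum>j<t. \<bar>disp w (k1 + j)\<bar>)"
  define G where "G = (\<Prod>j<t. gauss (disp w (k1 + j)))"
  have G0: "G \<ge> 0" unfolding G_def by (intro prod_nonneg) (auto simp: less_imp_le)
  have k12: "k1 < k2" using k by simp
  have bad: "2 * K * (real t - 1) \<le> 2 * W + real t + 2 * K^2"
   using bad_block_bound[OF R K k12 k(3) k(4,5,6)] by (simp add: t_def W_def)
  have Wle: "W \<le> C0 * real t + C1 * Y"
  proof -
   have "x (k1 + i) \<le> x (k1 + j)" if "i \<le> j" "j < t" for i j
    using w that k by (auto simp: ordered_def x_def t_def)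
   from ordered_pair_sum_bound[OF R per_pos this, where o' = "real k1"] show ?thesis
    unfolding W_def C0_def C1_def Y_def disp_def x_def by simp
  qed
  have "Phi N 0 w \<le> Phi k1 0 w * Phi (N - k1) k1 (\<lambda>j. w (k1 + j)) * exp (2 * real p * K^2)"
  proof -
   have "Phi N 0 w \<le> Phi k1 0 w * Phi (N - k1) k1 (\<lambda>j. w (k1 + j)) * exp (2 * real p * cross_sum R N x k1)"
    using Phi_split_le[of k1 "N - k1" 0 w] k by (simp add: x_def)
   also have "... \<le> Phi k1 0 w * Phi (N - k1) k1 (\<lambda>j. w (k1 + j)) * exp (2 * real p * K^2)"
    using k(4) by (intro mult_left_mono mult_nonneg_nonneg) (auto intro: mult_left_mono)
   finally show ?thesis .
  qed
  also have "Phi (N - k1) k1 (\<lambda>j. w (k1 + j)) \<le> Phi t k1 (\<lambda>j. w (k1 + j)) * Phi (N - k2) k2 (\<lambda>j. w (k2 + j)) * exp (2 * real p * K^2)"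
  proof -
   have e: "t + (N - k2) = N - k1" "k1 + t = k2" using k by (auto simp: t_def)
   have "Phi (N - k1) k1 (\<lambda>j. w (k1 + j)) \<le> Phi t k1 (\<lambda>j. w (k1 + j)) * Phi (N - k2) k2 (\<lambda>j. w (k2 + j)) *
     exp (2 * real p * cross_sum R (N - k1) (\<lambda>i. x (k1 + i)) t)"
    using Phi_split_le[of t "N - k2" k1 "\<lambda>j. w (k1 + j)"] unfolding e add.assoc[symmetric] x_def by simp
   also have "... \<le> Phi t k1 (\<lambda>j. w (k1 + j)) * Phi (N - k2) k2 (\<lambda>j. w (k2 + j)) * exp (2 * real p * K^2)"
   proof (intro mult_left_mono mult_nonneg_nonneg)
    have "cross_sum R (N - k1) (\<lambda>i. x (k1 + i)) t \<le> K^2"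
     using cross_sum_mono_suffix[of k1 k2 N x] k k12 by (simp add: t_def)
    thus "exp (2 * real p * cross_sum R (N - k1) (\<lambda>i. x (k1 + i)) t) \<le> exp (2 * real p * K^2)"
     by (simp add: mult_left_mono)
   qed auto
   finally show ?thesis .
  qed
  also have "Phi t k1 (\<lambda>j. w (k1 + j)) \<le> G * exp (2 * real p * W)"
   using interaction_le[where N = t and w = "\<lambda>j. w (k1 + j)"] G0
   by (simp add: Phi_def G_def W_def disp_def x_def mult_left_mono add_ac)
  finally have 1: "Phi N 0 w \<le> Phi k1 0 w * (G * exp (2 * real p * W) * Phi (N - k2) k2 (\<lambda>j. w (k2 + j)) * exp (2 * real p * K^2)) * exp (2 * real p * K^2)"
   by (simp add: mult_left_mono mult_right_mono)
  have "\<bar>disp w a\<bar> \<le> Y"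
  proof -
   have "\<bar>disp w (k1 + (a - k1))\<bar> \<le> Y" unfolding Y_def
    by (rule member_le_sum) (use k in \<open>auto simp: t_def\<close>)
   thus ?thesis using k by simp
  qed
  hence lamY: "lam * \<bar>disp w a\<bar> \<le> lam * Y" using lam by (rule mult_left_mono)
  \<comment> \<open>Adds the inequality \<open>0 \<le> W + t / 2 + K^2 + K - K * t\<close> from
    \<open>bad\<close> before bounding \<open>W\<close>; the term \<open>- K * t\<close> is the
    gain.\<close>
  have expo: "2 * real p * W + lam * \<bar>disp w a\<bar> \<le> (K^2 + K) + ((e0 - K) * real t + L * Y)"
  proof -
   have "(2 * real p + 1) * W \<le> (2 * real p + 1) * (C0 * real t + C1 * Y)"
    using Wle by (intro mult_left_mono) auto
   thus ?thesis using bad lamY by (simp add: e0_def L_def algebra_simps)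
  qed
  have blk: "block_fun \<eta> L k1 t w = G * exp ((e0 - K) * real t + L * Y)"
   unfolding block_fun_def G_def Y_def
   by (simp add: prod.distrib exp_add exp_sum[symmetric] sum_distrib_left \<eta>_def exp_of_nat_mult[symmetric] mult_ac)
  have "Phi N 0 w * exp (lam * \<bar>disp w a\<bar>) \<le> (Phi k1 0 w * (G * exp (2 * real p * W) * Phi (N - k2) k2 (\<lambda>j. w (k2 + j)) * exp (2 * real p * K^2)) * exp (2 * real p * K^2)) * exp (lam * \<bar>disp w a\<bar>)"
   using 1 by (rule mult_right_mono) simp
  also have "... = Phi k1 0 w * G * Phi (N - k2) k2 (\<lambda>j. w (k2 + j)) * exp (4 * real p * K^2) * exp (2 * real p * W + lam * \<bar>disp w a\<bar>)"
   by (simp add: exp_add[symmetric] mult.assoc)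
  also have "... \<le> Phi k1 0 w * G * Phi (N - k2) k2 (\<lambda>j. w (k2 + j)) * exp (4 * real p * K^2) * exp ((K^2 + K) + ((e0 - K) * real t + L * Y))"
   using expo G0 by (intro mult_left_mono mult_nonneg_nonneg) auto
  also have "... = C * (Phi k1 0 w * (block_fun \<eta> L k1 t w * Phi (N - k2) k2 (\<lambda>j. w (k2 + j))))"
   unfolding blk C_def by (simp add: exp_add mult_ac)
  finally show ?thesis using k k12 by (auto simp: t_def)
 qed
 show thesis
  by (rule that[of C \<eta> L]) (use eta main in \<open>auto simp: C_def \<eta>_def\<close>)
qed

end

section \<open>The ordered sector and the energy estimate for displacements\<close>

lemma sorting_permutation_ex:
 fixes x :: "nat => real"
 obtains f where "f permutes {..<N}" "!!i j. i \<le> j ==> j < N ==> x (f i) \<le> x (f j)"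
proof -
 let ?xs = "map x [0..<N]"
 obtain f where f: "f permutes {..<length ?xs}" "permute_list f ?xs = sort ?xs"
  using mset_eq_permutation[of "sort ?xs" ?xs] by auto
 have fN: "f permutes {..<N}" using f(1) by simp
 have nth: "x (f i) = sort ?xs ! i" if "i < N" for i
 proof -
  have "f i < N" using permutes_in_image[OF fN, of i] that by simp
  thus ?thesis unfolding f(2)[symmetric] using f(1) that by (simp add: permute_list_nth)
 qed
 have "x (f i) \<le> x (f j)" if "i \<le> j" "j < N" for i j
  using that nth[of i] nth[of j] sorted_nth_mono[OF sorted_sort, of i j ?xs] by simp
 thus thesis using that fN by blast
qed

lemma sorting_permutation_unique:
 fixes x :: "nat => real"
 assumes inj: "inj_on x {..<N}" and f: "f permutes {..<N}" "!!i j. i \<le> j ==> j < N ==> x (f i) \<le> x (f j)"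
  and g: "g permutes {..<N}" "!!i j. i \<le> j ==> j < N ==> x (g i) \<le> x (g j)"
 shows "f = g"
proof -
 have fg: "map (\<lambda>i. x (h i)) [0..<N] = sort (map x [0..<N])"
  if h: "h permutes {..<N}" "!!i j. i \<le> j ==> j < N ==> x (h i) \<le> x (h j)" for h
 proof (rule properties_for_sort[symmetric])
  have "permute_list h (map x [0..<N]) = map (\<lambda>i. x (h i)) [0..<N]"
   using permutes_in_image[OF h(1)] by (auto simp: permute_list_def)
  thus "mset (map (\<lambda>i. x (h i)) [0..<N]) = mset (map x [0..<N])"
   using mset_permute_list[of h "map x [0..<N]"] h(1) by simp
  show "sorted (map (\<lambda>i. x (h i)) [0..<N])"
   using h(2) by (auto simp: sorted_iff_nth_mono)
 qed
 have eq: "x (f i) = x (g i)" if "i < N" for i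
 proof -
  have "map (\<lambda>i. x (f i)) [0..<N] = map (\<lambda>i. x (g i)) [0..<N]" by (rule trans[OF fg[OF f] fg[OF g, symmetric]])
  thus ?thesis using that by simp
 qed
 have "f i = g i" for i
 proof (cases "i < N")
  case True
  thus ?thesis using eq[OF True] inj permutes_in_image[OF f(1), of i] permutes_in_image[OF g(1), of i]
   by (auto dest: inj_onD)
 next
  case False
  thus ?thesis using permutes_not_in[OF f(1), of i] permutes_not_in[OF g(1), of i] by simp
 qed
 thus ?thesis by blast
qed

context laughlin_cyl begin

lemma sets_ordered [measurable]: "ordered N \<inter> space (cylN R {..<N}) \<in> sets (cylN R {..<N})"
proof -
 have "ordered N \<inter> space (cylN R {..<N}) = {w \<in> space (cylN R {..<N}). \<forall>j\<in>{..<N}. \<forall>i\<in>{..j}. Re (w i) \<le> Re (w j)}"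
  by (auto simp: ordered_def)
 moreover have [measurable]: "j \<in> {..<N} ==> i \<in> {..j} ==> (\<lambda>w. w i) \<in> cylN R {..<N} \<rightarrow>\<^sub>M borel" for i j
  by (intro measurable_component_cyl) auto
 ultimately show ?thesis
  by (auto intro!: sets.sets_Collect_finite_All borel_measurable_le measurable_compose[OF _ measurable_Re_borel])
qed

lemma measurable_ind_ordered: "(indicator (ordered N) :: _ => ennreal) \<in> borel_measurable (cylN R {..<N})"
proof -
 have "(indicator (ordered N \<inter> space (cylN R {..<N})) :: _ => ennreal) \<in> borel_measurable (cylN R {..<N})"
  by (rule borel_measurable_indicator) (rule sets_ordered)
 thus ?thesis by (rule measurable_cong[THEN iffD1, rotated]) (simp add: indicator_def)
qed

text \<open>Almost every configuration is sorted by exactly one permutation, and all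
  \<open>fact N\<close> sectors contribute equally.\<close>

lemma nn_integral_symmetric:
 assumes f: "f \<in> borel_measurable (cylN R {..<N})"
  and sym: "!!g w. g permutes {..<N} ==> w \<in> space (cylN R {..<N}) ==> f (\<lambda>j\<in>{..<N}. w (g j)) = f w"
 shows "(\<integral>\<^sup>+w. f w \<partial>cylN R {..<N}) = fact N * (\<integral>\<^sup>+w. f w * indicator (ordered N) w \<partial>cylN R {..<N})"
proof -
 let ?M = "cylN R {..<N}" and ?P = "{g. g permutes {..<N}}"
 let ?c = "\<lambda>g w. \<lambda>j\<in>{..<N}. w (g j) :: complex"
 have finP: "finite ?P" by (simp add: finite_permutations)
 have mfi: "(\<lambda>w. f w * indicator (ordered N) w) \<in> borel_measurable ?M"
  using f measurable_ind_ordered by measurable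
 have gm: "g j \<in> {..<N}" if "g \<in> ?P" "j \<in> {..<N}" for g j
  using that permutes_in_image[of g "{..<N}" j] by auto
 have "AE w in ?M. \<forall>i\<in>{..<N}. \<forall>j\<in>{..<N}. i \<noteq> j \<longrightarrow> Re (w i) \<noteq> Re (w j)"
  by (intro AE_finite_allI AE_impI AE_cylN_no_ties) auto
 hence "AE w in ?M. f w = (\<Sum>g\<in>?P. f (?c g w) * indicator (ordered N) (?c g w))"
  using AE_space
 proof eventually_elim
  case (elim w)
  have inj: "inj_on (\<lambda>i. Re (w i)) {..<N}" using elim by (auto simp: inj_on_def)
  obtain h where h: "h permutes {..<N}" "!!i j. i \<le> j ==> j < N ==> Re (w (h i)) \<le> Re (w (h j))"
   using sorting_permutation_ex[of N "\<lambda>i. Re (w i)"] by blast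
  have ord: "?c g w \<in> ordered N \<longleftrightarrow> g = h" if "g \<in> ?P" for g
  proof
   assume "?c g w \<in> ordered N"
   hence "Re (w (g i)) \<le> Re (w (g j))" if "i \<le> j" "j < N" for i j
    using that by (force simp: ordered_def)
   thus "g = h" using sorting_permutation_unique[OF inj _ _ h(1) h(2)] that by blast
  next
   assume "g = h" thus "?c g w \<in> ordered N" using h(2) by (auto simp: ordered_def)
  qed
  have "(\<Sum>g\<in>?P. f (?c g w) * indicator (ordered N) (?c g w)) = (\<Sum>g\<in>?P. if g = h then f w else 0)"
   using elim(2) by (intro sum.cong refl) (auto simp: ord sym)
  thus ?case using h(1) finP by simp
 qed
 hence "(\<integral>\<^sup>+w. f w \<partial>?M) = (\<integral>\<^sup>+w. (\<Sum>g\<in>?P. f (?c g w) * indicator (ordered N) (?c g w)) \<partial>?M)"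
  by (rule nn_integral_cong_AE)
 also have "... = (\<Sum>g\<in>?P. \<integral>\<^sup>+w. f (?c g w) * indicator (ordered N) (?c g w) \<partial>?M)"
  by (intro nn_integral_sum measurable_cylN_restrict_fun[OF mfi]) (use gm in auto)
 also have "... = (\<Sum>g\<in>?P. \<integral>\<^sup>+w. f w * indicator (ordered N) w \<partial>?M)"
 proof (intro sum.cong refl)
  fix g assume "g \<in> ?P"
  hence "bij_betw g {..<N} {..<N}" by (auto intro: permutes_imp_bij)
  from nn_integral_reindex_cyl[OF _ _ this mfi, where s = 0]
  show "(\<integral>\<^sup>+w. f (?c g w) * indicator (ordered N) (?c g w) \<partial>?M) = (\<integral>\<^sup>+w. f w * indicator (ordered N) w \<partial>?M)"
   by simp
 qed
 also have "... = of_nat (card ?P) * (\<integral>\<^sup>+w. f w * indicator (ordered N) w \<partial>?M)" by simp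
 also have "card ?P = fact N" by (subst card_permutations[of _ N]) auto
 finally show ?thesis by simp
qed

definition Zord :: "nat => nat => ennreal" where
 "Zord N s = (\<integral>\<^sup>+w. ennreal (Phi N s w) * indicator (ordered N) w \<partial>cylN R {..<N})"

lemma measurable_Zord: "(\<lambda>w. ennreal (Phi N s w) * indicator (ordered N) w) \<in> borel_measurable (cylN R {..<N})"
 using measurable_ind_ordered measurable_Phi[of N "{..<N}" s] by measurable

lemma Zord_shift: "Zord N s = Zord N 0"
proof -
 have "Zord N 0 = (\<integral>\<^sup>+w. (\<lambda>w. ennreal (Phi N 0 w) * indicator (ordered N) w) (\<lambda>j\<in>{..<N}. w (id j) + of_real (- per * real s)) \<partial>cylN R {..<N})"
  unfolding Zord_def by (rule nn_integral_reindex_cyl[symmetric, OF _ _ bij_betw_id measurable_Zord]) simp_all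
 also have "... = Zord N s" unfolding Zord_def
  unfolding id_apply
 proof (intro nn_integral_cong)
  fix w
  have "Phi N 0 (\<lambda>j\<in>{..<N}. w j + of_real (- per * real s)) = Phi N s w"
   unfolding Phi_translate[of N s] by (rule Phi_cong) simp
  moreover have "(\<lambda>j\<in>{..<N}. w j + of_real (- per * real s)) \<in> ordered N \<longleftrightarrow> w \<in> ordered N"
   by (auto simp: ordered_def)
  ultimately show "(\<lambda>w. ennreal (Phi N 0 w) * indicator (ordered N) w) (\<lambda>j\<in>{..<N}. w j + of_real (- per * real s)) = ennreal (Phi N s w) * indicator (ordered N) w"
   by (simp add: indicator_def)
 qed
 finally show ?thesis ..
qed

lemma nn_integral_Phi: "(\<integral>\<^sup>+w. ennreal (Phi N s w) \<partial>cylN R {..<N}) = fact N * Zord N s"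
 unfolding Zord_def
proof (rule nn_integral_symmetric)
 fix g w assume g: "g permutes {..<N}"
 have "Phi N s (\<lambda>j\<in>{..<N}. w (g j)) = Phi N s (w \<circ> g)" by (rule Phi_cong) simp
 thus "ennreal (Phi N s (\<lambda>j\<in>{..<N}. w (g j))) = ennreal (Phi N s w)" using Phi_permute[OF g] by simp
qed (use measurable_Phi[of N "{..<N}" s] in measurable)

lemma measurable_block_fun: "k1 + t \<le> N ==> (\<lambda>w. block_fun \<eta> L k1 t w) \<in> borel_measurable (cylN R {..<N})"
proof -
 assume a: "k1 + t \<le> N"
 have [measurable]: "(\<lambda>w. w (k1 + j)) \<in> cylN R {..<N} \<rightarrow>\<^sub>M borel" if "j \<in> {..<t}" for j
  using that a by (intro measurable_component_cyl) auto
 show ?thesis unfolding block_fun_def disp_def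
  by (intro borel_measurable_prod borel_measurable_times measurable_const measurable_compose[OF _ gauss_measurable]
    measurable_compose[OF _ borel_measurable_exp] borel_measurable_diff borel_measurable_abs measurable_compose[OF _ measurable_Re_borel]) auto
qed

lemma nn_integral_block_fun:
 assumes "\<eta> \<ge> 0"
 shows "(\<integral>\<^sup>+w. ennreal (\<Prod>j<t. \<eta> * (gauss (Re (w j) - per * real (k1 + j)) * exp (L * \<bar>Re (w j) - per * real (k1 + j)\<bar>))) \<partial>cylN R {..<t})
  = (ennreal \<eta> * mass L) ^ t"
proof -
 interpret product_sigma_finite "\<lambda>_::nat. cyl_measure R" by (rule product_sigma_finite_cyl)
 let ?f = "\<lambda>j z. ennreal \<eta> * ennreal (gauss (Re z - per * real (k1 + j)) * exp (L * \<bar>Re z - per * real (k1 + j)\<bar>))"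
 have "(\<integral>\<^sup>+w. ennreal (\<Prod>j<t. \<eta> * (gauss (Re (w j) - per * real (k1 + j)) * exp (L * \<bar>Re (w j) - per * real (k1 + j)\<bar>))) \<partial>cylN R {..<t})
  = (\<integral>\<^sup>+w. (\<Prod>j<t. ?f j (w j)) \<partial>cylN R {..<t})"
  using assms by (intro nn_integral_cong) (simp add: prod_ennreal[symmetric] ennreal_mult less_imp_le)
 also have "... = (\<Prod>j<t. \<integral>\<^sup>+z. ?f j z \<partial>cyl_measure R)"
  by (rule product_nn_integral_prod) auto
 also have "... = (\<Prod>j<t. ennreal \<eta> * mass L)"
  by (intro prod.cong refl) (subst nn_integral_cmult, simp, simp only: mass_translate)
 finally show ?thesis by simp
qed

abbreviation ord_dens :: "nat => (nat => complex) => ennreal" where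
 "ord_dens N w \<equiv> ennreal (Phi N 0 w) * indicator (ordered N) w"

abbreviation disp_dens :: "nat => real => nat => (nat => complex) => ennreal" where
 "disp_dens N c a w \<equiv> ennreal (Phi N 0 w * exp (c * \<bar>disp w a\<bar>)) * indicator (ordered N) w"

abbreviation cut_dens :: "real => real => nat => nat => nat => (nat => complex) => ennreal" where
 "cut_dens \<eta> L N k1 k2 w \<equiv> ord_dens k1 w * (ennreal (block_fun \<eta> L k1 (k2 - k1) w) *
   (ennreal (Phi (N - k2) k2 (\<lambda>j. w (k2 + j))) * indicator (ordered (N - k2)) (\<lambda>j. w (k2 + j))))"

abbreviation cut_sum :: "real => nat => nat => ennreal" where
 "cut_sum C N a \<equiv> \<Sum>k1\<le>a. \<Sum>k2\<in>{a<..N}. ennreal C * (Zord k1 0 * (ennreal (cmass / 2) ^ (k2 - k1) * Zord (N - k2) 0))"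

text \<open>Order is required only within the left and the right piece, so the integral splits into
  independent factors; the full ordering would couple the pieces.\<close>

lemma block_integral:
 assumes k: "k1 < k2" "k2 \<le> N" and eta: "\<eta> > 0"
 shows "(\<integral>\<^sup>+w. cut_dens \<eta> L N k1 k2 w \<partial>cylN R {..<N})
   = Zord k1 0 * ((ennreal \<eta> * mass L) ^ (k2 - k1) * Zord (N - k2) 0)" (is ?g1)
  and "(\<lambda>w. cut_dens \<eta> L N k1 k2 w) \<in> borel_measurable (cylN R {..<N})" (is ?g2)
proof -
 define t r where "t = k2 - k1" and "r = N - k2"
 have N: "N = k1 + (t + r)" and k2: "k2 = k1 + t" using k by (auto simp: t_def r_def)
 define f1 where "f1 w = ennreal (Phi k1 0 w) * indicator (ordered k1) w" for w
 define f2 where "f2 w = ennreal (\<Prod>j<t. \<eta> * (gauss (Re (w j) - per * real (k1 + j)) * exp (L * \<bar>Re (w j) - per * real (k1 + j)\<bar>)))" for w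
 define f3 where "f3 w = ennreal (Phi r k2 w) * indicator (ordered r) w" for w
 define g where "g w = f2 (restrict w {..<t}) * f3 (\<lambda>j\<in>{..<r}. w (t + j))" for w
 have m1: "f1 \<in> borel_measurable (cylN R {..<k1})" and m3: "f3 \<in> borel_measurable (cylN R {..<r})"
  unfolding f1_def f3_def by (rule measurable_Zord)+
 have m2: "f2 \<in> borel_measurable (cylN R {..<t})" unfolding f2_def by measurable
 have mg: "g \<in> borel_measurable (cylN R {..<t + r})"
  unfolding g_def
  by (intro borel_measurable_times_ennreal measurable_cylN_restrict_fun[OF m2] measurable_cylN_restrict_fun[OF m3]) auto
 have eq: "cut_dens \<eta> L N k1 k2 w
   = f1 (restrict w {..<k1}) * g (\<lambda>j\<in>{..<t + r}. w (k1 + j))" for w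
 proof -
  have "f1 (restrict w {..<k1}) = ennreal (Phi k1 0 w) * indicator (ordered k1) w"
  proof -
   have "Phi k1 0 (restrict w {..<k1}) = Phi k1 0 w" by (rule Phi_cong) simp
   moreover have "restrict w {..<k1} \<in> ordered k1 \<longleftrightarrow> w \<in> ordered k1" by (auto simp: ordered_def)
   ultimately show ?thesis by (simp add: f1_def indicator_def)
  qed
  moreover have "f2 (restrict (\<lambda>j\<in>{..<t + r}. w (k1 + j)) {..<t}) = ennreal (block_fun \<eta> L k1 t w)"
   unfolding f2_def block_fun_def disp_def by (intro arg_cong[where f = ennreal] prod.cong) auto
  moreover have "f3 (\<lambda>j\<in>{..<r}. (\<lambda>j\<in>{..<t + r}. w (k1 + j)) (t + j)) = ennreal (Phi r k2 (\<lambda>j. w (k2 + j))) * indicator (ordered r) (\<lambda>j. w (k2 + j))"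
  proof -
   have "Phi r k2 (\<lambda>j\<in>{..<r}. (\<lambda>j\<in>{..<t + r}. w (k1 + j)) (t + j)) = Phi r k2 (\<lambda>j. w (k2 + j))"
    by (rule Phi_cong) (simp add: k2 add.assoc)
   moreover have "(\<lambda>j\<in>{..<r}. (\<lambda>j\<in>{..<t + r}. w (k1 + j)) (t + j)) \<in> ordered r \<longleftrightarrow> (\<lambda>j. w (k2 + j)) \<in> ordered r"
    by (auto simp: ordered_def k2 add.assoc)
   ultimately show ?thesis by (simp add: f3_def indicator_def)
  qed
  ultimately show ?thesis unfolding g_def t_def[symmetric] r_def[symmetric] by simp
 qed
 show ?g2
  unfolding eq
  by (intro borel_measurable_times_ennreal measurable_cylN_restrict_fun[OF m1] measurable_cylN_restrict_fun[OF mg]) (auto simp: N)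
 have "(\<integral>\<^sup>+w. f1 (restrict w {..<k1}) * g (\<lambda>j\<in>{..<t + r}. w (k1 + j)) \<partial>cylN R {..<N})
   = (\<integral>\<^sup>+w. f1 w \<partial>cylN R {..<k1}) * (\<integral>\<^sup>+w. g w \<partial>cylN R {..<t + r})"
  unfolding N by (rule nn_integral_cylN_split[OF m1 mg])
 also have "(\<integral>\<^sup>+w. g w \<partial>cylN R {..<t + r}) = (\<integral>\<^sup>+w. f2 w \<partial>cylN R {..<t}) * (\<integral>\<^sup>+w. f3 w \<partial>cylN R {..<r})"
  unfolding g_def by (rule nn_integral_cylN_split[OF m2 m3])
 also have "(\<integral>\<^sup>+w. f2 w \<partial>cylN R {..<t}) = (ennreal \<eta> * mass L) ^ t"
  unfolding f2_def by (rule nn_integral_block_fun) (use eta in simp)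
 also have "(\<integral>\<^sup>+w. f3 w \<partial>cylN R {..<r}) = Zord r 0"
  unfolding f3_def Zord_def[symmetric] by (rule Zord_shift)
 also have "(\<integral>\<^sup>+w. f1 w \<partial>cylN R {..<k1}) = Zord k1 0" unfolding f1_def Zord_def ..
 finally show ?g1
  unfolding eq t_def r_def .
qed

text \<open>The cuts found by \<open>block_bound\<close> depend on the configuration, so the bound
  is summed over all possible positions \<open>k1 \<le> a < k2\<close>; the decay in
  \<open>k2 - k1\<close> keeps this sum under control.\<close>

lemma ordered_exp_disp_bound:
 assumes lam: "lam \<ge> 0"
 obtains C where "C > 0" "!!N a. a < N ==>
   (\<integral>\<^sup>+w. disp_dens N lam a w \<partial>cylN R {..<N})
   \<le> cut_sum C N a"
proof -
 obtain C \<eta> L where C: "C > 0" "\<eta> > 0" and eta: "ennreal \<eta> * mass L \<le> ennreal (cmass / 2)"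
  and B: "!!N a w. w \<in> ordered N ==> a < N ==> \<exists>k1 k2. k1 \<le> a & a < k2 & k2 \<le> N &
    Phi N 0 w * exp (lam * \<bar>disp w a\<bar>) \<le>
    C * (Phi k1 0 w * (block_fun \<eta> L k1 (k2 - k1) w * Phi (N - k2) k2 (\<lambda>j. w (k2 + j))))"
  using block_bound[OF lam] by metis
 have "(\<integral>\<^sup>+w. disp_dens N lam a w \<partial>cylN R {..<N})
   \<le> cut_sum C N a"
  if a: "a < N" for N a
 proof -
  define F where "F k1 k2 w = cut_dens \<eta> L N k1 k2 w" for k1 k2 w
  have Fm: "F k1 k2 \<in> borel_measurable (cylN R {..<N})" if "k1 < k2" "k2 \<le> N" for k1 k2
   unfolding F_def using block_integral(2)[OF that C(2)] .
  have pt: "disp_dens N lam a w \<le> (\<Sum>k1\<le>a. \<Sum>k2\<in>{a<..N}. ennreal C * F k1 k2 w)" for w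
  proof (cases "w \<in> ordered N")
   case True
   obtain k1 k2 where k: "k1 \<le> a" "a < k2" "k2 \<le> N"
     "Phi N 0 w * exp (lam * \<bar>disp w a\<bar>) \<le> C * (Phi k1 0 w * (block_fun \<eta> L k1 (k2 - k1) w * Phi (N - k2) k2 (\<lambda>j. w (k2 + j))))"
    using B[OF True a] by blast
   have bf: "block_fun \<eta> L k1 (k2 - k1) w \<ge> 0"
    unfolding block_fun_def using C by (intro prod_nonneg) (auto simp: less_imp_le)
   have o: "w \<in> ordered k1" "(\<lambda>j. w (k2 + j)) \<in> ordered (N - k2)"
    using True k a by (auto simp: ordered_def)
   have "ennreal (Phi N 0 w * exp (lam * \<bar>disp w a\<bar>)) \<le> ennreal (C * (Phi k1 0 w * (block_fun \<eta> L k1 (k2 - k1) w * Phi (N - k2) k2 (\<lambda>j. w (k2 + j)))))"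
    using k(4) by (rule ennreal_leI)
   also have "... = ennreal C * F k1 k2 w"
    using C bf o by (simp add: F_def ennreal_mult)
   also have "... \<le> (\<Sum>k2\<in>{a<..N}. ennreal C * F k1 k2 w)"
    by (rule member_le_sum) (use k in auto)
   also have "... \<le> (\<Sum>k1\<le>a. \<Sum>k2\<in>{a<..N}. ennreal C * F k1 k2 w)"
    by (rule member_le_sum[where f = "\<lambda>k1. \<Sum>k2\<in>{a<..N}. ennreal C * F k1 k2 w"]) (use k in auto)
   finally show ?thesis using True by simp
  qed simp
  have "(\<integral>\<^sup>+w. disp_dens N lam a w \<partial>cylN R {..<N})
   \<le> (\<integral>\<^sup>+w. (\<Sum>k1\<le>a. \<Sum>k2\<in>{a<..N}. ennreal C * F k1 k2 w) \<partial>cylN R {..<N})"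
   by (intro nn_integral_mono pt)
  also have "... = (\<Sum>k1\<le>a. \<Sum>k2\<in>{a<..N}. \<integral>\<^sup>+w. ennreal C * F k1 k2 w \<partial>cylN R {..<N})"
   by (subst nn_integral_sum, use Fm in \<open>auto intro!: borel_measurable_sum\<close>)
     (intro sum.cong refl nn_integral_sum, use Fm in auto)
  also have "... \<le> cut_sum C N a"
  proof (intro sum_mono)
   fix k1 k2 assume k: "k1 \<in> {..a}" "k2 \<in> {a<..N}"
   hence kk: "k1 < k2" "k2 \<le> N" by auto
   have "(\<integral>\<^sup>+w. ennreal C * F k1 k2 w \<partial>cylN R {..<N}) = ennreal C * (\<integral>\<^sup>+w. F k1 k2 w \<partial>cylN R {..<N})"
    by (rule nn_integral_cmult) (rule Fm[OF kk])
   also have "(\<integral>\<^sup>+w. F k1 k2 w \<partial>cylN R {..<N}) = Zord k1 0 * ((ennreal \<eta> * mass L) ^ (k2 - k1) * Zord (N - k2) 0)"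
    unfolding F_def by (rule block_integral(1)[OF kk C(2)])
   also have "ennreal C * ... \<le> ennreal C * (Zord k1 0 * (ennreal (cmass / 2) ^ (k2 - k1) * Zord (N - k2) 0))"
    by (intro mult_left_mono mult_right_mono power_mono eta) auto
   finally show "(\<integral>\<^sup>+w. ennreal C * F k1 k2 w \<partial>cylN R {..<N}) \<le> ennreal C * (Zord k1 0 * (ennreal (cmass / 2) ^ (k2 - k1) * Zord (N - k2) 0))" .
  qed
  finally show ?thesis .
 qed
 thus thesis using C(1) that by blast
qed

end

section \<open>Orbitals\<close>

lemma measurable_cis [measurable]: "cis \<in> borel_measurable borel"
 by (intro borel_measurable_continuous_onI) (auto intro!: continuous_intros)

lemma measurable_Im_borel [measurable]: "Im \<in> borel_measurable borel"
 by (intro borel_measurable_continuous_onI continuous_intros)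

lemma measurable_cnj: "cnj \<in> borel_measurable borel"
 by (intro borel_measurable_continuous_onI continuous_intros)

lemma integral_cis_period:
 assumes R: "R > 0" and n: "n \<noteq> (0::int)"
 shows "(\<integral>y. indicator {0..2 * pi * R} y *\<^sub>R cis (of_int n * y / R) \<partial>lborel) = 0"
proof -
 define c where "c = \<i> * of_real (of_int n / R)"
 have c: "c \<noteq> 0" using R n by (simp add: c_def)
 have cis: "cis (of_int n * y / R) = exp (c * of_real y)" for y
  by (simp add: cis_conv_exp c_def mult.assoc)
 have "(\<integral>y. indicator {0..2 * pi * R} y *\<^sub>R cis (of_int n * y / R) \<partial>lborel) = exp (c * of_real (2 * pi * R)) / c - exp (c * of_real 0) / c"
 proof (rule integral_FTC_Icc)
  show "0 \<le> 2 * pi * R" using R by simp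
  show "((\<lambda>y. exp (c * of_real y) / c) has_vector_derivative cis (of_int n * x / R)) (at x within {0..2 * pi * R})" for x
   unfolding cis using c
   by (intro has_vector_derivative_real_field) (auto intro!: derivative_eq_intros)
  show "continuous_on {0..2 * pi * R} (\<lambda>y. cis (of_int n * y / R))"
   using R by (intro continuous_intros) auto
 qed
 also have "exp (c * of_real (2 * pi * R)) = 1"
 proof -
  have "of_int n * (2 * pi * R) / R = 2 * pi * of_int n" using R by simp
  hence "cis (of_int n * (2 * pi * R) / R) = 1" by (simp only: cis_multiple_2pi Ints_of_int)
  thus ?thesis by (simp only: cis)
 qed
 finally show ?thesis by simp
qed

lemma integral_cyl_fourier:
 fixes f :: "real => complex"
 assumes R: "R > 0" and n: "n \<noteq> (0::int)" and f [measurable]: "f \<in> borel_measurable borel"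
  and int: "integrable (cyl_measure R) (\<lambda>z. f (Re z) * cis (of_int n * Im z / R))"
 shows "(\<integral>z. f (Re z) * cis (of_int n * Im z / R) \<partial>cyl_measure R) = 0"
proof -
 let ?g = "\<lambda>z. indicator (cyl R) z *\<^sub>R (f (Re z) * cis (of_int n * Im z / R))"
 have int': "integrable lborel ?g" "(\<integral>z. f (Re z) * cis (of_int n * Im z / R) \<partial>cyl_measure R) = (\<integral>z. ?g z \<partial>lborel)"
  using int unfolding cyl_measure_def
  by (auto simp: integrable_restrict_space integral_restrict_space)
 have gm [measurable]: "?g \<in> borel_measurable borel" by measurable
 define G where "G = (\<lambda>(x, y). f x * (indicator {0..2 * pi * R} y *\<^sub>R cis (of_int n * y / R)))"
 have G: "?g (case z of (x, y) => Complex x y) = G z" for z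
  by (cases z) (auto simp: G_def cyl_def indicator_def)
 have intG: "integrable (lborel \<Otimes>\<^sub>M lborel) G"
 proof -
  have "integrable (distr (lborel \<Otimes>\<^sub>M lborel) borel (\<lambda>(x, y). Complex x y)) ?g"
   using int'(1) by (subst (asm) lborel_complex)
  thus ?thesis by (subst (asm) integrable_distr_eq) (auto simp: G)
 qed
 have "(\<integral>z. ?g z \<partial>lborel) = (\<integral>z. ?g z \<partial>distr (lborel \<Otimes>\<^sub>M lborel) borel (\<lambda>(x, y). Complex x y))"
  by (subst lborel_complex) (rule refl)
 also have "... = (\<integral>z. G z \<partial>(lborel \<Otimes>\<^sub>M lborel))"
  by (subst integral_distr) (auto simp: G)
 also have "... = (\<integral>x. \<integral>y. G (x, y) \<partial>lborel \<partial>lborel)"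
  by (rule lborel_pair.integral_fst'[OF intG, symmetric])
 also have "... = 0"
  unfolding G_def case_prod_conv integral_mult_right_zero integral_cis_period[OF R n] by simp
 finally show ?thesis using int'(2) by simp
qed

context laughlin_cyl begin

definition del :: real where "del = l^2 / R"

lemma del_pos: "del > 0" using l R by (simp add: del_def)
lemma per_del: "per = real p * del" by (simp add: per_def del_def)

definition orb :: "nat => complex => complex" where
 "orb k z = of_real (exp (- ((Re z - del * real k)^2 / (2 * l^2)))) * cis (real k * Im z / R)"

text \<open>The amplitude of an orbital list, normalised so that the exponential factor is 1 for the
  reference list \<open>0, p, 2p, ...\<close>.\<close>

definition omega :: "nat list => real" where
 "omega ms = of_int (vcoeff p ms) * exp (gam / 2 * ((\<Sum>x\<leftarrow>ms. (real x)^2) - (\<Sum>j<length ms. (real (p * j))^2)))"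

lemma measurable_orb [measurable]: "orb k \<in> borel_measurable borel"
 unfolding orb_def by measurable

lemma norm_orb: "norm (orb k z) = exp (- ((Re z - del * real k)^2 / (2 * l^2)))"
 by (simp add: orb_def norm_mult)

lemma orb_exp: "exp (z / of_real R) ^ k * of_real (exp (- ((Re z)^2 / (2 * l^2)))) = of_real (exp (gam / 2 * (real k)^2)) * orb k z"
proof -
 have "of_nat k * (z / of_real R) = Complex (real k * Re z / R) (real k * Im z / R)"
  by (auto simp: complex_eq_iff)
 hence "exp (z / of_real R) ^ k = of_real (exp (real k * Re z / R)) * cis (real k * Im z / R)"
  by (simp only: exp_of_nat_mult[symmetric]) (simp add: exp_eq_polar)
 moreover have "exp (real k * Re z / R) * exp (- ((Re z)^2 / (2 * l^2))) = exp (gam / 2 * (real k)^2) * exp (- ((Re z - del * real k)^2 / (2 * l^2)))"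
 proof -
  have "real k * Re z / R + - ((Re z)^2 / (2 * l^2)) = gam / 2 * (real k)^2 + - ((Re z - del * real k)^2 / (2 * l^2))"
   using l R by (simp add: gam_def del_def power2_eq_square field_simps)
  thus ?thesis by (simp only: exp_add[symmetric])
 qed
 ultimately have "exp (z / of_real R) ^ k * of_real (exp (- ((Re z)^2 / (2 * l^2)))) =
   of_real (exp (gam / 2 * (real k)^2) * exp (- ((Re z - del * real k)^2 / (2 * l^2)))) * cis (real k * Im z / R)"
  by (simp add: mult_ac del: of_real_exp flip: of_real_mult)
 thus ?thesis unfolding orb_def by (simp only: of_real_mult mult.assoc)
qed

lemma laughlin_expand:
 "laughlin l R p N w = of_real (exp (gam / 2 * (\<Sum>j<N. (real (p * j))^2))) *
   (\<Sum>ms\<in>nlists N (p * N). of_real (omega ms) * (\<Prod>i<N. orb (ms ! i) (w i)))"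
proof -
 have gs: "complex_of_real (exp (- (1 / (2 * l^2)) * (\<Sum>k<N. (Re (w k))^2))) = (\<Prod>k<N. of_real (exp (- ((Re (w k))^2 / (2 * l^2)))))"
 proof -
  have "- (1 / (2 * l^2)) * (\<Sum>k<N. (Re (w k))^2) = (\<Sum>k<N. - ((Re (w k))^2 / (2 * l^2)))"
   by (simp add: sum_negf sum_divide_distrib)
  thus ?thesis by (simp only: exp_sum[OF finite_lessThan] of_real_prod)
 qed
 have "laughlin l R p N w = vandermonde_pow p N (\<lambda>i. exp (w i / of_real R)) * of_real (exp (- (1 / (2 * l^2)) * (\<Sum>k<N. (Re (w k))^2)))"
  by (simp add: laughlin_def vandermonde_pow_def)
 also have "... = (\<Sum>ms\<in>nlists N (p * N). of_int (vcoeff p ms) * (monom_at (\<lambda>i. exp (w i / of_real R)) ms * (\<Prod>k<N. of_real (exp (- ((Re (w k))^2 / (2 * l^2)))))))"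
  unfolding vandermonde_pow_expand[OF p] gs sum_distrib_right mult.assoc ..
 also have "... = (\<Sum>ms\<in>nlists N (p * N). of_real (exp (gam / 2 * (\<Sum>j<N. (real (p * j))^2))) * (of_real (omega ms) * (\<Prod>i<N. orb (ms ! i) (w i))))"
 proof (intro sum.cong refl)
  fix ms assume "ms \<in> nlists N (p * N)"
  hence len: "length ms = N" by (simp add: nlists_def)
  have "monom_at (\<lambda>i. exp (w i / of_real R)) ms * (\<Prod>k<N. of_real (exp (- ((Re (w k))^2 / (2 * l^2)))))
   = (\<Prod>k<N. of_real (exp (gam / 2 * (real (ms ! k))^2)) * orb (ms ! k) (w k))"
   unfolding monom_at_def len prod.distrib[symmetric] orb_exp ..
  also have "... = of_real (exp (gam / 2 * (\<Sum>k<N. (real (ms ! k))^2))) * (\<Prod>i<N. orb (ms ! i) (w i))"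
   by (simp add: prod.distrib sum_distrib_left exp_sum del: of_real_exp)
  also have "(\<Sum>k<N. (real (ms ! k))^2) = (\<Sum>x\<leftarrow>ms. (real x)^2)"
   unfolding sum_list_sum_nth by (simp add: len atLeast0LessThan)
  finally show "of_int (vcoeff p ms) * (monom_at (\<lambda>i. exp (w i / of_real R)) ms * (\<Prod>k<N. of_real (exp (- ((Re (w k))^2 / (2 * l^2))))))
   = of_real (exp (gam / 2 * (\<Sum>j<N. (real (p * j))^2))) * (of_real (omega ms) * (\<Prod>i<N. orb (ms ! i) (w i)))"
   unfolding omega_def len by (simp add: right_diff_distrib exp_diff del: of_real_exp)
 qed
 finally show ?thesis by (simp add: sum_distrib_left)
qed

text \<open>The mean of \<open>h (Re z)\<close> when \<open>z\<close> has the normalised density of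
  the orbital \<open>k\<close>, a Gaussian in \<open>x\<close> centred at
  \<open>del * k\<close>.\<close>

definition hat :: "(real => complex) => nat => complex" where
 "hat h k = (\<integral>z. of_real (gauss (Re z - del * real k)) * h (Re z) \<partial>cyl_measure R) / of_real cmass"

lemma integrable_gauss: "integrable (cyl_measure R) (\<lambda>z. gauss (Re z - s))"
proof (rule integrableI_nonneg)
 show "(\<lambda>z. gauss (Re z - s)) \<in> borel_measurable (cyl_measure R)" by measurable
 show "(\<integral>\<^sup>+z. ennreal (gauss (Re z - s)) \<partial>cyl_measure R) < \<infinity>"
  using mass_translate[of s 0] mass_finite[of 0] by simp
qed (auto simp: less_imp_le)

lemma integral_gauss: "(\<integral>z. gauss (Re z - s) \<partial>cyl_measure R) = cmass"
 unfolding cmass_def using mass_translate[of s 0]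
 by (subst integral_eq_nn_integral) (auto simp: less_imp_le)

lemma orb_mult_cnj: "orb k z * cnj (orb m z) = of_real (exp (- ((Re z - del * real k)^2 / (2 * l^2))) * exp (- ((Re z - del * real m)^2 / (2 * l^2)))) * cis (of_int (int k - int m) * Im z / R)"
 by (simp add: orb_def cis_cnj cis_mult left_diff_distrib diff_divide_distrib)

lemma orb_mult_cnj_same: "orb k z * cnj (orb k z) = of_real (gauss (Re z - del * real k))"
 unfolding orb_mult_cnj by (simp add: gauss_def exp_add[symmetric])

lemma norm_orb_mult_le: "norm (orb k z) * norm (orb m z) \<le> gauss (Re z - del * real k) + gauss (Re z - del * real m)"
proof -
 define a b where "a = norm (orb k z)" and "b = norm (orb m z)"
 have "gauss (Re z - del * real k) = a^2" "gauss (Re z - del * real m) = b^2"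
  by (simp_all add: a_def b_def norm_orb gauss_def power2_eq_square exp_add[symmetric])
 moreover have "a * b \<le> a^2 + b^2"
  using sum_squares_bound[of a b] zero_le_power2[of a] zero_le_power2[of b] by linarith
 ultimately show ?thesis by (simp add: a_def b_def)
qed

lemma integrable_orb:
 assumes h [measurable]: "h \<in> borel_measurable borel" and b: "!!x. norm (h x) \<le> B"
 shows "integrable (cyl_measure R) (\<lambda>z. orb k z * cnj (orb m z) * h (Re z))"
proof (rule Bochner_Integration.integrable_bound[where f = "\<lambda>z. (gauss (Re z - del * real k) + gauss (Re z - del * real m)) * B"])
 show "integrable (cyl_measure R) (\<lambda>z. (gauss (Re z - del * real k) + gauss (Re z - del * real m)) * B)"
  by (intro integrable_mult_left Bochner_Integration.integrable_add integrable_gauss)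
 show "(\<lambda>z. orb k z * cnj (orb m z) * h (Re z)) \<in> borel_measurable (cyl_measure R)"
  by (intro measurable_cyl_measure borel_measurable_times measurable_orb measurable_compose[OF measurable_orb measurable_cnj]
    measurable_compose[OF measurable_Re_borel h])
 have B0: "B \<ge> 0" using b[of 0] norm_ge_zero order_trans by blast
 show "AE z in cyl_measure R. norm (orb k z * cnj (orb m z) * h (Re z)) \<le> norm ((gauss (Re z - del * real k) + gauss (Re z - del * real m)) * B)"
 proof (intro always_eventually allI)
  fix z
  have "norm (orb k z * cnj (orb m z) * h (Re z)) = norm (orb k z) * norm (orb m z) * norm (h (Re z))" by (simp add: norm_mult)
  also have "... \<le> (gauss (Re z - del * real k) + gauss (Re z - del * real m)) * B"
   by (intro mult_mono norm_orb_mult_le b) (auto simp: less_imp_le intro!: add_nonneg_nonneg)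
  finally show "norm (orb k z * cnj (orb m z) * h (Re z)) \<le> norm ((gauss (Re z - del * real k) + gauss (Re z - del * real m)) * B)" by simp
 qed
qed

text \<open>Since \<open>h\<close> sees only the axial coordinate, the angular integral still
  annihilates different orbitals; this is the reason for working with observables of
  \<open>x\<close> alone.\<close>

lemma integral_orb:
 assumes h [measurable]: "h \<in> borel_measurable borel" and b: "!!x. norm (h x) \<le> B"
 shows "(\<integral>z. orb k z * cnj (orb m z) * h (Re z) \<partial>cyl_measure R) = (if k = m then of_real cmass * hat h k else 0)"
proof (cases "k = m")
 case True
 thus ?thesis using cmass_pos by (simp add: orb_mult_cnj_same hat_def)
next
 case False
 define f where "f x = of_real (exp (- ((x - del * real k)^2 / (2 * l^2))) * exp (- ((x - del * real m)^2 / (2 * l^2)))) * h x" for x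
 have fm: "f \<in> borel_measurable borel" unfolding f_def by measurable
 have eq: "orb k z * cnj (orb m z) * h (Re z) = f (Re z) * cis (of_int (int k - int m) * Im z / R)" for z
  unfolding orb_mult_cnj f_def by (simp only: mult_ac)
 have "(\<integral>z. f (Re z) * cis (of_int (int k - int m) * Im z / R) \<partial>cyl_measure R) = 0"
 proof (rule integral_cyl_fourier[OF R _ fm])
  show "int k - int m \<noteq> 0" using False by simp
  show "integrable (cyl_measure R) (\<lambda>z. f (Re z) * cis (of_int (int k - int m) * Im z / R))"
   using integrable_orb[OF h b, of k m] unfolding eq .
 qed
 thus ?thesis using False unfolding eq by simp
qed

end

section \<open>Integrals of the wave function as sums over orbital configurations\<close>

lemma sum_nlists_append:
 "(\<Sum>xs\<in>nlists (a + c) Q. f xs) = (\<Sum>us\<in>nlists a Q. \<Sum>vs\<in>nlists c Q. f (us @ vs))"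
proof -
 have "(\<Sum>us\<in>nlists a Q. \<Sum>vs\<in>nlists c Q. f (us @ vs)) = (\<Sum>(us, vs)\<in>nlists a Q \<times> nlists c Q. f (us @ vs))"
  by (simp add: sum.cartesian_product)
 also have "... = (\<Sum>xs\<in>nlists (a + c) Q. f xs)"
  by (rule sum.reindex_bij_witness[where i = "\<lambda>xs. (take a xs, drop a xs)" and j = "\<lambda>(us, vs). us @ vs"])
   (auto simp: nlists_def dest: in_set_takeD in_set_dropD)
 finally show ?thesis ..
qed

lemma sum_nlists_mset:
 fixes F :: "nat multiset => 'a :: real_vector"
 shows "(\<Sum>ms\<in>nlists r Q. F (mset ms)) = (\<Sum>M\<in>cfg Q r. (fact r / mfact M) *\<^sub>R F M)"
proof -
 have "(\<Sum>ms\<in>nlists r Q. F (mset ms)) = (\<Sum>M\<in>cfg Q r. \<Sum>ms\<in>{ms \<in> nlists r Q. mset ms = M}. F (mset ms))"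
  by (rule sum.group[symmetric], simp, simp) (auto simp: nlists_def cfg_def)
 also have "... = (\<Sum>M\<in>cfg Q r. (fact r / mfact M) *\<^sub>R F M)"
 proof (rule sum.cong[OF refl])
  fix M assume M: "M \<in> cfg Q r"
  have eq: "{ms \<in> nlists r Q. mset ms = M} = permutations_of_multiset M"
   using M by (auto simp: permutations_of_multiset_def nlists_def cfg_def)
  have "real (card (permutations_of_multiset M)) = fact r / mfact M"
   using M card_permutations_of_multiset[of M]
   by (simp add: real_of_nat_div mfact_def cfg_def)
  thus "(\<Sum>ms\<in>{ms \<in> nlists r Q. mset ms = M}. F (mset ms)) = (fact r / mfact M) *\<^sub>R F M"
   unfolding eq by (simp add: permutations_of_multiset_def[symmetric] sum_constant_scaleR permutations_of_multisetD flip: \<open>real (card (permutations_of_multiset M)) = fact r / mfact M\<close> cong: sum.cong)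
 qed
 finally show ?thesis .
qed

context laughlin_cyl begin

abbreviation spliced :: "nat => nat => (nat => complex) => (nat => complex) => complex" where
 "spliced N n z w \<equiv> laughlin l R p N (\<lambda>i. if i < n then z i else w i)"

text \<open>One formula for all uses: \<open>h\<close> constant gives the correlation functions,
  \<open>n = 0\<close> gives the norm and the expectations of products of one-particle
  functions.\<close>

lemma integral_laughlin_product:
 fixes h :: "nat => real => complex"
 assumes n: "n \<le> N" and h: "!!i. h i \<in> borel_measurable borel" and b: "!!i x. norm (h i x) \<le> B"
 defines "Q \<equiv> p * N"
 shows "(\<integral>w. spliced N n z w * cnj (spliced N n z' w)
    * (\<Prod>i\<in>{n..<N}. h i (Re (w i))) \<partial>cylN R {n..<N})
   = of_real (exp (gam * (\<Sum>j<N. (real (p * j))^2)) * cmass ^ (N - n)) *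
    (\<Sum>ks\<in>nlists n Q. \<Sum>ks'\<in>nlists n Q. (\<Sum>ms\<in>nlists (N - n) Q. of_real (omega (ks @ ms) * omega (ks' @ ms)) * (\<Prod>i<N - n. hat (h (n + i)) (ms ! i)))
     * (\<Prod>i<n. orb (ks ! i) (z i) * cnj (orb (ks' ! i) (z' i))))" (is "?L = _")
  and "integrable (cylN R {n..<N}) (\<lambda>w. spliced N n z w * cnj (spliced N n z' w)
    * (\<Prod>i\<in>{n..<N}. h i (Re (w i))))"
proof -
 interpret product_sigma_finite "\<lambda>_::nat. cyl_measure R" by (rule product_sigma_finite_cyl)
 let ?I = "{n..<N}"
 define E where "E = exp (gam * (\<Sum>j<N. (real (p * j))^2))"
 define P where "P as bs = (\<Prod>i<n. orb (as ! i) (z i) * cnj (orb (bs ! i) (z' i)))" for as bs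
 define f where "f as bs i u = orb (as ! i) u * cnj (orb (bs ! i) u) * h i (Re u)" for as bs :: "nat list" and i u
 have lt: "{..<N} = {..<n} \<union> ?I" using n by auto
 let ?c = "\<lambda>as bs. of_real E * of_real (omega as * omega bs) * P as bs"
 have expand: "spliced N n z w * cnj (spliced N n z' w) * (\<Prod>i\<in>?I. h i (Re (w i)))
  = (\<Sum>as\<in>nlists N Q. \<Sum>bs\<in>nlists N Q. ?c as bs * (\<Prod>i\<in>?I. f as bs i (w i)))" for w
 proof -
  have ee: "exp (gam / 2 * S) * exp (gam / 2 * S) = exp (gam * S)" for S by (simp add: exp_add[symmetric])
  have pr: "(\<Prod>i<N. orb (as ! i) (if i < n then zz i else w i)) = (\<Prod>i<n. orb (as ! i) (zz i)) * (\<Prod>i\<in>?I. orb (as ! i) (w i))" for as zz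
   unfolding lt by (subst prod.union_disjoint) auto
  have "spliced N n z w * cnj (spliced N n z' w) * (\<Prod>i\<in>?I. h i (Re (w i)))
   = of_real E * ((\<Sum>as\<in>nlists N Q. of_real (omega as) * (\<Prod>i<N. orb (as ! i) (if i < n then z i else w i))) *
      (\<Sum>bs\<in>nlists N Q. of_real (omega bs) * cnj (\<Prod>i<N. orb (bs ! i) (if i < n then z' i else w i)))) * (\<Prod>i\<in>?I. h i (Re (w i)))"
   unfolding laughlin_expand Q_def E_def by (simp add: ee[symmetric] del: of_real_exp cnj_prod of_nat_mult)
  also have "... = (\<Sum>as\<in>nlists N Q. \<Sum>bs\<in>nlists N Q. of_real E * (of_real (omega as) * (\<Prod>i<N. orb (as ! i) (if i < n then z i else w i)) *
      (of_real (omega bs) * cnj (\<Prod>i<N. orb (bs ! i) (if i < n then z' i else w i)))) * (\<Prod>i\<in>?I. h i (Re (w i))))"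
   by (simp only: sum_product) (simp only: sum_distrib_left sum_distrib_right)
  also have "... = (\<Sum>as\<in>nlists N Q. \<Sum>bs\<in>nlists N Q. ?c as bs * (\<Prod>i\<in>?I. f as bs i (w i)))"
   unfolding pr P_def f_def prod.distrib by (intro sum.cong refl) (simp add: mult_ac)
  finally show ?thesis .
 qed
 have intf: "integrable (cyl_measure R) (f as bs i)" for as bs i
  unfolding f_def by (rule integrable_orb[OF h b])
 have intp: "integrable (cylN R ?I) (\<lambda>w. \<Prod>i\<in>?I. f as bs i (w i))" for as bs
  by (rule product_integrable_prod) (use intf in auto)
 show "integrable (cylN R ?I) (\<lambda>w. spliced N n z w * cnj (spliced N n z' w) * (\<Prod>i\<in>?I. h i (Re (w i))))"
  unfolding expand by (intro Bochner_Integration.integrable_sum integrable_mult_right intp)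
 let ?H = "\<lambda>ms. \<Prod>i<N - n. hat (h (n + i)) (ms ! i)"
 \<comment> \<open>The integral over particle \<open>i\<close>. Its product over \<open>i\<close>
   forces the two lists to agree on all integrated particles, which collapses the double
   sum.\<close>
 define D where "D i a b = (if a = b then of_real cmass * hat (h i) a else 0)" for i and a b :: nat
 have "?L = (\<integral>w. (\<Sum>as\<in>nlists N Q. \<Sum>bs\<in>nlists N Q. ?c as bs * (\<Prod>i\<in>?I. f as bs i (w i))) \<partial>cylN R ?I)"
  unfolding expand ..
 also have "... = (\<Sum>as\<in>nlists N Q. \<Sum>bs\<in>nlists N Q. \<integral>w. ?c as bs * (\<Prod>i\<in>?I. f as bs i (w i)) \<partial>cylN R ?I)"
  by (subst Bochner_Integration.integral_sum, (intro Bochner_Integration.integrable_sum integrable_mult_right intp)[1],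
    intro sum.cong refl Bochner_Integration.integral_sum integrable_mult_right intp)
 also have "... = (\<Sum>as\<in>nlists N Q. \<Sum>bs\<in>nlists N Q. ?c as bs * (\<Prod>i\<in>?I. D i (as ! i) (bs ! i)))"
 proof (intro sum.cong refl)
  fix as bs
  have "(\<integral>w. (\<Prod>i\<in>?I. f as bs i (w i)) \<partial>cylN R ?I) = (\<Prod>i\<in>?I. integral\<^sup>L (cyl_measure R) (f as bs i))"
   by (rule product_integral_prod) (use intf in auto)
  also have "... = (\<Prod>i\<in>?I. D i (as ! i) (bs ! i))"
   unfolding f_def D_def by (intro prod.cong refl integral_orb[OF h b])
  finally show "(\<integral>w. ?c as bs * (\<Prod>i\<in>?I. f as bs i (w i)) \<partial>cylN R ?I)
   = ?c as bs * (\<Prod>i\<in>?I. D i (as ! i) (bs ! i))"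
   by (simp only: integral_mult_right_zero)
 qed
 also have "... = (\<Sum>ks\<in>nlists n Q. \<Sum>ms\<in>nlists (N - n) Q. \<Sum>ks'\<in>nlists n Q. \<Sum>ms'\<in>nlists (N - n) Q.
    if ms' = ms then of_real E * of_real (omega (ks @ ms) * omega (ks' @ ms)) * P ks ks' * (of_real cmass ^ (N - n) * ?H ms) else 0)"
 proof -
  have split: "(\<Sum>xs\<in>nlists N Q. F xs) = (\<Sum>us\<in>nlists n Q. \<Sum>vs\<in>nlists (N - n) Q. F (us @ vs))" for F :: "nat list => complex"
   using sum_nlists_append[of F n "N - n" Q] n by simp
  show ?thesis unfolding split
  proof (intro sum.cong refl)
   fix ks ms ks' ms' assume L: "ks \<in> nlists n Q" "ms \<in> nlists (N - n) Q" "ks' \<in> nlists n Q" "ms' \<in> nlists (N - n) Q"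
   hence len: "length ks = n" "length ms = N - n" "length ks' = n" "length ms' = N - n" by (auto simp: nlists_def)
   have PP: "P (ks @ ms) (ks' @ ms') = P ks ks'"
    unfolding P_def using len by (intro prod.cong refl) (simp add: nth_append)
   have DD: "(\<Prod>i\<in>?I. D i ((ks @ ms) ! i) ((ks' @ ms') ! i)) = (\<Prod>i<N - n. D (n + i) (ms ! i) (ms' ! i))"
    by (rule prod.reindex_bij_witness[where i = "\<lambda>i. n + i" and j = "\<lambda>i. i - n"]) (use len in \<open>auto simp: nth_append\<close>)
   have D2: "(\<Prod>i<N - n. D (n + i) (ms ! i) (ms' ! i)) = (if ms' = ms then of_real cmass ^ (N - n) * ?H ms else 0)"
   proof (cases "ms' = ms")
    case True thus ?thesis by (simp add: D_def prod.distrib)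
   next
    case False
    then obtain i where "i < N - n" "ms ! i \<noteq> ms' ! i" using len by (metis nth_equalityI)
    hence "\<exists>i\<in>{..<N - n}. D (n + i) (ms ! i) (ms' ! i) = 0" by (auto simp: D_def)
    thus ?thesis using False by (simp add: prod_zero)
   qed
   show "of_real E * of_real (omega (ks @ ms) * omega (ks' @ ms')) * P (ks @ ms) (ks' @ ms') * (\<Prod>i\<in>?I. D i ((ks @ ms) ! i) ((ks' @ ms') ! i))
    = (if ms' = ms then of_real E * of_real (omega (ks @ ms) * omega (ks' @ ms)) * P ks ks' * (of_real cmass ^ (N - n) * ?H ms) else 0)"
    unfolding PP DD D2 by simp
  qed
 qed
 also have "... = (\<Sum>ks\<in>nlists n Q. \<Sum>ms\<in>nlists (N - n) Q. \<Sum>ks'\<in>nlists n Q.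
    of_real E * of_real (omega (ks @ ms) * omega (ks' @ ms)) * P ks ks' * (of_real cmass ^ (N - n) * ?H ms))"
  by (intro sum.cong refl) simp
 also have "... = (\<Sum>ks\<in>nlists n Q. \<Sum>ks'\<in>nlists n Q. \<Sum>ms\<in>nlists (N - n) Q.
    of_real E * of_real (omega (ks @ ms) * omega (ks' @ ms)) * P ks ks' * (of_real cmass ^ (N - n) * ?H ms))"
  by (intro sum.cong refl sum.swap)
 also have "... = of_real (E * cmass ^ (N - n)) *
    (\<Sum>ks\<in>nlists n Q. \<Sum>ks'\<in>nlists n Q. (\<Sum>ms\<in>nlists (N - n) Q. of_real (omega (ks @ ms) * omega (ks' @ ms)) * ?H ms) * P ks ks')"
  unfolding sum_distrib_left sum_distrib_right by (intro sum.cong refl) simp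
 finally show "?L = of_real (exp (gam * (\<Sum>j<N. (real (p * j))^2)) * cmass ^ (N - n)) *
    (\<Sum>ks\<in>nlists n Q. \<Sum>ks'\<in>nlists n Q. (\<Sum>ms\<in>nlists (N - n) Q. of_real (omega (ks @ ms) * omega (ks' @ ms)) * ?H ms)
     * (\<Prod>i<n. orb (ks ! i) (z i) * cnj (orb (ks' ! i) (z' i))))"
  unfolding E_def P_def .
qed

text \<open>Joins the amplitudes to the multiset weights: zipping the two lists turns a product of
  amplitudes into a \<open>pair_weight\<close>.\<close>

lemma omega_mult:
 assumes "length ks' = length ks"
 shows "omega (ks @ ms) * omega (ks' @ ms) = pair_weight gam p (mset (zip ks ks') + diag (mset ms))"
proof -
 let ?ps = "zip ks ks' @ map (\<lambda>x. (x, x)) ms"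
 have ps: "mset ?ps = mset (zip ks ks') + diag (mset ms)" by (simp add: diag_def)
 have m: "map fst ?ps = ks @ ms" "map snd ?ps = ks' @ ms" using assms by (simp_all add: o_def)
 define S where "S = (\<Sum>j<length ?ps. (real (p * j))^2)"
 have len: "length (ks @ ms) = length ?ps" "length (ks' @ ms) = length ?ps" using assms by simp_all
 have sq: "(\<Sum>(x, y)\<in>#mset ?ps. ((real x)^2 + (real y)^2) / 2) = ((\<Sum>x\<leftarrow>map fst ?ps. (real x)^2) + (\<Sum>x\<leftarrow>map snd ?ps. (real x)^2)) / 2"
 proof -
  have "(\<Sum>(x, y)\<in>#mset qs. ((real x)^2 + (real y)^2) / 2) = ((\<Sum>x\<leftarrow>map fst qs. (real x)^2) + (\<Sum>x\<leftarrow>map snd qs. (real x)^2)) / 2" for qs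
   by (induction qs) (auto simp: add_divide_distrib)
  thus ?thesis .
 qed
 have "pair_weight gam p (mset ?ps) = of_int (vcoeff p (ks @ ms) * vcoeff p (ks' @ ms)) *
   exp (gam * (((\<Sum>x\<leftarrow>ks @ ms. (real x)^2) + (\<Sum>x\<leftarrow>ks' @ ms. (real x)^2)) / 2 - S))"
  unfolding pair_weight_def sq pair_coeff_mset[OF p] m S_def by simp
 also have "... = omega (ks @ ms) * omega (ks' @ ms)"
  unfolding omega_def len S_def[symmetric]
  by (simp add: exp_add[symmetric] algebra_simps add_divide_distrib diff_divide_distrib)
 finally show ?thesis unfolding ps ..
qed

lemma sum_omega_mult:
 assumes "ks \<in> nlists n Q" "ks' \<in> nlists n Q" "n \<le> N" "Q = p * N"
 shows "(\<Sum>ms\<in>nlists (N - n) Q. omega (ks @ ms) * omega (ks' @ ms)) = fact (N - n) * corr_sum gam p N (mset (zip ks ks'))"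
proof -
 have l: "length ks = n" "length ks' = n" using assms by (auto simp: nlists_def)
 have "(\<Sum>ms\<in>nlists (N - n) Q. omega (ks @ ms) * omega (ks' @ ms)) = (\<Sum>ms\<in>nlists (N - n) Q. pair_weight gam p (mset (zip ks ks') + diag (mset ms)))"
  by (intro sum.cong refl omega_mult) (simp add: l)
 also have "... = (\<Sum>M\<in>cfg Q (N - n). (fact (N - n) / mfact M) *\<^sub>R pair_weight gam p (mset (zip ks ks') + diag M))"
  by (rule sum_nlists_mset)
 also have "... = fact (N - n) * corr_sum gam p N (mset (zip ks ks'))"
  unfolding corr_sum_def corr_weight_def using l assms(4) by (simp add: sum_distrib_left)
 finally show ?thesis .
qed

end

context laughlin_cyl begin

abbreviation Z :: "nat => real" where "Z N \<equiv> part_fun gam p N"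

lemma nlists_0: "nlists 0 Q = {[]}" by (auto simp: nlists_def)

lemma laughlin_mult_cnj: "laughlin l R p N w * cnj (laughlin l R p N w) = of_real (exp (gam * (\<Sum>j<N. (real (p * j))^2)) * Phi N 0 w)"
 unfolding complex_norm_square[symmetric] laughlin_cmod2 ..

lemma integral_Phi_lists:
 fixes h :: "nat => real => complex"
 assumes h: "!!i. h i \<in> borel_measurable borel" and b: "!!i x. norm (h i x) \<le> B"
 shows "(\<integral>w. of_real (Phi N 0 w) * (\<Prod>i<N. h i (Re (w i))) \<partial>cylN R {..<N})
   = of_real (cmass ^ N) * (\<Sum>ms\<in>nlists N (p * N). of_real (omega ms * omega ms) * (\<Prod>i<N. hat (h i) (ms ! i)))" (is ?g1)
  and "integrable (cylN R {..<N}) (\<lambda>w. of_real (Phi N 0 w) * (\<Prod>i<N. h i (Re (w i))))" (is ?g2)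
proof -
 define E where "E = exp (gam * (\<Sum>j<N. (real (p * j))^2))"
 have E: "E \<noteq> 0" by (simp add: E_def)
 note * = integral_laughlin_product[of 0 N h B "\<lambda>_. 0" "\<lambda>_. 0", OF _ h b, simplified nlists_0]
 have eq: "of_real (Phi N 0 w) * (\<Prod>i<N. h i (Re (w i))) = (laughlin l R p N (\<lambda>i. if i < 0 then 0 else w i) * cnj (laughlin l R p N (\<lambda>i. if i < 0 then 0 else w i)) * (\<Prod>i\<in>{0..<N}. h i (Re (w i)))) / of_real E" for w
  using E by (simp add: laughlin_mult_cnj E_def atLeast0LessThan)
 have "integrable (cylN R {0..<N}) (\<lambda>w. (laughlin l R p N (\<lambda>i. if i < 0 then 0 else w i) * cnj (laughlin l R p N (\<lambda>i. if i < 0 then 0 else w i)) * (\<Prod>i\<in>{0..<N}. h i (Re (w i)))) / of_real E)"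
  by (intro integrable_divide integral_laughlin_product(2)[OF _ h b]) simp
 thus ?g2
  unfolding eq by (simp add: atLeast0LessThan)
 have "(\<integral>w. of_real (Phi N 0 w) * (\<Prod>i<N. h i (Re (w i))) \<partial>cylN R {..<N})
  = (\<integral>w. laughlin l R p N (\<lambda>i. if i < 0 then 0 else w i) * cnj (laughlin l R p N (\<lambda>i. if i < 0 then 0 else w i)) * (\<Prod>i\<in>{0..<N}. h i (Re (w i))) \<partial>cylN R {0..<N}) / of_real E"
  unfolding eq by (simp only: integral_divide_zero atLeast0LessThan)
 also have "... = of_real (cmass ^ N) * (\<Sum>ms\<in>nlists N (p * N). of_real (omega ms * omega ms) * (\<Prod>i<N. hat (h i) (ms ! i)))"
  using E by (subst integral_laughlin_product(1)[OF _ h b]) (simp_all add: nlists_0 E_def)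
 finally show ?g1 .
qed

lemma omega_square: "omega ms * omega ms = pair_weight gam p (diag (mset ms))"
 using omega_mult[of "[]" "[]" ms] by simp

lemma sum_omega_square:
 fixes F :: "nat multiset => complex"
 shows "(\<Sum>ms\<in>nlists N (p * N). of_real (omega ms * omega ms) * F (mset ms)) = fact N * (\<Sum>M\<in>cfg (p * N) N. of_real (conf_weight gam p M) * F M)"
proof -
 have "(\<Sum>ms\<in>nlists N (p * N). of_real (omega ms * omega ms) * F (mset ms)) = (\<Sum>M\<in>cfg (p * N) N. (fact N / mfact M) *\<^sub>R (of_real (pair_weight gam p (diag M)) * F M))"
  unfolding omega_square by (rule sum_nlists_mset)
 also have "... = fact N * (\<Sum>M\<in>cfg (p * N) N. of_real (conf_weight gam p M) * F M)"
  unfolding sum_distrib_left conf_weight_def corr_weight_def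
  by (intro sum.cong refl) (simp add: scaleR_conv_of_real)
 finally show ?thesis .
qed

lemma integral_Phi_product:
 fixes h :: "real => complex"
 assumes h: "h \<in> borel_measurable borel" and b: "!!x. norm (h x) \<le> B"
 shows "(\<integral>w. of_real (Phi N 0 w) * (\<Prod>i<N. h (Re (w i))) \<partial>cylN R {..<N})
   = of_real (cmass ^ N * fact N) * (\<Sum>M\<in>cfg (p * N) N. of_real (conf_weight gam p M) * (\<Prod>x\<in>#M. hat h x))" (is ?g1)
  and "integrable (cylN R {..<N}) (\<lambda>w. of_real (Phi N 0 w) * (\<Prod>i<N. h (Re (w i))))" (is ?g2)
proof -
 show ?g2
  by (rule integral_Phi_lists(2)[OF h b])
 have "(\<integral>w. of_real (Phi N 0 w) * (\<Prod>i<N. h (Re (w i))) \<partial>cylN R {..<N})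
   = of_real (cmass ^ N) * (\<Sum>ms\<in>nlists N (p * N). of_real (omega ms * omega ms) * (\<Prod>i<N. hat h (ms ! i)))"
  by (rule integral_Phi_lists(1)[OF h b])
 also have "(\<Sum>ms\<in>nlists N (p * N). of_real (omega ms * omega ms) * (\<Prod>i<N. hat h (ms ! i)))
   = (\<Sum>ms\<in>nlists N (p * N). of_real (omega ms * omega ms) * (\<Prod>x\<in>#mset ms. hat h x))"
 proof (intro sum.cong refl)
  fix ms assume "ms \<in> nlists N (p * N)"
  hence "length ms = N" by (simp add: nlists_def)
  hence "(\<Prod>x\<in>#mset ms. hat h x) = (\<Prod>i<N. hat h (ms ! i))"
   using prod.list_conv_set_nth[of "map (hat h) ms"]
   by (simp add: prod_mset_prod_list[symmetric] atLeast0LessThan flip: mset_map)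
  thus "of_real (omega ms * omega ms) * (\<Prod>i<N. hat h (ms ! i)) = of_real (omega ms * omega ms) * (\<Prod>x\<in>#mset ms. hat h x)" by simp
 qed
 also have "... = fact N * (\<Sum>M\<in>cfg (p * N) N. of_real (conf_weight gam p M) * (\<Prod>x\<in>#M. hat h x))"
  by (rule sum_omega_square)
 finally show ?g1 by (simp add: mult_ac)
qed

lemma hat_1: "hat (\<lambda>_. 1) k = 1"
proof -
 have "(\<integral>z. complex_of_real (gauss (Re z - del * real k)) * 1 \<partial>cyl_measure R) = of_real cmass"
  using integral_gauss[of "del * real k"] integrable_gauss[of "del * real k"]
  by (simp only: mult_1_right integral_complex_of_real)
 thus ?thesis using cmass_pos by (simp add: hat_def)
qed

lemma integral_Phi: "(\<integral>w. Phi N 0 w \<partial>cylN R {..<N}) = cmass ^ N * fact N * Z N"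
 and integrable_Phi: "integrable (cylN R {..<N}) (\<lambda>w. Phi N 0 w)"
proof -
 note * = integral_Phi_product[of "\<lambda>_. 1" 1 N]
 have i: "integrable (cylN R {..<N}) (\<lambda>w. complex_of_real (Phi N 0 w))" using *(2) by simp
 from integrable_Re[OF i] show ii: "integrable (cylN R {..<N}) (\<lambda>w. Phi N 0 w)" by simp
 have "complex_of_real (\<integral>w. Phi N 0 w \<partial>cylN R {..<N}) = of_real (cmass ^ N * fact N * Z N)"
  using *(1) by (simp add: hat_1 part_fun_eq)
 thus "(\<integral>w. Phi N 0 w \<partial>cylN R {..<N}) = cmass ^ N * fact N * Z N" by (simp only: of_real_eq_iff)
qed

text \<open>The bridge between the energy estimate, made in position space, and the partition
  function, defined by orbital sums.\<close>

lemma Zord_eq: "Zord N 0 = ennreal (cmass ^ N * Z N)"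
proof -
 have Z0: "Z N \<ge> 0" using part_fun_nonneg[OF p] .
 have "fact N * Zord N 0 = (\<integral>\<^sup>+w. ennreal (Phi N 0 w) \<partial>cylN R {..<N})" by (rule nn_integral_Phi[symmetric])
 also have "... = ennreal (cmass ^ N * fact N * Z N)"
  by (subst nn_integral_eq_integral[OF integrable_Phi]) (auto simp: integral_Phi)
 also have "... = fact N * ennreal (cmass ^ N * Z N)"
 proof -
  have "cmass ^ N * fact N * Z N = real (fact N) * (cmass ^ N * Z N)" by simp
  thus ?thesis using Z0 cmass_pos by (simp only: ennreal_mult of_nat_0_le_iff ennreal_of_nat_eq_real_of_nat[symmetric] mult_nonneg_nonneg zero_le_power less_imp_le) simp
 qed
 finally have "of_nat (fact N) * Zord N 0 = of_nat (fact N) * ennreal (cmass ^ N * Z N)" by simp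
 thus ?thesis by (subst (asm) ennreal_mult_cancel_left) (auto simp: ennreal_of_nat_eq_real_of_nat)
qed

lemma laughlin_norm2_eq: "laughlin_norm2 l R p N = exp (gam * (\<Sum>j<N. (real (p * j))^2)) * (cmass ^ N * fact N * Z N)"
 unfolding laughlin_norm2_def laughlin_cmod2 by (simp add: integral_Phi)

text \<open>The coefficient of the correlation function in the basis of orbitals.\<close>
definition occ :: "nat => (nat \<times> nat) multiset => real" where
 "occ N K = corr_sum gam p N K / Z N"

lemma Z_pos: "Z N > 0" using part_fun_ge_1[OF p, of gam N] by linarith

abbreviation "rhoN \<equiv> rho_fin l R p"

lemma rho_fin_eq:
 assumes n: "n \<le> N"
 shows "rhoN N n z z' = (\<Sum>ks\<in>nlists n (p * N). \<Sum>ks'\<in>nlists n (p * N). of_real (occ N (mset (zip ks ks')) / cmass ^ n) *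
   (\<Prod>i<n. orb (ks ! i) (z i) * cnj (orb (ks' ! i) (z' i))))"
proof -
 define E where "E = exp (gam * (\<Sum>j<N. (real (p * j))^2))"
 have E: "E \<noteq> 0" by (simp add: E_def)
 let ?S = "\<lambda>ks ks'. \<Sum>ms\<in>nlists (N - n) (p * N). of_real (omega (ks @ ms) * omega (ks' @ ms)) * (\<Prod>i<N - n. hat (\<lambda>_. 1) (ms ! i))"
 have I: "(\<integral>w. spliced N n z w * cnj (spliced N n z' w) \<partial>cylN R {n..<N})
  = of_real (E * cmass ^ (N - n)) * (\<Sum>ks\<in>nlists n (p * N). \<Sum>ks'\<in>nlists n (p * N). of_real (fact (N - n) * corr_sum gam p N (mset (zip ks ks'))) *
    (\<Prod>i<n. orb (ks ! i) (z i) * cnj (orb (ks' ! i) (z' i))))"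
 proof -
  have "(\<integral>w. spliced N n z w * cnj (spliced N n z' w) * (\<Prod>i\<in>{n..<N}. 1) \<partial>cylN R {n..<N})
   = of_real (E * cmass ^ (N - n)) * (\<Sum>ks\<in>nlists n (p * N). \<Sum>ks'\<in>nlists n (p * N). (?S ks ks') *
    (\<Prod>i<n. orb (ks ! i) (z i) * cnj (orb (ks' ! i) (z' i))))"
   unfolding E_def by (rule integral_laughlin_product(1)[OF n, where B = 1 and h = "\<lambda>_ _. 1"]) auto
  also have "... = of_real (E * cmass ^ (N - n)) * (\<Sum>ks\<in>nlists n (p * N). \<Sum>ks'\<in>nlists n (p * N). of_real (fact (N - n) * corr_sum gam p N (mset (zip ks ks'))) *
    (\<Prod>i<n. orb (ks ! i) (z i) * cnj (orb (ks' ! i) (z' i))))"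
  proof (intro arg_cong2[where f = "(*)"] sum.cong refl)
   fix ks ks' assume k: "ks \<in> nlists n (p * N)" "ks' \<in> nlists n (p * N)"
   have "(?S ks ks')
    = complex_of_real (\<Sum>ms\<in>nlists (N - n) (p * N). omega (ks @ ms) * omega (ks' @ ms))"
    by (simp add: hat_1)
   thus "(?S ks ks')
    = complex_of_real (fact (N - n) * corr_sum gam p N (mset (zip ks ks')))"
    by (simp only: sum_omega_mult[OF k n refl])
  qed
  finally show ?thesis by simp
 qed
 have c: "complex_of_real (fact N / (fact (N - n) * laughlin_norm2 l R p N)) * (of_real (E * cmass ^ (N - n)) * (of_real (fact (N - n) * X) * Y))
   = of_real (X / Z N / cmass ^ n) * Y" for X Y
 proof -
  have "fact N / (fact (N - n) * laughlin_norm2 l R p N) * (E * cmass ^ (N - n)) * (fact (N - n) * X) = X / Z N / cmass ^ n"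
  proof -
   have "cmass ^ N = cmass ^ (N - n) * cmass ^ n" using n by (simp flip: power_add)
   thus ?thesis unfolding laughlin_norm2_eq E_def[symmetric] using E cmass_pos Z_pos[of N] by (simp add: field_simps)
  qed
  thus ?thesis by (simp only: mult.assoc[symmetric] of_real_mult[symmetric])
 qed
 show ?thesis unfolding rho_fin_def I sum_distrib_left c occ_def ..
qed

end

section \<open>Growth of the partition function\<close>

text \<open>On each side of \<open>s\<close> the distances have pairwise different integer parts, so
  two geometric series bound the sum.\<close>

lemma sum_exp_dist_le:
 fixes s lam :: real
 assumes lam: "lam > 0" and A: "finite A"
 shows "(\<Sum>a\<in>A. exp (- lam * \<bar>real a - s\<bar>)) \<le> 2 / (1 - exp (- lam))"
proof -
 define q where "q = exp (- lam)"
 have q: "0 < q" "q < 1" using lam by (auto simp: q_def)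
 define d where "d a = \<bar>real a - s\<bar>" for a :: nat
 have geo: "(\<Sum>a\<in>B. exp (- lam * d a)) \<le> 1 / (1 - q)" if B: "finite B" "inj_on (\<lambda>a. nat \<lfloor>d a\<rfloor>) B" for B
 proof -
  have "exp (- lam * d a) \<le> q ^ nat \<lfloor>d a\<rfloor>" for a
  proof -
   have "real (nat \<lfloor>d a\<rfloor>) \<le> d a" by (simp add: d_def)
   hence "exp (- lam * d a) \<le> exp (real (nat \<lfloor>d a\<rfloor>) * - lam)" using lam by (simp add: mult.commute)
   thus ?thesis by (simp only: q_def exp_of_nat_mult)
  qed
  hence "(\<Sum>a\<in>B. exp (- lam * d a)) \<le> (\<Sum>a\<in>B. q ^ nat \<lfloor>d a\<rfloor>)" by (rule sum_mono)
  also have "... = (\<Sum>i\<in>(\<lambda>a. nat \<lfloor>d a\<rfloor>) ` B. q ^ i)" using B(2) by (simp add: sum.reindex)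
  also have "... \<le> (\<Sum>i<Suc (Max (insert 0 ((\<lambda>a. nat \<lfloor>d a\<rfloor>) ` B))). q ^ i)"
   using B(1) q by (intro sum_mono2) (auto simp: less_Suc_eq_le)
  also have "... \<le> 1 / (1 - q)" using q by (subst sum_gp_strict) (auto simp: divide_right_mono)
  finally show ?thesis .
 qed
 have inj: "a = b" if "nat \<lfloor>d a\<rfloor> = nat \<lfloor>d b\<rfloor>" "s \<le> real a \<longleftrightarrow> s \<le> real b" for a b
  using that unfolding d_def by (auto simp: abs_if split: if_splits) linarith+
 have "(\<Sum>a\<in>A. exp (- lam * d a)) = (\<Sum>a\<in>A \<inter> {a. s \<le> real a}. exp (- lam * d a)) + (\<Sum>a\<in>A \<inter> - {a. s \<le> real a}. exp (- lam * d a))"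
  using sum.Int_Diff[OF A, of _ "{a. s \<le> real a}"] by (simp only: Diff_eq)
 also have "... \<le> 1 / (1 - q) + 1 / (1 - q)"
  using A by (intro add_mono geo) (auto intro!: inj_onI dest: inj)
 finally show ?thesis by (simp add: q_def d_def)
qed

text \<open>The exponent splits at \<open>a\<close> into \<open>a - k1\<close> and
  \<open>k2 - a\<close>, which gives a product of two geometric sums bounded by 2 and 1.\<close>

lemma sum_half_blocks_le:
 fixes a N :: nat
 shows "(\<Sum>k1\<le>a. \<Sum>k2\<in>{a<..N}. (1 / 2 :: real) ^ (k2 - k1)) \<le> 2"
proof -
 have "(\<Sum>k1\<le>a. \<Sum>k2\<in>{a<..N}. (1 / 2 :: real) ^ (k2 - k1)) = (\<Sum>k1\<le>a. \<Sum>k2\<in>{a<..N}. (1 / 2) ^ (a - k1) * (1 / 2) ^ (k2 - a))"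
  by (intro sum.cong refl) (auto simp flip: power_add)
 also have "... = (\<Sum>k1\<le>a. (1 / 2) ^ (a - k1)) * (\<Sum>k2\<in>{a<..N}. (1 / 2 :: real) ^ (k2 - a))"
  by (simp add: sum_product)
 also have "... \<le> 2 * 1"
 proof (rule mult_mono)
  have "(\<Sum>k1\<le>a. (1 / 2 :: real) ^ (a - k1)) = (\<Sum>i<Suc a. (1 / 2) ^ i)"
   by (rule sum.reindex_bij_witness[where i = "\<lambda>i. a - i" and j = "\<lambda>k. a - k"]) auto
  also have "... \<le> 2" by (subst sum_gp_strict) auto
  finally show "(\<Sum>k1\<le>a. (1 / 2 :: real) ^ (a - k1)) \<le> 2" .
  have "(\<Sum>k2\<in>{a<..N}. (1 / 2 :: real) ^ (k2 - a)) = (\<Sum>i<N - a. (1 / 2) ^ Suc i)"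
   by (rule sum.reindex_bij_witness[where i = "\<lambda>i. a + Suc i" and j = "\<lambda>k. k - Suc a"]) (auto simp: Suc_diff_Suc)
  also have "... = (1 / 2) * (\<Sum>i<N - a. (1 / 2) ^ i)" by (simp add: sum_distrib_left)
  also have "... \<le> 1" by (subst sum_gp_strict) auto
  finally show "(\<Sum>k2\<in>{a<..N}. (1 / 2 :: real) ^ (k2 - a)) \<le> 1" .
 qed (auto intro: sum_nonneg)
 finally show ?thesis by simp
qed

text \<open>A two-sided form of Fekete's lemma: \<open>ln r\<close> is the supremum of
  \<open>ln (z n) / n\<close>, and submultiplicativity up to \<open>C\<close> bounds this supremum
  by each \<open>ln (C * z n) / n\<close>.\<close>

lemma multiplicative_growth:
 fixes z :: "nat => real"
 assumes z1: "!!n. z n \<ge> 1" and C: "C \<ge> 1"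
  and sup: "!!i j. z i * z j \<le> z (i + j)" and sub: "!!i j. z (i + j) \<le> C * z i * z j"
 obtains r where "r > 0" "!!n. z n \<le> r ^ n" "!!n. r ^ n \<le> C * z n"
proof -
 have zpos: "z n > 0" for n using z1[of n] by linarith
 have up: "z m ^ k \<le> z (m * k)" for m k
 proof (induction k)
  case 0 show ?case using z1[of 0] by simp
 next
  case (Suc k)
  have "z m ^ Suc k \<le> z m * z (m * k)" using Suc zpos[of m] by simp
  also have "... \<le> z (m + m * k)" by (rule sup)
  finally show ?case by simp
 qed
 have dn: "C * z (n * k) \<le> (C * z n) ^ k" if "k \<ge> 1" for n k
  using that
 proof (induction k rule: dec_induct)
  case (step k)
  have "C * z (n * Suc k) \<le> C * (C * z n * z (n * k))"
   using sub[of n "n * k"] C by (intro mult_left_mono) auto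
  also have "... = (C * z n) * (C * z (n * k))" by simp
  also have "... \<le> (C * z n) * (C * z n) ^ k" using step C zpos[of n] by (intro mult_left_mono) auto
  finally show ?case by simp
 qed simp
 define a where "a n = ln (z n) / real n" for n
 have ab: "a m \<le> ln (C * z n) / real n" if m: "m \<ge> 1" and n: "n \<ge> 1" for m n
 proof -
  have "z m ^ n \<le> z (m * n)" by (rule up)
  also have "... \<le> C * z (n * m)" using C zpos[of "n * m"] by (simp add: mult.commute)
  also have "... \<le> (C * z n) ^ m" by (rule dn[OF m])
  finally have "ln (z m ^ n) \<le> ln ((C * z n) ^ m)" using zpos C by (intro ln_mono) auto
  hence "real n * ln (z m) \<le> real m * ln (C * z n)"
   using zpos[of m] zpos[of n] C by (simp add: ln_realpow)
  thus ?thesis using m n by (simp add: a_def field_simps)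
 qed
 define s where "s = (SUP m\<in>{1..}. a m)"
 have bdd: "bdd_above (a ` {1..})" using ab[of _ 1] by (auto intro!: bdd_aboveI[where M = "ln (C * z 1) / real 1"])
 have lo: "a m \<le> s" if "m \<ge> 1" for m unfolding s_def using that bdd by (intro cSUP_upper) auto
 have hi: "s \<le> ln (C * z n) / real n" if "n \<ge> 1" for n
  unfolding s_def using ab that by (intro cSUP_least) auto
 have z0: "z 0 = 1"
 proof -
  have "z 0 * z 0 \<le> z 0" using sup[of 0 0] by simp
  hence "z 0 \<le> 1" using zpos[of 0] by simp
  thus ?thesis using z1[of 0] by simp
 qed
 show thesis
 proof (rule that[of "exp s"])
  fix n
  show "z n \<le> exp s ^ n"
  proof (cases "n = 0")
   case False
   hence "ln (z n) \<le> real n * s" using lo[of n] by (simp add: a_def field_simps)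
   hence "exp (ln (z n)) \<le> exp (real n * s)" by simp
   thus ?thesis using zpos[of n] by (simp add: exp_of_nat_mult)
  qed (simp add: z0)
  show "exp s ^ n \<le> C * z n"
  proof (cases "n = 0")
   case False
   hence "real n * s \<le> ln (C * z n)" using hi[of n] by (simp add: field_simps)
   hence "exp (real n * s) \<le> exp (ln (C * z n))" by simp
   thus ?thesis using zpos[of n] C by (simp add: exp_of_nat_mult)
  qed (use C z0 in simp)
 qed simp
qed

context laughlin_cyl begin

lemma ordered_exp_disp_bound_real:
 assumes lam: "lam \<ge> 0"
 obtains C where "C > 0" "!!N a. a < N ==>
   (\<integral>\<^sup>+w. disp_dens N lam a w \<partial>cylN R {..<N})
   \<le> ennreal (C * cmass ^ N * (\<Sum>k1\<le>a. \<Sum>k2\<in>{a<..N}. (1 / 2) ^ (k2 - k1) * (Z k1 * Z (N - k2))))"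
proof -
 obtain C where C: "C > 0" and B: "!!N a. a < N ==>
   (\<integral>\<^sup>+w. disp_dens N lam a w \<partial>cylN R {..<N})
   \<le> cut_sum C N a"
  using ordered_exp_disp_bound[OF lam] by blast
 have "cut_sum C N a
   = ennreal (C * cmass ^ N * (\<Sum>k1\<le>a. \<Sum>k2\<in>{a<..N}. (1 / 2) ^ (k2 - k1) * (Z k1 * Z (N - k2))))" for N a
 proof -
  have t: "ennreal C * (Zord k1 0 * (ennreal (cmass / 2) ^ (k2 - k1) * Zord (N - k2) 0)) = ennreal (C * cmass ^ N * ((1 / 2) ^ (k2 - k1) * (Z k1 * Z (N - k2))))"
   if k: "k1 \<le> a" "k2 \<in> {a<..N}" for k1 k2
  proof -
   have "N = k1 + (k2 - k1) + (N - k2)" using k by auto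
   hence e: "cmass ^ N = cmass ^ k1 * cmass ^ (k2 - k1) * cmass ^ (N - k2)" by (metis power_add)
   have "ennreal C * (Zord k1 0 * (ennreal (cmass / 2) ^ (k2 - k1) * Zord (N - k2) 0))
    = ennreal (C * (cmass ^ k1 * Z k1 * ((cmass / 2) ^ (k2 - k1) * (cmass ^ (N - k2) * Z (N - k2)))))"
    using C cmass_pos Z_pos[of k1] Z_pos[of "N - k2"]
    by (simp only: Zord_eq ennreal_power less_imp_le ennreal_mult mult_nonneg_nonneg zero_le_power divide_nonneg_nonneg zero_le_numeral)
   also have "C * (cmass ^ k1 * Z k1 * ((cmass / 2) ^ (k2 - k1) * (cmass ^ (N - k2) * Z (N - k2)))) = C * cmass ^ N * ((1 / 2) ^ (k2 - k1) * (Z k1 * Z (N - k2)))"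
    unfolding e by (simp add: power_divide)
   finally show ?thesis .
  qed
  have nn: "0 \<le> C * cmass ^ N * ((1 / 2) ^ (k2 - k1) * (Z k1 * Z (N - k2)))" for k1 k2
   using C cmass_pos Z_pos[of k1] Z_pos[of "N - k2"] by simp
  have "cut_sum C N a
   = (\<Sum>k1\<le>a. \<Sum>k2\<in>{a<..N}. ennreal (C * cmass ^ N * ((1 / 2) ^ (k2 - k1) * (Z k1 * Z (N - k2)))))"
   by (intro sum.cong refl t) auto
  also have "... = ennreal (\<Sum>k1\<le>a. \<Sum>k2\<in>{a<..N}. C * cmass ^ N * ((1 / 2) ^ (k2 - k1) * (Z k1 * Z (N - k2))))"
   using nn by (simp add: sum_nonneg)
  finally show ?thesis by (simp add: sum_distrib_left)
 qed
 thus thesis using B C that by presburger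
qed

lemma Z_supermult: "Z i * Z j \<le> Z (i + j)"
 using part_fun_supermult[OF p, of i "i + j" gam] by simp

lemma Z_mono: "i \<le> j ==> Z i \<le> Z j"
 by (rule part_fun_mono[OF p])

text \<open>The block around particle \<open>i\<close> leaves at most \<open>i\<close> particles on
  its left and at most \<open>j\<close> on its right. Since \<open>Z\<close> is monotone, the sum
  over blocks is geometric.\<close>

lemma Z_submult:
 obtains C where "C \<ge> 1" "!!i j. Z (i + j) \<le> C * Z i * Z j"
proof -
 obtain C where C: "C > 0" and B: "!!N a. a < N ==>
   (\<integral>\<^sup>+w. ennreal (Phi N 0 w * exp (0 * \<bar>disp w a\<bar>)) * indicator (ordered N) w \<partial>cylN R {..<N})
   \<le> ennreal (C * cmass ^ N * (\<Sum>k1\<le>a. \<Sum>k2\<in>{a<..N}. (1 / 2) ^ (k2 - k1) * (Z k1 * Z (N - k2))))"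
  using ordered_exp_disp_bound_real[of 0] by auto
 have "Z (i + j) \<le> max 1 (2 * C) * Z i * Z j" for i j
 \<comment> \<open>For \<open>j = 0\<close> there is no particle with index \<open>i\<close>, so the
   block estimate does not apply.\<close>
 proof (cases "j = 0")
  case True
  thus ?thesis using Z_pos[of i] part_fun_0[OF p, of gam] by simp
 next
  case False
  let ?N = "i + j"
  have "ennreal (cmass ^ ?N * Z ?N) \<le> ennreal (C * cmass ^ ?N * (\<Sum>k1\<le>i. \<Sum>k2\<in>{i<..?N}. (1 / 2) ^ (k2 - k1) * (Z k1 * Z (?N - k2))))"
   using B[of i ?N] False by (simp add: Zord_eq[symmetric] Zord_def)
  hence "cmass ^ ?N * Z ?N \<le> C * cmass ^ ?N * (\<Sum>k1\<le>i. \<Sum>k2\<in>{i<..?N}. (1 / 2) ^ (k2 - k1) * (Z k1 * Z (?N - k2)))"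
  proof (subst (asm) ennreal_le_iff)
   show "0 \<le> C * cmass ^ ?N * (\<Sum>k1\<le>i. \<Sum>k2\<in>{i<..?N}. (1 / 2) ^ (k2 - k1) * (Z k1 * Z (?N - k2)))"
    using C cmass_pos Z_pos by (intro mult_nonneg_nonneg sum_nonneg) (auto intro: less_imp_le)
  qed
  hence "Z ?N \<le> C * (\<Sum>k1\<le>i. \<Sum>k2\<in>{i<..?N}. (1 / 2) ^ (k2 - k1) * (Z k1 * Z (?N - k2)))"
   using cmass_pos by (simp add: mult.left_commute mult.assoc)
  also have "... \<le> C * (\<Sum>k1\<le>i. \<Sum>k2\<in>{i<..?N}. (1 / 2) ^ (k2 - k1) * (Z i * Z j))"
   using C Z_pos by (intro mult_left_mono sum_mono mult_mono Z_mono) (auto intro!: mult_nonneg_nonneg less_imp_le)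
  also have "... = C * ((\<Sum>k1\<le>i. \<Sum>k2\<in>{i<..?N}. (1 / 2) ^ (k2 - k1)) * (Z i * Z j))"
   by (simp add: sum_distrib_right)
  also have "... \<le> C * (2 * (Z i * Z j))"
   using C Z_pos by (intro mult_left_mono mult_right_mono sum_half_blocks_le) (auto intro!: mult_nonneg_nonneg less_imp_le)
  also have "... \<le> max 1 (2 * C) * (Z i * Z j)"
   using Z_pos[of i] Z_pos[of j] by (simp add: max_def)
  finally show ?thesis by simp
 qed
 thus thesis by (intro that[of "max 1 (2 * C)"]) auto
qed

text \<open>The renewal theorem applies since \<open>Z\<close> is nearly multiplicative.\<close>
lemma Z_growth_ex:
 "\<exists>r v c. r > 0 & v > 0 & c > 0 & (\<forall>n. c \<le> Z n / r ^ n & Z n / r ^ n \<le> 1) & (\<lambda>n. Z n / r ^ n) \<longlonglongrightarrow> v"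
proof -
 obtain C where C: "C \<ge> 1" "!!i j. Z (i + j) \<le> C * Z i * Z j" using Z_submult by blast
 obtain r where r: "r > 0" "!!n. Z n \<le> r ^ n" "!!n. r ^ n \<le> C * Z n"
  using multiplicative_growth[of Z C] part_fun_ge_1[OF p] C Z_supermult by blast
 define u where "u n = Z n / r ^ n" for n
 have lo: "1 / C \<le> u n" and hi: "u n \<le> 1" for n
  using r(2,3)[of n] r(1) C(1) by (simp_all add: u_def field_simps)
 have ren: "u n = (\<Sum>i=1..n. (irreducible_sum gam p i / r ^ i) * u (n - i))" if "n \<ge> 1" for n
 proof -
  have "u n = (\<Sum>i=1..n. irreducible_sum gam p i * Z (n - i)) / r ^ n"
   unfolding u_def part_fun_renewal[OF p that, of gam] ..
  also have "... = (\<Sum>i=1..n. (irreducible_sum gam p i / r ^ i) * u (n - i))"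
   unfolding sum_divide_distrib
  proof (intro sum.cong refl)
   fix i assume "i \<in> {1..n}"
   hence "r ^ n = r ^ i * r ^ (n - i)" by (simp flip: power_add)
   thus "irreducible_sum gam p i * Z (n - i) / r ^ n = irreducible_sum gam p i / r ^ i * u (n - i)"
    by (simp add: u_def)
  qed
  finally show ?thesis .
 qed
 obtain v where "v > 0" "u \<longlonglongrightarrow> v"
 proof (rule renewal_theorem_bounded_below[where u = u and f = "\<lambda>i. irreducible_sum gam p i / r ^ i" and c = "1 / C"])
  show "u 0 = 1" by (simp add: u_def part_fun_0[OF p])
  show "0 \<le> irreducible_sum gam p i / r ^ i" for i using irreducible_sum_nonneg[OF p] r by simp
  show "0 < irreducible_sum gam p 1 / r ^ 1" using irreducible_sum_1[OF p] r by simp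
  show "0 < 1 / C" using C by simp
 qed (use ren lo hi that in auto)
 thus ?thesis using r(1) lo hi C(1)
  by (intro exI[of _ r] exI[of _ v] exI[of _ "1 / C"]) (auto simp: u_def[abs_def])
qed

text \<open>Fixes one rate from \<open>Z_growth_ex\<close>; only the properties in
  \<open>growth_props\<close> enter afterwards.\<close>

definition growth :: real where
 "growth = (SOME r. r > 0 & (\<exists>v c. v > 0 & c > 0 & (\<forall>n. c \<le> Z n / r ^ n & Z n / r ^ n \<le> 1) & (\<lambda>n. Z n / r ^ n) \<longlonglongrightarrow> v))"

definition uu :: "nat => real" where "uu n = Z n / growth ^ n"
definition vv :: real where "vv = lim uu"

lemma growth_props: "growth > 0" "\<exists>v c. v > 0 & c > 0 & (\<forall>n. c \<le> uu n & uu n \<le> 1) & uu \<longlonglongrightarrow> v"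
proof -
 have "\<exists>r. r > 0 & (\<exists>v c. v > 0 & c > 0 & (\<forall>n. c \<le> Z n / r ^ n & Z n / r ^ n \<le> 1) & (\<lambda>n. Z n / r ^ n) \<longlonglongrightarrow> v)"
  using Z_growth_ex by blast
 from someI_ex[OF this, folded growth_def]
 show "growth > 0" "\<exists>v c. v > 0 & c > 0 & (\<forall>n. c \<le> uu n & uu n \<le> 1) & uu \<longlonglongrightarrow> v"
  unfolding uu_def[abs_def] by blast+
qed

lemma uu_lim: "uu \<longlonglongrightarrow> vv" and vv_pos: "vv > 0"
 using growth_props(2) by (auto simp: vv_def limI)

lemma uu_le_1: "uu n \<le> 1" and uu_pos: "uu n > 0"
 using growth_props(2) less_le_trans by blast+

lemma Z_uu: "Z n = uu n * growth ^ n" using growth_props(1) by (simp add: uu_def)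

text \<open>Relative to the total weight \<open>cmass ^ N * Z N\<close> of the ordered sector,
  displacements have exponential moments of every order, uniformly in \<open>N\<close> and in the
  particle.\<close>

lemma ordered_exp_disp:
 assumes lam: "lam \<ge> 0"
 obtains C where "C > 0" "!!N a. a < N ==>
   (\<integral>\<^sup>+w. disp_dens N lam a w \<partial>cylN R {..<N})
   \<le> ennreal (C * (cmass ^ N * Z N))"
proof -
 obtain C where C: "C > 0" and B: "!!N a. a < N ==>
   (\<integral>\<^sup>+w. disp_dens N lam a w \<partial>cylN R {..<N})
   \<le> ennreal (C * cmass ^ N * (\<Sum>k1\<le>a. \<Sum>k2\<in>{a<..N}. (1 / 2) ^ (k2 - k1) * (Z k1 * Z (N - k2))))"
  using ordered_exp_disp_bound_real[OF lam] by blast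
 have le: "C * cmass ^ N * (\<Sum>k1\<le>a. \<Sum>k2\<in>{a<..N}. (1 / 2) ^ (k2 - k1) * (Z k1 * Z (N - k2))) \<le> (2 * C) * (cmass ^ N * Z N)" for N a
 proof -
  have "Z k1 * Z (N - k2) \<le> Z N" if "k1 \<le> a" "k2 \<in> {a<..N}" for k1 k2
  proof -
   have "k1 + (N - k2) \<le> N" using that by auto
   thus ?thesis using Z_supermult[of k1 "N - k2"] Z_mono[of "k1 + (N - k2)" N] by linarith
  qed
  hence "(\<Sum>k1\<le>a. \<Sum>k2\<in>{a<..N}. (1 / 2) ^ (k2 - k1) * (Z k1 * Z (N - k2))) \<le> (\<Sum>k1\<le>a. \<Sum>k2\<in>{a<..N}. (1 / 2) ^ (k2 - k1) * Z N)"
   by (intro sum_mono mult_left_mono) auto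
  also have "... = (\<Sum>k1\<le>a. \<Sum>k2\<in>{a<..N}. (1 / 2) ^ (k2 - k1)) * Z N" by (simp add: sum_distrib_right)
  also have "... \<le> 2 * Z N" using Z_pos[of N] by (intro mult_right_mono sum_half_blocks_le) auto
  finally have "C * cmass ^ N * (\<Sum>k1\<le>a. \<Sum>k2\<in>{a<..N}. (1 / 2) ^ (k2 - k1) * (Z k1 * Z (N - k2))) \<le> C * cmass ^ N * (2 * Z N)"
   using C cmass_pos by (intro mult_left_mono) auto
  thus ?thesis by (simp add: mult_ac)
 qed
 show thesis
  by (rule that[of "2 * C"], use C in simp) (rule order_trans[OF B ennreal_leI[OF le]])
qed

end

context laughlin_cyl begin

section \<open>Particle numbers\<close>

definition nrm :: "nat => real" where "nrm N = cmass ^ N * fact N * Z N"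

lemma nrm_pos: "nrm N > 0" using cmass_pos Z_pos[of N] by (simp add: nrm_def)

definition mu :: "nat => (nat => complex) measure" where
 "mu N = density (cylN R {..<N}) (\<lambda>w. ennreal (Phi N 0 w / nrm N))"

lemma sets_mu [measurable_cong]: "sets (mu N) = sets (cylN R {..<N})" by (simp add: mu_def)
lemma space_mu [simp]: "space (mu N) = space (cylN R {..<N})" by (simp add: mu_def)

lemma measurable_Phi' [measurable]: "(\<lambda>w. Phi N 0 w) \<in> borel_measurable (cylN R {..<N})"
 by (rule measurable_Phi) simp

lemma prob_space_mu: "prob_space (mu N)"
proof
 have "emeasure (mu N) (space (mu N)) = (\<integral>\<^sup>+w. ennreal (Phi N 0 w / nrm N) \<partial>cylN R {..<N})"
  unfolding mu_def by (subst emeasure_density) (auto intro!: nn_integral_cong)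
 also have "... = ennreal (\<integral>w. Phi N 0 w / nrm N \<partial>cylN R {..<N})"
  using nrm_pos[of N] integrable_Phi[of N] by (intro nn_integral_eq_integral) (auto simp: less_imp_le)
 also have "(\<integral>w. Phi N 0 w / nrm N \<partial>cylN R {..<N}) = 1"
  using nrm_pos[of N] integral_Phi[of N] by (simp add: nrm_def[symmetric])
 finally show "emeasure (mu N) (space (mu N)) = 1" by simp
qed

lemma nn_integral_mu:
 assumes "g \<in> borel_measurable (cylN R {..<N})"
 shows "(\<integral>\<^sup>+w. g w \<partial>mu N) = (\<integral>\<^sup>+w. ennreal (Phi N 0 w / nrm N) * g w \<partial>cylN R {..<N})"
 unfolding mu_def by (rule nn_integral_density) (use assms in auto)

lemma integral_mu_product:
 fixes h :: "nat => real => complex"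
 assumes h: "!!i. h i \<in> borel_measurable borel" and b: "!!i x. norm (h i x) \<le> B"
 shows "(\<integral>w. (\<Prod>i<N. h i (Re (w i))) \<partial>mu N)
   = (\<Sum>ms\<in>nlists N (p * N). of_real (omega ms * omega ms) * (\<Prod>i<N. hat (h i) (ms ! i))) / of_real (fact N * Z N)"
proof -
 have hm: "(\<lambda>w. \<Prod>i<N. h i (Re (w i))) \<in> borel_measurable (cylN R {..<N})"
  by (intro borel_measurable_prod measurable_compose[OF _ h] measurable_compose[OF _ measurable_Re_borel]) measurable
 have "(\<integral>w. (\<Prod>i<N. h i (Re (w i))) \<partial>mu N) = (\<integral>w. (Phi N 0 w / nrm N) *\<^sub>R (\<Prod>i<N. h i (Re (w i))) \<partial>cylN R {..<N})"
  unfolding mu_def using nrm_pos[of N] by (intro integral_density hm) (auto simp: less_imp_le)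
 also have "... = (\<integral>w. of_real (Phi N 0 w) * (\<Prod>i<N. h i (Re (w i))) \<partial>cylN R {..<N}) / of_real (nrm N)"
  by (subst integral_divide_zero[symmetric]) (simp add: scaleR_conv_of_real)
 also have "... = (\<Sum>ms\<in>nlists N (p * N). of_real (omega ms * omega ms) * (\<Prod>i<N. hat (h i) (ms ! i))) / of_real (fact N * Z N)"
  unfolding integral_Phi_lists(1)[OF h b] nrm_def using cmass_pos by (simp add: field_simps)
 finally show ?thesis .
qed

text \<open>The law of the occupied orbitals, a probability vector because the weights are squares
  of amplitudes.\<close>

definition prb :: "nat => nat multiset => real" where
 "prb N M = conf_weight gam p M / Z N"

lemma prb_nonneg: "prb N M \<ge> 0" using p Z_pos[of N] by (simp add: prb_def)

lemma sum_prb: "(\<Sum>M\<in>cfg (p * N) N. prb N M) = 1"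
 using Z_pos[of N] by (simp add: prb_def part_fun_eq sum_divide_distrib[symmetric])

lemma integral_mu_prod_same:
 fixes h :: "real => complex"
 assumes h: "h \<in> borel_measurable borel" and b: "!!x. norm (h x) \<le> B"
 shows "(\<integral>w. (\<Prod>i<N. h (Re (w i))) \<partial>mu N) = (\<Sum>M\<in>cfg (p * N) N. of_real (prb N M) * (\<Prod>x\<in>#M. hat h x))"
proof -
 have hm: "(\<lambda>w. \<Prod>i<N. h (Re (w i))) \<in> borel_measurable (cylN R {..<N})"
  by (intro borel_measurable_prod measurable_compose[OF _ h] measurable_compose[OF _ measurable_Re_borel]) measurable
 have "(\<integral>w. (\<Prod>i<N. h (Re (w i))) \<partial>mu N) = (\<integral>w. (Phi N 0 w / nrm N) *\<^sub>R (\<Prod>i<N. h (Re (w i))) \<partial>cylN R {..<N})"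
  unfolding mu_def using nrm_pos[of N] by (intro integral_density hm) (auto simp: less_imp_le)
 also have "... = (\<integral>w. of_real (Phi N 0 w) * (\<Prod>i<N. h (Re (w i))) \<partial>cylN R {..<N}) / of_real (nrm N)"
  by (subst integral_divide_zero[symmetric]) (simp add: scaleR_conv_of_real)
 also have "... = (\<Sum>M\<in>cfg (p * N) N. of_real (conf_weight gam p M) * (\<Prod>x\<in>#M. hat h x)) / of_real (Z N)"
  unfolding integral_Phi_product(1)[OF h b] nrm_def using cmass_pos by simp
 finally show ?thesis by (simp add: sum_divide_distrib prb_def)
qed

definition cnt :: "nat => real => (nat => complex) => nat" where
 "cnt N x w = card {j. j < N & Re (w j) < x}"

text \<open>The number of particles left of \<open>x\<close> if they sat at the multiples of
  \<open>per\<close>, up to rounding and clamped to what \<open>N\<close> particles allow.\<close>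

definition cl :: "nat => real => real" where
 "cl N x = max 0 (min (real N) (x / per))"

text \<open>A count that deviates from \<open>cl\<close> displaces a particle next to
  \<open>x\<close> by a comparable amount. As it is not known which particle this is, the bound sums
  over all of them.\<close>

lemma cnt_ordered_exp_le:
 assumes lam: "lam > 0" and w: "w \<in> ordered N"
 shows "exp (lam * \<bar>real (cnt N x w) - cl N x\<bar>) \<le> exp lam +
   (\<Sum>a<N. exp (3 * lam) * exp (- lam * \<bar>real a - cl N x\<bar>) * exp (2 * lam / per * \<bar>disp w a\<bar>))"
proof -
 define n where "n = cnt N x w"
 define s where "s = cl N x"
 let ?t = "\<lambda>a. exp (3 * lam) * exp (- lam * \<bar>real a - s\<bar>) * exp (2 * lam / per * \<bar>disp w a\<bar>)"
 have mono: "Re (w i) \<le> Re (w j)" if "i \<le> j" "j < N" for i j using w that by (auto simp: ordered_def)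
 have nN: "n \<le> N"
 proof -
  have "card {j. j < N & Re (w j) < x} \<le> card {..<N}" by (rule card_mono) auto
  thus ?thesis by (simp add: n_def cnt_def)
 qed
 have below: "Re (w a) < x" if "a < n" for a
 proof (rule ccontr)
  assume nx: "\<not> Re (w a) < x"
  have "j < a" if "j < N" "Re (w j) < x" for j
  proof (rule ccontr)
   assume "\<not> j < a"
   hence "Re (w a) \<le> Re (w j)" using mono[of a j] that(1) by simp
   thus False using nx that(2) by linarith
  qed
  hence "{j. j < N & Re (w j) < x} \<subseteq> {..<a}" by blast
  hence "card {j. j < N & Re (w j) < x} \<le> card {..<a}" by (rule card_mono[rotated]) simp
  thus False using that by (simp add: n_def cnt_def)
 qed
 have above: "Re (w a) \<ge> x" if "n \<le> a" "a < N" for a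
 proof (rule ccontr)
  assume nx: "\<not> Re (w a) \<ge> x"
  have "j < N & Re (w j) < x" if "j \<le> a" for j
   using mono[OF that \<open>a < N\<close>] nx that \<open>a < N\<close> by linarith
  hence "{..a} \<subseteq> {j. j < N & Re (w j) < x}" by blast
  hence "card {..a} \<le> card {j. j < N & Re (w j) < x}" by (rule card_mono[rotated]) simp
  thus False using that by (simp add: n_def cnt_def)
 qed
 \<comment> \<open>The deviation is paid for twice by the displacement: one copy gives the claim,
   the other the decay in \<open>real a - s\<close> that makes the sum over \<open>a\<close>
   converge. Hence the rate \<open>2 * lam / per\<close> and the constant
   \<open>3 * lam\<close>.\<close>
 have trm: "exp (lam * \<bar>real n - s\<bar>) \<le> (\<Sum>a<N. ?t a)"
  if a: "a < N" "\<bar>real n - s\<bar> \<le> 1 + \<bar>disp w a\<bar> / per" "\<bar>real a - s\<bar> \<le> 1 + \<bar>real n - s\<bar>" for a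
 proof -
  have "lam * \<bar>real n - s\<bar> \<le> 3 * lam + - lam * \<bar>real a - s\<bar> + 2 * lam / per * \<bar>disp w a\<bar>"
  proof -
   have "lam * (2 * \<bar>real n - s\<bar>) \<le> lam * (2 + 2 * (\<bar>disp w a\<bar> / per))" using a(2) lam by (intro mult_left_mono) auto
   moreover have "lam * \<bar>real a - s\<bar> \<le> lam * (1 + \<bar>real n - s\<bar>)" using a(3) lam by (intro mult_left_mono) auto
   ultimately show ?thesis by (simp add: algebra_simps)
  qed
  hence "exp (lam * \<bar>real n - s\<bar>) \<le> exp (3 * lam + - lam * \<bar>real a - s\<bar> + 2 * lam / per * \<bar>disp w a\<bar>)"
   by simp
  also have "... = ?t a"
   by (simp only: exp_add)
  also have "... \<le> (\<Sum>a<N. ?t a)"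
   using a(1) by (intro member_le_sum[where f = "?t"]) auto
  finally show ?thesis .
 qed
 have pos: "0 \<le> (\<Sum>a<N. ?t a)"
  by (intro sum_nonneg) auto
 \<comment> \<open>With too many particles on the left the witness is \<open>n - 1\<close>, the last
   one left of \<open>x\<close>; with too few it is \<open>n\<close>, the first one not left of
   \<open>x\<close>. In both cases the clamp in \<open>cl\<close> acts in the harmless
   direction.\<close>
 consider "real n > s + 1" | "real n < s" | "\<bar>real n - s\<bar> \<le> 1" by linarith
 hence "exp (lam * \<bar>real n - s\<bar>) \<le> exp lam + (\<Sum>a<N. ?t a)"
 proof cases
  case 1
  define a where "a = n - 1"
  have s0: "s \<ge> 0" by (simp add: s_def cl_def)
  hence a: "a < n" "real n = real a + 1" using 1 by (auto simp: a_def of_nat_diff)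
  have "x / per \<le> s" using 1 nN by (auto simp: s_def cl_def)
  hence "x \<le> per * s" using per_pos by (simp add: field_simps)
  hence "disp w a < per * s - per * real a" using below[OF a(1)] by (simp add: disp_def)
  hence "per * (real a - s) < - disp w a" by (simp add: algebra_simps)
  hence "real a - s < \<bar>disp w a\<bar> / per" using per_pos by (simp add: field_simps abs_if split: if_splits)
  hence "exp (lam * \<bar>real n - s\<bar>) \<le> (\<Sum>a<N. ?t a)"
   using a nN 1 by (intro trm[of a]) auto
  thus ?thesis by (simp add: add_increasing)
 next
  case 2
  have sN: "s \<le> N" by (simp add: s_def cl_def)
  hence nN': "n < N" using 2 by linarith
  have "s \<le> x / per" using 2 by (auto simp: s_def cl_def)
  hence "per * s \<le> x" using per_pos by (simp add: field_simps)
  hence "disp w n \<ge> per * s - per * real n" using above[of n] nN' by (simp add: disp_def)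
  hence "per * (s - real n) \<le> \<bar>disp w n\<bar>" by (simp add: algebra_simps)
  hence "s - real n \<le> \<bar>disp w n\<bar> / per" using per_pos by (simp add: field_simps)
  hence "exp (lam * \<bar>real n - s\<bar>) \<le> (\<Sum>a<N. ?t a)"
   using nN' 2 by (intro trm[of n]) auto
  thus ?thesis by (simp add: add_increasing)
 next
  case 3
  hence "exp (lam * \<bar>real n - s\<bar>) \<le> exp lam" using lam by simp
  thus ?thesis using pos by linarith
 qed
 thus ?thesis by (simp add: n_def s_def)
qed

lemma measurable_cnt [measurable]: "(\<lambda>w. real (cnt N x w)) \<in> borel_measurable (cylN R {..<N})"
proof -
 have "real (cnt N x w) = (\<Sum>j<N. indicator {..<x} (Re (w j)))" for w
  by (simp add: cnt_def indicator_def sum.If_cases Int_def)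
 moreover have "(\<lambda>w. \<Sum>j<N. indicator {..<x} (Re (w j)) :: real) \<in> borel_measurable (cylN R {..<N})"
  by measurable
 ultimately show ?thesis by simp
qed

lemma measurable_disp: "a < N ==> (\<lambda>w. disp w a) \<in> borel_measurable (cylN R {..<N})"
 unfolding disp_def by measurable

text \<open>Counts do not depend on the numbering, so the integral reduces to the ordered sector,
  where displacements are controlled. Uniformity in \<open>N\<close> and \<open>x\<close> is
  essential later.\<close>

lemma count_exp_moment:
 assumes lam: "lam > 0"
 obtains C where "C > 0" "!!N x. (\<integral>\<^sup>+w. ennreal (exp (lam * \<bar>real (cnt N x w) - cl N x\<bar>)) \<partial>mu N) \<le> ennreal C"
proof -
 obtain C where C: "C > 0" and B: "!!N a. a < N ==>
   (\<integral>\<^sup>+w. disp_dens N (2 * lam / per) a w \<partial>cylN R {..<N})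
   \<le> ennreal (C * (cmass ^ N * Z N))"
  using ordered_exp_disp[of "2 * lam / per"] lam per_pos by (auto simp: less_imp_le)
 define C' where "C' = exp lam + exp (3 * lam) * C * (2 / (1 - exp (- lam)))"
 have q: "exp (- lam) < 1" using lam by simp
 have C': "C' > 0" unfolding C'_def using C q by (intro add_pos_nonneg mult_nonneg_nonneg) auto
 have "(\<integral>\<^sup>+w. ennreal (exp (lam * \<bar>real (cnt N x w) - cl N x\<bar>)) \<partial>mu N) \<le> ennreal C'" for N x
 proof -
  let ?M = "cylN R {..<N}"
  define G where "G w = ennreal (exp (lam * \<bar>real (cnt N x w) - cl N x\<bar>))" for w
  define k where "k a = exp (3 * lam) * exp (- lam * \<bar>real a - cl N x\<bar>)" for a :: nat
  let ?S = "\<lambda>w. \<Sum>a<N. ennreal (k a) * (disp_dens N (2 * lam / per) a w)"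
 have k0: "k a \<ge> 0" for a by (simp add: k_def)
  have Gm: "G \<in> borel_measurable ?M" unfolding G_def by measurable
  have "(\<integral>\<^sup>+w. G w \<partial>mu N) = (\<integral>\<^sup>+w. ennreal (Phi N 0 w / nrm N) * G w \<partial>?M)" by (rule nn_integral_mu[OF Gm])
  also have "... = (\<integral>\<^sup>+w. ennreal (1 / nrm N) * (ennreal (Phi N 0 w) * G w) \<partial>?M)"
   using nrm_pos[of N] by (intro nn_integral_cong) (simp add: ennreal_mult'[symmetric] mult.assoc[symmetric])
  also have "... = ennreal (1 / nrm N) * (\<integral>\<^sup>+w. ennreal (Phi N 0 w) * G w \<partial>?M)"
   using Gm by (intro nn_integral_cmult) measurable
  also have "(\<integral>\<^sup>+w. ennreal (Phi N 0 w) * G w \<partial>?M) = fact N * (\<integral>\<^sup>+w. ennreal (Phi N 0 w) * G w * indicator (ordered N) w \<partial>?M)"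
  proof (rule nn_integral_symmetric)
   show "(\<lambda>w. ennreal (Phi N 0 w) * G w) \<in> borel_measurable ?M" using Gm by measurable
   fix g w assume g: "g permutes {..<N}"
   have "Phi N 0 (\<lambda>j\<in>{..<N}. w (g j)) = Phi N 0 (w \<circ> g)" by (rule Phi_cong) simp
   moreover have "cnt N x (\<lambda>j\<in>{..<N}. w (g j)) = cnt N x w"
   proof -
    have "bij_betw g {j. j < N & Re (w (g j)) < x} {j. j < N & Re (w j) < x}"
    proof (rule bij_betw_byWitness[where f' = "inv g"])
     show "\<forall>a\<in>{j. j < N & Re (w (g j)) < x}. inv g (g a) = a" using permutes_inverses[OF g] by simp
     show "\<forall>a\<in>{j. j < N & Re (w j) < x}. g (inv g a) = a" using permutes_inverses[OF g] by simp
     show "g ` {j. j < N & Re (w (g j)) < x} \<subseteq> {j. j < N & Re (w j) < x}"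
      using permutes_in_image[OF g] by auto
     show "inv g ` {j. j < N & Re (w j) < x} \<subseteq> {j. j < N & Re (w (g j)) < x}"
      using permutes_in_image[OF permutes_inv[OF g]] permutes_inverses[OF g] by auto
    qed
    hence "card {j. j < N & Re (w (g j)) < x} = card {j. j < N & Re (w j) < x}" by (rule bij_betw_same_card)
    moreover have "{j. j < N & Re ((\<lambda>j\<in>{..<N}. w (g j)) j) < x} = {j. j < N & Re (w (g j)) < x}" by auto
    ultimately show ?thesis by (simp add: cnt_def)
   qed
   ultimately show "ennreal (Phi N 0 (\<lambda>j\<in>{..<N}. w (g j))) * G (\<lambda>j\<in>{..<N}. w (g j)) = ennreal (Phi N 0 w) * G w"
    using Phi_permute[OF g] by (simp add: G_def)
  qed
  also have "(\<integral>\<^sup>+w. ennreal (Phi N 0 w) * G w * indicator (ordered N) w \<partial>?M)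
   \<le> (\<integral>\<^sup>+w. ennreal (exp lam) * (ord_dens N w) +
     (?S w) \<partial>?M)"
  proof (rule nn_integral_mono)
   fix w
   show "ennreal (Phi N 0 w) * G w * indicator (ordered N) w \<le> ennreal (exp lam) * (ord_dens N w) +
     (?S w)"
   proof (cases "w \<in> ordered N")
    case True
    have "Phi N 0 w * exp (lam * \<bar>real (cnt N x w) - cl N x\<bar>) \<le> Phi N 0 w * (exp lam + (\<Sum>a<N. k a * exp (2 * lam / per * \<bar>disp w a\<bar>)))"
     using cnt_ordered_exp_le[OF lam True, of x] by (intro mult_left_mono) (auto simp: k_def)
    also have "... = exp lam * Phi N 0 w + (\<Sum>a<N. k a * (Phi N 0 w * exp (2 * lam / per * \<bar>disp w a\<bar>)))"
     by (simp add: distrib_left sum_distrib_left mult_ac)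
    finally have "ennreal (Phi N 0 w * exp (lam * \<bar>real (cnt N x w) - cl N x\<bar>)) \<le> ennreal (exp lam * Phi N 0 w + (\<Sum>a<N. k a * (Phi N 0 w * exp (2 * lam / per * \<bar>disp w a\<bar>))))"
     by (rule ennreal_leI)
    also have "... = ennreal (exp lam * Phi N 0 w) + (\<Sum>a<N. ennreal (k a * (Phi N 0 w * exp (2 * lam / per * \<bar>disp w a\<bar>))))"
     using k0 by (subst ennreal_plus) (auto intro!: sum_nonneg)
    finally show ?thesis using True k0 by (simp add: G_def ennreal_mult)
   qed simp
  qed
  also have "... = ennreal (exp lam) * (\<integral>\<^sup>+w. ord_dens N w \<partial>?M) +
     (\<Sum>a<N. ennreal (k a) * (\<integral>\<^sup>+w. disp_dens N (2 * lam / per) a w \<partial>?M))"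
  proof -
   have m1: "(\<lambda>w. ord_dens N w) \<in> borel_measurable ?M" by (rule measurable_Zord)
   have m2: "(\<lambda>w. disp_dens N (2 * lam / per) a w) \<in> borel_measurable ?M" if "a \<in> {..<N}" for a
   proof (intro borel_measurable_times_ennreal measurable_ind_ordered)
    have [measurable]: "(\<lambda>w. disp w a) \<in> borel_measurable ?M" using that by (intro measurable_disp) simp
    show "(\<lambda>w. ennreal (Phi N 0 w * exp (2 * lam / per * \<bar>disp w a\<bar>))) \<in> borel_measurable ?M" by measurable
   qed
   have m3: "(\<lambda>w. ennreal (k a) * (disp_dens N (2 * lam / per) a w)) \<in> borel_measurable ?M" if "a \<in> {..<N}" for a
    by (rule borel_measurable_times_ennreal[OF borel_measurable_const m2[OF that]])
   show ?thesis
   proof (subst nn_integral_add)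
    have "(\<integral>\<^sup>+w. (?S w) \<partial>?M)
     = (\<Sum>a<N. \<integral>\<^sup>+w. ennreal (k a) * (disp_dens N (2 * lam / per) a w) \<partial>?M)"
     by (rule nn_integral_sum) (rule m3)
    also have "... = (\<Sum>a<N. ennreal (k a) * (\<integral>\<^sup>+w. disp_dens N (2 * lam / per) a w \<partial>?M))"
     by (intro sum.cong refl nn_integral_cmult m2)
    finally show "(\<integral>\<^sup>+w. ennreal (exp lam) * (ord_dens N w) \<partial>?M) +
     (\<integral>\<^sup>+w. (?S w) \<partial>?M)
     = ennreal (exp lam) * (\<integral>\<^sup>+w. ord_dens N w \<partial>?M) +
     (\<Sum>a<N. ennreal (k a) * (\<integral>\<^sup>+w. disp_dens N (2 * lam / per) a w \<partial>?M))"
     by (simp only: nn_integral_cmult[OF m1])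
   qed (rule borel_measurable_times_ennreal[OF borel_measurable_const m1], rule borel_measurable_sum, rule m3)
  qed
  also have "... \<le> ennreal (exp lam) * ennreal (cmass ^ N * Z N) + (\<Sum>a<N. ennreal (k a) * ennreal (C * (cmass ^ N * Z N)))"
   by (intro add_mono sum_mono mult_left_mono B) (auto simp: Zord_def[symmetric] Zord_eq)
  also have "... = ennreal ((exp lam + (\<Sum>a<N. k a) * C) * (cmass ^ N * Z N))"
   using k0 C cmass_pos Z_pos[of N]
   by (simp add: ennreal_mult[symmetric] sum_nonneg ennreal_plus[symmetric] distrib_right sum_distrib_right mult.assoc del: ennreal_plus)
  also have "... \<le> ennreal (C' * (cmass ^ N * Z N))"
  proof (rule ennreal_leI, rule mult_right_mono)
   have "(\<Sum>a<N. k a) = exp (3 * lam) * (\<Sum>a\<in>{..<N}. exp (- lam * \<bar>real a - cl N x\<bar>))"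
    by (simp add: k_def sum_distrib_left)
   also have "... \<le> exp (3 * lam) * (2 / (1 - exp (- lam)))"
    by (intro mult_left_mono sum_exp_dist_le lam) auto
   finally have "(\<Sum>a<N. k a) * C \<le> exp (3 * lam) * (2 / (1 - exp (- lam))) * C" using C by (intro mult_right_mono) auto
   thus "exp lam + (\<Sum>a<N. k a) * C \<le> C'" by (simp add: C'_def mult_ac)
  qed (use cmass_pos Z_pos[of N] in auto)
  finally have "(\<integral>\<^sup>+w. G w \<partial>mu N) \<le> ennreal (1 / nrm N) * (fact N * ennreal (C' * (cmass ^ N * Z N)))"
   by (simp add: mult_left_mono)
  also have "... = ennreal (1 / nrm N * (real (fact N) * (C' * (cmass ^ N * Z N))))"
  proof -
   have f: "(fact N :: ennreal) = ennreal (real (fact N))" by (metis ennreal_of_nat_eq_real_of_nat of_nat_fact)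
   show ?thesis unfolding f using nrm_pos[of N] C' cmass_pos Z_pos[of N]
    by (simp only: ennreal_mult of_nat_0_le_iff mult_nonneg_nonneg zero_le_power less_imp_le zero_less_divide_1_iff)
  qed
  also have "1 / nrm N * (real (fact N) * (C' * (cmass ^ N * Z N))) = C'"
  proof -
   have "real (fact N) * (C' * (cmass ^ N * Z N)) = C' * nrm N" by (simp add: nrm_def)
   hence "1 / nrm N * (real (fact N) * (C' * (cmass ^ N * Z N))) = 1 / nrm N * (C' * nrm N)" by (simp only:)
   thus ?thesis using nrm_pos[of N] by simp
  qed
  finally show ?thesis unfolding G_def .
 qed
 thus thesis using C' that by blast
qed

end

section \<open>Expectations over orbital configurations and the density of renewals\<close>

context laughlin_cyl begin

definition EL :: "nat => (nat multiset => real) => real" where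
 "EL N F = (\<Sum>M\<in>cfg (p * N) N. prb N M * F M)"

lemma EL_mono: "(!!M. M \<in> cfg (p * N) N ==> F M \<le> G M) ==> EL N F \<le> EL N G"
 unfolding EL_def by (intro sum_mono mult_left_mono) (auto simp: prb_nonneg)

lemma EL_add: "EL N (\<lambda>M. F M + G M) = EL N F + EL N G"
 by (simp add: EL_def distrib_left sum.distrib)

lemma EL_diff: "EL N (\<lambda>M. F M - G M) = EL N F - EL N G"
 by (simp add: EL_def right_diff_distrib sum_subtractf)

lemma EL_cmult: "EL N (\<lambda>M. c * F M) = c * EL N F"
 by (simp add: EL_def sum_distrib_left mult.left_commute)

lemma EL_sum: "EL N (\<lambda>M. \<Sum>i\<in>A. F i M) = (\<Sum>i\<in>A. EL N (F i))"
 unfolding EL_def sum_distrib_left by (rule sum.swap)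

lemma EL_const: "EL N (\<lambda>_. c) = c"
 using sum_prb[of N] by (simp add: EL_def sum_distrib_right[symmetric])

definition ren :: "nat => nat multiset => real" where "ren i M = of_bool (ren_left p i M)"

lemma ren_01: "0 \<le> ren i M" "ren i M \<le> 1" by (auto simp: ren_def)

text \<open>Two renewals cut the system into three independent pieces; the exponential growth
  cancels, and only the convergent ratios \<open>uu\<close> remain.\<close>

lemma EL_ren_ren:
 assumes "i \<le> j" "j \<le> N"
 shows "EL N (\<lambda>M. ren i M * ren j M) = uu i * uu (j - i) * uu (N - j) / uu N"
proof -
 have "EL N (\<lambda>M. ren i M * ren j M) = (\<Sum>M | M \<in> cfg (p * N) N & ren_left p i M & ren_left p j M. prb N M)"
  unfolding EL_def ren_def by (rule sum.mono_neutral_cong_right) auto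
 also have "... = Z i * Z (j - i) * Z (N - j) / Z N"
  unfolding prb_def sum_divide_distrib[symmetric] sum_two_renewals[OF p assms] ..
 also have "... = uu i * uu (j - i) * uu (N - j) / uu N"
 proof -
  have "growth ^ N = growth ^ i * growth ^ (j - i) * growth ^ (N - j)" using assms by (simp flip: power_add)
  thus ?thesis unfolding Z_uu[of i] Z_uu[of "j - i"] Z_uu[of "N - j"] Z_uu[of N]
   using growth_props(1) uu_pos[of N] by simp
 qed
 finally show ?thesis .
qed

lemma EL_ren:
 assumes "i \<le> N"
 shows "EL N (ren i) = uu i * uu (N - i) / uu N"
proof -
 have "EL N (ren i) = EL N (\<lambda>M. ren i M * ren i M)" by (intro arg_cong[where f = "EL N"] ext) (simp add: ren_def)
 also have "... = uu i * uu 0 * uu (N - i) / uu N" using EL_ren_ren[of i i N] assms by simp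
 also have "uu 0 = 1" by (simp add: uu_def part_fun_0[OF p])
 finally show ?thesis by simp
qed

text \<open>The limits of the one-point and two-point renewal probabilities are \<open>vv\<close>
  and \<open>vv^2\<close>: distant renewals decorrelate.\<close>

lemma uu_ratio_bounds:
 assumes e: "e > 0"
 obtains D where
  "!!a b c. D \<le> a ==> D \<le> b ==> D \<le> c ==> \<bar>uu a * uu b / uu c - vv\<bar> \<le> e"
  "!!a b c d. D \<le> a ==> D \<le> b ==> D \<le> c ==> D \<le> d ==> \<bar>uu a * uu b * uu c / uu d - vv^2\<bar> \<le> e"
proof -
 have v: "vv > 0" by (rule vv_pos)
 have t: "((\<lambda>k. (vv + k)^2 / (vv - k)) \<longlongrightarrow> (vv + 0)^2 / (vv - 0)) (at_right 0)"
  "((\<lambda>k. (vv - k)^2 / (vv + k)) \<longlongrightarrow> (vv - 0)^2 / (vv + 0)) (at_right 0)"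
  "((\<lambda>k. (vv + k) ^ 3 / (vv - k)) \<longlongrightarrow> (vv + 0) ^ 3 / (vv - 0)) (at_right 0)"
  "((\<lambda>k. (vv - k) ^ 3 / (vv + k)) \<longlongrightarrow> (vv - 0) ^ 3 / (vv + 0)) (at_right 0)"
  by (intro tendsto_intros; use v in simp)+
 have lim: "(vv + 0)^2 / (vv - 0) = vv" "(vv - 0)^2 / (vv + 0) = vv" "(vv + 0) ^ 3 / (vv - 0) = vv^2" "(vv - 0) ^ 3 / (vv + 0) = vv^2"
  using v by (simp_all add: power2_eq_square power3_eq_cube)
 note t = t[unfolded lim]
 have "eventually (\<lambda>k. (vv + k)^2 / (vv - k) < vv + e) (at_right 0)" "eventually (\<lambda>k. (vv - k)^2 / (vv + k) > vv - e) (at_right 0)"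
  "eventually (\<lambda>k. (vv + k) ^ 3 / (vv - k) < vv^2 + e) (at_right 0)" "eventually (\<lambda>k. (vv - k) ^ 3 / (vv + k) > vv^2 - e) (at_right 0)"
  using order_tendstoD(2)[OF t(1), of "vv + e"] order_tendstoD(1)[OF t(2), of "vv - e"]
   order_tendstoD(2)[OF t(3), of "vv^2 + e"] order_tendstoD(1)[OF t(4), of "vv^2 - e"] e by auto
 moreover have "eventually (\<lambda>k. 0 < k) (at_right (0::real))" "eventually (\<lambda>k. k < vv) (at_right 0)"
  using v by (auto simp: eventually_at_right_less eventually_at_right)
 ultimately have "eventually (\<lambda>k. (vv + k)^2 / (vv - k) < vv + e & (vv - k)^2 / (vv + k) > vv - e &
   (vv + k) ^ 3 / (vv - k) < vv^2 + e & (vv - k) ^ 3 / (vv + k) > vv^2 - e & 0 < k & k < vv) (at_right 0)"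
  by eventually_elim auto
 then obtain k where k: "(vv + k)^2 / (vv - k) < vv + e" "(vv - k)^2 / (vv + k) > vv - e"
   "(vv + k) ^ 3 / (vv - k) < vv^2 + e" "(vv - k) ^ 3 / (vv + k) > vv^2 - e" "0 < k" "k < vv"
  using eventually_happens'[of "at_right (0::real)"] by (auto simp: trivial_limit_at_right_real)
 have "eventually (\<lambda>n. \<bar>uu n - vv\<bar> < k) sequentially"
  using uu_lim k(5) by (auto simp: tendsto_iff dist_real_def)
 then obtain D where D: "!!n. n \<ge> D ==> \<bar>uu n - vv\<bar> < k" by (auto simp: eventually_sequentially)
 have b: "vv - k \<le> uu n" "uu n \<le> vv + k" if "n \<ge> D" for n using D[OF that] by auto
 show thesis
 proof (rule that[of D])
  fix a b' c assume n: "D \<le> a" "D \<le> b'" "D \<le> c"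
  have "uu a * uu b' / uu c \<le> (vv + k) * (vv + k) / (vv - k)"
   using b n k uu_pos by (intro frac_le mult_mono) (auto simp: less_imp_le)
  moreover have "uu a * uu b' / uu c \<ge> (vv - k) * (vv - k) / (vv + k)"
   using b n k uu_pos by (intro frac_le mult_mono) (auto simp: less_imp_le)
  ultimately show "\<bar>uu a * uu b' / uu c - vv\<bar> \<le> e" using k(1,2) by (simp add: power2_eq_square)
 next
  fix a b' c d assume n: "D \<le> a" "D \<le> b'" "D \<le> c" "D \<le> d"
  have "uu a * uu b' * uu c / uu d \<le> (vv + k) * (vv + k) * (vv + k) / (vv - k)"
   using b n k uu_pos by (intro frac_le mult_mono mult_nonneg_nonneg) (auto simp: less_imp_le)
  moreover have "uu a * uu b' * uu c / uu d \<ge> (vv - k) * (vv - k) * (vv - k) / (vv + k)"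
   using b n k uu_pos by (intro frac_le mult_mono mult_nonneg_nonneg) (auto simp: less_imp_le)
  ultimately show "\<bar>uu a * uu b' * uu c / uu d - vv^2\<bar> \<le> e" using k(3,4) by (simp add: power3_eq_cube)
 qed
qed

text \<open>Normalised by the asymptotic density, so that it is close to 1 in the bulk. It is
  exactly 0 if the window contains no renewal, so its variance also bounds that event.\<close>

definition ren_avg :: "nat => nat => nat multiset => real" where
 "ren_avg s T M = (\<Sum>i\<in>{s..<s+T}. ren i M) / (vv * real T)"

lemma ren_avg_bounds: "0 \<le> ren_avg s T M" "ren_avg s T M \<le> 1 / vv"
proof -
 show "0 \<le> ren_avg s T M" unfolding ren_avg_def using vv_pos by (intro divide_nonneg_nonneg sum_nonneg) (auto simp: ren_01)
 have "(\<Sum>i\<in>{s..<s+T}. ren i M) \<le> (\<Sum>i\<in>{s..<s+T}. 1)" by (intro sum_mono ren_01)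
 hence "(\<Sum>i\<in>{s..<s+T}. ren i M) \<le> real T" by simp
 thus "ren_avg s T M \<le> 1 / vv" unfolding ren_avg_def using vv_pos
  by (cases "T = 0") (auto simp: field_simps)
qed

text \<open>Law of large numbers for the renewals in a window, by the second moment method.\<close>
lemma ren_avg_variance:
 assumes e: "e > 0"
 obtains T d where "T \<ge> 1" "!!N s. d \<le> s ==> s + T + d \<le> N ==> EL N (\<lambda>M. (1 - ren_avg s T M)^2) \<le> e"
proof -
 have v: "vv > 0" by (rule vv_pos)
 \<comment> \<open>The error \<open>h\<close> per probability enters with total factor
   \<open>2 / vv + 1 / vv^2\<close> and then uses half of \<open>e\<close>; the choice of
   \<open>T\<close> uses the other half for pairs closer than \<open>D\<close>.\<close>
 define h where "h = e / (2 * (2 / vv + 1 / vv^2))"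
 have c0: "2 / vv + 1 / vv^2 > 0" using v by (intro add_pos_pos) auto
 have h: "h > 0" using e c0 by (simp add: h_def)
 obtain D where D: "!!a b c. D \<le> a ==> D \<le> b ==> D \<le> c ==> \<bar>uu a * uu b / uu c - vv\<bar> \<le> h"
  "!!a b c d. D \<le> a ==> D \<le> b ==> D \<le> c ==> D \<le> d ==> \<bar>uu a * uu b * uu c / uu d - vv^2\<bar> \<le> h"
  using uu_ratio_bounds[OF h] by metis
 obtain T :: nat where T: "real T > 2 * (2 * real D) / (vv^2 * e) + 1" using reals_Archimedean2 by blast
 have "2 * (2 * real D) / (vv^2 * e) \<ge> 0" using v e by simp
 hence T1: "T \<ge> 1" and T0: "real T > 0" using T by linarith+
 have "EL N (\<lambda>M. (1 - ren_avg s T M)^2) \<le> e" if s: "D \<le> s" "s + T + D \<le> N" for N s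
 proof -
  let ?W = "{s..<s+T}"
  let ?S = "\<lambda>M. \<Sum>i\<in>?W. ren i M"
  have q1: "EL N (ren i) \<ge> vv - h" if "i \<in> ?W" for i
  proof -
   have "\<bar>uu i * uu (N - i) / uu N - vv\<bar> \<le> h" using that s by (intro D(1)) auto
   thus ?thesis using EL_ren[of i N] that s by auto
  qed
  have q2': "EL N (\<lambda>M. ren i M * ren j M) \<le> vv^2 + h" if "i \<in> ?W" "j \<in> ?W" "i + D \<le> j" for i j
  proof -
   have "\<bar>uu i * uu (j - i) * uu (N - j) / uu N - vv^2\<bar> \<le> h" using that s by (intro D(2)) auto
   thus ?thesis using EL_ren_ren[of i j N] that s by auto
  qed
  \<comment> \<open>Asymptotic independence holds only for pairs at distance at least
    \<open>D\<close>; the others are estimated by 1, and there are at most \<open>2 * D\<close> of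
    them per index.\<close>
  have q2: "EL N (\<lambda>M. ren i M * ren j M) \<le> (vv^2 + h) + of_bool (i < j + D & j < i + D)" if "i \<in> ?W" "j \<in> ?W" for i j
  proof -
   consider "i + D \<le> j" | "j + D \<le> i" | "i < j + D & j < i + D" by linarith
   thus ?thesis
   proof cases
    case 1 thus ?thesis using q2'[of i j] that by (auto simp: of_bool_def)
   next
    case 2 thus ?thesis using q2'[of j i] that by (auto simp: of_bool_def mult.commute)
   next
    case 3
    have "EL N (\<lambda>M. ren i M * ren j M) \<le> EL N (\<lambda>_. 1)"
     by (intro EL_mono mult_le_one ren_01)
    hence "EL N (\<lambda>M. ren i M * ren j M) \<le> 1" by (simp add: EL_const)
    moreover have "0 \<le> vv^2" by simp
    ultimately have "EL N (\<lambda>M. ren i M * ren j M) \<le> (vv^2 + h) + 1" using h by linarith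
    thus ?thesis using 3 by simp
   qed
  qed
  have "EL N (\<lambda>M. (1 - ren_avg s T M)^2) = EL N (\<lambda>M. 1 - 2 / (vv * T) * ?S M + 1 / (vv * T)^2 * (\<Sum>i\<in>?W. \<Sum>j\<in>?W. ren i M * ren j M))"
  proof (intro arg_cong[where f = "EL N"] ext)
   fix M
   have "(1 - ren_avg s T M)^2 = 1 - 2 / (vv * T) * ?S M + 1 / (vv * T)^2 * (?S M * ?S M)"
    by (simp add: ren_avg_def power2_eq_square algebra_simps)
   thus "(1 - ren_avg s T M)^2 = 1 - 2 / (vv * T) * ?S M + 1 / (vv * T)^2 * (\<Sum>i\<in>?W. \<Sum>j\<in>?W. ren i M * ren j M)"
    by (simp only: sum_product)
  qed
  also have "... = 1 - 2 / (vv * T) * (\<Sum>i\<in>?W. EL N (ren i)) + 1 / (vv * T)^2 * (\<Sum>i\<in>?W. \<Sum>j\<in>?W. EL N (\<lambda>M. ren i M * ren j M))"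
   by (simp only: EL_add EL_diff EL_cmult EL_const EL_sum)
  also have "... \<le> 1 - 2 / (vv * T) * (\<Sum>i\<in>?W. vv - h) + 1 / (vv * T)^2 * (\<Sum>i\<in>?W. \<Sum>j\<in>?W. (vv^2 + h) + of_bool (i < j + D & j < i + D))"
   using v by (intro add_mono diff_mono mult_left_mono sum_mono q1 q2) auto
  also have "(\<Sum>i\<in>?W. vv - h) = real T * (vv - h)" by simp
  also have "(\<Sum>i\<in>?W. \<Sum>j\<in>?W. (vv^2 + h) + of_bool (i < j + D & j < i + D)) \<le> real T * (real T * (vv^2 + h) + 2 * real D)"
  proof -
   have "(\<Sum>j\<in>?W. of_bool (i < j + D & j < i + D) :: real) \<le> 2 * real D" for i
   proof -
    have "(\<Sum>j\<in>?W. of_bool (i < j + D & j < i + D) :: real) = real (card (?W \<inter> {j. i < j + D & j < i + D}))"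
     by (simp add: of_bool_def sum.If_cases Int_def)
    also have "card (?W \<inter> {j. i < j + D & j < i + D}) \<le> card {i + 1 - D..<i + D}" by (intro card_mono) auto
    also have "real (card {i + 1 - D..<i + D}) \<le> 2 * real D" by simp
    finally show ?thesis by simp
   qed
   hence "(\<Sum>j\<in>?W. (vv^2 + h) + of_bool (i < j + D & j < i + D)) \<le> real T * (vv^2 + h) + 2 * real D" for i
    by (simp add: sum.distrib)
   hence "(\<Sum>i\<in>?W. \<Sum>j\<in>?W. (vv^2 + h) + of_bool (i < j + D & j < i + D)) \<le> (\<Sum>i\<in>?W. real T * (vv^2 + h) + 2 * real D)"
    by (intro sum_mono)
   thus ?thesis by simp
  qed
  also have "1 - 2 / (vv * T) * (real T * (vv - h)) + 1 / (vv * T)^2 * (real T * (real T * (vv^2 + h) + 2 * real D))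
    = (2 / vv + 1 / vv^2) * h + 2 * real D / (vv^2 * T)"
   using v T0 by (simp add: field_simps power2_eq_square)
  also have "(2 / vv + 1 / vv^2) * h = e / 2" unfolding h_def using c0 by (simp add: field_simps)
  also have "2 * real D / (vv^2 * T) \<le> e / 2"
  proof -
   have "2 * (2 * real D) / (vv^2 * e) \<le> real T" using T by linarith
   hence "4 * real D \<le> T * (vv^2 * e)" using v e by (simp add: field_simps)
   thus ?thesis using v T0 by (simp add: field_simps)
  qed
  finally show ?thesis by (simp add: divide_right_mono)
 qed
 thus thesis using T1 that by blast
qed

end

section \<open>Exponential moments of particle and occupation numbers\<close>

context laughlin_cyl begin

lemma cl_diff_le:
 assumes "len \<ge> 0"
 shows "cl N (a + len) - cl N a \<le> len / per" "cl N (a + len) \<ge> cl N a"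
proof -
 define u d where "u = a / per" and "d = len / per"
 have d: "d \<ge> 0" using assms per_pos by (simp add: d_def)
 have e: "cl N (a + len) = max 0 (min (real N) (u + d))" "cl N a = max 0 (min (real N) u)"
  by (simp_all add: cl_def u_def d_def add_divide_distrib)
 show "cl N (a + len) - cl N a \<le> len / per" unfolding e d_def[symmetric] using d by linarith
 show "cl N (a + len) \<ge> cl N a" unfolding e using d by linarith
qed

definition win :: "nat => real => real => (nat => complex) => nat" where
 "win N a len w = card {j. j < N & a \<le> Re (w j) & Re (w j) < a + len}"

lemma win_eq:
 assumes "len \<ge> 0"
 shows "cnt N (a + len) w = cnt N a w + win N a len w"
proof -
 have "{j. j < N & Re (w j) < a + len} = {j. j < N & Re (w j) < a} \<union> {j. j < N & a \<le> Re (w j) & Re (w j) < a + len}"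
  using assms by auto
 thus ?thesis unfolding cnt_def win_def by (simp add: card_Un_disjoint disjoint_iff)
qed

lemma win_exp_moment:
 assumes lam: "lam > 0" and len: "len \<ge> 0"
 obtains C where "C > 0" "!!N a. (\<integral>\<^sup>+w. ennreal (exp (lam * real (win N a len w))) \<partial>mu N) \<le> ennreal C"
proof -
 obtain C where C: "C > 0" "!!N x. (\<integral>\<^sup>+w. ennreal (exp (2 * lam * \<bar>real (cnt N x w) - cl N x\<bar>)) \<partial>mu N) \<le> ennreal C"
  using count_exp_moment[of "2 * lam"] lam by auto
 define e where "e = exp (lam * len / per)"
 have e: "e > 0" by (simp add: e_def)
 have "(\<integral>\<^sup>+w. ennreal (exp (lam * real (win N a len w))) \<partial>mu N) \<le> ennreal (e * (2 * C))" for N a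
 proof -
  define f where "f x w = exp (2 * lam * \<bar>real (cnt N x w) - cl N x\<bar>)" for x w
  have pt: "exp (lam * real (win N a len w)) \<le> e * (f a w + f (a + len) w)" for w
  proof -
   define A B where "A = lam * \<bar>real (cnt N a w) - cl N a\<bar>" and "B = lam * \<bar>real (cnt N (a + len) w) - cl N (a + len)\<bar>"
   have "real (win N a len w) \<le> len / per + \<bar>real (cnt N a w) - cl N a\<bar> + \<bar>real (cnt N (a + len) w) - cl N (a + len)\<bar>"
    using win_eq[OF len, of N a w] cl_diff_le(1)[OF len, of N a] by linarith
   hence "lam * real (win N a len w) \<le> lam * (len / per + \<bar>real (cnt N a w) - cl N a\<bar> + \<bar>real (cnt N (a + len) w) - cl N (a + len)\<bar>)"
    using lam by (intro mult_left_mono) auto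
   also have "... = lam * len / per + (A + B)" by (simp add: A_def B_def distrib_left)
   finally have "exp (lam * real (win N a len w)) \<le> exp (lam * len / per + (A + B))" by simp
   also have "... = e * (exp A * exp B)" by (simp add: e_def exp_add)
   also have "exp A * exp B \<le> (exp A)^2 + (exp B)^2"
    using sum_squares_bound[of "exp A" "exp B"] zero_le_power2[of "exp A"] zero_le_power2[of "exp B"] by linarith
   also have "(exp A)^2 = f a w" by (simp add: f_def A_def exp_double[symmetric])
   also have "(exp B)^2 = f (a + len) w" by (simp add: f_def B_def exp_double[symmetric])
   finally show ?thesis using e by (simp add: mult_left_mono)
  qed
  have fm: "(\<lambda>w. ennreal (f x w)) \<in> borel_measurable (mu N)" for x unfolding f_def by measurable
  have "(\<integral>\<^sup>+w. ennreal (exp (lam * real (win N a len w))) \<partial>mu N) \<le> (\<integral>\<^sup>+w. ennreal e * (ennreal (f a w) + ennreal (f (a + len) w)) \<partial>mu N)"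
   using pt e by (intro nn_integral_mono) (auto simp: f_def ennreal_plus[symmetric] ennreal_mult[symmetric] simp del: ennreal_plus intro!: ennreal_leI)
  also have "... = ennreal e * ((\<integral>\<^sup>+w. ennreal (f a w) \<partial>mu N) + (\<integral>\<^sup>+w. ennreal (f (a + len) w) \<partial>mu N))"
   using fm by (subst nn_integral_cmult) (auto simp: nn_integral_add)
  also have "... \<le> ennreal e * (ennreal C + ennreal C)"
   unfolding f_def by (intro mult_left_mono add_mono C) auto
  also have "... = ennreal (e * (2 * C))" using e C by (simp add: ennreal_mult ennreal_plus[symmetric] del: ennreal_plus)
  finally show ?thesis .
 qed
 thus thesis using e C that[of "e * (2 * C)"] by simp
qed

lemma hat_of_real: "hat (\<lambda>x. of_real (h x)) k = of_real ((\<integral>z. gauss (Re z - del * real k) * h (Re z) \<partial>cyl_measure R) / cmass)"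
 unfolding hat_def by (simp flip: of_real_mult)

lemma integrable_gauss_bounded:
 assumes h: "h \<in> borel_measurable borel" and b: "!!x. \<bar>h x\<bar> \<le> B"
 shows "integrable (cyl_measure R) (\<lambda>z. gauss (Re z - s) * h (Re z))"
proof (rule Bochner_Integration.integrable_bound[where f = "\<lambda>z. gauss (Re z - s) * B"])
 show "integrable (cyl_measure R) (\<lambda>z. gauss (Re z - s) * B)" by (intro integrable_mult_left integrable_gauss)
 show "(\<lambda>z. gauss (Re z - s) * h (Re z)) \<in> borel_measurable (cyl_measure R)"
  by (intro borel_measurable_times measurable_compose[OF measurable_Re_cyl h]) measurable
 have B0: "B \<ge> 0" using b[of 0] by linarith
 show "AE z in cyl_measure R. norm (gauss (Re z - s) * h (Re z)) \<le> norm (gauss (Re z - s) * B)"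
  using b B0 by (intro always_eventually allI) (auto simp: abs_mult less_imp_le intro!: mult_left_mono)
qed

lemma integral_cyl_translate:
 fixes f :: "complex => 'a :: {banach, second_countable_topology}"
 assumes f: "f \<in> borel_measurable (cyl_measure R)"
 shows "(\<integral>z. f (z + of_real s) \<partial>cyl_measure R) = (\<integral>z. f z \<partial>cyl_measure R)"
proof -
 have "(\<integral>z. f z \<partial>cyl_measure R) = (\<integral>z. f z \<partial>distr (cyl_measure R) (cyl_measure R) (\<lambda>z. z + of_real s))"
  by (simp only: distr_translate_cyl)
 also have "... = (\<integral>z. f (z + of_real s) \<partial>cyl_measure R)"
  by (rule integral_distr[OF measurable_translate_cyl f])
 finally show ?thesis ..
qed

lemma mu_moment:
 fixes f :: "(nat => complex) => real"
 assumes f: "f \<in> borel_measurable (mu N)" "!!w. 0 \<le> f w" and C: "(\<integral>\<^sup>+w. ennreal (f w) \<partial>mu N) \<le> ennreal C" "0 \<le> C"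
 shows "integrable (mu N) f" "(\<integral>w. f w \<partial>mu N) \<le> C" (is ?g2)
proof -
 show "integrable (mu N) f"
  using C(1) by (intro integrableI_nonneg f) (auto simp: f intro: le_less_trans)
 show ?g2
  using C by (subst integral_eq_nn_integral) (auto simp: f enn2real_leI)
qed

lemma interval_cyl:
 assumes "a \<le> b"
 shows "integrable (cyl_measure R) (\<lambda>z. indicator {a..<b} (Re z) :: real)" (is ?g1)
  and "(\<integral>z. indicator {a..<b} (Re z) \<partial>cyl_measure R) = 2 * pi * R * (b - a)" (is ?g2)
proof -
 have "(\<integral>\<^sup>+z. ennreal (indicator {a..<b} (Re z)) \<partial>cyl_measure R) = ennreal (2 * pi * R) * (\<integral>\<^sup>+x. indicator {a..<b} x \<partial>lborel)"
  by (subst nn_integral_cyl_Re[where f = "\<lambda>x. ennreal (indicator {a..<b} x)"]) (use R in \<open>auto simp: ennreal_indicator\<close>)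
 hence nn: "(\<integral>\<^sup>+z. ennreal (indicator {a..<b} (Re z)) \<partial>cyl_measure R) = ennreal (2 * pi * R * (b - a))"
  using assms R by (simp add: ennreal_mult[symmetric])
 have m: "(\<lambda>z. indicator {a..<b} (Re z) :: real) \<in> borel_measurable (cyl_measure R)"
  by (rule measurable_compose[OF measurable_Re_cyl]) measurable
 show ?g1 by (intro integrableI_nonneg m) (auto simp: nn)
 show ?g2
  using m R assms by (subst integral_eq_nn_integral) (auto simp: nn)
qed

lemma measurable_win: "len \<ge> 0 ==> (\<lambda>w. real (win N b len w)) \<in> borel_measurable (mu N)"
proof -
 assume "len \<ge> 0"
 hence "(\<lambda>w. real (win N b len w)) = (\<lambda>w. real (cnt N (b + len) w) - real (cnt N b w))" using win_eq[of len N b] by auto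
 thus ?thesis by (rule ssubst) measurable
qed

text \<open>Occupation numbers of orbitals are controlled by particle numbers in position space, since the
 position distribution is the orbital distribution convolved with Gaussians.\<close>
lemma count_exp_lattice:
 obtains b C where "b > 1" "C > 0" "!!N x. EL N (\<lambda>M. b ^ count M x) \<le> C"
proof -
 \<comment> \<open>A lower bound for the probability that a particle in orbital \<open>x\<close>
   lies within axial distance 1 of the centre of this orbital.\<close>
 define \<eta> where "\<eta> = gauss 1 * (2 * pi * R * 2) / cmass"
 have eta: "\<eta> > 0" using R cmass_pos by (simp add: \<eta>_def)
 obtain C where C: "C > 0" "!!N a. (\<integral>\<^sup>+w. ennreal (exp (ln 3 * real (win N a 2 w))) \<partial>mu N) \<le> ennreal C"
  using win_exp_moment[of "ln 3" 2] by auto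
 define b where "b = 1 + 2 * \<eta>"
 have b: "b > 1" using eta by (simp add: b_def)
 have "EL N (\<lambda>M. b ^ count M x) \<le> C" for N x
 proof -
  define ind where "ind y = (indicator {del * real x - 1..<del * real x + 1} y :: real)" for y
  \<comment> \<open>Its product over the particles is 3 to the number of particles in the window,
    while its orbital mean is at least 1 everywhere and at least \<open>b\<close> in orbital
    \<open>x\<close>.\<close>
  define h where "h y = 1 + 2 * ind y" for y
  have hm: "h \<in> borel_measurable borel" unfolding h_def ind_def by measurable
  have hb: "\<bar>h y\<bar> \<le> 3" "h y \<ge> 1" for y by (auto simp: h_def ind_def indicator_def)
  define H where "H k = (\<integral>z. gauss (Re z - del * real k) * h (Re z) \<partial>cyl_measure R) / cmass" for k
  have ig: "(\<integral>z. gauss (Re z - del * real k) + c * ind (Re z) \<partial>cyl_measure R) = cmass + c * (2 * pi * R * 2)"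
   "integrable (cyl_measure R) (\<lambda>z. gauss (Re z - del * real k) + c * ind (Re z))" for c k
   using interval_cyl[of "del * real x - 1" "del * real x + 1"] integrable_gauss[of "del * real k"]
   by (simp_all add: ind_def integral_gauss)
  have H: "(if k = x then b else 1) \<le> H k" for k
  proof -
   define c where "c = (if k = x then 2 * gauss 1 else 0)"
   have "cmass + c * (2 * pi * R * 2) \<le> (\<integral>z. gauss (Re z - del * real k) * h (Re z) \<partial>cyl_measure R)"
    unfolding ig(1)[of k, symmetric]
   proof (intro integral_mono ig(2) integrable_gauss_bounded[OF hm hb(1)])
    fix z
    have "gauss 1 \<le> gauss (Re z - del * real x)" if "ind (Re z) \<noteq> 0"
     using that l by (auto simp: ind_def gauss_def indicator_def abs_square_le_1 abs_le_iff divide_right_mono split: if_splits)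
    thus "gauss (Re z - del * real k) + c * ind (Re z) \<le> gauss (Re z - del * real k) * h (Re z)"
     by (cases "ind (Re z) = 0") (auto simp: c_def h_def ind_def indicator_def less_imp_le split: if_splits)
   qed
   hence "(cmass + c * (2 * pi * R * 2)) / cmass \<le> H k" unfolding H_def using cmass_pos by (intro divide_right_mono) auto
   thus ?thesis using cmass_pos by (simp add: c_def b_def \<eta>_def add_divide_distrib split: if_splits)
  qed
  have "EL N (\<lambda>M. b ^ count M x) \<le> EL N (\<lambda>M. \<Prod>k\<in>#M. H k)"
  proof (rule EL_mono)
   fix M show "b ^ count M x \<le> (\<Prod>k\<in>#M. H k)"
   proof (induction M)
    case (add y M)
    have "(if y = x then b else 1) * b ^ count M x \<le> H y * (\<Prod>k\<in>#M. H k)"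
     using add H[of y] b by (intro mult_mono) (auto intro: order.trans[rotated] split: if_splits)
    thus ?case by (simp split: if_splits)
   qed simp
  qed
  also have "EL N (\<lambda>M. \<Prod>k\<in>#M. H k) = Re (\<integral>w. (\<Prod>i<N. complex_of_real (h (Re (w i)))) \<partial>mu N)"
  proof -
   have hatH: "hat (\<lambda>y. complex_of_real (h y)) k = of_real (H k)" for k unfolding hat_of_real H_def ..
   have pm: "(\<Prod>k\<in>#M. complex_of_real (H k)) = of_real (\<Prod>k\<in>#M. H k)" for M by (induction M) auto
   have "(\<integral>w. (\<Prod>i<N. complex_of_real (h (Re (w i)))) \<partial>mu N) = (\<Sum>M\<in>cfg (p * N) N. of_real (prb N M) * (\<Prod>k\<in>#M. hat (\<lambda>y. complex_of_real (h y)) k))"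
    by (rule integral_mu_prod_same[where B = 3]) (use hm hb in auto)
   also have "... = of_real (EL N (\<lambda>M. \<Prod>k\<in>#M. H k))" unfolding hatH pm by (simp add: EL_def)
   finally show ?thesis by simp
  qed
  also have "... = (\<integral>w. (\<Prod>i<N. h (Re (w i))) \<partial>mu N)"
   by (simp flip: of_real_prod)
  also have "(\<lambda>w. \<Prod>i<N. h (Re (w i))) = (\<lambda>w. exp (ln 3 * real (win N (del * real x - 1) 2 w)))"
  proof
   fix w
   have "(\<Prod>i<N. h (Re (w i))) = (\<Prod>i<N. if del * real x - 1 \<le> Re (w i) & Re (w i) < del * real x - 1 + 2 then 3 else 1)"
    by (intro prod.cong refl) (auto simp: h_def ind_def indicator_def)
   also have "... = 3 ^ win N (del * real x - 1) 2 w" by (simp add: prod.If_cases win_def Int_def)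
   also have "... = exp (ln 3 * real (win N (del * real x - 1) 2 w))" by (simp add: exp_of_nat2_mult mult.commute)
   finally show "(\<Prod>i<N. h (Re (w i))) = exp (ln 3 * real (win N (del * real x - 1) 2 w))" .
  qed
  also have "(\<integral>w. exp (ln 3 * real (win N (del * real x - 1) 2 w)) \<partial>mu N) \<le> C"
   using C by (intro mu_moment(2) measurable_compose[OF measurable_win]) auto
  finally show ?thesis .
 qed
 thus thesis using C(1) b that by blast
qed

lemma count_power_moment:
 obtains B where "B > 0" "!!N x. EL N (\<lambda>M. real (count M x) ^ q) \<le> B"
proof -
 obtain b C where b: "b > 1" "C > 0" "!!N x. EL N (\<lambda>M. b ^ count M x) \<le> C"
  using count_exp_lattice by blast
 define c where "c = ln b"
 have c: "c > 0" using b(1) by (simp add: c_def)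
 define B where "B = fact q / c ^ q"
 have B: "B > 0" using c by (simp add: B_def)
 have le: "real n ^ q \<le> B * b ^ n" for n
 proof -
  have "(c * real n) ^ q / fact q \<le> exp (c * real n)"
   using sum_le_suminf[OF summable_exp_generic, of "{q}" "c * real n"] c
   by (simp add: exp_def field_simps)
  also have "exp (c * real n) = b ^ n"
   using b(1) exp_of_nat_mult[of n c] by (simp add: c_def mult.commute)
  finally show ?thesis using c by (simp add: B_def field_simps)
 qed
 have "EL N (\<lambda>M. real (count M x) ^ q) \<le> B * C" for N x
 proof -
  have "EL N (\<lambda>M. real (count M x) ^ q) \<le> EL N (\<lambda>M. B * b ^ count M x)" by (intro EL_mono le)
  also have "... = B * EL N (\<lambda>M. b ^ count M x)" by (rule EL_cmult)
  also have "... \<le> B * C" using b B by (intro mult_left_mono) auto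
  finally show ?thesis .
 qed
 thus thesis using that[of "B * C"] B b(2) by simp
qed

end

context laughlin_cyl begin

section \<open>Correlations of occupation numbers\<close>

text \<open>Bounds the ratio of \<open>mfact\<close> before and after the particles
  \<open>\<kappa>\<close> are added: it is a product of \<open>size \<kappa>\<close> multiplicities,
  each at most the maximum taken here.\<close>

definition mult_bound :: "nat multiset => nat multiset => real" where
 "mult_bound \<kappa> M = real (Max (insert 1 (count M ` set_mset \<kappa>))) ^ size \<kappa>"

lemma mfact_add_mset: "mfact (add_mset x M) = real (Suc (count M x)) * mfact M"
proof -
 have "mfact (add_mset x M) = (\<Prod>y\<in>insert x (set_mset M). fact (count (add_mset x M) y))"
  by (simp add: mfact_def)
 also have "... = fact (count (add_mset x M) x) * (\<Prod>y\<in>set_mset M - {x}. fact (count (add_mset x M) y))"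
  by (simp add: prod.insert_remove)
 also have "(\<Prod>y\<in>set_mset M - {x}. fact (count (add_mset x M) y)) = (\<Prod>y\<in>set_mset M - {x}. fact (count M y) :: real)"
  by (intro prod.cong) auto
 also have "fact (count (add_mset x M) x) = real (Suc (count M x)) * fact (count M x)" by simp
 also have "real (Suc (count M x)) * fact (count M x) * (\<Prod>y\<in>set_mset M - {x}. fact (count M y)) = real (Suc (count M x)) * mfact M"
 proof (cases "x \<in># M")
  case True
  thus ?thesis unfolding mfact_def by (simp add: prod.remove[of "set_mset M" x])
 next
  case False
  hence "count M x = 0" "set_mset M - {x} = set_mset M" by (auto simp: not_in_iff)
  thus ?thesis by (simp add: mfact_def)
 qed
 finally show ?thesis .
qed

lemma mfact_plus_le:
 assumes "!!x. x \<in># \<kappa> ==> real (count (\<kappa> + M) x) \<le> c" "c \<ge> 0"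
 shows "mfact (\<kappa> + M) \<le> c ^ size \<kappa> * mfact M"
 using assms(1)
proof (induction \<kappa>)
 case (add x \<kappa>)
 have "mfact (add_mset x \<kappa> + M) = real (Suc (count (\<kappa> + M) x)) * mfact (\<kappa> + M)"
  by (simp add: mfact_add_mset)
 also have "... \<le> c * (c ^ size \<kappa> * mfact M)"
 proof (intro mult_mono)
  show "real (Suc (count (\<kappa> + M) x)) \<le> c" using add.prems[of x] by simp
  show "mfact (\<kappa> + M) \<le> c ^ size \<kappa> * mfact M"
  proof (rule add.IH)
   fix y assume "y \<in># \<kappa>"
   hence "real (count (add_mset x \<kappa> + M) y) \<le> c" by (intro add.prems) auto
   thus "real (count (\<kappa> + M) y) \<le> c" by (simp split: if_splits)
  qed
 qed (use assms(2) in \<open>auto simp: less_imp_le\<close>)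
 finally show ?case by (simp add: mult_ac)
qed simp

lemma mfact_plus_mult_bound: "mfact (\<kappa> + M) \<le> mult_bound \<kappa> (\<kappa> + M) * mfact M"
 unfolding mult_bound_def
proof (rule mfact_plus_le)
 fix x assume "x \<in># \<kappa>"
 hence "count (\<kappa> + M) x \<le> Max (insert 1 (count (\<kappa> + M) ` set_mset \<kappa>))" by (intro Max_ge) auto
 thus "real (count (\<kappa> + M) x) \<le> real (Max (insert 1 (count (\<kappa> + M) ` set_mset \<kappa>)))" by (rule of_nat_mono)
qed simp
lemma mult_bound_ge_1: "mult_bound \<kappa> M \<ge> 1"
proof -
 have "Max (insert 1 (count M ` set_mset \<kappa>)) \<ge> 1" by (intro Max_ge) auto
 hence "real (Max (insert 1 (count M ` set_mset \<kappa>))) \<ge> 1" by simp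
 thus ?thesis unfolding mult_bound_def by (rule one_le_power)
qed

lemma mult_bound_square: "(mult_bound \<kappa> M)^2 \<le> 1 + (\<Sum>x\<in>set_mset \<kappa>. real (count M x) ^ (2 * size \<kappa>))"
proof -
 define c where "c = Max (insert 1 (count M ` set_mset \<kappa>))"
 have "c \<in> insert 1 (count M ` set_mset \<kappa>)" unfolding c_def by (rule Max_in) auto
 then consider "c = 1" | x where "x \<in># \<kappa>" "c = count M x" by auto
 hence "real c ^ (2 * size \<kappa>) \<le> 1 + (\<Sum>x\<in>set_mset \<kappa>. real (count M x) ^ (2 * size \<kappa>))"
 proof cases
  case 1
  thus ?thesis by (simp add: sum_nonneg)
 next
  case 2
  have "real (count M x) ^ (2 * size \<kappa>) \<le> (\<Sum>x\<in>set_mset \<kappa>. real (count M x) ^ (2 * size \<kappa>))"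
   using 2(1) by (intro member_le_sum) auto
  thus ?thesis using 2(2) by simp
 qed
 thus ?thesis by (simp add: mult_bound_def c_def power_mult[symmetric] mult.commute)
qed

text \<open>The bound depends on the size of \<open>\<kappa>\<close> only, not on the orbitals in it
  or on \<open>N\<close>.\<close>

lemma mult_bound_moment:
 obtains B where "B \<ge> 1" "!!N \<kappa>. size \<kappa> = n ==> EL N (\<lambda>M. (mult_bound \<kappa> M)^2) \<le> B"
proof -
 obtain B where B: "B > 0" "!!N x. EL N (\<lambda>M. real (count M x) ^ (2 * n)) \<le> B"
  using count_power_moment by blast
 have "EL N (\<lambda>M. (mult_bound \<kappa> M)^2) \<le> 1 + real n * B" if s: "size \<kappa> = n" for N \<kappa>
 proof -
  have "EL N (\<lambda>M. (mult_bound \<kappa> M)^2) \<le> EL N (\<lambda>M. 1 + (\<Sum>x\<in>set_mset \<kappa>. real (count M x) ^ (2 * n)))"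
   using mult_bound_square[of \<kappa>] s by (intro EL_mono) auto
  also have "... = 1 + (\<Sum>x\<in>set_mset \<kappa>. EL N (\<lambda>M. real (count M x) ^ (2 * n)))"
   unfolding EL_add EL_sum EL_const ..
  also have "... \<le> 1 + (\<Sum>x\<in>set_mset \<kappa>. B)" by (intro add_left_mono sum_mono B)
  also have "... \<le> 1 + real n * B"
  proof -
   have "card (set_mset \<kappa>) \<le> n" using s size_multiset_overloaded_eq[of \<kappa>]
    by (simp add: size_multiset_overloaded_eq) (metis card_eq_sum count_greater_eq_one_iff sum_mono)
   thus ?thesis using B(1) by (simp add: mult_right_mono)
  qed
  finally show ?thesis .
 qed
 thus ?thesis using B(1) by (intro that[of "1 + real n * B"]) auto
qed

text \<open>A pair weight is the product of two real amplitudes, so twice its absolute value is at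
  most the sum of their squares, and these are weights of genuine configurations.\<close>

lemma abs_pair_weight_le:
 "\<bar>pair_weight gam p (K + diag M)\<bar>
   \<le> (pair_weight gam p (diag (image_mset fst K + M)) + pair_weight gam p (diag (image_mset snd K + M))) / 2"
proof -
 obtain ps where ps: "mset ps = K" using ex_mset by blast
 obtain ms where ms: "mset ms = M" using ex_mset by blast
 define a b where "a = omega (map fst ps @ ms)" and "b = omega (map snd ps @ ms)"
 have "pair_weight gam p (K + diag M) = a * b"
  using omega_mult[of "map snd ps" "map fst ps" ms] by (simp add: zip_map_fst_snd ps ms a_def b_def)
 moreover have "pair_weight gam p (diag (image_mset fst K + M)) = a * a" "pair_weight gam p (diag (image_mset snd K + M)) = b * b"
  by (simp_all add: a_def b_def omega_square ps[symmetric] ms[symmetric])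
 moreover have "\<bar>a * b\<bar> \<le> (a * a + b * b) / 2"
  using sum_squares_bound[of "\<bar>a\<bar>" "\<bar>b\<bar>"] by (simp add: abs_mult power2_eq_square)
 ultimately show ?thesis by simp
qed

lemma conf_weight_eq: "conf_weight g q M = pair_weight g q (diag M) / mfact M"
 by (simp add: conf_weight_def corr_weight_def)

lemma abs_corr_weight_le:
 "\<bar>corr_weight gam p K M\<bar>
   \<le> (conf_weight gam p (image_mset fst K + M) * mult_bound (image_mset fst K) (image_mset fst K + M)
   + conf_weight gam p (image_mset snd K + M) * mult_bound (image_mset snd K) (image_mset snd K + M)) / 2"
proof -
 have *: "pair_weight gam p (diag (\<kappa> + M)) / mfact M \<le> conf_weight gam p (\<kappa> + M) * mult_bound \<kappa> (\<kappa> + M)" for \<kappa>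
 proof -
  have "pair_weight gam p (diag (\<kappa> + M)) / mfact M = conf_weight gam p (\<kappa> + M) * (mfact (\<kappa> + M) / mfact M)"
   using mfact_pos[of "\<kappa> + M"] by (simp add: conf_weight_eq del: mfact_pos)
  also have "... \<le> conf_weight gam p (\<kappa> + M) * mult_bound \<kappa> (\<kappa> + M)"
   using mfact_plus_mult_bound[of \<kappa> M] p by (intro mult_left_mono) (auto simp: divide_le_eq)
  finally show ?thesis .
 qed
 have "\<bar>corr_weight gam p K M\<bar> = \<bar>pair_weight gam p (K + diag M)\<bar> / mfact M"
  using mfact_pos[of M] by (simp add: corr_weight_def abs_divide del: mfact_pos)
 also have "... \<le> (pair_weight gam p (diag (image_mset fst K + M)) + pair_weight gam p (diag (image_mset snd K + M))) / 2 / mfact M"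
  by (intro divide_right_mono abs_pair_weight_le) (simp add: less_imp_le)
 also have "... = (pair_weight gam p (diag (image_mset fst K + M)) / mfact M + pair_weight gam p (diag (image_mset snd K + M)) / mfact M) / 2"
  by (simp add: add_divide_distrib)
 also have "... \<le> (conf_weight gam p (image_mset fst K + M) * mult_bound (image_mset fst K) (image_mset fst K + M)
   + conf_weight gam p (image_mset snd K + M) * mult_bound (image_mset snd K) (image_mset snd K + M)) / 2"
  by (intro divide_right_mono add_mono *) simp
 finally show ?thesis .
qed

text \<open>Restoring the observed particles, once by their first and once by their second orbitals,
  turns a sum over the remaining particles into expectations over full configurations.
  \<open>F'\<close> must dominate \<open>F\<close> after they have been restored.\<close>

lemma sum_abs_corr_weight_le:
 assumes K: "!!x y. (x, y) \<in># K ==> x < p * N & y < p * N" and n: "size K \<le> N"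
  and F: "!!M \<kappa>. M \<in> cfg (p * N) (N - size K) ==> \<kappa> = image_mset fst K \<or> \<kappa> = image_mset snd K ==> F M \<le> F' (\<kappa> + M)"
  and F0: "!!M. 0 \<le> F M" and F'0: "!!M. 0 \<le> F' M"
 shows "(\<Sum>M\<in>cfg (p * N) (N - size K). \<bar>corr_weight gam p K M\<bar> * F M) / Z N
  \<le> (EL N (\<lambda>M. mult_bound (image_mset fst K) M * F' M) + EL N (\<lambda>M. mult_bound (image_mset snd K) M * F' M)) / 2"
proof -
 have *: "(\<Sum>M\<in>cfg (p * N) (N - size K). conf_weight gam p (\<kappa> + M) * mult_bound \<kappa> (\<kappa> + M) * F' (\<kappa> + M)) \<le> Z N * EL N (\<lambda>M. mult_bound \<kappa> M * F' M)"
  if \<kappa>: "\<kappa> = image_mset fst K \<or> \<kappa> = image_mset snd K" for \<kappa>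
 proof -
  have s: "size \<kappa> = size K" "set_mset \<kappa> \<subseteq> {..<p * N}" using \<kappa> K by auto
  have "(\<Sum>M\<in>cfg (p * N) (N - size K). conf_weight gam p (\<kappa> + M) * mult_bound \<kappa> (\<kappa> + M) * F' (\<kappa> + M))
   = (\<Sum>M\<in>(+) \<kappa> ` cfg (p * N) (N - size K). conf_weight gam p M * mult_bound \<kappa> M * F' M)"
   by (subst sum.reindex) (auto simp: inj_on_def)
  also have "... \<le> (\<Sum>M\<in>cfg (p * N) N. conf_weight gam p M * mult_bound \<kappa> M * F' M)"
  proof (rule sum_mono2)
   show "(+) \<kappa> ` cfg (p * N) (N - size K) \<subseteq> cfg (p * N) N" using s n by (auto simp: cfg_def)
   fix M show "0 \<le> conf_weight gam p M * mult_bound \<kappa> M * F' M"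
    using p F'0 mult_bound_ge_1[of \<kappa> M] by (intro mult_nonneg_nonneg) auto
  qed simp
  also have "... = Z N * EL N (\<lambda>M. mult_bound \<kappa> M * F' M)"
   using Z_pos[of N] by (simp add: EL_def prb_def sum_distrib_left mult.assoc)
  finally show ?thesis .
 qed
 let ?a = "image_mset fst K" and ?b = "image_mset snd K"
 have "(\<Sum>M\<in>cfg (p * N) (N - size K). \<bar>corr_weight gam p K M\<bar> * F M)
  \<le> (\<Sum>M\<in>cfg (p * N) (N - size K). (conf_weight gam p (?a + M) * mult_bound ?a (?a + M) * F' (?a + M)
   + conf_weight gam p (?b + M) * mult_bound ?b (?b + M) * F' (?b + M)) / 2)"
 proof (rule sum_mono)
  fix M assume M: "M \<in> cfg (p * N) (N - size K)"
  define A B where "A = conf_weight gam p (?a + M) * mult_bound ?a (?a + M)" and "B = conf_weight gam p (?b + M) * mult_bound ?b (?b + M)"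
  have AB: "0 \<le> A" "0 \<le> B" unfolding A_def B_def using p mult_bound_ge_1[of ?a "?a + M"] mult_bound_ge_1[of ?b "?b + M"]
   by (auto intro!: mult_nonneg_nonneg)
  have "\<bar>corr_weight gam p K M\<bar> * F M \<le> (A + B) / 2 * F M"
   unfolding A_def B_def by (intro mult_right_mono abs_corr_weight_le F0)
  also have "... = (A * F M + B * F M) / 2" by (simp add: algebra_simps)
  also have "... \<le> (A * F' (?a + M) + B * F' (?b + M)) / 2"
   by (intro divide_right_mono add_mono mult_left_mono F AB M) auto
  finally show "\<bar>corr_weight gam p K M\<bar> * F M \<le> (conf_weight gam p (?a + M) * mult_bound ?a (?a + M) * F' (?a + M)
   + conf_weight gam p (?b + M) * mult_bound ?b (?b + M) * F' (?b + M)) / 2" by (simp add: A_def B_def)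
 qed
 also have "... \<le> (Z N * EL N (\<lambda>M. mult_bound ?a M * F' M) + Z N * EL N (\<lambda>M. mult_bound ?b M * F' M)) / 2"
  unfolding sum_divide_distrib[symmetric] sum.distrib by (intro divide_right_mono add_mono *) auto
 finally show ?thesis using Z_pos[of N] by (simp add: divide_le_eq field_simps)
qed

lemma EL_cong_support:
 assumes "!!M. M \<in> cfg (p * N) N ==> conf_weight gam p M \<noteq> 0 ==> F M = G M"
 shows "EL N F = EL N G"
 unfolding EL_def by (intro sum.cong refl) (use assms in \<open>auto simp: prb_def\<close>)

lemma occ_bounded:
 obtains B where "B \<ge> 1" "!!N K. size K = n ==> n \<le> N ==> (!!x y. (x, y) \<in># K ==> x < p * N & y < p * N) ==> \<bar>occ N K\<bar> \<le> B"
proof -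
 obtain B where B: "B \<ge> 1" "!!N \<kappa>. size \<kappa> = n ==> EL N (\<lambda>M. (mult_bound \<kappa> M)^2) \<le> B"
  using mult_bound_moment by blast
 have "\<bar>occ N K\<bar> \<le> B" if K: "size K = n" "n \<le> N" "!!x y. (x, y) \<in># K ==> x < p * N & y < p * N" for N K
 proof -
  have *: "EL N (\<lambda>M. mult_bound \<kappa> M * 1) \<le> B" if "size \<kappa> = n" for \<kappa>
  proof -
   have "mult_bound \<kappa> M * 1 \<le> (mult_bound \<kappa> M)^2" for M using mult_bound_ge_1[of \<kappa> M] by (simp add: power2_eq_square)
   hence "EL N (\<lambda>M. mult_bound \<kappa> M * 1) \<le> EL N (\<lambda>M. (mult_bound \<kappa> M)^2)" by (intro EL_mono)
   thus ?thesis using B(2)[OF that, of N] by linarith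
  qed
  have "\<bar>occ N K\<bar> = \<bar>corr_sum gam p N K\<bar> / Z N" using Z_pos[of N] by (simp add: occ_def abs_divide)
  also have "... \<le> (\<Sum>M\<in>cfg (p * N) (N - size K). \<bar>corr_weight gam p K M\<bar> * 1) / Z N"
   unfolding corr_sum_def using Z_pos[of N] by (intro divide_right_mono) auto
  also have "... \<le> (EL N (\<lambda>M. mult_bound (image_mset fst K) M * 1) + EL N (\<lambda>M. mult_bound (image_mset snd K) M * 1)) / 2"
   by (rule sum_abs_corr_weight_le) (use K in auto)
  also have "... \<le> (B + B) / 2" using K(1) by (intro divide_right_mono add_mono *) auto
  finally show ?thesis by simp
 qed
 thus ?thesis using B(1) that by blast
qed

section \<open>Correlation coefficients as averages over pairs of renewals\<close>

definition unshift_pairs :: "nat => (nat \<times> nat) multiset => (nat \<times> nat) multiset" where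
 "unshift_pairs s A = image_mset (\<lambda>(x, y). (x - s, y - s)) A"

lemma size_unshift_pairs [simp]: "size (unshift_pairs s A) = size A"
 by (simp add: unshift_pairs_def)

lemma shift_unshift_pairs:
 assumes "!!x y. (x, y) \<in># A ==> s \<le> x & s \<le> y"
 shows "shift_pairs s (unshift_pairs s A) = A"
proof -
 have "shift_pairs s (unshift_pairs s A) = image_mset (\<lambda>z. z) A"
  unfolding shift_pairs_def unshift_pairs_def multiset.map_comp
  by (rule image_mset_cong) (use assms in auto)
 thus ?thesis by simp
qed

lemma unshift_shift_pairs: "unshift_pairs (s + a) (shift_pairs a A) = unshift_pairs s A"
 by (simp add: unshift_pairs_def shift_pairs_def multiset.map_comp o_def case_prod_unfold)

text \<open>The coefficient of the piece between two renewals, averaged over one renewal to the left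
  of \<open>K\<close> and one to the right. It does not involve \<open>N\<close> and depends only on
  relative positions, as \<open>occ_avg_shift\<close> records.\<close>

definition occ_avg :: "nat => nat => nat => (nat \<times> nat) multiset => real" where
 "occ_avg T s t K = (\<Sum>i\<in>{s..<s+T}. \<Sum>j\<in>{t..<t+T}. occ (j - i) (unshift_pairs (p * i) K)) / (real T)^2"

lemma occ_avg_shift: "occ_avg T (s + a) (t + a) (shift_pairs (p * a) K) = occ_avg T s t K"
proof -
 have 1: "(\<Sum>i\<in>{s+a..<s+a+T}. f i) = (\<Sum>i\<in>{s..<s+T}. f (i + a))" for f :: "nat => real" and s
  using sum.shift_bounds_nat_ivl[of f s a "s + T"] by (simp add: add_ac)
 show ?thesis unfolding occ_avg_def 1 distrib_left unshift_shift_pairs by simp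
qed

definition right_avg :: "nat => nat => nat => nat multiset => real" where
 "right_avg N t T M = (\<Sum>j\<in>{t..<t+T}. of_bool (ren_right p N j M)) / (vv * real T)"

text \<open>Particles beyond the window do not influence its renewals, so the average may be
  evaluated with or without the observed particles; \<open>right_avg_union\<close> is the mirror
  image.\<close>

lemma ren_avg_union:
 assumes "!!x. x \<in># \<kappa> ==> p * (s + T) \<le> x"
 shows "ren_avg s T (\<kappa> + M) = ren_avg s T M"
proof -
 have "ren i (\<kappa> + M) = ren i M" if "i \<in> {s..<s+T}" for i
 proof -
  have "p * i \<le> p * (s + T)" using that by simp
  hence "filter_mset (\<lambda>x. x < p * i) \<kappa> = {#}" by (intro filter_mset_none notI) (use assms in \<open>meson leD order.trans\<close>)
  thus ?thesis by (simp only: ren_def ren_left_def filter_union_mset add_0)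
 qed
 thus ?thesis by (simp add: ren_avg_def)
qed

lemma right_avg_union:
 assumes "!!x. x \<in># \<kappa> ==> x < p * t"
 shows "right_avg N t T (\<kappa> + M) = right_avg N t T M"
proof -
 have "ren_right p N j (\<kappa> + M) = ren_right p N j M" if "j \<in> {t..<t+T}" for j
 proof -
  have "p * t \<le> p * j" using that by simp
  hence "filter_mset (\<lambda>x. \<not> x < p * j) \<kappa> = {#}" by (intro filter_mset_none) (use assms in \<open>meson not_less order.strict_trans2\<close>)
  thus ?thesis by (simp only: ren_right_def filter_union_mset add_0)
 qed
 thus ?thesis by (simp add: right_avg_def)
qed

lemma right_avg_eq:
 assumes "M \<in> cfg (p * N) N" "conf_weight gam p M \<noteq> 0" "t + T \<le> N"
 shows "right_avg N t T M = ren_avg t T M"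
 unfolding right_avg_def ren_avg_def ren_def
 by (intro arg_cong2[where f = "(/)"] sum.cong refl) (use ren_right_iff_left[OF p assms(2)] assms in \<open>auto simp: cfg_def\<close>)

text \<open>Expands both window averages and factorises at every pair of renewals; what remains
  besides the middle coefficient is the ratio of the \<open>uu\<close>.\<close>

lemma sum_corr_weight_avg:
 assumes K: "size K = n" "!!x y. (x, y) \<in># K ==> p * (s + T) \<le> x & x < p * t & p * (s + T) \<le> y & y < p * t"
  and st: "s + T + n \<le> t" "t + T \<le> N"
 shows "(\<Sum>M\<in>cfg (p * N) (N - n). corr_weight gam p K M * (ren_avg s T M * right_avg N t T M)) / Z N
  = (\<Sum>i\<in>{s..<s+T}. \<Sum>j\<in>{t..<t+T}. (uu i * uu (j - i) * uu (N - j) / uu N) * occ (j - i) (unshift_pairs (p * i) K)) / (vv * real T)^2"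
proof -
 let ?A = "\<Sum>M\<in>cfg (p * N) (N - n). corr_weight gam p K M * (ren_avg s T M * right_avg N t T M)"
 define q where "q i j = (\<Sum>M\<in>cfg (p * N) (N - n). corr_weight gam p K M * (ren i M * of_bool (ren_right p N j M)))" for i j
 have q: "q i j / Z N = (uu i * uu (j - i) * uu (N - j) / uu N) * occ (j - i) (unshift_pairs (p * i) K)"
  if ij: "i \<in> {s..<s+T}" "j \<in> {t..<t+T}" for i j
 proof -
  define U where "U = unshift_pairs (p * i) K"
  have le: "p * i \<le> p * (s + T)" "p * t \<le> p * j" "i \<le> j" "j \<le> N" using ij st by auto
  have sU: "shift_pairs (p * i) U = K" unfolding U_def
  proof (rule shift_unshift_pairs)
   fix x y assume "(x, y) \<in># K"
   from K(2)[OF this] show "p * i \<le> x & p * i \<le> y" using le by linarith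
  qed
  have "q i j = (\<Sum>M | M \<in> cfg (p * N) (N - size U) & ren_left p i M & ren_right p N j M & True. corr_weight gam p (shift_pairs (p * i) U) M)"
   unfolding q_def sU by (rule sum.mono_neutral_cong_right) (auto simp: ren_def U_def K(1))
  also have "... = Z i * corr_sum gam p (j - i) U * Z (N - j)"
  proof (subst corr_sum_renewal_split[OF p le(3,4), where P = "\<lambda>_. True"])
   fix x y assume "(x, y) \<in># U"
   then obtain a b where "(a, b) \<in># K" "x = a - p * i" "y = b - p * i" by (auto simp: U_def unshift_pairs_def)
   moreover have "p * i \<le> a & a < p * j & p * i \<le> b & b < p * j" using K(2)[OF \<open>(a, b) \<in># K\<close>] le by linarith
   ultimately show "x < p * (j - i) & y < p * (j - i)" by (auto simp: right_diff_distrib')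
  next
   have "n + i \<le> j" using ij st by simp
   thus "size U \<le> j - i" using K(1) by (simp add: U_def)
  qed (simp add: part_fun_eq)
  also have "... = Z i * (Z (j - i) * occ (j - i) U) * Z (N - j)" using Z_pos[of "j - i"] by (simp add: occ_def)
  finally have "q i j / Z N = uu i * uu (j - i) * uu (N - j) * occ (j - i) U / uu N * (growth ^ i * growth ^ (j - i) * growth ^ (N - j) / growth ^ N)"
   by (simp add: Z_uu mult_ac)
  also have "growth ^ i * growth ^ (j - i) * growth ^ (N - j) = growth ^ N" using le by (simp flip: power_add)
  finally show ?thesis using growth_props(1) by (simp add: U_def)
 qed
 have "?A
  = (\<Sum>M\<in>cfg (p * N) (N - n). \<Sum>i\<in>{s..<s+T}. \<Sum>j\<in>{t..<t+T}. corr_weight gam p K M * (ren i M * of_bool (ren_right p N j M))) / (vv * real T)^2"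
  unfolding ren_avg_def right_avg_def times_divide_times_eq
  unfolding power2_eq_square[symmetric] times_divide_eq_right
  unfolding sum_divide_distrib[symmetric] sum_product
  unfolding sum_distrib_left ..
 also have "(\<Sum>M\<in>cfg (p * N) (N - n). \<Sum>i\<in>{s..<s+T}. \<Sum>j\<in>{t..<t+T}. corr_weight gam p K M * (ren i M * of_bool (ren_right p N j M)))
   = (\<Sum>i\<in>{s..<s+T}. \<Sum>j\<in>{t..<t+T}. q i j)"
  unfolding q_def by (subst sum.swap, intro sum.cong refl, subst sum.swap) (rule refl)
 finally have "?A / Z N
  = (\<Sum>i\<in>{s..<s+T}. \<Sum>j\<in>{t..<t+T}. q i j / Z N) / (vv * real T)^2"
  by (simp add: sum_divide_distrib mult.commute)
 also have "(\<Sum>i\<in>{s..<s+T}. \<Sum>j\<in>{t..<t+T}. q i j / Z N) = (\<Sum>i\<in>{s..<s+T}. \<Sum>j\<in>{t..<t+T}. (uu i * uu (j - i) * uu (N - j) / uu N) * occ (j - i) (unshift_pairs (p * i) K))"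
  by (intro sum.cong refl q)
 finally show ?thesis .
qed

lemma product_defect_square:
 assumes "0 \<le> a" "a \<le> 1 / vv"
 shows "(1 - a * b)^2 \<le> 2 * (1 - a)^2 + 2 / vv^2 * (1 - b)^2"
proof -
 have "1 - a * b = (1 - a) + a * (1 - b)" by (simp add: algebra_simps)
 hence "(1 - a * b)^2 \<le> 2 * (1 - a)^2 + 2 * (a * (1 - b))^2"
  using sum_squares_bound[of "1 - a" "a * (1 - b)"] by (simp only: power2_sum)
 also have "(a * (1 - b))^2 \<le> (1 / vv)^2 * (1 - b)^2"
  unfolding power_mult_distrib using assms by (intro mult_right_mono power_mono) auto
 finally show ?thesis by (simp add: power_divide)
qed

text \<open>The product of the two window averages is close to 1 in mean square, so it can be
  inserted into the sum at small cost; afterwards each pair of renewals factorises and the ratios of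
  the \<open>uu\<close> are close to \<open>vv^2\<close>.\<close>

lemma occ_approx:
 assumes e: "e > 0"
 obtains T d where "T \<ge> 1" "n \<le> d"
  "!!N s t K. d \<le> s ==> s + T + d \<le> t ==> t + T + d \<le> N ==> size K = n ==>
    (!!x y. (x, y) \<in># K ==> p * (s + T) \<le> x & x < p * t & p * (s + T) \<le> y & y < p * t) ==>
    \<bar>occ N K - occ_avg T s t K\<bar> \<le> e"
proof -
 have v: "vv > 0" by (rule vv_pos)
 obtain B where B: "B \<ge> 1" "!!N \<kappa>. size \<kappa> = n ==> EL N (\<lambda>M. (mult_bound \<kappa> M)^2) \<le> B"
  using mult_bound_moment by blast
 obtain C where C: "C \<ge> 1" "!!N K. size K = n ==> n \<le> N ==> (!!x y. (x, y) \<in># K ==> x < p * N & y < p * N) ==> \<bar>occ N K\<bar> \<le> C"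
  using occ_bounded by blast
 \<comment> \<open>The weight in Young's inequality between the multiplicity, whose second moment is
   only bounded, and the defect of the averages, whose second moment is small. With
   \<open>\<eta>\<close> below, both parts become \<open>e / 4\<close>.\<close>
 define \<tau> where "\<tau> = e / (2 * B)"
 have \<tau>: "\<tau> > 0" using e B(1) by (simp add: \<tau>_def)
 define c where "c = 2 + 2 / vv^2"
 have c: "c > 0" using v by (simp add: c_def add_pos_pos)
 define \<eta> where "\<eta> = e * \<tau> / (2 * c)"
 have \<eta>: "\<eta> > 0" using e \<tau> c by (simp add: \<eta>_def)
 obtain T d1 where T: "T \<ge> 1" "!!N s. d1 \<le> s ==> s + T + d1 \<le> N ==> EL N (\<lambda>M. (1 - ren_avg s T M)^2) \<le> \<eta>"
  using ren_avg_variance[OF \<eta>] by blast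
 have e0: "e * vv^2 / (2 * C) > 0" using e v C(1) by simp
 obtain D where "!!a b c. D \<le> a ==> D \<le> b ==> D \<le> c ==> \<bar>uu a * uu b / uu c - vv\<bar> \<le> e * vv^2 / (2 * C)"
  and D: "!!a b c d. D \<le> a ==> D \<le> b ==> D \<le> c ==> D \<le> d ==> \<bar>uu a * uu b * uu c / uu d - vv^2\<bar> \<le> e * vv^2 / (2 * C)"
  by (rule uu_ratio_bounds[OF e0]) blast
 define d where "d = max n (max d1 D)"
 show thesis
 proof (rule that[of T d])
  fix N s t K
  assume st: "d \<le> s" "s + T + d \<le> t" "t + T + d \<le> N" and K: "size K = n"
   and E: "!!x y. (x, y) \<in># K ==> p * (s + T) \<le> x & x < p * t & p * (s + T) \<le> y & y < p * t"
  have d: "n \<le> d" "d1 \<le> d" "D \<le> d" by (auto simp: d_def)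
  let ?cw = "corr_weight gam p K" and ?C = "cfg (p * N) (N - n)"
  let ?F = "\<lambda>M. \<bar>1 - ren_avg s T M * right_avg N t T M\<bar>"
  let ?A = "\<Sum>M\<in>?C. ?cw M * (ren_avg s T M * right_avg N t T M)"
 have ptN: "p * t \<le> p * N" using st by simp
  have 1: "\<bar>occ N K - ?A / Z N\<bar> \<le> e / 2"
  proof -
   have *: "EL N (\<lambda>M. mult_bound \<kappa> M * ?F M) \<le> e / 2" if \<kappa>: "size \<kappa> = n" for \<kappa>
   proof -
    have "EL N (\<lambda>M. mult_bound \<kappa> M * ?F M) = EL N (\<lambda>M. mult_bound \<kappa> M * \<bar>1 - ren_avg s T M * ren_avg t T M\<bar>)"
     by (rule EL_cong_support) (use st right_avg_eq[of _ N t T] in auto)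
    also have "... \<le> EL N (\<lambda>M. \<tau> / 2 * (mult_bound \<kappa> M)^2 + 1 / (2 * \<tau>) * (2 * (1 - ren_avg s T M)^2 + 2 / vv^2 * (1 - ren_avg t T M)^2))"
    proof (rule EL_mono)
     fix M
     define g f where "g = mult_bound \<kappa> M" and "f = \<bar>1 - ren_avg s T M * ren_avg t T M\<bar>"
     have "0 \<le> (\<tau> * g - f)^2" by simp
     hence "2 * (\<tau> * g * f) \<le> (\<tau> * g)^2 + f^2" by (simp add: power2_diff)
     hence "g * f \<le> ((\<tau> * g)^2 + f^2) / (2 * \<tau>)" using \<tau> by (simp add: field_simps)
     also have "... = \<tau> / 2 * g^2 + 1 / (2 * \<tau>) * f^2" using \<tau> by (simp add: field_simps power2_eq_square)
     also have "... \<le> \<tau> / 2 * g^2 + 1 / (2 * \<tau>) * (2 * (1 - ren_avg s T M)^2 + 2 / vv^2 * (1 - ren_avg t T M)^2)"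
      unfolding f_def power2_abs using \<tau>
      by (intro add_left_mono mult_left_mono product_defect_square ren_avg_bounds) auto
     finally show "mult_bound \<kappa> M * \<bar>1 - ren_avg s T M * ren_avg t T M\<bar> \<le> \<tau> / 2 * (mult_bound \<kappa> M)^2 + 1 / (2 * \<tau>) * (2 * (1 - ren_avg s T M)^2 + 2 / vv^2 * (1 - ren_avg t T M)^2)"
      by (simp add: g_def f_def)
    qed
    also have "... = \<tau> / 2 * EL N (\<lambda>M. (mult_bound \<kappa> M)^2)
      + 1 / (2 * \<tau>) * (2 * EL N (\<lambda>M. (1 - ren_avg s T M)^2) + 2 / vv^2 * EL N (\<lambda>M. (1 - ren_avg t T M)^2))"
     unfolding EL_add EL_cmult ..
    also have "... \<le> \<tau> / 2 * B + 1 / (2 * \<tau>) * (2 * \<eta> + 2 / vv^2 * \<eta>)"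
     using \<tau> st d by (intro add_mono mult_left_mono B(2) \<kappa> T(2)) auto
    also have "... = \<tau> * B / 2 + c * \<eta> / (2 * \<tau>)" by (simp add: c_def field_simps)
    also have "\<tau> * B / 2 = e / 4" using B(1) by (simp add: \<tau>_def)
    also have "c * \<eta> / (2 * \<tau>) = e / 4" using \<tau> c by (simp add: \<eta>_def)
    finally show ?thesis by simp
   qed
   have "occ N K - ?A / Z N
    = (\<Sum>M\<in>?C. ?cw M * (1 - ren_avg s T M * right_avg N t T M)) / Z N"
    by (simp add: occ_def corr_sum_def K diff_divide_distrib sum_subtractf right_diff_distrib)
   also have "\<bar>...\<bar> \<le> (\<Sum>M\<in>cfg (p * N) (N - size K). \<bar>?cw M\<bar> * ?F M) / Z N"
    unfolding abs_divide K using Z_pos[of N]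
    by (intro order.trans[OF divide_right_mono[OF sum_abs]]) (auto simp: abs_mult)
   also have "... \<le> (EL N (\<lambda>M. mult_bound (image_mset fst K) M * ?F M) + EL N (\<lambda>M. mult_bound (image_mset snd K) M * ?F M)) / 2"
   proof (rule sum_abs_corr_weight_le)
    fix M \<kappa> assume "\<kappa> = image_mset fst K \<or> \<kappa> = image_mset snd K"
    hence "p * (s + T) \<le> x & x < p * t" if "x \<in># \<kappa>" for x using that E by auto
    thus "?F M \<le> ?F (\<kappa> + M)" by (simp add: ren_avg_union right_avg_union)
   next
    fix x y assume "(x, y) \<in># K"
    from E[OF this] show "x < p * N & y < p * N" using ptN by linarith
   qed (use st K d in auto)
   also have "... \<le> (e / 2 + e / 2) / 2" using K by (intro divide_right_mono add_mono *) auto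
   finally show ?thesis by simp
  qed
  have 2: "\<bar>?A / Z N - occ_avg T s t K\<bar> \<le> e / 2"
  proof -
   let ?o = "\<lambda>i j. occ (j - i) (unshift_pairs (p * i) K)" and ?u = "\<lambda>i j. uu i * uu (j - i) * uu (N - j) / uu N"
   have main: "?A / Z N = (\<Sum>i\<in>{s..<s+T}. \<Sum>j\<in>{t..<t+T}. ?u i j * ?o i j) / (vv * real T)^2"
    by (rule sum_corr_weight_avg[OF K E]) (use st d in auto)
   have av: "occ_avg T s t K = (\<Sum>i\<in>{s..<s+T}. \<Sum>j\<in>{t..<t+T}. vv^2 * ?o i j) / (vv * real T)^2"
    using v by (simp add: occ_avg_def sum_distrib_left[symmetric] power_mult_distrib)
   have df: "?A / Z N - occ_avg T s t K
    = (\<Sum>i\<in>{s..<s+T}. \<Sum>j\<in>{t..<t+T}. (?u i j - vv^2) * ?o i j) / (vv * real T)^2"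
    unfolding main av by (simp add: diff_divide_distrib sum_subtractf left_diff_distrib)
   have tm: "\<bar>(?u i j - vv^2) * ?o i j\<bar> \<le> e * vv^2 / 2" if ij: "i \<in> {s..<s+T}" "j \<in> {t..<t+T}" for i j
   proof -
    have "\<bar>(?u i j - vv^2) * ?o i j\<bar> \<le> (e * vv^2 / (2 * C)) * C"
     unfolding abs_mult
    proof (intro mult_mono)
     show "\<bar>?u i j - vv^2\<bar> \<le> e * vv^2 / (2 * C)" by (rule D) (use ij st d in auto)
     show "\<bar>?o i j\<bar> \<le> C"
     proof (rule C(2))
      have "n + i \<le> j" using ij st d by simp
      thus "size (unshift_pairs (p * i) K) = n" "n \<le> j - i" using K by auto
      fix x y assume "(x, y) \<in># unshift_pairs (p * i) K"
      then obtain a b where ab: "(a, b) \<in># K" "x = a - p * i" "y = b - p * i" by (auto simp: unshift_pairs_def)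
      have "p * i \<le> p * (s + T)" "p * t \<le> p * j" using ij by auto
      hence "p * i \<le> a & a < p * j & p * i \<le> b & b < p * j" using E[OF ab(1)] by linarith
      thus "x < p * (j - i) & y < p * (j - i)" using ab by (auto simp: right_diff_distrib')
     qed
    qed (use e v C(1) in auto)
    also have "... = e * vv^2 / 2" using C(1) by simp
    finally show ?thesis .
   qed
   have "\<bar>\<Sum>i\<in>{s..<s+T}. \<Sum>j\<in>{t..<t+T}. (?u i j - vv^2) * ?o i j\<bar> \<le> (\<Sum>i\<in>{s..<s+T}. \<Sum>j\<in>{t..<t+T}. e * vv^2 / 2)"
    by (intro order.trans[OF sum_abs] sum_mono tm)
   hence "\<bar>\<Sum>i\<in>{s..<s+T}. \<Sum>j\<in>{t..<t+T}. (?u i j - vv^2) * ?o i j\<bar> \<le> (vv * real T)^2 * (e / 2)"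
    by (simp add: power2_eq_square mult_ac)
   thus ?thesis unfolding df abs_divide using v T(1) by (simp add: divide_le_eq mult.commute)
  qed
  show "\<bar>occ N K - occ_avg T s t K\<bar> \<le> e" using 1 2 by linarith
 qed (use T(1) in \<open>auto simp: d_def\<close>)
qed

text \<open>The shifted coefficient is approximated with the shifted windows, which gives the same
  \<open>occ_avg\<close>; the size of the box drops out.\<close>

lemma occ_shift_invariant:
 assumes e: "e > 0"
 obtains d where "n \<le> d" "!!N N' a K. size K = n ==> 2 * d \<le> N ==> N + a \<le> N' ==>
    (!!x y. (x, y) \<in># K ==> p * d \<le> x & x < p * (N - d) & p * d \<le> y & y < p * (N - d)) ==>
    \<bar>occ N K - occ N' (shift_pairs (p * a) K)\<bar> \<le> e"
proof -
 obtain T d where d: "T \<ge> 1" "n \<le> d"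
  "!!N s t K. d \<le> s ==> s + T + d \<le> t ==> t + T + d \<le> N ==> size K = n ==>
    (!!x y. (x, y) \<in># K ==> p * (s + T) \<le> x & x < p * t & p * (s + T) \<le> y & y < p * t) ==>
    \<bar>occ N K - occ_avg T s t K\<bar> \<le> e / 2"
  by (rule occ_approx[of "e / 2" n]) (use e in simp, blast)
 show thesis
 proof (rule that[of "2 * d + T"])
  fix N N' a K
  assume K: "size K = n" and N: "2 * (2 * d + T) \<le> N" "N + a \<le> N'"
   and E: "!!x y. (x, y) \<in># K ==> p * (2 * d + T) \<le> x & x < p * (N - (2 * d + T)) & p * (2 * d + T) \<le> y & y < p * (N - (2 * d + T))"
  define t where "t = N - (T + d)"
  have "p * (d + T) \<le> p * (2 * d + T)" "p * (N - (2 * d + T)) \<le> p * t" using N by (auto simp: t_def)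
  hence E': "p * (d + T) \<le> x & x < p * t & p * (d + T) \<le> y & y < p * t" if "(x, y) \<in># K" for x y
   using E[OF that] by linarith
  have 1: "\<bar>occ N K - occ_avg T d t K\<bar> \<le> e / 2"
   by (rule d(3)) (use N K E' in \<open>auto simp: t_def\<close>)
  have "\<bar>occ N' (shift_pairs (p * a) K) - occ_avg T (d + a) (t + a) (shift_pairs (p * a) K)\<bar> \<le> e / 2"
  proof (rule d(3))
   fix x y assume "(x, y) \<in># shift_pairs (p * a) K"
   then obtain u w where uw: "(u, w) \<in># K" "x = u + p * a" "y = w + p * a" by (auto simp: shift_pairs_def)
   have e1: "p * (d + a + T) = p * (d + T) + p * a" "p * (t + a) = p * t + p * a" by (simp_all add: algebra_simps)
   show "p * (d + a + T) \<le> x & x < p * (t + a) & p * (d + a + T) \<le> y & y < p * (t + a)"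
    unfolding e1 uw(2,3) using E'[OF uw(1)] by linarith
  qed (use N K in \<open>auto simp: t_def\<close>)
  thus "\<bar>occ N K - occ N' (shift_pairs (p * a) K)\<bar> \<le> e" using 1 unfolding occ_avg_shift by linarith
 qed (use d(2) in auto)
qed

end

section \<open>The bulk limit\<close>

lemma sum_nlists_prod:
 fixes f :: "nat => nat => 'a :: comm_semiring_1"
 shows "(\<Sum>ks\<in>nlists n Q. \<Prod>i<n. f i (ks ! i)) = (\<Prod>i<n. \<Sum>k<Q. f i k)"
proof (induction n)
 case (Suc n)
 have "(\<Sum>ks\<in>nlists (n + 1) Q. \<Prod>i<Suc n. f i (ks ! i)) = (\<Sum>us\<in>nlists n Q. \<Sum>vs\<in>nlists 1 Q. \<Prod>i<Suc n. f i ((us @ vs) ! i))"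
  by (rule sum_nlists_append)
 also have "... = (\<Sum>us\<in>nlists n Q. \<Sum>vs\<in>nlists 1 Q. (\<Prod>i<n. f i (us ! i)) * f n (vs ! 0))"
  by (intro sum.cong refl) (auto simp: nlists_def nth_append)
 also have "nlists 1 Q = (\<lambda>k. [k]) ` {..<Q}" by (auto simp: nlists_def length_Suc_conv)
 also have "(\<Sum>us\<in>nlists n Q. \<Sum>vs\<in>(\<lambda>k. [k]) ` {..<Q}. (\<Prod>i<n. f i (us ! i)) * f n (vs ! 0))
   = (\<Sum>us\<in>nlists n Q. \<Sum>k<Q. (\<Prod>i<n. f i (us ! i)) * f n k)"
  by (subst sum.reindex) (auto simp: inj_on_def)
 finally show ?case by (simp add: sum_product[symmetric] Suc)
next
 case 0
 have "nlists 0 Q = {[]}" by (auto simp: nlists_def)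
 thus ?case by simp
qed

context laughlin_cyl begin

text \<open>A crude exponential envelope. The Gaussian orbital is bounded by its square, so one
  power can make the sum over orbitals converge while the other provides smallness far from the
  point.\<close>

definition orb_env :: "nat => complex => real" where
 "orb_env k z = exp (- \<bar>real k - Re z / del\<bar>)"

lemma norm_orb_le_env:
 obtains C where "C > 0" "!!k z. norm (orb k z) \<le> C * (orb_env k z)^2"
proof -
 define C where "C = exp (2 * l^2 / del^2)"
 have "norm (orb k z) \<le> C * (orb_env k z)^2" for k z
 proof -
  define y where "y = \<bar>Re z - del * real k\<bar>"
  have "real k - Re z / del = - ((Re z - del * real k) / del)" using del_pos by (simp add: field_simps)
  hence y: "\<bar>real k - Re z / del\<bar> = y / del" using del_pos by (simp only: abs_minus_cancel abs_divide y_def abs_of_pos)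
  have "0 \<le> (y / (2 * l) - l / del)^2 + (y / (2 * l) - l / del)^2" by simp
  also have "... = y^2 / (2 * l^2) - 2 * (y / del) + 2 * l^2 / del^2"
   using l del_pos by (simp add: power2_eq_square field_simps)
  finally have "- (y^2 / (2 * l^2)) \<le> 2 * l^2 / del^2 + 2 * (- (y / del))" by simp
  hence "exp (- (y^2 / (2 * l^2))) \<le> exp (2 * l^2 / del^2 + 2 * (- (y / del)))" by simp
  also have "... = C * (exp (- (y / del)))^2" by (simp only: exp_add exp_double C_def)
  finally show ?thesis by (simp add: norm_orb orb_env_def y) (simp add: y_def)
 qed
 thus ?thesis by (intro that[of C]) (auto simp: C_def)
qed

lemma sum_orb_env: "finite A ==> (\<Sum>k\<in>A. orb_env k z) \<le> 2 / (1 - exp (- 1))"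
 using sum_exp_dist_le[of 1 A "Re z / del"] by (simp add: orb_env_def)

lemma orb_shift: "orb (k + p * a) (z + of_real (real a * per)) = cis (real (p * a) * Im z / R) * orb k z"
 by (simp add: orb_def per_del algebra_simps cis_mult add_divide_distrib)

text \<open>Translation by \<open>a\<close> periods maps an orbital to the one with index larger by
  \<open>p * a\<close> only up to an angular phase. This factor compensates it; it is 1 on the
  diagonal.\<close>

definition phase :: "nat => nat => (nat => complex) => (nat => complex) => complex" where
 "phase n a z z' = (\<Prod>i<n. cis (- (real (p * a) * (Im (z i) - Im (z' i)) / R)))"

lemma norm_phase [simp]: "norm (phase n a z z') = 1"
 by (simp add: phase_def prod_norm[symmetric])

lemma phase_same [simp]: "phase n a z z = 1"
 by (simp add: phase_def)

lemma phase_add: "phase n (a + c) z z' = phase n a z z' * phase n c z z'"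
 by (simp add: phase_def prod.distrib[symmetric] cis_mult algebra_simps add_divide_distrib diff_divide_distrib)

lemma phase_shift [simp]: "phase n a (shift_x s z) (shift_x s z') = phase n a z z'"
 by (simp add: phase_def shift_x_def)

definition orb_prod :: "nat => nat list => nat list => (nat => complex) => (nat => complex) => complex" where
 "orb_prod n ks ks' z z' = (\<Prod>i<n. orb (ks ! i) (z i) * cnj (orb (ks' ! i) (z' i)))"

lemma orb_prod_shift:
 assumes "length ks = n" "length ks' = n"
 shows "phase n a z z' * orb_prod n (map (\<lambda>k. k + p * a) ks) (map (\<lambda>k. k + p * a) ks') (shift_x (real a * per) z) (shift_x (real a * per) z')
  = orb_prod n ks ks' z z'"
proof -
 have "cis (- (real (p * a) * (y - y') / R)) * ((cis (real (p * a) * y / R) * u) * cnj (cis (real (p * a) * y' / R) * w)) = u * cnj w" for y y' u w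
 proof -
  have "cis (- (real (p * a) * (y - y') / R)) * (cis (real (p * a) * y / R) * cnj (cis (real (p * a) * y' / R))) = 1"
   by (simp add: cis_cnj cis_mult algebra_simps diff_divide_distrib)
  thus ?thesis by (simp add: mult_ac)
 qed
 thus ?thesis unfolding phase_def orb_prod_def prod.distrib[symmetric] shift_x_def
  by (intro prod.cong refl) (simp add: assms orb_shift del: of_real_mult complex_cnj_mult)
qed

lemma rho_fin_orb_prod:
 "n \<le> N ==> rhoN N n z z' = (\<Sum>ks\<in>nlists n (p * N). \<Sum>ks'\<in>nlists n (p * N). of_real (occ N (mset (zip ks ks')) / cmass ^ n) * orb_prod n ks ks' z z')"
 unfolding orb_prod_def by (rule rho_fin_eq)

definition env_prod :: "nat => nat list => (nat => complex) => real" where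
 "env_prod n ks z = (\<Prod>i<n. orb_env (ks ! i) (z i))"

lemma orb_env_bounds: "0 < orb_env k z" "orb_env k z \<le> 1" by (simp_all add: orb_env_def)

lemma env_prod_bounds: "0 \<le> env_prod n ks z" "env_prod n ks z \<le> 1"
 unfolding env_prod_def by (auto intro!: prod_nonneg prod_le_1 simp: less_imp_le orb_env_bounds)

lemma norm_orb_prod_le:
 obtains C where "C > 0" "!!ks ks' z z'. norm (orb_prod n ks ks' z z') \<le> C * ((env_prod n ks z)^2 * (env_prod n ks' z')^2)"
proof -
 obtain C where C: "C > 0" "!!k z. norm (orb k z) \<le> C * (orb_env k z)^2" by (rule norm_orb_le_env) blast
 have "norm (orb_prod n ks ks' z z') \<le> (C * C) ^ n * ((env_prod n ks z)^2 * (env_prod n ks' z')^2)" for ks ks' z z'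
 proof -
  have "norm (orb_prod n ks ks' z z') = (\<Prod>i<n. norm (orb (ks ! i) (z i)) * norm (orb (ks' ! i) (z' i)))"
   by (simp add: orb_prod_def prod_norm[symmetric] norm_mult)
  also have "... \<le> (\<Prod>i<n. (C * (orb_env (ks ! i) (z i))^2) * (C * (orb_env (ks' ! i) (z' i))^2))"
   using C by (intro prod_mono conjI mult_mono mult_nonneg_nonneg) (auto simp: less_imp_le)
  also have "... = (C * C) ^ n * ((env_prod n ks z)^2 * (env_prod n ks' z')^2)"
   by (simp add: env_prod_def prod.distrib power_mult_distrib prod_power_distrib)
  finally show ?thesis .
 qed
 thus ?thesis using C(1) by (intro that[of "(C * C) ^ n"]) auto
qed

lemma sum_env_prod: "(\<Sum>ks\<in>nlists n Q. env_prod n ks z) \<le> (2 / (1 - exp (- 1))) ^ n"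
proof -
 have "(\<Sum>ks\<in>nlists n Q. env_prod n ks z) = (\<Prod>i<n. \<Sum>k<Q. orb_env k (z i))"
  unfolding env_prod_def by (rule sum_nlists_prod)
 also have "... \<le> (\<Prod>i<n. 2 / (1 - exp (- 1)))"
  by (intro prod_mono conjI sum_orb_env sum_nonneg) (auto simp: less_imp_le orb_env_bounds)
 finally show ?thesis by simp
qed

lemma shift_pairs_zip: "mset (zip (map (\<lambda>k. k + s) ks) (map (\<lambda>k. k + s) ks')) = shift_pairs s (mset (zip ks ks'))"
 by (simp add: shift_pairs_def zip_map_map case_prod_unfold)

text \<open>Places the smaller box at offset \<open>a\<close> inside the larger one. Both
  correlation functions become sums over the same lists and can be compared coefficient by
  coefficient.\<close>

lemma rho_fin_shifted_sum:
 assumes n: "n \<le> N" and N': "N + a \<le> N'"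
 defines "S \<equiv> (\<lambda>ks. map (\<lambda>k. k + p * a) ks) ` nlists n (p * N)"
 shows "rhoN N n z z' = (\<Sum>us\<in>nlists n (p * N'). \<Sum>us'\<in>nlists n (p * N').
   of_real ((if us \<in> S & us' \<in> S then occ N (unshift_pairs (p * a) (mset (zip us us'))) else 0) / cmass ^ n)
    * (phase n a z z' * orb_prod n us us' (shift_x (real a * per) z) (shift_x (real a * per) z')))"
  (is "_ = (\<Sum>us\<in>?A. \<Sum>us'\<in>?A. of_real ((if us \<in> S & us' \<in> S then ?o us us' else 0) / cmass ^ n) * ?F us us')")
proof -
 let ?G = "\<lambda>us us'. of_real ((if us \<in> S & us' \<in> S then ?o us us' else 0) / cmass ^ n) * ?F us us'"
 let ?sh = "\<lambda>ks. map (\<lambda>k. k + p * a) ks"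
 have inj: "inj_on ?sh X" for X :: "nat list set" by (auto simp: inj_on_def)
 have SA: "S \<subseteq> ?A"
 proof -
  have "p * N + p * a \<le> p * N'" using N' by (simp flip: distrib_left)
  hence "k + p * a < p * N'" if "k < p * N" for k using that by linarith
  thus ?thesis by (auto simp: S_def nlists_def subset_eq)
 qed
 have "(\<Sum>us\<in>?A. \<Sum>us'\<in>?A. ?G us us')
  = (\<Sum>us\<in>S. \<Sum>us'\<in>S. of_real (?o us us' / cmass ^ n) * ?F us us')"
 proof -
  have "(\<Sum>us\<in>?A. \<Sum>us'\<in>?A. ?G us us')
   = (\<Sum>us\<in>S. \<Sum>us'\<in>?A. ?G us us')"
   by (rule sum.mono_neutral_right) (use SA in auto)
  also have "... = (\<Sum>us\<in>S. \<Sum>us'\<in>S. of_real (?o us us' / cmass ^ n) * ?F us us')"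
   by (intro sum.cong refl sum.mono_neutral_cong_right) (use SA in auto)
  finally show ?thesis .
 qed
 also have "... = (\<Sum>ks\<in>nlists n (p * N). \<Sum>ks'\<in>nlists n (p * N). of_real (?o (?sh ks) (?sh ks') / cmass ^ n) * ?F (?sh ks) (?sh ks'))"
  unfolding S_def by (simp only: sum.reindex[OF inj] o_def)
 also have "... = (\<Sum>ks\<in>nlists n (p * N). \<Sum>ks'\<in>nlists n (p * N). of_real (occ N (mset (zip ks ks')) / cmass ^ n) * orb_prod n ks ks' z z')"
 proof (intro sum.cong refl)
  fix ks ks' assume "ks \<in> nlists n (p * N)" "ks' \<in> nlists n (p * N)"
  hence "length ks = n" "length ks' = n" by (auto simp: nlists_def)
  hence 1: "?F (?sh ks) (?sh ks') = orb_prod n ks ks' z z'" by (rule orb_prod_shift)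
  have "?o (?sh ks) (?sh ks') = occ N (unshift_pairs 0 (mset (zip ks ks')))"
   unfolding shift_pairs_zip using unshift_shift_pairs[of 0 "p * a"] by simp
  hence 2: "?o (?sh ks) (?sh ks') = occ N (mset (zip ks ks'))" by (simp add: unshift_pairs_def)
  show "of_real (?o (?sh ks) (?sh ks') / cmass ^ n) * ?F (?sh ks) (?sh ks') = of_real (occ N (mset (zip ks ks')) / cmass ^ n) * orb_prod n ks ks' z z'"
   unfolding 1 2 ..
 qed
 finally show ?thesis using rho_fin_orb_prod[OF n, of z z'] by simp
qed

text \<open>A list with an orbital outside the core window has a factor located at distance at least
  \<open>m\<close> from its point.\<close>

lemma env_prod_outside:
 assumes k: "ks \<in> nlists n Q" "\<not> (\<forall>k\<in>set ks. p * d0 \<le> k & k < p * d1)"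
  and z: "!!i. i < n ==> del * (real (p * d0) + m) \<le> Re (z i) & Re (z i) \<le> del * (real (p * d1) - m)"
 shows "env_prod n ks z \<le> exp (- m)"
proof -
 obtain i where i: "i < n" "\<not> (p * d0 \<le> ks ! i & ks ! i < p * d1)"
  using k by (auto simp: nlists_def in_set_conv_nth)
 have "real (p * d0) + m \<le> Re (z i) / del" "Re (z i) / del \<le> real (p * d1) - m"
  using z[OF i(1)] del_pos by (simp_all add: le_divide_eq divide_le_eq mult.commute)
 moreover have "real (ks ! i) \<le> real (p * d0) \<or> real (p * d1) \<le> real (ks ! i)" using i(2) by (auto simp only: of_nat_le_iff)
 ultimately have "m \<le> \<bar>real (ks ! i) - Re (z i) / del\<bar>" by linarith
 hence "orb_env (ks ! i) (z i) \<le> exp (- m)" by (simp add: orb_env_def)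
 moreover have "env_prod n ks z \<le> orb_env (ks ! i) (z i)"
 proof -
  have "env_prod n ks z = orb_env (ks ! i) (z i) * (\<Prod>j\<in>{..<n} - {i}. orb_env (ks ! j) (z j))"
   unfolding env_prod_def using i(1) by (subst prod.remove[of _ i]) auto
  also have "... \<le> orb_env (ks ! i) (z i) * 1"
   by (intro mult_left_mono prod_le_1) (auto simp: less_imp_le orb_env_bounds)
  finally show ?thesis by simp
 qed
 ultimately show ?thesis by linarith
qed

lemma occ_zip_bounded:
 obtains B where "B \<ge> 1" "!!N ks ks'. ks \<in> nlists n (p * N) ==> ks' \<in> nlists n (p * N) ==> n \<le> N ==> \<bar>occ N (mset (zip ks ks'))\<bar> \<le> B"
proof -
 obtain B where B: "B \<ge> 1" "!!N K. size K = n ==> n \<le> N ==> (!!x y. (x, y) \<in># K ==> x < p * N & y < p * N) ==> \<bar>occ N K\<bar> \<le> B"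
  by (rule occ_bounded) blast
 show ?thesis
  by (rule that[OF B(1)], rule B(2)) (auto simp: nlists_def dest: set_zip_leftD set_zip_rightD)
qed

text \<open>Coefficients of lists in the core agree by \<open>occ_shift_invariant\<close>. The other
  lists are negligible because the points lie deep inside the core and the coefficients are
  bounded.\<close>

lemma rho_fin_shift_invariant:
 assumes e: "e > 0"
 obtains d where "!!N N' a z z'. d \<le> real N ==> N + a \<le> N' ==>
   (!!i. i < n ==> d \<le> Re (z i) & Re (z i) \<le> per * real N - d) ==>
   (!!i. i < n ==> d \<le> Re (z' i) & Re (z' i) \<le> per * real N - d) ==>
   norm (rhoN N n z z' - phase n a z z' * rhoN N' n (shift_x (real a * per) z) (shift_x (real a * per) z')) \<le> e"
proof -
 obtain B where B: "B \<ge> 1" "!!N ks ks'. ks \<in> nlists n (p * N) ==> ks' \<in> nlists n (p * N) ==> n \<le> N ==> \<bar>occ N (mset (zip ks ks'))\<bar> \<le> B"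
  by (rule occ_zip_bounded) blast
 obtain C where C: "C > 0" "!!ks ks' z z'. norm (orb_prod n ks ks' z z') \<le> C * ((env_prod n ks z)^2 * (env_prod n ks' z')^2)"
  by (rule norm_orb_prod_le) blast
 define S :: real where "S = (2 / (1 - exp (- 1))) ^ n"
 have S: "S > 0" unfolding S_def by (intro zero_less_power divide_pos_pos) auto
 \<comment> \<open>The total weight of the envelopes. A uniform coefficient error \<open>?b\<close>
   costs \<open>?b * K0\<close>, and \<open>\<eta>\<close> is chosen to make this exactly
   \<open>e\<close>.\<close>
 define K0 where "K0 = C / cmass ^ n * (S * S)"
 have K0: "K0 > 0" using C(1) S cmass_pos by (simp add: K0_def)
 have e1: "e / (2 * K0) > 0" using e K0 by simp
 obtain d0 where d0: "n \<le> d0" "!!N N' a K. size K = n ==> 2 * d0 \<le> N ==> N + a \<le> N' ==>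
    (!!x y. (x, y) \<in># K ==> p * d0 \<le> x & x < p * (N - d0) & p * d0 \<le> y & y < p * (N - d0)) ==>
    \<bar>occ N K - occ N' (shift_pairs (p * a) K)\<bar> \<le> e / (2 * K0)"
  by (rule occ_shift_invariant[OF e1, of n]) blast
 define \<eta> where "\<eta> = e / (4 * B * K0)"
 have \<eta>: "\<eta> > 0" using e B(1) K0 by (simp add: \<eta>_def)
 define m where "m = max 0 (- ln \<eta>)"
 have "exp (- m) \<le> exp (ln \<eta>)" by (simp add: m_def)
 hence m: "m \<ge> 0" "exp (- m) \<le> \<eta>" using \<eta> by (auto simp: m_def)
 define d where "d = max (real (2 * d0)) (del * (real (p * d0) + m))"
 let ?b = "e / (2 * K0) + 2 * B * \<eta>"
 show thesis
 proof (rule that[of d])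
  fix N N' a and z z' :: "nat => complex"
  assume N: "d \<le> real N" "N + a \<le> N'"
   and z: "!!i. i < n ==> d \<le> Re (z i) & Re (z i) \<le> per * real N - d"
   and z': "!!i. i < n ==> d \<le> Re (z' i) & Re (z' i) \<le> per * real N - d"
  have N2: "2 * d0 \<le> N" using N(1) by (simp add: d_def)
  have nN: "n \<le> N" "n \<le> N'" using N2 d0(1) N(2) by auto
  let ?sh = "\<lambda>ks. map (\<lambda>k. k + p * a) ks"
  define \<S> where "\<S> = ?sh ` nlists n (p * N)"
  define zs where "zs = shift_x (real a * per) z"
  define zs' where "zs' = shift_x (real a * per) z'"
  define c where "c us us' = (if us \<in> \<S> & us' \<in> \<S> then occ N (unshift_pairs (p * a) (mset (zip us us'))) else 0)" for us us'
  define o2 where "o2 us us' = occ N' (mset (zip us us'))" for us us'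
  define core where "core us \<longleftrightarrow> (\<forall>k\<in>set us. p * (d0 + a) \<le> k & k < p * (N - d0 + a))" for us
  let ?A = "nlists n (p * N')"
  have d_ge: "del * (real (p * d0) + m) \<le> d" by (simp add: d_def)
  have pos: "del * (real (p * (d0 + a)) + m) \<le> Re (y i + of_real (real a * per)) & Re (y i + of_real (real a * per)) \<le> del * (real (p * (N - d0 + a)) - m)"
   if y: "d \<le> Re (y i) & Re (y i) \<le> per * real N - d" for y :: "nat => complex" and i
  proof -
   have 1: "del * (real (p * (d0 + a)) + m) = del * (real (p * d0) + m) + real a * per"
    by (simp add: per_del algebra_simps)
   have 2: "del * (real (p * (N - d0 + a)) - m) = per * real N - del * (real (p * d0) + m) + real a * per"
   proof -
    have "d0 \<le> N" using N2 by simp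
    hence *: "real (p * (N - d0 + a)) = real p * (real N - real d0 + real a)" by (simp only: of_nat_mult of_nat_add of_nat_diff)
    show ?thesis unfolding * by (simp add: per_del algebra_simps)
   qed
   show ?thesis unfolding 1 2 using y d_ge by simp
  qed
  have env: "env_prod n us zs \<le> \<eta>" "env_prod n us zs' \<le> \<eta>" if "us \<in> ?A" "\<not> core us" for us
   using env_prod_outside[OF that[unfolded core_def], of m zs] env_prod_outside[OF that[unfolded core_def], of m zs']
    pos[OF z] pos[OF z'] m(2) unfolding zs_def zs'_def shift_x_def by (meson order.trans)+
  have zipn: "mset (zip (?sh ks) (?sh ks')) = shift_pairs (p * a) (mset (zip ks ks'))" for ks ks'
   by (rule shift_pairs_zip)
  have un: "unshift_pairs (p * a) (shift_pairs (p * a) K) = K" for K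
   using unshift_shift_pairs[of 0 "p * a" K] by (simp add: unshift_pairs_def)
  have cB: "\<bar>c us us'\<bar> \<le> B" for us us'
  proof (cases "us \<in> \<S> & us' \<in> \<S>")
   case True
   then obtain ks ks' where k: "us = ?sh ks" "us' = ?sh ks'" "ks \<in> nlists n (p * N)" "ks' \<in> nlists n (p * N)" by (auto simp: \<S>_def)
   show ?thesis using True B(2)[OF k(3,4) nN(1)] by (simp add: c_def k(1,2) zipn un)
  next
   case False
   hence "c us us' = 0" unfolding c_def by (rule if_not_P)
   thus ?thesis using B(1) by simp
  qed
  have oB: "\<bar>o2 us us'\<bar> \<le> B" if "us \<in> ?A" "us' \<in> ?A" for us us'
   unfolding o2_def by (rule B(2)[OF that nN(2)])
  have coreS: "\<exists>ks. us = ?sh ks & ks \<in> nlists n (p * N) & (\<forall>k\<in>set ks. p * d0 \<le> k & k < p * (N - d0))"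
   if us: "us \<in> ?A" "core us" for us
  proof (intro exI[of _ "map (\<lambda>k. k - p * a) us"] conjI)
   have b: "p * d0 + p * a \<le> k & k < p * (N - d0) + p * a" if "k \<in> set us" for k
    using us(2) that unfolding core_def distrib_left by blast
   show "us = ?sh (map (\<lambda>k. k - p * a) us)" by (rule sym) (simp add: map_idI, use b in \<open>fastforce intro!: map_idI\<close>)
   show *: "\<forall>k\<in>set (map (\<lambda>k. k - p * a) us). p * d0 \<le> k & k < p * (N - d0)"
   proof
    fix k assume "k \<in> set (map (\<lambda>k. k - p * a) us)"
    then obtain k' where "k = k' - p * a" "k' \<in> set us" by auto
    with b[of k'] show "p * d0 \<le> k & k < p * (N - d0)" by linarith
   qed
   have "p * (N - d0) \<le> p * N" by simp
   hence "\<forall>k\<in>set (map (\<lambda>k. k - p * a) us). k < p * N" using * order.strict_trans2 by blast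
   thus "map (\<lambda>k. k - p * a) us \<in> nlists n (p * N)" using us(1) by (auto simp: nlists_def)
  qed
  have coreE: "\<bar>c us us' - o2 us us'\<bar> \<le> e / (2 * K0)" if us: "us \<in> ?A" "core us" "us' \<in> ?A" "core us'" for us us'
  proof -
   from coreS[OF us(1,2)] obtain ks where k: "us = ?sh ks" "ks \<in> nlists n (p * N)" "\<forall>k\<in>set ks. p * d0 \<le> k & k < p * (N - d0)" by blast
   from coreS[OF us(3,4)] obtain ks' where k': "us' = ?sh ks'" "ks' \<in> nlists n (p * N)" "\<forall>k\<in>set ks'. p * d0 \<le> k & k < p * (N - d0)" by blast
   have "\<bar>occ N (mset (zip ks ks')) - occ N' (shift_pairs (p * a) (mset (zip ks ks')))\<bar> \<le> e / (2 * K0)"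
   proof (rule d0(2)[OF _ N2 N(2)])
    show "size (mset (zip ks ks')) = n" using k(2) k'(2) by (auto simp: nlists_def)
    fix x y assume "(x, y) \<in># mset (zip ks ks')"
    hence "x \<in> set ks" "y \<in> set ks'" by (auto dest: set_zip_leftD set_zip_rightD)
    thus "p * d0 \<le> x & x < p * (N - d0) & p * d0 \<le> y & y < p * (N - d0)" using k(3) k'(3) by blast
   qed
   moreover have "us \<in> \<S>" "us' \<in> \<S>" using k k' by (auto simp: \<S>_def)
   ultimately show ?thesis by (simp add: c_def o2_def k(1) k'(1) zipn un)
  qed
  have bound: "norm (of_real ((c us us' - o2 us us') / cmass ^ n) * (phase n a z z' * orb_prod n us us' zs zs'))
    \<le> ?b * (C / cmass ^ n) * (env_prod n us zs * env_prod n us' zs')"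
   if us: "us \<in> ?A" "us' \<in> ?A" for us us'
  proof -
   define E E' where "E = env_prod n us zs" and "E' = env_prod n us' zs'"
   have E: "0 \<le> E" "E \<le> 1" "0 \<le> E'" "E' \<le> 1" by (auto simp: E_def E'_def env_prod_bounds)
   have sq: "E^2 \<le> E" "E'^2 \<le> E'" using E by (auto simp: power2_eq_square mult_left_le)
   \<comment> \<open>Of each squared envelope one power is kept for the summation. Outside the core
     the spare power is at most \<open>\<eta>\<close>.\<close>
   have "\<bar>c us us' - o2 us us'\<bar> * (E^2 * E'^2) \<le> ?b * (E * E')"
   proof (cases "core us & core us'")
    case True
    hence "\<bar>c us us' - o2 us us'\<bar> * (E^2 * E'^2) \<le> e / (2 * K0) * (E * E')"
     using us E sq e K0 by (intro mult_mono coreE) auto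
    also have "... \<le> ?b * (E * E')" using E B(1) \<eta> by (intro mult_right_mono) auto
    finally show ?thesis .
   next
    case False
    hence "E \<le> \<eta> \<or> E' \<le> \<eta>" using env us by (auto simp: E_def E'_def)
    hence "E^2 * E'^2 \<le> \<eta> * (E * E')"
    proof
     assume "E \<le> \<eta>"
     hence "E^2 * E'^2 \<le> (\<eta> * E) * E'" unfolding power2_eq_square[of E] using E sq by (intro mult_mono) auto
     thus ?thesis by simp
    next
     assume "E' \<le> \<eta>"
     hence "E^2 * E'^2 \<le> E * (\<eta> * E')" unfolding power2_eq_square[of E'] using E sq by (intro mult_mono) auto
     thus ?thesis by (simp add: mult_ac)
    qed
    moreover have "\<bar>c us us' - o2 us us'\<bar> \<le> 2 * B" using cB[of us us'] oB[OF us] by linarith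
    ultimately have "\<bar>c us us' - o2 us us'\<bar> * (E^2 * E'^2) \<le> 2 * B * (\<eta> * (E * E'))"
     using mult_mono[of "\<bar>c us us' - o2 us us'\<bar>" "2 * B" "E^2 * E'^2" "\<eta> * (E * E')"] B(1) by simp
    also have "... \<le> ?b * (E * E')"
     using E e K0 by (simp add: distrib_right mult.assoc)
    finally show ?thesis .
   qed
   moreover have "norm (orb_prod n us us' zs zs') \<le> C * (E^2 * E'^2)" unfolding E_def E'_def by (rule C(2))
   ultimately have "\<bar>c us us' - o2 us us'\<bar> * norm (orb_prod n us us' zs zs') \<le> C * (?b * (E * E'))"
   proof -
    assume 1: "\<bar>c us us' - o2 us us'\<bar> * (E^2 * E'^2) \<le> ?b * (E * E')"
     and 2: "norm (orb_prod n us us' zs zs') \<le> C * (E^2 * E'^2)"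
    have "\<bar>c us us' - o2 us us'\<bar> * norm (orb_prod n us us' zs zs') \<le> \<bar>c us us' - o2 us us'\<bar> * (C * (E^2 * E'^2))"
     by (rule mult_left_mono[OF 2]) simp
    also have "... = C * (\<bar>c us us' - o2 us us'\<bar> * (E^2 * E'^2))" by (simp only: mult_ac)
    also have "... \<le> C * (?b * (E * E'))" using C(1) by (intro mult_left_mono[OF 1]) simp
    finally show ?thesis .
   qed
   hence "\<bar>c us us' - o2 us us'\<bar> * norm (orb_prod n us us' zs zs') / cmass ^ n \<le> C * (?b * (E * E')) / cmass ^ n"
    using cmass_pos by (intro divide_right_mono) auto
   thus ?thesis using cmass_pos by (simp add: norm_mult norm_divide norm_power E_def E'_def mult_ac del: of_real_diff)
  qed
  have df: "rhoN N n z z' - phase n a z z' * rhoN N' n zs zs'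
    = (\<Sum>us\<in>?A. \<Sum>us'\<in>?A. of_real ((c us us' - o2 us us') / cmass ^ n) * (phase n a z z' * orb_prod n us us' zs zs'))"
  proof -
   have "rhoN N n z z' = (\<Sum>us\<in>?A. \<Sum>us'\<in>?A. of_real (c us us' / cmass ^ n) * (phase n a z z' * orb_prod n us us' zs zs'))"
    unfolding c_def zs_def zs'_def \<S>_def by (rule rho_fin_shifted_sum[OF nN(1) N(2)])
   moreover have "phase n a z z' * rhoN N' n zs zs' = (\<Sum>us\<in>?A. \<Sum>us'\<in>?A. of_real (o2 us us' / cmass ^ n) * (phase n a z z' * orb_prod n us us' zs zs'))"
    unfolding rho_fin_orb_prod[OF nN(2)] sum_distrib_left o2_def by (intro sum.cong refl) (simp only: mult_ac)
   ultimately show ?thesis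
    by (simp only: sum_subtractf[symmetric] left_diff_distrib[symmetric] of_real_diff[symmetric] diff_divide_distrib[symmetric])
  qed
  have "norm (rhoN N n z z' - phase n a z z' * rhoN N' n zs zs') \<le> (\<Sum>us\<in>?A. \<Sum>us'\<in>?A. ?b * (C / cmass ^ n) * (env_prod n us zs * env_prod n us' zs'))"
   unfolding df by (intro sum_norm_le bound)
  also have "... = ?b * (C / cmass ^ n) * ((\<Sum>us\<in>?A. env_prod n us zs) * (\<Sum>us'\<in>?A. env_prod n us' zs'))"
   unfolding sum_product unfolding sum_distrib_left by (rule refl)
  also have "... \<le> ?b * (C / cmass ^ n) * (S * S)"
   unfolding S_def using e K0 B(1) \<eta> C(1) cmass_pos
   by (intro mult_left_mono mult_mono sum_env_prod sum_nonneg) (auto simp: env_prod_bounds)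
  also have "... = ?b * K0" by (simp add: K0_def mult_ac)
  also have "... = e" using K0 B(1) by (simp add: \<eta>_def field_simps)
  finally show "norm (rhoN N n z z' - phase n a z z' * rhoN N' n (shift_x (real a * per) z) (shift_x (real a * per) z')) \<le> e"
   by (simp add: zs_def zs'_def)
 qed
qed

section \<open>Construction and periodicity of the infinite-volume correlation functions\<close>

definition rho_shifted :: "nat => (nat => complex) => (nat => complex) => nat => complex" where
 "rho_shifted n z z' M = phase n M z z' * rhoN (2 * M) n (shift_x (real M * per) z) (shift_x (real M * per) z')"

definition rho_inf :: "nat => (nat => complex) => (nat => complex) => complex" where
 "rho_inf n z z' = lim (rho_shifted n z z')"

lemma shift_x_shift_x: "shift_x s (shift_x t z) = shift_x (t + s) z"
 by (simp add: shift_x_def add.assoc)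

lemma eventually_bulk:
 "eventually (\<lambda>M. d \<le> real (2 * M) & (\<forall>i<n. d \<le> Re (shift_x (real M * per) z i) & Re (shift_x (real M * per) z i) \<le> per * real (2 * M) - d)) sequentially"
proof -
 have "eventually (\<lambda>M. d \<le> real M * per + x & real M * per + x \<le> per * real (2 * M) - d) sequentially" for x
 proof -
  have "filterlim (\<lambda>M. real M * per) at_top sequentially"
   by (rule filterlim_at_top_mult_tendsto_pos[OF tendsto_const per_pos filterlim_real_sequentially])
  hence "eventually (\<lambda>M. d + \<bar>x\<bar> \<le> real M * per) sequentially" by (simp add: filterlim_at_top)
  thus ?thesis by eventually_elim (auto simp: algebra_simps)
 qed
 hence "eventually (\<lambda>M. \<forall>i\<in>{..<n}. d \<le> real M * per + Re (z i) & real M * per + Re (z i) \<le> per * real (2 * M) - d) sequentially"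
  by (intro eventually_ball_finite) auto
 moreover have "eventually (\<lambda>M. d \<le> real M) sequentially"
  using filterlim_real_sequentially by (simp add: filterlim_at_top)
 ultimately show ?thesis
  by eventually_elim (auto simp: shift_x_def add.commute)
qed

text \<open>The points are moved by \<open>M\<close> periods into a box of \<open>2 * M\<close>
  particles, so their distance to both ends grows. Two such approximations differ by a shift, and
  the phases compose by \<open>phase_add\<close>.\<close>

lemma rho_shifted_Cauchy: "Cauchy (rho_shifted n z z')"
proof (rule CauchyI')
 fix e :: real assume "e > 0"
 hence e: "e / 2 > 0" by simp
 obtain d where d: "!!N N' a z z'. d \<le> real N ==> N + a \<le> N' ==>
   (!!i. i < n ==> d \<le> Re (z i) & Re (z i) \<le> per * real N - d) ==>
   (!!i. i < n ==> d \<le> Re (z' i) & Re (z' i) \<le> per * real N - d) ==>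
   norm (rhoN N n z z' - phase n a z z' * rhoN N' n (shift_x (real a * per) z) (shift_x (real a * per) z')) \<le> e / 2"
  by (rule rho_fin_shift_invariant[OF e, of n]) blast
 obtain M0 where M0: "!!M. M0 \<le> M ==> (d \<le> real (2 * M) & (\<forall>i<n. d \<le> Re (shift_x (real M * per) z i) & Re (shift_x (real M * per) z i) \<le> per * real (2 * M) - d))
   & (d \<le> real (2 * M) & (\<forall>i<n. d \<le> Re (shift_x (real M * per) z' i) & Re (shift_x (real M * per) z' i) \<le> per * real (2 * M) - d))"
  using eventually_conj[OF eventually_bulk[of d n z] eventually_bulk[of d n z']] unfolding eventually_sequentially by blast
 have "dist (rho_shifted n z z' M) (rho_shifted n z z' M') < e" if M: "M0 \<le> M" "M < M'" for M M'
 proof -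
  have Ma: "real M * per + real (M' - M) * per = real M' * per" using M by (simp add: of_nat_diff algebra_simps)
  have Mb: "M + (M' - M) = M'" using M by simp
  let ?z = "shift_x (real M * per) z" and ?z' = "shift_x (real M * per) z'"
  have "norm (rhoN (2 * M) n ?z ?z' - phase n (M' - M) ?z ?z' * rhoN (2 * M') n (shift_x (real (M' - M) * per) ?z) (shift_x (real (M' - M) * per) ?z')) \<le> e / 2"
   by (rule d) (use M0[OF M(1)] M in auto)
  hence "norm (phase n M z z' * (rhoN (2 * M) n ?z ?z' - phase n (M' - M) z z' * rhoN (2 * M') n (shift_x (real M' * per) z) (shift_x (real M' * per) z'))) \<le> e / 2"
   by (simp only: norm_mult norm_phase shift_x_shift_x Ma phase_shift mult_1)
  also have "phase n M z z' * (rhoN (2 * M) n ?z ?z' - phase n (M' - M) z z' * rhoN (2 * M') n (shift_x (real M' * per) z) (shift_x (real M' * per) z'))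
   = rho_shifted n z z' M - rho_shifted n z z' M'"
   using phase_add[of n M "M' - M" z z'] unfolding Mb by (simp add: rho_shifted_def right_diff_distrib mult.assoc)
  finally show ?thesis using \<open>e > 0\<close> by (simp add: dist_norm)
 qed
 thus "\<exists>M. \<forall>m\<ge>M. \<forall>n'>m. dist (rho_shifted n z z' m) (rho_shifted n z z' n') < e" by blast
qed

lemma rho_shifted_tendsto: "rho_shifted n z z' \<longlonglongrightarrow> rho_inf n z z'"
 using Cauchy_convergent[OF rho_shifted_Cauchy, of n z z'] by (simp add: rho_inf_def convergent_LIMSEQ_iff)

text \<open>A box of \<open>N\<close> particles is compared with the approximations of index
  \<open>M \<ge> N\<close>, into which it fits after the shift by \<open>M\<close>; the bound
  survives the limit in \<open>M\<close>.\<close>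

lemma rho_fin_near_rho_inf:
 assumes e: "e > 0"
 obtains d where "!!N z z'. d \<le> real N ==>
   (!!i. i < n ==> d \<le> Re (z i) & Re (z i) \<le> per * real N - d) ==>
   (!!i. i < n ==> d \<le> Re (z' i) & Re (z' i) \<le> per * real N - d) ==>
   norm (rhoN N n z z' - rho_inf n z z') \<le> e"
proof -
 obtain d where d: "!!N N' a z z'. d \<le> real N ==> N + a \<le> N' ==>
   (!!i. i < n ==> d \<le> Re (z i) & Re (z i) \<le> per * real N - d) ==>
   (!!i. i < n ==> d \<le> Re (z' i) & Re (z' i) \<le> per * real N - d) ==>
   norm (rhoN N n z z' - phase n a z z' * rhoN N' n (shift_x (real a * per) z) (shift_x (real a * per) z')) \<le> e"
  by (rule rho_fin_shift_invariant[OF e, of n]) blast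
 show thesis
 proof (rule that[of d])
  fix N z z'
  assume N: "d \<le> real N" "!!i. i < n ==> d \<le> Re (z i) & Re (z i) \<le> per * real N - d"
   "!!i. i < n ==> d \<le> Re (z' i) & Re (z' i) \<le> per * real N - d"
  show "norm (rhoN N n z z' - rho_inf n z z') \<le> e"
  proof (rule LIMSEQ_le_const2)
   show "(\<lambda>M. norm (rhoN N n z z' - rho_shifted n z z' M)) \<longlonglongrightarrow> norm (rhoN N n z z' - rho_inf n z z')"
    by (intro tendsto_intros rho_shifted_tendsto)
   have "norm (rhoN N n z z' - rho_shifted n z z' M) \<le> e" if "N \<le> M" for M
    unfolding rho_shifted_def by (rule d) (use N that in auto)
   thus "\<exists>M0. \<forall>M\<ge>M0. norm (rhoN N n z z' - rho_shifted n z z' M) \<le> e" by blast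
  qed
 qed
qed

lemma is_bulk_limit_rho_inf: "is_bulk_limit l R p n (rho_inf n)"
 unfolding is_bulk_limit_def
proof (intro allI impI)
 fix e :: real assume "e > 0"
 hence e: "e / 2 > 0" by simp
 obtain d where d: "!!N z z'. d \<le> real N ==>
   (!!i. i < n ==> d \<le> Re (z i) & Re (z i) \<le> per * real N - d) ==>
   (!!i. i < n ==> d \<le> Re (z' i) & Re (z' i) \<le> per * real N - d) ==>
   norm (rhoN N n z z' - rho_inf n z z') \<le> e / 2"
  by (rule rho_fin_near_rho_inf[OF e, of n]) blast
 have "cmod (rhoN N n z z' - rho_inf n z z') < e"
  if N: "nat \<lceil>d\<rceil> \<le> N" and z: "z \<in> bulk_configs l R p N n d" "z' \<in> bulk_configs l R p N n d" for N z z'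
 proof -
  have pn: "real p * real N * l^2 / R = per * real N" by (simp add: per_def)
  have "d \<le> real N" using N by linarith
  hence "norm (rhoN N n z z' - rho_inf n z z') \<le> e / 2"
   by (rule d) (use z in \<open>auto simp: bulk_configs_def pn\<close>)
  thus ?thesis using \<open>e > 0\<close> by linarith
 qed
 thus "\<exists>d N0. \<forall>N\<ge>N0. \<forall>z\<in>bulk_configs l R p N n d. \<forall>z'\<in>bulk_configs l R p N n d. cmod (rhoN N n z z' - rho_inf n z z') < e"
  by blast
qed

text \<open>The approximation of index \<open>M\<close> at the translated points uses the same
  shifted points as the one of index \<open>M + 1\<close> at the original points. They differ only
  by the size of the box, and all phases are trivial on the diagonal.\<close>

lemma rho_inf_periodic: "rho_inf n (shift_x per z) (shift_x per z) = rho_inf n z z"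
proof (rule ccontr)
 assume ne: "rho_inf n (shift_x per z) (shift_x per z) \<noteq> rho_inf n z z"
 define e where "e = norm (rho_inf n (shift_x per z) (shift_x per z) - rho_inf n z z) / 2"
 have e: "e > 0" using ne by (simp add: e_def)
 obtain d where d: "!!N N' a z z'. d \<le> real N ==> N + a \<le> N' ==>
   (!!i. i < n ==> d \<le> Re (z i) & Re (z i) \<le> per * real N - d) ==>
   (!!i. i < n ==> d \<le> Re (z' i) & Re (z' i) \<le> per * real N - d) ==>
   norm (rhoN N n z z' - phase n a z z' * rhoN N' n (shift_x (real a * per) z) (shift_x (real a * per) z')) \<le> e"
  by (rule rho_fin_shift_invariant[OF e, of n]) blast
 let ?w = "shift_x per z"
 obtain M0 where M0: "!!M. M0 \<le> M ==> d \<le> real (2 * M) & (\<forall>i<n. d \<le> Re (shift_x (real M * per) ?w i) & Re (shift_x (real M * per) ?w i) \<le> per * real (2 * M) - d)"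
  using eventually_bulk[of d n ?w] unfolding eventually_sequentially by blast
 have "norm (rho_shifted n ?w ?w M - rho_shifted n z z (Suc M)) \<le> e" if "M0 \<le> M" for M
 proof -
  have *: "shift_x (real (Suc M) * per) z = shift_x (real M * per) ?w" by (simp add: shift_x_shift_x distrib_right add.commute)
  have "norm (rhoN (2 * M) n (shift_x (real M * per) ?w) (shift_x (real M * per) ?w) - phase n 0 (shift_x (real M * per) ?w) (shift_x (real M * per) ?w)
    * rhoN (2 * Suc M) n (shift_x (real 0 * per) (shift_x (real M * per) ?w)) (shift_x (real 0 * per) (shift_x (real M * per) ?w))) \<le> e"
   by (rule d) (use M0[OF that] in auto)
  thus ?thesis unfolding rho_shifted_def * phase_same shift_x_shift_x by simp
 qed
 moreover have "(\<lambda>M. norm (rho_shifted n ?w ?w M - rho_shifted n z z (Suc M))) \<longlonglongrightarrow> norm (rho_inf n ?w ?w - rho_inf n z z)"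
  by (intro tendsto_intros rho_shifted_tendsto LIMSEQ_Suc)
 ultimately have "norm (rho_inf n ?w ?w - rho_inf n z z) \<le> e"
  by (intro LIMSEQ_le_const2) auto
 thus False using e by (simp add: e_def)
qed

end

section \<open>Symmetry breaking\<close>

lemma norm_cis_diff_le: "norm (cis a - cis b) \<le> \<bar>a - b\<bar>"
proof -
 have 1: "norm (cis t - 1) \<le> \<bar>t\<bar>" for t
 proof (rule power2_le_imp_le)
  have "(norm (cis t - 1))^2 = 2 - 2 * cos t"
   unfolding cmod_power2 using sin_cos_squared_add[of t] by (simp add: power2_diff)
  also have "... = 4 * (sin (t / 2))^2" using cos_double_sin[of "t / 2"] by simp
  also have "... \<le> 4 * \<bar>t / 2\<bar>^2"
   using power_mono[OF abs_sin_x_le_abs_x[of "t / 2"], of 2] by simp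
  finally show "(norm (cis t - 1))^2 \<le> \<bar>t\<bar>^2" by (simp add: power_divide)
 qed simp
 have "cis a - cis b = cis b * (cis (a - b) - 1)" by (simp add: right_diff_distrib cis_mult)
 thus ?thesis using 1[of "a - b"] by (simp add: norm_mult)
qed

lemma norm_prod_mset_diff:
 fixes f g :: "'a => complex"
 assumes "!!x. x \<in># M ==> norm (f x) \<le> 1" "!!x. x \<in># M ==> norm (g x) \<le> 1"
 shows "norm ((\<Prod>x\<in>#M. f x) - (\<Prod>x\<in>#M. g x)) \<le> (\<Sum>x\<in>#M. norm (f x - g x))"
 using assms
proof (induction M)
 case (add x M)
 let ?F = "\<Prod>x\<in>#M. f x" and ?G = "\<Prod>x\<in>#M. g x"
 have G: "norm ?G \<le> 1" using add.prems(2)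
  by (induction M) (auto simp: norm_mult intro!: mult_le_one)
 have "f x * ?F - g x * ?G = f x * (?F - ?G) + (f x - g x) * ?G" by (simp add: algebra_simps)
 also have "norm ... \<le> 1 * (\<Sum>x\<in>#M. norm (f x - g x)) + norm (f x - g x) * 1"
 proof (intro order.trans[OF norm_triangle_ineq] add_mono)
  have "norm (?F - ?G) \<le> (\<Sum>x\<in>#M. norm (f x - g x))" using add.prems by (intro add.IH) auto
  thus "norm (f x * (?F - ?G)) \<le> 1 * (\<Sum>x\<in>#M. norm (f x - g x))"
   unfolding norm_mult using add.prems(1)[of x] by (intro mult_mono) auto
  show "norm ((f x - g x) * ?G) \<le> norm (f x - g x) * 1"
   unfolding norm_mult using G by (intro mult_left_mono) auto
 qed
 finally show ?case by simp
qed simp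

definition ramp :: "real => real" where "ramp u = max 0 (min 1 u)"

text \<open>The three regimes before, after and along the ramp. Exponential errors are chosen
  because they are integrable against the Gaussian orbitals and become exponentials in the distance
  of the orbital.\<close>

lemma ramp_bounds:
 fixes X L :: real
 assumes L: "L > 0"
 shows "\<bar>ramp (X / L)\<bar> \<le> exp X / L" "\<bar>ramp (X / L) - 1\<bar> \<le> exp (L - X) / L" (is ?g2)
  "\<bar>ramp (X / L) - X / L\<bar> \<le> (exp (- X) + exp (X - L)) / L" (is ?g3)
proof -
 have e: "Y / L \<le> exp Y / L" "0 \<le> exp Y / L" for Y
 proof -
  have "Y \<le> exp Y" using exp_ge_add_one_self[of Y] by linarith
  thus "Y / L \<le> exp Y / L" "0 \<le> exp Y / L" using L by (simp_all add: divide_right_mono)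
 qed
 have l: "(L - X) / L = 1 - X / L" "(X - L) / L = X / L - 1" "(- X) / L = - (X / L)"
  using L by (simp_all add: diff_divide_distrib)
 show "\<bar>ramp (X / L)\<bar> \<le> exp X / L" using e[of X] by (simp add: ramp_def max_def min_def)
 show ?g2 using e[of "L - X"] unfolding l by (simp add: ramp_def max_def min_def)
 show ?g3
 proof -
  define v where "v = X / L"
  show ?thesis using e[of "- X"] e[of "X - L"] unfolding l add_divide_distrib v_def[symmetric]
   by (simp add: ramp_def max_def min_def)
 qed
qed

lemma tri_real: "real (tri q j) = real q * (real j * (real j - 1) / 2)"
 by (induction j) (auto simp: tri_def algebra_simps)

lemma prod_mset_cis:
 "(\<Prod>x\<in>#B. cis (c * (real x / q - y))) = cis (c * (real (sum_mset B) / q - real (size B) * y))"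
 by (induction B) (auto simp: cis_mult algebra_simps add_divide_distrib)

text \<open>\<open>\<alpha>\<close> and \<open>\<beta>\<close> are the distances of the renewals
  from the ends of the ramp. They enter at order \<open>1 / L\<close>, except for the phase
  \<open>- 2 * pi * \<beta>\<close>; as \<open>j\<close> and \<open>L\<close> are integers, this
  equals \<open>2 * pi * y\<close> up to full turns. That is where the dependence on the position
  comes from.\<close>

lemma block_phase:
 fixes L i j :: nat and y :: real
 defines "\<alpha> \<equiv> y - real i" and "\<beta> \<equiv> real j - y - real L"
 assumes L: "L \<ge> 1"
 shows "cis (- (2 * pi / real L) * ((real j * (real j - 1) / 2 - real i * (real i - 1) / 2) - (real j - real i) * y))
  = cis (2 * pi * y - pi * (real L - 1) - pi * ((\<alpha> + \<beta>) * (\<beta> - \<alpha> - 1)) / real L)"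
proof -
 have i: "real i = y - \<alpha>" and j: "real j = y + real L + \<beta>" by (simp_all add: \<alpha>_def \<beta>_def)
 have "(real j * (real j - 1) / 2 - real i * (real i - 1) / 2) - (real j - real i) * y
   = (real L * (real L - 1) + 2 * real L * \<beta> + (\<alpha> + \<beta>) * (\<beta> - \<alpha> - 1)) / 2"
  unfolding i j by (simp add: field_simps power2_eq_square)
 hence "- (2 * pi / real L) * ((real j * (real j - 1) / 2 - real i * (real i - 1) / 2) - (real j - real i) * y)
   = - (2 * pi / real L) * ((real L * (real L - 1) + 2 * real L * \<beta> + (\<alpha> + \<beta>) * (\<beta> - \<alpha> - 1)) / 2)" by (simp only:)
 also have "... = - (pi * (real L - 1)) - 2 * pi * \<beta> - pi * ((\<alpha> + \<beta>) * (\<beta> - \<alpha> - 1)) / real L"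
  using L by (simp add: field_simps)
 also have "... = (2 * pi * y - pi * (real L - 1) - pi * ((\<alpha> + \<beta>) * (\<beta> - \<alpha> - 1)) / real L) + 2 * pi * of_int (int L - int j)"
  by (simp add: \<beta>_def algebra_simps)
 finally show ?thesis by (simp only: cis_mult[symmetric] cis_multiple_2pi[OF Ints_of_int] mult_1_right)
qed

context laughlin_cyl begin

definition hat_const :: real where "hat_const = enn2real (mass (1 / per)) / cmass"

lemma hat_const_nonneg: "hat_const \<ge> 0"
 using cmass_pos by (simp add: hat_const_def)

lemma integrable_gauss_exp: "integrable (cyl_measure R) (\<lambda>z. gauss (Re z - s) * exp (L * \<bar>Re z - s\<bar>))"
 and integral_gauss_exp: "(\<integral>z. gauss (Re z - s) * exp (L * \<bar>Re z - s\<bar>) \<partial>cyl_measure R) = enn2real (mass L)"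
proof -
 have m: "(\<lambda>z. gauss (Re z - s) * exp (L * \<bar>Re z - s\<bar>)) \<in> borel_measurable (cyl_measure R)" by measurable
 show "integrable (cyl_measure R) (\<lambda>z. gauss (Re z - s) * exp (L * \<bar>Re z - s\<bar>))"
  by (intro integrableI_nonneg m) (use mass_finite[of L] in \<open>auto simp: mass_translate less_imp_le\<close>)
 show "(\<integral>z. gauss (Re z - s) * exp (L * \<bar>Re z - s\<bar>) \<partial>cyl_measure R) = enn2real (mass L)"
  by (subst integral_eq_nn_integral) (use m in \<open>auto simp: mass_translate less_imp_le\<close>)
qed

lemma integrable_gauss_complex:
 fixes h :: "real => complex"
 assumes h: "h \<in> borel_measurable borel" and b: "!!x. norm (h x) \<le> B"
 shows "integrable (cyl_measure R) (\<lambda>z. of_real (gauss (Re z - del * real k)) * h (Re z))"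
 using integrable_orb[OF h b, of k k] by (simp add: orb_mult_cnj_same)

lemma norm_hat_diff_le:
 assumes h: "h \<in> borel_measurable borel" "!!x. norm (h x) \<le> B" and h': "h' \<in> borel_measurable borel" "!!x. norm (h' x) \<le> B'"
  and A: "!!x. norm (h x - h' x) \<le> A * exp (1 / per * \<bar>x - del * real k\<bar>)"
 shows "norm (hat h k - hat h' k) \<le> A * hat_const"
proof -
 note ih = integrable_gauss_complex[OF h, of k] and ih' = integrable_gauss_complex[OF h', of k]
 have df: "hat h k - hat h' k = (\<integral>z. of_real (gauss (Re z - del * real k)) * (h (Re z) - h' (Re z)) \<partial>cyl_measure R) / of_real cmass"
  unfolding hat_def by (simp add: right_diff_distrib Bochner_Integration.integral_diff[OF ih ih'] diff_divide_distrib)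
 have "norm (hat h k - hat h' k) \<le> (\<integral>z. A * (gauss (Re z - del * real k) * exp (1 / per * \<bar>Re z - del * real k\<bar>)) \<partial>cyl_measure R) / cmass"
  unfolding df norm_divide norm_of_real abs_of_pos[OF cmass_pos]
 proof (intro divide_right_mono order.trans[OF integral_norm_bound] integral_mono)
  show "integrable (cyl_measure R) (\<lambda>z. norm (of_real (gauss (Re z - del * real k)) * (h (Re z) - h' (Re z))))"
   using Bochner_Integration.integrable_diff[OF ih ih'] by (simp only: right_diff_distrib[symmetric] integrable_norm)
  show "integrable (cyl_measure R) (\<lambda>z. A * (gauss (Re z - del * real k) * exp (1 / per * \<bar>Re z - del * real k\<bar>)))"
   by (intro integrable_mult_right integrable_gauss_exp)
  fix z
  have "gauss (Re z - del * real k) * norm (h (Re z) - h' (Re z)) \<le> gauss (Re z - del * real k) * (A * exp (1 / per * \<bar>Re z - del * real k\<bar>))"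
   by (intro mult_left_mono A) (simp add: less_imp_le)
  thus "norm (of_real (gauss (Re z - del * real k)) * (h (Re z) - h' (Re z))) \<le> A * (gauss (Re z - del * real k) * exp (1 / per * \<bar>Re z - del * real k\<bar>))"
   by (simp add: norm_mult mult_ac abs_of_pos)
 qed (use cmass_pos in auto)
 also have "... = A * hat_const"
  by (simp only: integral_mult_right_zero integral_gauss_exp hat_const_def times_divide_eq_right)
 finally show ?thesis .
qed

lemma integral_gauss_odd:
 assumes f: "f \<in> borel_measurable borel" "!!x. \<bar>f x\<bar> \<le> B" and odd: "!!x. f (- x) = - f x"
 shows "(\<integral>z. gauss (Re z) * f (Re z) \<partial>cyl_measure R) = 0"
proof -
 have i: "integrable (cyl_measure R) (\<lambda>z. gauss (Re z) * f (Re z))"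
  using integrable_gauss_bounded[OF f, of 0] by simp
 have m: "(\<lambda>x. ennreal (c * (gauss x * f x))) \<in> borel_measurable borel" for c
  using f(1) by measurable
 have "(\<integral>\<^sup>+z. ennreal (- 1 * (gauss (Re z) * f (Re z))) \<partial>cyl_measure R) = ennreal (2 * pi * R) * (\<integral>\<^sup>+x. ennreal (- 1 * (gauss x * f x)) \<partial>lborel)"
  by (rule nn_integral_cyl_Re[OF m R])
 also have "(\<integral>\<^sup>+x. ennreal (- 1 * (gauss x * f x)) \<partial>lborel) = (\<integral>\<^sup>+x. ennreal (1 * (gauss x * f x)) \<partial>lborel)"
  by (subst nn_integral_real_affine[where c = "-1" and t = 0, OF m]) (simp_all add: odd gauss_def)
 also have "ennreal (2 * pi * R) * ... = (\<integral>\<^sup>+z. ennreal (1 * (gauss (Re z) * f (Re z))) \<partial>cyl_measure R)"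
  by (rule nn_integral_cyl_Re[OF m R, symmetric])
 finally show ?thesis by (simp add: real_lebesgue_integral_def[OF i])
qed

lemma measurable_cis_linear [measurable]: "(\<lambda>x. cis (b * x + c)) \<in> borel_measurable borel"
 by measurable

text \<open>The first order vanishes since the sine is odd. The quadratic bound is essential: about
  \<open>L\<close> particles feel a slope \<open>b\<close> of order \<open>1 / L\<close>, so only
  then does their total error tend to 0.\<close>

lemma norm_hat_cis_0: "norm (hat (\<lambda>x. cis (b * x)) 0 - 1) \<le> (b * per)^2 * hat_const"
proof -
 have ic: "integrable (cyl_measure R) (\<lambda>z. complex_of_real (gauss (Re z) * cos (b * Re z)))"
  and iss: "integrable (cyl_measure R) (\<lambda>z. complex_of_real (gauss (Re z) * sin (b * Re z)))"
  using integrable_gauss_bounded[of "\<lambda>x. cos (b * x)" 1 0] integrable_gauss_bounded[of "\<lambda>x. sin (b * x)" 1 0]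
  by (intro integrable_of_real; simp)+
 have "(\<integral>z. of_real (gauss (Re z - del * real 0)) * cis (b * Re z) \<partial>cyl_measure R)
  = (\<integral>z. complex_of_real (gauss (Re z) * cos (b * Re z)) + \<i> * complex_of_real (gauss (Re z) * sin (b * Re z)) \<partial>cyl_measure R)"
  by (intro Bochner_Integration.integral_cong refl) (simp add: complex_eq_iff)
 also have "... = (\<integral>z. complex_of_real (gauss (Re z) * cos (b * Re z)) \<partial>cyl_measure R) + \<i> * (\<integral>z. complex_of_real (gauss (Re z) * sin (b * Re z)) \<partial>cyl_measure R)"
  by (subst Bochner_Integration.integral_add[OF ic integrable_mult_right[OF iss]]) simp
 also have "(\<integral>z. complex_of_real (gauss (Re z) * sin (b * Re z)) \<partial>cyl_measure R) = 0"
  using integral_gauss_odd[of "\<lambda>x. sin (b * x)" 1] by (simp del: of_real_mult)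
 finally have "hat (\<lambda>x. cis (b * x)) 0 = hat (\<lambda>x. of_real (cos (b * x))) 0" by (simp add: hat_def)
 moreover have "norm (hat (\<lambda>x. of_real (cos (b * x))) 0 - hat (\<lambda>_. 1) 0) \<le> (b * per)^2 * hat_const"
 proof (rule norm_hat_diff_le[where B = 1 and B' = 1])
  fix x :: real
  define t where "t = \<bar>x\<bar> / per"
  have t: "t \<ge> 0" "\<bar>b * x\<bar> = \<bar>b * per\<bar> * t" using per_pos by (simp_all add: t_def abs_mult)
  have "\<bar>sin (b * x / 2)\<bar>^2 \<le> \<bar>b * x / 2\<bar>^2" by (intro power_mono abs_sin_x_le_abs_x) simp
  moreover have "cos (b * x) = 1 - 2 * (sin (b * x / 2))^2" using cos_double_sin[of "b * x / 2"] by simp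
  ultimately have "1 - cos (b * x) \<le> (b * x)^2 / 2" by (simp add: power_divide)
  also have "... = (b * per)^2 * (t^2 / 2)" using t(2) by (metis power2_abs power_mult_distrib times_divide_eq_right)
  also have "... \<le> (b * per)^2 * exp t"
   using exp_lower_Taylor_quadratic[OF t(1)] t(1) by (intro mult_left_mono) auto
  finally have *: "1 - cos (b * x) \<le> (b * per)^2 * exp (1 / per * \<bar>x - del * real 0\<bar>)" by (simp add: t_def)
  show "norm (complex_of_real (cos (b * x)) - 1) \<le> (b * per)^2 * exp (1 / per * \<bar>x - del * real 0\<bar>)"
  proof -
   have "complex_of_real (cos (b * x)) - 1 = of_real (cos (b * x) - 1)" by simp
   hence "norm (complex_of_real (cos (b * x)) - 1) = \<bar>cos (b * x) - 1\<bar>" by (simp only: norm_of_real)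
   also have "... = 1 - cos (b * x)" using cos_le_one[of "b * x"] by linarith
   finally show ?thesis using * by linarith
  qed
 qed auto
 ultimately show ?thesis by (simp add: hat_1)
qed

lemma hat_cis_linear: "hat (\<lambda>x. cis (b * (x - c))) k = cis (b * (del * real k - c)) * hat (\<lambda>x. cis (b * x)) 0"
proof -
 let ?f = "\<lambda>z. of_real (gauss (Re z - del * real k)) * cis (b * (Re z - c))"
 have m: "?f \<in> borel_measurable (cyl_measure R)" by measurable
 have "(\<integral>z. ?f z \<partial>cyl_measure R) = (\<integral>z. ?f (z + of_real (del * real k)) \<partial>cyl_measure R)"
  by (rule integral_cyl_translate[OF m, symmetric])
 also have "... = (\<integral>z. cis (b * (del * real k - c)) * (of_real (gauss (Re z - del * real 0)) * cis (b * Re z)) \<partial>cyl_measure R)"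
 proof (intro Bochner_Integration.integral_cong refl)
  fix z
  have "b * (Re z + del * real k - c) = b * (del * real k - c) + b * Re z" by (simp add: algebra_simps)
  hence "cis (b * (Re z + del * real k - c)) = cis (b * (del * real k - c)) * cis (b * Re z)" by (simp only: cis_mult)
  thus "?f (z + of_real (del * real k)) = cis (b * (del * real k - c)) * (of_real (gauss (Re z - del * real 0)) * cis (b * Re z))"
   by simp
 qed
 finally show ?thesis by (simp add: hat_def)
qed

definition twist :: "nat => real => real => complex" where
 "twist L y x = cis (- (2 * pi * ramp ((x / per - y) / real L)))"

lemma measurable_twist [measurable]: "twist L y \<in> borel_measurable borel"
 unfolding twist_def ramp_def by measurable

lemma norm_twist [simp]: "norm (twist L y x) = 1" by (simp add: twist_def)

lemma norm_hat_le: 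
 assumes h: "h \<in> borel_measurable borel" "!!x. norm (h x) \<le> 1"
 shows "norm (hat h k) \<le> 1"
proof -
 have "norm (\<integral>z. of_real (gauss (Re z - del * real k)) * h (Re z) \<partial>cyl_measure R) \<le> (\<integral>z. gauss (Re z - del * real k) \<partial>cyl_measure R)"
  using integrable_gauss_complex[OF h, of k] h(2)
  by (intro order.trans[OF integral_norm_bound] integral_mono integrable_gauss integrable_norm)
   (auto simp: norm_mult less_imp_le intro!: mult_left_le)
 thus ?thesis using cmass_pos by (simp add: hat_def norm_divide integral_gauss)
qed

lemma norm_hat_twist_diff:
 assumes p: "!!x. \<bar>ramp ((x / per - y) / real L) - u x\<bar> \<le> A / real L * exp (1 / per * \<bar>x - del * real k\<bar>)"
  and u: "u \<in> borel_measurable borel"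
 shows "norm (hat (twist L y) k - hat (\<lambda>x. cis (- (2 * pi * u x))) k) \<le> 2 * pi * hat_const * A / real L"
proof -
 have "norm (hat (twist L y) k - hat (\<lambda>x. cis (- (2 * pi * u x))) k) \<le> (2 * pi * (A / real L)) * hat_const"
 proof (rule norm_hat_diff_le[where B = 1 and B' = 1])
  fix x
  have "norm (twist L y x - cis (- (2 * pi * u x))) \<le> 2 * pi * \<bar>ramp ((x / per - y) / real L) - u x\<bar>"
   unfolding twist_def by (rule order.trans[OF norm_cis_diff_le]) (simp add: abs_mult flip: right_diff_distrib)
  also have "... \<le> 2 * pi * (A / real L * exp (1 / per * \<bar>x - del * real k\<bar>))" by (intro mult_left_mono p) simp
  finally show "norm (twist L y x - cis (- (2 * pi * u x))) \<le> 2 * pi * (A / real L) * exp (1 / per * \<bar>x - del * real k\<bar>)" by simp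
  show "(\<lambda>x. cis (- (2 * pi * u x))) \<in> borel_measurable borel" using u by measurable
 qed auto
 thus ?thesis by (simp add: mult_ac)
qed

lemma exp_per_le: "exp (x / per - y) \<le> exp (real k / real p - y) * exp (1 / per * \<bar>x - del * real k\<bar>)"
 "exp (y - x / per) \<le> exp (y - real k / real p) * exp (1 / per * \<bar>x - del * real k\<bar>)"
proof -
 have "del * real k / per = real k / real p" using del_pos by (simp add: per_del)
 hence "x / per = real k / real p + (x - del * real k) / per" by (simp add: diff_divide_distrib)
 moreover have "\<bar>(x - del * real k) / per\<bar> = 1 / per * \<bar>x - del * real k\<bar>" using per_pos by simp
 ultimately have "x / per - y \<le> (real k / real p - y) + 1 / per * \<bar>x - del * real k\<bar>"
  "y - x / per \<le> (y - real k / real p) + 1 / per * \<bar>x - del * real k\<bar>" by linarith+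
 thus "exp (x / per - y) \<le> exp (real k / real p - y) * exp (1 / per * \<bar>x - del * real k\<bar>)"
  "exp (y - x / per) \<le> exp (y - real k / real p) * exp (1 / per * \<bar>x - del * real k\<bar>)" by (simp_all flip: exp_add)
qed

text \<open>The mean phase of an orbital: nearly 1 before and after the ramp, nearly linear along
  it. The last bound carries an error of order \<open>1 / L^2\<close> for every orbital, while all
  other errors decay away from the ends of the ramp.\<close>

lemma hat_twist_bounds:
 assumes L: "L \<ge> 1"
 shows "norm (hat (twist L y) k - 1) \<le> 2 * pi * hat_const * exp (real k / real p - y) / real L" (is ?g1)
  and "norm (hat (twist L y) k - 1) \<le> 2 * pi * hat_const * exp (y + real L - real k / real p) / real L" (is ?g2)
  and "norm (hat (twist L y) k - cis (- (2 * pi / real L) * (real k / real p - y)))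
   \<le> 2 * pi * hat_const * (exp (y - real k / real p) + exp (real k / real p - (y + real L))) / real L + (2 * pi / real L)^2 * hat_const" (is ?g3)
proof -
 have L0: "real L > 0" using L by simp
 let ?e = "\<lambda>x. exp (1 / per * \<bar>x - del * real k\<bar>)"
 have m: "a \<le> c * d ==> a / real L \<le> c / real L * d" for a c d
  using L0 by (simp add: divide_right_mono)
 have "norm (hat (twist L y) k - hat (\<lambda>x. cis (- (2 * pi * 0))) k) \<le> 2 * pi * hat_const * exp (real k / real p - y) / real L"
 proof (rule norm_hat_twist_diff)
  fix x show "\<bar>ramp ((x / per - y) / real L) - 0\<bar> \<le> exp (real k / real p - y) / real L * ?e x"
   using ramp_bounds(1)[OF L0, of "x / per - y"] m[OF exp_per_le(1)[of x y k]] by linarith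
 qed simp
 thus ?g1 by (simp add: hat_1)
 have "norm (hat (twist L y) k - hat (\<lambda>x. cis (- (2 * pi * 1))) k) \<le> 2 * pi * hat_const * exp (y + real L - real k / real p) / real L"
 proof (rule norm_hat_twist_diff)
  fix x show "\<bar>ramp ((x / per - y) / real L) - 1\<bar> \<le> exp (y + real L - real k / real p) / real L * ?e x"
   using ramp_bounds(2)[OF L0, of "x / per - y"] m[OF exp_per_le(2)[of "y + real L" x k]] by (simp add: algebra_simps)
 qed simp
 moreover have "cis (- (2 * pi)) = 1" by (simp flip: cis_cnj)
 ultimately show ?g2 by (simp add: hat_1)
 define b where "b = - (2 * pi / (real L * per))"
 have b: "(b * per)^2 = (2 * pi / real L)^2" using per_pos by (simp add: b_def power_mult_distrib)
 have "norm (hat (twist L y) k - hat (\<lambda>x. cis (- (2 * pi * ((x / per - y) / real L)))) k)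
   \<le> 2 * pi * hat_const * (exp (y - real k / real p) + exp (real k / real p - (y + real L))) / real L"
 proof (rule norm_hat_twist_diff)
  fix x
  have "exp (- (x / per - y)) + exp ((x / per - y) - real L)
   \<le> (exp (y - real k / real p) + exp (real k / real p - (y + real L))) * ?e x"
   using exp_per_le(2)[of y x k] exp_per_le(1)[of x "y + real L" k] by (simp add: distrib_right diff_diff_eq)
  thus "\<bar>ramp ((x / per - y) / real L) - (x / per - y) / real L\<bar>
   \<le> (exp (y - real k / real p) + exp (real k / real p - (y + real L))) / real L * ?e x"
   using ramp_bounds(3)[OF L0, of "x / per - y"] m by (meson order.trans)
 qed measurable
 moreover have "(\<lambda>x. cis (- (2 * pi * ((x / per - y) / real L)))) = (\<lambda>x. cis (b * (x - y * per)))"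
  using per_pos L0 by (intro ext arg_cong[where f = cis]) (simp add: b_def field_simps)
 moreover have "hat (\<lambda>x. cis (b * (x - y * per))) k = cis (- (2 * pi / real L) * (real k / real p - y)) * hat (\<lambda>x. cis (b * x)) 0"
 proof -
  have "b * (del * real k - y * per) = - (2 * pi / real L) * (real k / real p - y)"
   using del_pos p L0 by (simp add: b_def per_del field_simps)
  thus ?thesis by (simp only: hat_cis_linear)
 qed
 moreover have "norm (cis (- (2 * pi / real L) * (real k / real p - y)) * hat (\<lambda>x. cis (b * x)) 0 - cis (- (2 * pi / real L) * (real k / real p - y)))
   \<le> (2 * pi / real L)^2 * hat_const"
 proof -
  have "c * h - c = c * (h - 1)" for c h :: complex by (simp add: algebra_simps)
  thus ?thesis using norm_hat_cis_0[of b] unfolding b by (simp only: norm_mult norm_cis mult_1)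
 qed
 ultimately show ?g3
  by (simp only:) (rule norm_diff_triangle_le)
qed

end

section \<open>Expectation of the product of phases over all particles\<close>

lemma sum_mset_count: "set_mset M \<subseteq> A ==> finite A ==> (\<Sum>x\<in>#M. f x) = (\<Sum>x\<in>A. real (count M x) * f x)"
proof (induction M)
 case (add x M)
 have "(\<Sum>y\<in>A. real (count (add_mset x M) y) * f y) = (\<Sum>y\<in>A. (if y = x then f y else 0) + real (count M y) * f y)"
  by (intro sum.cong) (auto simp: algebra_simps)
 also have "... = f x + (\<Sum>y\<in>A. real (count M y) * f y)"
  unfolding sum.distrib using add.prems by (simp add: sum.delta)
 finally show ?case using add by simp
qed simp

context laughlin_cyl begin

text \<open>Decays with the distance of the orbital from the two ends of the ramp, measured in
  periods; its sum over a configuration therefore has bounded mean.\<close>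

definition edge_dist :: "nat => real => nat => real" where
 "edge_dist L y x = exp (- \<bar>real x / real p - y\<bar>) + exp (- \<bar>real x / real p - (y + real L)\<bar>)"

lemma edge_dist_nonneg: "edge_dist L y x \<ge> 0" by (simp add: edge_dist_def)

definition twist_limit :: "nat => real => complex" where
 "twist_limit L y = cis (2 * pi * y - pi * (real L - 1))"

text \<open>Each factor is replaced by the exact linear phase between the renewals \<open>i\<close>
  and \<open>j\<close> and by 1 elsewhere. The product of these is determined by the number of
  particles and the momentum between the renewals, hence by \<open>i\<close> and \<open>j\<close>
  alone.\<close>

lemma prod_hat_twist_renewal:
 assumes T: "T \<ge> 0"
 obtains C where "C \<ge> 0" "!!N M i j L y. M \<in> cfg (p * N) N ==> ren_left p i M ==> ren_left p j M ==> L \<ge> 1 ==>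
  real i \<le> y ==> y \<le> real i + T ==> y + real L \<le> real j ==> real j \<le> y + real L + T ==>
  norm ((\<Prod>x\<in>#M. hat (twist L y) x) - twist_limit L y) \<le> C / real L * (1 + (\<Sum>x\<in>#M. edge_dist L y x))"
proof -
 \<comment> \<open>A renewal may lie up to \<open>T\<close> beyond an end of the ramp. There the
   signed distance from that end exceeds the negative absolute distance by at most
   \<open>2 * T\<close>.\<close>
 define A where "A = 2 * pi * hat_const * exp (2 * T)"
 define A' where "A' = (2 * pi)^2 * hat_const"
 define C where "C = A + A' * (1 + 2 * T) + pi * (2 * T * (T + 1))"
 have nn: "A \<ge> 0" "A' \<ge> 0" "C \<ge> 0" using hat_const_nonneg T by (auto simp: A_def A'_def C_def)
 have "norm ((\<Prod>x\<in>#M. hat (twist L y) x) - twist_limit L y) \<le> C / real L * (1 + (\<Sum>x\<in>#M. edge_dist L y x))"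
  if M: "M \<in> cfg (p * N) N" and ren: "ren_left p i M" "ren_left p j M" and L: "L \<ge> 1"
   and ij: "real i \<le> y" "y \<le> real i + T" "y + real L \<le> real j" "real j \<le> y + real L + T" for N M i j L y
 proof -
  define c where "c = - (2 * pi / real L)"
  define inb where "inb x \<longleftrightarrow> p * i \<le> x & x < p * j" for x
  define tg where "tg x = (if inb x then cis (c * (real x / real p - y)) else 1)" for x
  define E where "E = (\<Sum>x\<in>#M. edge_dist L y x)"
  have E: "E \<ge> 0" unfolding E_def by (induction M) (auto simp: edge_dist_nonneg)
  have "real i \<le> real j" using ij by linarith
  hence ij': "i \<le> j" "p * i \<le> p * j" by simp_all
  have pd: "real x / real p \<ge> real i \<longleftrightarrow> p * i \<le> x" "real x / real p < real j \<longleftrightarrow> x < p * j" for x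
   using p by (simp_all add: le_divide_eq divide_less_eq mult.commute flip: of_nat_mult)
  have A1: "2 * pi * hat_const * e / real L \<le> A / real L * d" if "e \<le> exp (2 * T) * d" for e d
  proof -
   have "2 * pi * hat_const * e \<le> 2 * pi * hat_const * (exp (2 * T) * d)" using that hat_const_nonneg by (intro mult_left_mono) auto
   thus ?thesis using L by (simp add: A_def divide_right_mono mult_ac)
  qed
  have ed: "e1 \<le> exp (2 * T) * (e1' + e2')" if "e1 \<le> exp (2 * T) * e1'" "0 \<le> e2'" for e1 e1' e2' :: real
   using that by (simp add: distrib_left add_increasing2)
  have pt: "norm (hat (twist L y) x - tg x) \<le> A / real L * edge_dist L y x + (if inb x then A' / (real L)^2 else 0)" for x
  proof (cases "inb x")
   case True
   let ?m = "real x / real p"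
   have m: "real i \<le> ?m" "?m < real j" using True pd by (auto simp: inb_def)
   have "y - ?m \<le> 2 * T + - \<bar>?m - y\<bar>" "?m - (y + real L) \<le> 2 * T + - \<bar>?m - (y + real L)\<bar>"
    using m ij T by linarith+
   hence "exp (y - ?m) \<le> exp (2 * T) * exp (- \<bar>?m - y\<bar>)" "exp (?m - (y + real L)) \<le> exp (2 * T) * exp (- \<bar>?m - (y + real L)\<bar>)"
    unfolding exp_add[symmetric] by simp_all
   hence "exp (y - ?m) + exp (?m - (y + real L)) \<le> exp (2 * T) * edge_dist L y x"
    unfolding edge_dist_def distrib_left by linarith
   from A1[OF this] hat_twist_bounds(3)[OF L, of y x] show ?thesis
    using True by (simp add: tg_def c_def A'_def power_divide)
  next
   case False
   then consider "x < p * i" | "p * j \<le> x" by (auto simp: inb_def)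
   hence "norm (hat (twist L y) x - 1) \<le> A / real L * edge_dist L y x"
   proof cases
    case 1
    hence "real x / real p < real i" using pd(1)[of x] by linarith
    hence "real x / real p - y \<le> 2 * T + - \<bar>real x / real p - y\<bar>" using ij T by linarith
    hence "exp (real x / real p - y) \<le> exp (2 * T) * exp (- \<bar>real x / real p - y\<bar>)" unfolding exp_add[symmetric] by simp
    thus ?thesis unfolding edge_dist_def
     by (intro order.trans[OF hat_twist_bounds(1)[OF L, of y x]] A1 ed) auto
   next
    case 2
    hence "real j \<le> real x / real p" using pd(2)[of x] by linarith
    hence "y + real L - real x / real p \<le> 2 * T + - \<bar>real x / real p - (y + real L)\<bar>" using ij T by linarith
    hence "exp (y + real L - real x / real p) \<le> exp (2 * T) * exp (- \<bar>real x / real p - (y + real L)\<bar>)" unfolding exp_add[symmetric] by simp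
    thus ?thesis unfolding edge_dist_def add.commute[of "exp (- \<bar>real x / real p - y\<bar>)"]
     by (intro order.trans[OF hat_twist_bounds(2)[OF L, of y x]] A1 ed) auto
   qed
   thus ?thesis using False by (simp add: tg_def)
  qed
  define Bk where "Bk = filter_mset inb M"
  have split: "filter_mset (\<lambda>x. x < p * j) M = filter_mset (\<lambda>x. x < p * i) M + Bk"
  proof (rule multiset_eqI)
   fix x
   have "x < p * j" if "x < p * i" using ij'(2) that by linarith
   thus "count (filter_mset (\<lambda>x. x < p * j) M) x = count (filter_mset (\<lambda>x. x < p * i) M + Bk) x"
    by (auto simp: Bk_def inb_def)
  qed
  have sizeB: "size Bk = j - i" and sumB: "sum_mset Bk = tri p j - tri p i"
   using ren arg_cong[OF split, of size] arg_cong[OF split, of sum_mset] by (auto simp: ren_left_def)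
  have "tri p i \<le> tri p j" unfolding tri_def by (rule sum_mono2) (use ij' in auto)
  hence sumB': "real (sum_mset Bk) / real p = real j * (real j - 1) / 2 - real i * (real i - 1) / 2"
   using p by (simp add: sumB of_nat_diff tri_real field_simps)
  have "(\<Prod>x\<in>#M. tg x) = (\<Prod>x\<in>#Bk. cis (c * (real x / real p - y)))"
   unfolding Bk_def by (induction M) (auto simp: tg_def)
  also have "... = cis (c * ((real j * (real j - 1) / 2 - real i * (real i - 1) / 2) - (real j - real i) * y))"
   unfolding prod_mset_cis sumB' sizeB using ij' by (simp add: of_nat_diff)
  also have "... = cis (2 * pi * y - pi * (real L - 1) - pi * (((y - real i) + (real j - y - real L)) * ((real j - y - real L) - (y - real i) - 1)) / real L)"
   unfolding c_def by (rule block_phase[OF L])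
  finally have tgp: "(\<Prod>x\<in>#M. tg x) = cis (2 * pi * y - pi * (real L - 1) - pi * (((y - real i) + (real j - y - real L)) * ((real j - y - real L) - (y - real i) - 1)) / real L)" .
  have "norm ((\<Prod>x\<in>#M. tg x) - twist_limit L y) \<le> pi * (2 * T * (T + 1)) / real L"
  proof -
   have "norm ((\<Prod>x\<in>#M. tg x) - twist_limit L y) \<le> \<bar>pi * (((y - real i) + (real j - y - real L)) * ((real j - y - real L) - (y - real i) - 1)) / real L\<bar>"
    unfolding tgp twist_limit_def by (rule order.trans[OF norm_cis_diff_le]) simp
   also have "... = pi * (\<bar>(y - real i) + (real j - y - real L)\<bar> * \<bar>(real j - y - real L) - (y - real i) - 1\<bar>) / real L"
    by (simp add: abs_mult)
   also have "... \<le> pi * ((2 * T) * (T + 1)) / real L"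
    using ij T by (intro divide_right_mono mult_left_mono mult_mono) (auto simp: abs_le_iff)
   finally show ?thesis .
  qed
  moreover have "norm ((\<Prod>x\<in>#M. hat (twist L y) x) - (\<Prod>x\<in>#M. tg x)) \<le> A / real L * E + A' * (1 + 2 * T) / real L"
  proof -
   have "norm ((\<Prod>x\<in>#M. hat (twist L y) x) - (\<Prod>x\<in>#M. tg x)) \<le> (\<Sum>x\<in>#M. norm (hat (twist L y) x - tg x))"
    by (rule norm_prod_mset_diff) (auto simp: tg_def intro!: norm_hat_le)
   also have "... \<le> (\<Sum>x\<in>#M. A / real L * edge_dist L y x + (if inb x then A' / (real L)^2 else 0))"
    by (intro sum_mset_mono pt)
   also have "... = A / real L * E + real (size Bk) * (A' / (real L)^2)"
    unfolding E_def Bk_def by (induction M) (auto simp: algebra_simps add_divide_distrib)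
   \<comment> \<open>About \<open>L\<close> particles carry the bulk error \<open>A' / L^2\<close>
     each, which still leaves a factor \<open>1 / L\<close>.\<close>
   also have "... \<le> A / real L * E + (real L * (1 + 2 * T)) * (A' / (real L)^2)"
   proof (intro add_left_mono mult_right_mono)
    have "2 * T \<le> real L * (2 * T)" using L T by (simp add: mult_le_cancel_right1)
    thus "real (size Bk) \<le> real L * (1 + 2 * T)" using ij ij'(1) by (simp add: sizeB of_nat_diff distrib_left)
   qed (use nn in auto)
   also have "(real L * (1 + 2 * T)) * (A' / (real L)^2) = A' * (1 + 2 * T) / real L" using L by (simp add: power2_eq_square)
   finally show ?thesis .
  qed
  ultimately have "norm ((\<Prod>x\<in>#M. hat (twist L y) x) - twist_limit L y)
   \<le> A / real L * E + A' * (1 + 2 * T) / real L + pi * (2 * T * (T + 1)) / real L"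
   using norm_triangle_ineq[of "(\<Prod>x\<in>#M. hat (twist L y) x) - (\<Prod>x\<in>#M. tg x)" "(\<Prod>x\<in>#M. tg x) - twist_limit L y"] by simp
  also have "... \<le> C / real L * (1 + E)"
  proof -
   have "A * E \<le> C * E" using E nn T by (intro mult_right_mono) (auto simp: C_def)
   moreover have "A' * (1 + 2 * T) + pi * (2 * T * (T + 1)) \<le> C" using nn by (simp add: C_def)
   ultimately have "(A * E + A' * (1 + 2 * T) + pi * (2 * T * (T + 1))) / real L \<le> (C * (1 + E)) / real L"
    by (intro divide_right_mono) (auto simp: distrib_left)
   thus ?thesis by (simp add: add_divide_distrib)
  qed
  finally show ?thesis by (simp add: E_def)
 qed
 thus ?thesis using nn(3) that by blast
qed

lemma edge_dist_moment:
 obtains B where "B \<ge> 0" "!!N L y. EL N (\<lambda>M. \<Sum>x\<in>#M. edge_dist L y x) \<le> B"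
proof -
 obtain B where B: "B > 0" "!!N x. EL N (\<lambda>M. real (count M x) ^ 1) \<le> B" by (rule count_power_moment) blast
 define S where "S = 2 / (1 - exp (- (1 / real p)))"
 have S: "(\<Sum>x\<in>A. exp (- \<bar>real x / real p - y\<bar>)) \<le> S" if "finite A" for A y
 proof -
  have "\<bar>real x / real p - y\<bar> = 1 / real p * \<bar>real x - real p * y\<bar>" for x
  proof -
   have "real x / real p - y = 1 / real p * (real x - real p * y)" using p by (simp add: field_simps)
   thus ?thesis by (simp only: abs_mult) simp
  qed
  thus ?thesis using sum_exp_dist_le[of "1 / real p" A "real p * y"] p that by (simp add: S_def)
 qed
 have "EL N (\<lambda>M. \<Sum>x\<in>#M. edge_dist L y x) \<le> B * (S + S)" for N L y
 proof -
  have "EL N (\<lambda>M. \<Sum>x\<in>#M. edge_dist L y x) \<le> EL N (\<lambda>M. \<Sum>x<p * N. edge_dist L y x * real (count M x) ^ 1)"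
   by (rule EL_mono) (subst sum_mset_count[of _ "{..<p * N}"], auto simp: cfg_def mult.commute)
  also have "... = (\<Sum>x<p * N. edge_dist L y x * EL N (\<lambda>M. real (count M x) ^ 1))"
   unfolding EL_sum EL_cmult ..
  also have "... \<le> (\<Sum>x<p * N. edge_dist L y x * B)"
   by (intro sum_mono mult_left_mono B edge_dist_nonneg)
  also have "... = B * ((\<Sum>x<p * N. exp (- \<bar>real x / real p - y\<bar>)) + (\<Sum>x<p * N. exp (- \<bar>real x / real p - (y + real L)\<bar>)))"
   unfolding edge_dist_def sum_distrib_right[symmetric] sum.distrib by (rule mult.commute)
  also have "... \<le> B * (S + S)" using B(1) by (intro mult_left_mono add_mono S) auto
  finally show ?thesis .
 qed
 moreover have "S \<ge> 0" using S[of "{}" 0] by simp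
 ultimately show ?thesis using B(1) that[of "B * (S + S)"] by simp
qed

abbreviation twist_mean :: "nat => nat => real => complex" where
 "twist_mean N L y \<equiv> \<integral>w. (\<Prod>j<N. twist L y (Re (w j))) \<partial>mu N"

text \<open>Windows near both ends of the ramp contain renewals with high probability; the window
  length \<open>T\<close> is fixed by the variance, and only then is \<open>L\<close> taken
  large.\<close>

lemma expectation_twist:
 assumes e: "e > 0"
 obtains L d where "L \<ge> 1" "!!N y. d \<le> y ==> y + real L + d \<le> real N ==>
   norm (twist_mean N L y - twist_limit L y) \<le> e"
proof -
 have e8: "e / 8 > 0" using e by simp
 obtain T d0 where T: "T \<ge> 1" "!!N s. d0 \<le> s ==> s + T + d0 \<le> N ==> EL N (\<lambda>M. (1 - ren_avg s T M)^2) \<le> e / 8"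
  by (rule ren_avg_variance[OF e8]) blast
 obtain B where B: "B \<ge> 0" "!!N L y. EL N (\<lambda>M. \<Sum>x\<in>#M. edge_dist L y x) \<le> B" by (rule edge_dist_moment) blast
 have T1: "real T + 1 \<ge> 0" by simp
 obtain C where C: "C \<ge> 0" "!!N M i j L y. M \<in> cfg (p * N) N ==> ren_left p i M ==> ren_left p j M ==> L \<ge> 1 ==>
  real i \<le> y ==> y \<le> real i + (real T + 1) ==> y + real L \<le> real j ==> real j \<le> y + real L + (real T + 1) ==>
  norm ((\<Prod>x\<in>#M. hat (twist L y) x) - twist_limit L y) \<le> C / real L * (1 + (\<Sum>x\<in>#M. edge_dist L y x))"
  by (rule prod_hat_twist_renewal[OF T1]) blast
 define L where "L = nat \<lceil>2 * C * (1 + B) / e\<rceil> + 1"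
 have L: "L \<ge> 1" by (simp add: L_def)
 have "2 * C * (1 + B) / e \<le> real L" unfolding L_def by linarith
 hence CL: "C / real L * (1 + B) \<le> e / 2" using e L by (simp add: field_simps)
 show thesis
 proof (rule that[OF L])
  fix N y assume y: "real d0 + real T + 2 \<le> y" "y + real L + (real d0 + real T + 2) \<le> real N"
  \<comment> \<open>The windows are adjacent to the ramp on its outer sides. Rounding
    \<open>y\<close> to integers is the reason for \<open>real T + 1\<close> in place of
    \<open>real T\<close>.\<close>
  define s where "s = nat \<lfloor>y\<rfloor> - T"
  define t where "t = nat \<lceil>y\<rceil> + L"
  have s: "real s + real T \<le> y" "y \<le> real s + real T + 1" "d0 \<le> s" and t: "y + real L \<le> real t" "real t \<le> y + real L + 1"
   using y unfolding s_def t_def by linarith+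
  have "real (s + T + d0) \<le> real N" "real (t + T + d0) \<le> real N" "real d0 \<le> real t" using s t y by (auto simp del: of_nat_le_iff)
  hence N: "s + T + d0 \<le> N" "t + T + d0 \<le> N" "d0 \<le> t" by linarith+
  let ?D = "\<lambda>M. (\<Prod>x\<in>#M. hat (twist L y) x) - twist_limit L y" and ?S = "\<lambda>M. \<Sum>x\<in>#M. edge_dist L y x"
  have "twist_mean N L y = (\<Sum>M\<in>cfg (p * N) N. of_real (prb N M) * (\<Prod>x\<in>#M. hat (twist L y) x))"
   by (rule integral_mu_prod_same[where B = 1]) auto
  hence "twist_mean N L y - twist_limit L y = (\<Sum>M\<in>cfg (p * N) N. of_real (prb N M) * ?D M)"
   using sum_prb[of N] by (simp add: right_diff_distrib sum_subtractf flip: sum_distrib_right of_real_sum)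
  hence "norm (twist_mean N L y - twist_limit L y) \<le> EL N (\<lambda>M. norm (?D M))"
   unfolding EL_def by (simp only:) (intro sum_norm_le, simp add: norm_mult prb_nonneg)
  also have "... \<le> EL N (\<lambda>M. C / real L * (1 + ?S M) + (2 * (1 - ren_avg s T M)^2 + 2 * (1 - ren_avg t T M)^2))"
  proof (rule EL_mono)
   fix M assume M: "M \<in> cfg (p * N) N"
   have S0: "0 \<le> ?S M" by (induction M) (auto simp: edge_dist_nonneg)
   show "norm (?D M) \<le> C / real L * (1 + ?S M) + (2 * (1 - ren_avg s T M)^2 + 2 * (1 - ren_avg t T M)^2)"
   proof (cases "(\<exists>i\<in>{s..<s+T}. ren_left p i M) & (\<exists>j\<in>{t..<t+T}. ren_left p j M)")
    case True
    then obtain i j where ij: "i \<in> {s..<s+T}" "ren_left p i M" "j \<in> {t..<t+T}" "ren_left p j M" by blast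
    have b: "real s \<le> real i" "real i + 1 \<le> real s + real T" "real t \<le> real j" "real j + 1 \<le> real t + real T" using ij by auto
    have "norm (?D M) \<le> C / real L * (1 + ?S M)"
     by (rule C(2)[OF M ij(2,4) L]) (use b s t in linarith)+
    thus ?thesis by (simp add: add_increasing2)
   next
    \<comment> \<open>Without a renewal in one of the windows its average is 0, and the trivial
      bound 2 on the difference is covered by the variance terms.\<close>
    case False
    hence "ren_avg s T M = 0 \<or> ren_avg t T M = 0" by (auto simp: ren_avg_def ren_def)
    hence "2 \<le> 2 * (1 - ren_avg s T M)^2 + 2 * (1 - ren_avg t T M)^2" by auto
    moreover have "norm (?D M) \<le> 1 + 1"
    proof (intro order.trans[OF norm_triangle_ineq4] add_mono)
     show "norm (\<Prod>x\<in>#M. hat (twist L y) x) \<le> 1"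
      by (induction M) (auto simp: norm_mult intro!: mult_le_one norm_hat_le)
    qed (simp add: twist_limit_def)
    moreover have "0 \<le> C / real L * (1 + ?S M)" using C(1) S0 by simp
    ultimately show ?thesis by linarith
   qed
  qed
  also have "... = C / real L * (1 + EL N ?S) + (2 * EL N (\<lambda>M. (1 - ren_avg s T M)^2) + 2 * EL N (\<lambda>M. (1 - ren_avg t T M)^2))"
   unfolding EL_add EL_cmult EL_const ..
  also have "... \<le> C / real L * (1 + B) + (2 * (e / 8) + 2 * (e / 8))"
   using C(1) N s by (intro add_mono mult_left_mono B T(2)) auto
  also have "... \<le> e" using CL by linarith
  finally show "norm (twist_mean N L y - twist_limit L y) \<le> e" .
 qed
qed

end

section \<open>Filler particles: replacing a product over all particles by an observable of
  \<open>n\<close> particles\<close>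

lemma prod_minus_1_le:
 fixes f :: "nat => real"
 assumes f: "!!i. i < m ==> \<bar>f i - 1\<bar> \<le> x / q" and x: "x \<ge> 0" and q: "q \<ge> 1"
 shows "\<bar>(\<Prod>i<m. f i) - 1\<bar> \<le> ((1 + x) ^ m - 1) / q"
 using f
proof (induction m)
 case (Suc m)
 define P where "P = (\<Prod>i<m. f i)"
 have IH: "\<bar>P - 1\<bar> \<le> ((1 + x) ^ m - 1) / q" unfolding P_def using Suc.prems by (intro Suc.IH) auto
 have fm: "\<bar>f m - 1\<bar> \<le> x / q" using Suc.prems by simp
 have "x / q \<le> x" using mult_left_mono[OF q x] q by (simp add: divide_le_eq)
 hence fb: "\<bar>f m\<bar> \<le> 1 + x" using fm by linarith
 have "\<bar>P * f m - 1\<bar> = \<bar>f m * (P - 1) + (f m - 1)\<bar>" by (simp add: algebra_simps)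
 also have "... \<le> \<bar>f m\<bar> * \<bar>P - 1\<bar> + \<bar>f m - 1\<bar>" by (metis abs_mult abs_triangle_ineq)
 also have "... \<le> (1 + x) * (((1 + x) ^ m - 1) / q) + x / q"
  using IH fm fb x by (intro add_mono mult_mono) auto
 also have "... = ((1 + x) ^ Suc m - 1) / q" by (simp add: algebra_simps add_divide_distrib[symmetric] diff_divide_distrib[symmetric])
 finally show ?case by (simp add: P_def)
qed simp

lemma falling_fact: "fact m * real (v choose m) = (\<Prod>i<m. real v - real i)"
 by (simp add: binomial_gbinomial gbinomial_prod_rev atLeast0LessThan)

text \<open>\<open>c\<close> is the product of the factors \<open>(n - i) / n\<close> for
  \<open>i < s\<close> and \<open>(v - i) / q\<close> for \<open>i < n - s\<close>. The
  normalisation is chosen so that both are close to 1 when \<open>n\<close> is large against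
  \<open>s^2\<close> and then \<open>q\<close> is large, with \<open>v\<close> close to
  \<open>q\<close>.\<close>

lemma filler_coeff_le:
 fixes n s v :: nat and q :: real
 assumes n: "n \<ge> 1" and q: "q \<ge> 1"
 defines "c \<equiv> (if s \<le> n then fact n / real n ^ n * ((real n / q) ^ (n - s) * real (v choose (n - s))) else 0)"
 shows "\<bar>c - 1\<bar> \<le> (real s)^2 / real n + (1 + (\<bar>real v - q\<bar> + real n)) ^ n / q"
proof (cases "s \<le> n")
 case True
 define a where "a = (\<Prod>i<s. (real n - real i) / real n)"
 define b where "b = (\<Prod>i<n - s. (real v - real i) / q)"
 let ?x = "\<bar>real v - q\<bar> + real n"
 have "fact n = fact s * fact (n - s) * real (n choose s)"
  using binomial_fact_lemma[OF True] by (metis of_nat_fact of_nat_mult)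
 hence f: "fact n = fact (n - s) * (\<Prod>i<s. real n - real i)" using falling_fact[of s n] by (simp add: mult_ac)
 have "a * b = (\<Prod>i<s. real n - real i) / real n ^ s * (fact (n - s) * real (v choose (n - s)) / q ^ (n - s))"
  by (simp add: a_def b_def prod_dividef falling_fact)
 also have "... = fact n / real n ^ s * (real (v choose (n - s)) / q ^ (n - s))" by (simp add: f)
 also have "... = c"
 proof -
  have "real n ^ n = real n ^ s * real n ^ (n - s)" using True by (simp flip: power_add)
  thus ?thesis using n True by (simp add: c_def power_divide)
 qed
 finally have c: "c = a * b" by simp
 have fac: "0 \<le> (real n - real i) / real n & (real n - real i) / real n \<le> 1" if "i < s" for i
  using that True n by (auto simp: divide_le_eq)
 have a01: "0 \<le> a" "a \<le> 1" unfolding a_def by (intro prod_nonneg prod_le_1; use fac in auto)+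
 have "\<bar>a - 1\<bar> = norm ((\<Prod>i<s. (real n - real i) / real n) - (\<Prod>i<s. 1))" by (simp add: a_def)
 also have "... \<le> (\<Sum>i<s. norm ((real n - real i) / real n - 1))"
 proof (rule norm_prod_diff)
  fix i assume "i \<in> {..<s}"
  hence "0 \<le> (real n - real i) / real n" "(real n - real i) / real n \<le> 1" using fac by auto
  thus "norm ((real n - real i) / real n) \<le> 1" unfolding real_norm_def by linarith
 qed simp
 also have "... \<le> (\<Sum>i<s. real s / real n)"
  using n by (intro sum_mono) (simp add: diff_divide_distrib divide_right_mono)
 finally have a: "\<bar>a - 1\<bar> \<le> (real s)^2 / real n" by (simp add: power2_eq_square)
 have "\<bar>b - 1\<bar> \<le> ((1 + ?x) ^ (n - s) - 1) / q"
  unfolding b_def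
 proof (rule prod_minus_1_le[OF _ _ q])
  fix i assume "i < n - s"
  hence "\<bar>real v - real i - q\<bar> \<le> ?x" by linarith
  hence "\<bar>(real v - real i - q) / q\<bar> \<le> ?x / q" using q by (simp add: divide_right_mono abs_divide)
  thus "\<bar>(real v - real i) / q - 1\<bar> \<le> ?x / q" using q by (simp add: diff_divide_distrib)
 qed simp
 also have "... \<le> (1 + ?x) ^ n / q"
 proof -
  have "(1 + ?x) ^ (n - s) \<le> (1 + ?x) ^ n" by (intro power_increasing) auto
  thus ?thesis using q by (intro divide_right_mono) auto
 qed
 finally have b: "\<bar>b - 1\<bar> \<le> (1 + ?x) ^ n / q" .
 have "c - 1 = a * (b - 1) + (a - 1)" by (simp add: c algebra_simps)
 hence "\<bar>c - 1\<bar> \<le> a * \<bar>b - 1\<bar> + \<bar>a - 1\<bar>" using a01 by (metis abs_mult abs_of_nonneg abs_triangle_ineq)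
 also have "a * \<bar>b - 1\<bar> \<le> \<bar>b - 1\<bar>" using a01 by (simp add: mult_left_le_one_le)
 finally show ?thesis using a b by linarith
next
 case False
 hence "real n \<le> real s * real s" using n by (metis less_imp_le linorder_not_le mult_le_mono nat_mult_1 of_nat_le_iff of_nat_mult order.trans)
 hence "1 \<le> (real s)^2 / real n" using n by (simp add: power2_eq_square)
 moreover have "0 \<le> (1 + (\<bar>real v - q\<bar> + real n)) ^ n / q" using q by simp
 ultimately show ?thesis using False by (simp add: c_def)
qed

lemma prod_one_plus_Pow:
 fixes f :: "'a => 'b :: comm_ring_1"
 assumes "finite W" shows "(\<Prod>j\<in>W. 1 + f j) = (\<Sum>S\<in>Pow W. \<Prod>j\<in>S. f j)"
 using assms
proof (induction W)
 case (insert x W)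
 have "(\<Sum>S\<in>Pow (insert x W). \<Prod>j\<in>S. f j) = (\<Sum>S\<in>Pow W. \<Prod>j\<in>S. f j) + (\<Sum>S\<in>insert x ` Pow W. \<Prod>j\<in>S. f j)"
  unfolding Pow_insert using insert.hyps by (intro sum.union_disjoint) auto
 also have "(\<Sum>S\<in>insert x ` Pow W. \<Prod>j\<in>S. f j) = (\<Sum>S\<in>Pow W. \<Prod>j\<in>insert x S. f j)"
  by (rule sum.reindex_cong[of "insert x"]) (use insert.hyps in \<open>auto simp: inj_on_def\<close>)
 also have "... = (\<Sum>S\<in>Pow W. f x * (\<Prod>j\<in>S. f j))"
  using insert.hyps by (intro sum.cong refl prod.insert) (auto intro: finite_subset)
 finally show ?case using insert by (simp add: sum_distrib_left distrib_right sum.distrib)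
qed simp

text \<open>An \<open>n\<close>-subset with nonzero product consists of a set \<open>S\<close> of
  particles on the ramp and \<open>n - card S\<close> fillers, which contribute only through their
  number.\<close>

lemma subsets_with_filler:
 fixes \<phi> :: "'a => complex" and t :: complex
 assumes J: "finite J" and W: "W \<subseteq> J" "!!j. j \<in> J ==> j \<notin> W ==> \<phi> j = 0" and V: "V \<subseteq> J" "V \<inter> W = {}"
 shows "(\<Sum>A | A \<subseteq> J & card A = n. \<Prod>j\<in>A. \<phi> j + (if j \<in> V then t else 0))
   = (\<Sum>S\<in>Pow W. (if card S \<le> n then t ^ (n - card S) * of_nat (card V choose (n - card S)) else 0) * (\<Prod>j\<in>S. \<phi> j))"
  (is "(\<Sum>A | A \<subseteq> J & card A = n. ?F A) = _")
proof -
 have fin: "finite W" "finite V" using J W V finite_subset by blast+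
 have finS: "finite S" if "S \<subseteq> W \<union> V" for S using fin that by (meson finite_UnI finite_subset)
 have "(\<Sum>A | A \<subseteq> J & card A = n. ?F A) = (\<Sum>A | A \<subseteq> W \<union> V & card A = n. ?F A)"
 proof (rule sum.mono_neutral_right)
  show "\<forall>A\<in>{A. A \<subseteq> J & card A = n} - {A. A \<subseteq> W \<union> V & card A = n}. ?F A = 0"
  proof
   fix A assume "A \<in> {A. A \<subseteq> J & card A = n} - {A. A \<subseteq> W \<union> V & card A = n}"
   then obtain j where "A \<subseteq> J" "j \<in> A" "j \<notin> W" "j \<notin> V" by blast
   thus "?F A = 0" using J W(2) by (intro prod_zero[OF finite_subset[OF _ J]]) auto
  qed
 qed (use J W V in auto)
 also have "... = (\<Sum>(S, U)\<in>Sigma {S\<in>Pow W. card S \<le> n} (\<lambda>S. {U. U \<subseteq> V & card U = n - card S}). t ^ (n - card S) * (\<Prod>j\<in>S. \<phi> j))"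
 proof (rule sum.reindex_bij_witness[where j = "\<lambda>A. (A \<inter> W, A \<inter> V)" and i = "\<lambda>(S, U). S \<union> U"])
  fix A assume A: "A \<in> {A. A \<subseteq> W \<union> V & card A = n}"
  hence fA: "finite (A \<inter> W)" "finite (A \<inter> V)" using fin by auto
  have AU: "A \<inter> W \<union> A \<inter> V = A" "(A \<inter> W) \<inter> (A \<inter> V) = {}" using A V by auto
  hence ca: "card (A \<inter> W) + card (A \<inter> V) = n" using A card_Un_disjoint[OF fA] by simp
  show "(case (A \<inter> W, A \<inter> V) of (S, U) => S \<union> U) = A" using AU by simp
  show "(A \<inter> W, A \<inter> V) \<in> Sigma {S\<in>Pow W. card S \<le> n} (\<lambda>S. {U. U \<subseteq> V & card U = n - card S})" using ca by auto
  have "?F A = (\<Prod>j\<in>A \<inter> W. \<phi> j + (if j \<in> V then t else 0)) * (\<Prod>j\<in>A \<inter> V. \<phi> j + (if j \<in> V then t else 0))"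
   using prod.union_disjoint[OF fA AU(2), of "\<lambda>j. \<phi> j + (if j \<in> V then t else 0)"] unfolding AU(1) .
  also have "(\<Prod>j\<in>A \<inter> W. \<phi> j + (if j \<in> V then t else 0)) = (\<Prod>j\<in>A \<inter> W. \<phi> j)" by (intro prod.cong) (use V in auto)
  also have "(\<Prod>j\<in>A \<inter> V. \<phi> j + (if j \<in> V then t else 0)) = (\<Prod>j\<in>A \<inter> V. t)" by (intro prod.cong) (use V W in auto)
  finally show "(case (A \<inter> W, A \<inter> V) of (S, U) => t ^ (n - card S) * (\<Prod>j\<in>S. \<phi> j)) = ?F A"
   using ca by (simp add: mult.commute) (metis add_diff_cancel_left')
 next
  fix SU assume "SU \<in> Sigma {S\<in>Pow W. card S \<le> n} (\<lambda>S. {U. U \<subseteq> V & card U = n - card S})"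
  then obtain S U where SU: "SU = (S, U)" "S \<subseteq> W" "U \<subseteq> V" "card S \<le> n" "card U = n - card S" by auto
  hence "finite S" "finite U" "S \<inter> U = {}" using fin V finite_subset by blast+
  hence "card (S \<union> U) = n" using SU by (simp add: card_Un_disjoint)
  thus "(case SU of (S, U) => S \<union> U) \<in> {A. A \<subseteq> W \<union> V & card A = n}" using SU by auto
  show "((case SU of (S, U) => S \<union> U) \<inter> W, (case SU of (S, U) => S \<union> U) \<inter> V) = SU" using SU V by auto
 qed
 also have "... = (\<Sum>S\<in>{S\<in>Pow W. card S \<le> n}. of_nat (card V choose (n - card S)) * (t ^ (n - card S) * (\<Prod>j\<in>S. \<phi> j)))"
  by (subst sum.Sigma[symmetric]) (use fin in \<open>auto simp: n_subsets\<close>)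
 also have "... = (\<Sum>S\<in>Pow W. (if card S \<le> n then t ^ (n - card S) * of_nat (card V choose (n - card S)) else 0) * (\<Prod>j\<in>S. \<phi> j))"
  by (rule sum.mono_neutral_cong_left) (use fin in \<open>auto simp: mult_ac\<close>)
 finally show ?thesis .
qed

text \<open>Expanding the full product over subsets \<open>S\<close> of \<open>W\<close> gives
  coefficient 1 for each; the filler sum has coefficients close to 1. The factor
  \<open>3 ^ card W\<close> is the sum of \<open>2 ^ card S\<close> over all
  \<open>S\<close>.\<close>

lemma filler_approx:
 fixes \<phi> :: "'a => complex" and q :: real
 assumes J: "finite J" and W: "W \<subseteq> J" "!!j. j \<in> J ==> j \<notin> W ==> \<phi> j = 0" and V: "V \<subseteq> J" "V \<inter> W = {}"
  and b: "!!j. norm (\<phi> j) \<le> 2" and n: "n \<ge> 1" and q: "q \<ge> 1"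
 shows "norm (of_real (fact n / real n ^ n) * (\<Sum>A | A \<subseteq> J & card A = n. \<Prod>j\<in>A. \<phi> j + (if j \<in> V then of_real (real n / q) else 0)) - (\<Prod>j\<in>J. 1 + \<phi> j))
   \<le> 3 ^ card W * ((real (card W))^2 / real n + (1 + (\<bar>real (card V) - q\<bar> + real n)) ^ n / q)"
proof -
 define c where "c s = (if s \<le> n then fact n / real n ^ n * ((real n / q) ^ (n - s) * real (card V choose (n - s))) else 0)" for s
 define K where "K = (real (card W))^2 / real n + (1 + (\<bar>real (card V) - q\<bar> + real n)) ^ n / q"
 have fin: "finite W" using J W finite_subset by blast
 have "(\<Prod>j\<in>J. 1 + \<phi> j) = (\<Prod>j\<in>W. 1 + \<phi> j)" by (rule prod.mono_neutral_right) (use J W in auto)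
 also have "... = (\<Sum>S\<in>Pow W. \<Prod>j\<in>S. \<phi> j)" by (rule prod_one_plus_Pow[OF fin])
 finally have P: "(\<Prod>j\<in>J. 1 + \<phi> j) = (\<Sum>S\<in>Pow W. \<Prod>j\<in>S. \<phi> j)" .
 have T: "of_real (fact n / real n ^ n) * (\<Sum>A | A \<subseteq> J & card A = n. \<Prod>j\<in>A. \<phi> j + (if j \<in> V then of_real (real n / q) else 0))
   = (\<Sum>S\<in>Pow W. of_real (c (card S)) * (\<Prod>j\<in>S. \<phi> j))"
  by (subst subsets_with_filler[OF J W V]) (auto simp: sum_distrib_left c_def intro!: sum.cong)
 have "norm ((\<Sum>S\<in>Pow W. of_real (c (card S)) * (\<Prod>j\<in>S. \<phi> j)) - (\<Sum>S\<in>Pow W. \<Prod>j\<in>S. \<phi> j))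
   = norm (\<Sum>S\<in>Pow W. of_real (c (card S) - 1) * (\<Prod>j\<in>S. \<phi> j))"
  by (simp add: sum_subtractf left_diff_distrib)
 also have "... \<le> (\<Sum>S\<in>Pow W. K * (\<Prod>j\<in>S. 2))"
 proof (intro sum_norm_le)
  fix S assume "S \<in> Pow W"
  hence "card S \<le> card W" using fin by (auto intro: card_mono)
  hence "(real (card S))^2 / real n \<le> (real (card W))^2 / real n" using n by (intro divide_right_mono power_mono) auto
  hence "\<bar>c (card S) - 1\<bar> \<le> K" using filler_coeff_le[OF n q, of "card S" "card V"] unfolding c_def K_def by linarith
  moreover have "norm (\<Prod>j\<in>S. \<phi> j) \<le> (\<Prod>j\<in>S. 2)" unfolding prod_norm[symmetric] by (intro prod_mono) (use b in auto)
  ultimately show "norm (of_real (c (card S) - 1) * (\<Prod>j\<in>S. \<phi> j)) \<le> K * (\<Prod>j\<in>S. 2)"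
   unfolding norm_mult norm_of_real by (intro mult_mono) auto
 qed
 also have "... = 3 ^ card W * K"
  using prod_one_plus_Pow[OF fin, of "\<lambda>_. 2 :: real"] by (simp add: sum_distrib_left[symmetric] mult.commute)
 finally show ?thesis unfolding T P K_def .
qed

lemma power_le_fact_exp:
 fixes x :: real
 assumes "x \<ge> 0" shows "x ^ n \<le> fact n * exp x"
proof -
 have "x ^ n / fact n \<le> exp x"
  using sum_le_suminf[OF summable_exp_generic, of "{n}" x] assms by (simp add: exp_def field_simps)
 thus ?thesis by (simp add: divide_le_eq mult.commute)
qed

text \<open>Brings the error into a form linear in exponentials of single counts, whose expectations
  are known to be bounded; products are separated by the inequality between a product and a sum of
  squares.\<close>

lemma filler_error_le:
 fixes \<nu> n :: nat and q k A B :: real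
 assumes n: "n \<ge> 1" and q: "q \<ge> 1" and k: "\<bar>k\<bar> \<le> \<bar>A\<bar> + \<bar>B\<bar>"
 shows "3 ^ \<nu> * ((real \<nu>)^2 / real n + (1 + (\<bar>k\<bar> + real n)) ^ n / q)
  \<le> 2 / real n * exp (4 * real \<nu>) + fact n * exp (1 + real n) / q * (exp (4 * real \<nu>) + (exp (4 * \<bar>A\<bar>) + exp (4 * \<bar>B\<bar>)))"
proof -
 have "(3::real) \<le> exp 2" using exp_lower_Taylor_quadratic[of 2] by simp
 hence "(3::real) ^ \<nu> \<le> exp 2 ^ \<nu>" by (intro power_mono) auto
 hence e3: "(3::real) ^ \<nu> \<le> exp (2 * real \<nu>)" by (simp add: exp_of_nat_mult[symmetric] mult.commute)
 have e2: "(real \<nu>)^2 \<le> 2 * exp (real \<nu>)" using exp_lower_Taylor_quadratic[of "real \<nu>"] by simp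
 have "3 ^ \<nu> * (real \<nu>)^2 \<le> exp (2 * real \<nu>) * (2 * exp (real \<nu>))" by (intro mult_mono e3 e2) auto
 also have "... = 2 * exp (3 * real \<nu>)" by (simp flip: exp_add)
 also have "... \<le> 2 * exp (4 * real \<nu>)" by simp
 finally have 1: "3 ^ \<nu> * ((real \<nu>)^2 / real n) \<le> 2 / real n * exp (4 * real \<nu>)"
  using n by (simp add: divide_right_mono)
 have sq: "x * y \<le> x^2 + y^2" if "0 \<le> x" "0 \<le> y" for x y :: real
  using sum_squares_bound[of x y] zero_le_power2[of x] zero_le_power2[of y] by linarith
 have "3 ^ \<nu> * (1 + (\<bar>k\<bar> + real n)) ^ n \<le> exp (2 * real \<nu>) * (fact n * exp (1 + (\<bar>k\<bar> + real n)))"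
  by (intro mult_mono e3 power_le_fact_exp) auto
 also have "... = fact n * exp (1 + real n) * (exp (2 * real \<nu>) * exp \<bar>k\<bar>)" by (simp add: exp_add mult_ac)
 also have "exp (2 * real \<nu>) * exp \<bar>k\<bar> \<le> exp (2 * real \<nu>) * (exp \<bar>A\<bar> * exp \<bar>B\<bar>)"
  using k by (simp flip: exp_add)
 also have "... \<le> (exp (2 * real \<nu>))^2 + (exp \<bar>A\<bar> * exp \<bar>B\<bar>)^2" by (rule sq) auto
 also have "... \<le> (exp (2 * real \<nu>))^2 + (((exp \<bar>A\<bar>)^2)^2 + ((exp \<bar>B\<bar>)^2)^2)"
  unfolding power_mult_distrib by (intro add_left_mono sq) auto
 also have "... = exp (4 * real \<nu>) + (exp (4 * \<bar>A\<bar>) + exp (4 * \<bar>B\<bar>))" by (simp flip: exp_double)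
 finally have "3 ^ \<nu> * (1 + (\<bar>k\<bar> + real n)) ^ n \<le> fact n * exp (1 + real n) * (exp (4 * real \<nu>) + (exp (4 * \<bar>A\<bar>) + exp (4 * \<bar>B\<bar>)))"
  by (simp add: mult_left_mono)
 hence "3 ^ \<nu> * ((1 + (\<bar>k\<bar> + real n)) ^ n / q) \<le> fact n * exp (1 + real n) / q * (exp (4 * real \<nu>) + (exp (4 * \<bar>A\<bar>) + exp (4 * \<bar>B\<bar>)))"
  using q by (simp add: divide_right_mono)
 with 1 show ?thesis by (simp add: distrib_left)
qed

context laughlin_cyl begin

lemma measurable_mu_component [measurable]: "j < N ==> (\<lambda>w. Re (w j)) \<in> borel_measurable (mu N)"
 using measurable_compose[OF measurable_component_cyl measurable_Re_borel, of j "{..<N}"]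
 by (simp add: measurable_cong_sets[OF sets_mu refl])

lemma integrable_mu_prod:
 fixes h :: "real => complex"
 assumes h: "h \<in> borel_measurable borel" "!!x. norm (h x) \<le> B" and A: "A \<subseteq> {..<N}"
 shows "integrable (mu N) (\<lambda>w. \<Prod>j\<in>A. h (Re (w j)))"
proof -
 interpret prob_space "mu N" by (rule prob_space_mu)
 have "norm (\<Prod>j\<in>A. h (Re (w j))) \<le> (\<Prod>j\<in>A. B)" for w
  unfolding prod_norm[symmetric] by (intro prod_mono) (use h in auto)
 thus ?thesis
  by (intro integrable_const_bound[of _ "\<Prod>j\<in>A. B"] borel_measurable_prod measurable_compose[OF measurable_mu_component h(1)])
   (use A in auto)
qed

text \<open>The deviation of the phase from 1 lives on the ramp; the filler window follows directly
  after it and holds about \<open>q\<close> particles, so the fillers of one observed particle sum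
  to about \<open>n\<close>.\<close>

definition filler :: "nat => nat => nat => real => real => complex" where
 "filler n q L y x = twist L y x - 1 + (if per * (y + real L) \<le> x & x < per * (y + real L) + per * real q then of_real (real n / real q) else 0)"

lemma measurable_filler [measurable]: "filler n q L y \<in> borel_measurable borel"
 unfolding filler_def by measurable

lemma norm_filler_le: "norm (filler n q L y x) \<le> 2 + real n / real q"
proof -
 have "norm (twist L y x - 1) \<le> 2" using norm_triangle_ineq4[of "twist L y x" 1] by simp
 thus ?thesis unfolding filler_def by (intro norm_triangle_le add_mono) (auto simp: norm_divide)
qed

lemma twist_outside:
 assumes L: "L \<ge> 1" and x: "x < per * y \<or> per * y + per * real L \<le> x"
 shows "twist L y x = 1"
proof -
 have L0: "real L > 0" using L by simp
 from x show ?thesis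
 proof
  assume "x < per * y"
  hence "(x / per - y) / real L \<le> 0" using per_pos L0 by (simp add: divide_le_0_iff field_simps)
  thus ?thesis by (simp add: twist_def ramp_def)
 next
  assume "per * y + per * real L \<le> x"
  hence "1 \<le> (x / per - y) / real L" using per_pos L0 by (simp add: field_simps)
  hence "ramp ((x / per - y) / real L) = 1" by (simp add: ramp_def)
  moreover have "cis (- (2 * pi)) = 1" by (simp flip: cis_cnj)
  ultimately show ?thesis by (simp add: twist_def)
 qed
qed

text \<open>A symmetric sum over \<open>n\<close>-tuples of particles, so its expectation is an
  integral of the \<open>n\<close>-point function.\<close>

definition filler_sum :: "nat => nat => nat => real => nat => (nat => complex) => complex" where
 "filler_sum n q L y N w = of_real (fact n / real n ^ n) * (\<Sum>A | A \<subseteq> {..<N} & card A = n. \<Prod>j\<in>A. filler n q L y (Re (w j)))"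

lemma filler_sum_approx:
 assumes L: "L \<ge> 1" and n: "n \<ge> 1" and q: "q \<ge> 1" and y: "0 \<le> y" "y + real L + real q \<le> real N"
 defines "a \<equiv> per * (y + real L)"
 shows "norm (filler_sum n q L y N w - (\<Prod>j<N. twist L y (Re (w j))))
  \<le> 2 / real n * exp (4 * real (win N (per * y) (per * real L) w))
   + fact n * exp (1 + real n) / real q * (exp (4 * real (win N (per * y) (per * real L) w))
    + (exp (4 * \<bar>real (cnt N a w) - cl N a\<bar>) + exp (4 * \<bar>real (cnt N (a + per * real q) w) - cl N (a + per * real q)\<bar>)))"
proof -
 define W where "W = {j. j < N & per * y \<le> Re (w j) & Re (w j) < per * y + per * real L}"
 define V where "V = {j. j < N & a \<le> Re (w j) & Re (w j) < a + per * real q}"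
 let ?\<phi> = "\<lambda>j. twist L y (Re (w j)) - 1"
 have cW: "card W = win N (per * y) (per * real L) w" and cV: "card V = win N a (per * real q) w"
  by (simp_all add: W_def V_def win_def)
 have pq: "per * real q \<ge> 0" using per_pos by simp
 have "cl N (a + per * real q) - cl N a = real q"
  using y per_pos by (simp add: cl_def a_def distrib_left[symmetric])
 hence k: "\<bar>real (card V) - real q\<bar> \<le> \<bar>real (cnt N a w) - cl N a\<bar> + \<bar>real (cnt N (a + per * real q) w) - cl N (a + per * real q)\<bar>"
  unfolding cV using win_eq[OF pq, of N a w] by linarith
 have "norm (of_real (fact n / real n ^ n) * (\<Sum>A | A \<subseteq> {..<N} & card A = n. \<Prod>j\<in>A. ?\<phi> j + (if j \<in> V then of_real (real n / real q) else 0)) - (\<Prod>j\<in>{..<N}. 1 + ?\<phi> j))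
   \<le> 3 ^ card W * ((real (card W))^2 / real n + (1 + (\<bar>real (card V) - real q\<bar> + real n)) ^ n / real q)"
 proof (rule filler_approx)
  show "?\<phi> j = 0" if "j \<in> {..<N}" "j \<notin> W" for j
   using that twist_outside[OF L, of "Re (w j)" y] by (auto simp: W_def not_le not_less)
  show "norm (?\<phi> j) \<le> 2" for j using norm_triangle_ineq4[of "twist L y (Re (w j))" 1] by simp
  show "V \<inter> W = {}" by (auto simp: V_def W_def a_def distrib_left)
 qed (use n q in \<open>auto simp: V_def W_def\<close>)
 also have "(\<Sum>A | A \<subseteq> {..<N} & card A = n. \<Prod>j\<in>A. ?\<phi> j + (if j \<in> V then of_real (real n / real q) else 0))
   = (\<Sum>A | A \<subseteq> {..<N} & card A = n. \<Prod>j\<in>A. filler n q L y (Re (w j)))"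
 proof (rule sum.cong[OF refl], rule prod.cong[OF refl])
  fix A j assume "A \<in> {A. A \<subseteq> {..<N} & card A = n}" "j \<in> A"
  hence "j < N" by auto
  thus "?\<phi> j + (if j \<in> V then of_real (real n / real q) else 0) = filler n q L y (Re (w j))"
   by (simp add: filler_def V_def a_def)
 qed
 also have "3 ^ card W * ((real (card W))^2 / real n + (1 + (\<bar>real (card V) - real q\<bar> + real n)) ^ n / real q)
  \<le> 2 / real n * exp (4 * real (card W)) + fact n * exp (1 + real n) / real q * (exp (4 * real (card W))
   + (exp (4 * \<bar>real (cnt N a w) - cl N a\<bar>) + exp (4 * \<bar>real (cnt N (a + per * real q) w) - cl N (a + per * real q)\<bar>)))"
  by (rule filler_error_le[OF n _ k]) (use q in simp)
 finally show ?thesis by (simp add: filler_sum_def cW)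
qed

text \<open>The error has one part of order \<open>1 / n\<close> with constants that depend on
  \<open>L\<close>, and one part of order \<open>1 / q\<close> with a constant that depends on
  \<open>n\<close>; hence \<open>n\<close> is fixed before \<open>q\<close>, both uniformly in
  \<open>N\<close> and \<open>y\<close>.\<close>

lemma filler_expectation:
 assumes L: "L \<ge> 1" and e: "e > 0"
 obtains n q where "n \<ge> 1" "q \<ge> 1" "!!N y. 0 \<le> y ==> y + real L + real q \<le> real N ==>
  norm ((\<integral>w. filler_sum n q L y N w \<partial>mu N) - twist_mean N L y) \<le> e"
proof -
 have pL: "per * real L \<ge> 0" using per_pos by simp
 obtain C where C: "C > 0" "!!N a. (\<integral>\<^sup>+w. ennreal (exp (4 * real (win N a (per * real L) w))) \<partial>mu N) \<le> ennreal C"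
  by (rule win_exp_moment[of 4 "per * real L"]) (use pL in simp_all)
 obtain C' where C': "C' > 0" "!!N x. (\<integral>\<^sup>+w. ennreal (exp (4 * \<bar>real (cnt N x w) - cl N x\<bar>)) \<partial>mu N) \<le> ennreal C'"
  by (rule count_exp_moment[of 4]) simp_all
 define n where "n = nat \<lceil>4 * C / e\<rceil> + 1"
 have n: "n \<ge> 1" "4 * C / e \<le> real n" unfolding n_def by (simp, linarith)
 define K where "K = fact n * exp (1 + real n)"
 have K: "K > 0" by (simp add: K_def)
 define q where "q = nat \<lceil>2 * K * (C + (C' + C')) / e\<rceil> + 1"
 have q: "q \<ge> 1" "2 * K * (C + (C' + C')) / e \<le> real q" unfolding q_def by (simp, linarith)
 have nb: "2 / real n * C \<le> e / 2" using n e by (simp add: field_simps)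
 have qb: "K / real q * (C + (C' + C')) \<le> e / 2" using q e by (simp add: field_simps)
 show thesis
 proof (rule that[OF n(1) q(1)])
  fix N y assume y: "0 \<le> y" "y + real L + real q \<le> real N"
  let ?a = "per * (y + real L)"
  let ?f = "\<lambda>w. exp (4 * real (win N (per * y) (per * real L) w))" and ?g = "\<lambda>x w. exp (4 * \<bar>real (cnt N x w) - cl N x\<bar>)"
  have f: "integrable (mu N) ?f" "(\<integral>w. ?f w \<partial>mu N) \<le> C"
   using measurable_win[OF pL] C by (auto intro!: mu_moment)
  have g: "integrable (mu N) (?g x)" "(\<integral>w. ?g x w \<partial>mu N) \<le> C'" for x
   using C' by (auto intro!: mu_moment)
  have isu: "integrable (mu N) (filler_sum n q L y N)"
   unfolding filler_sum_def
   by (intro integrable_mult_right Bochner_Integration.integrable_sum integrable_mu_prod[OF measurable_filler norm_filler_le]) auto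
  have it: "integrable (mu N) (\<lambda>w. \<Prod>j<N. twist L y (Re (w j)))"
   by (rule integrable_mu_prod[where B = 1]) auto
  have "(\<integral>w. filler_sum n q L y N w \<partial>mu N) - twist_mean N L y = (\<integral>w. filler_sum n q L y N w - (\<Prod>j<N. twist L y (Re (w j))) \<partial>mu N)"
   by (simp add: isu it)
  hence "norm ((\<integral>w. filler_sum n q L y N w \<partial>mu N) - twist_mean N L y)
    \<le> (\<integral>w. norm (filler_sum n q L y N w - (\<Prod>j<N. twist L y (Re (w j)))) \<partial>mu N)" by simp
  also have "... \<le> (\<integral>w. 2 / real n * ?f w + K / real q * (?f w + (?g ?a w + ?g (?a + per * real q) w)) \<partial>mu N)"
   using filler_sum_approx[OF L n(1) q(1) y] unfolding K_def
   by (intro integral_mono integrable_norm Bochner_Integration.integrable_diff Bochner_Integration.integrable_add integrable_mult_right f g isu it) auto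
  also have "... = 2 / real n * (\<integral>w. ?f w \<partial>mu N) + K / real q * ((\<integral>w. ?f w \<partial>mu N) + ((\<integral>w. ?g ?a w \<partial>mu N) + (\<integral>w. ?g (?a + per * real q) w \<partial>mu N)))"
   by (simp add: f g)
  also have "... \<le> 2 / real n * C + K / real q * (C + (C' + C'))"
   using K by (intro add_mono mult_left_mono f g) auto
  also have "... \<le> e" using nb qb by linarith
  finally show "norm ((\<integral>w. filler_sum n q L y N w \<partial>mu N) - twist_mean N L y) \<le> e" .
 qed
qed

end

section \<open>From correlation functions to the absence of smaller periods\<close>

lemma permutation_image_ex:
 assumes "finite S" "A \<subseteq> S" "B \<subseteq> S" "card A = card B"
 obtains f where "f permutes S" "f ` A = B"
proof -
 have fin: "finite A" "finite B" "finite (S - A)" "finite (S - B)" using assms finite_subset by auto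
 obtain g where g: "bij_betw g A B" using finite_same_card_bij[OF fin(1,2) assms(4)] by blast
 have "card (S - A) = card (S - B)" using assms fin by (simp add: card_Diff_subset)
 then obtain h where h: "bij_betw h (S - A) (S - B)" using finite_same_card_bij[OF fin(3,4)] by blast
 define f where "f x = (if x \<in> A then g x else if x \<in> S then h x else x)" for x
 have "bij_betw f A B" using g by (rule bij_betw_cong[THEN iffD1, rotated]) (simp add: f_def)
 moreover have "bij_betw f (S - A) (S - B)" using h by (rule bij_betw_cong[THEN iffD1, rotated]) (simp add: f_def)
 ultimately have "bij_betw f (A \<union> (S - A)) (B \<union> (S - B))" by (rule bij_betw_combine) auto
 hence "bij_betw f S S" using assms by (simp add: Un_absorb1)
 hence "f permutes S" by (rule bij_imp_permutes) (use assms in \<open>auto simp: f_def\<close>)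
 thus ?thesis using that \<open>bij_betw f A B\<close> by (auto simp: bij_betw_def)
qed

context laughlin_cyl begin

lemma distr_mu_permute:
 assumes f: "f permutes {..<N}"
 shows "distr (mu N) (cylN R {..<N}) (\<lambda>w. \<lambda>j\<in>{..<N}. w (f j)) = mu N"
proof -
 let ?T = "\<lambda>w. \<lambda>j\<in>{..<N}. w (f j) :: complex"
 have bij: "bij_betw f {..<N} {..<N}" using f by (rule permutes_imp_bij)
 have T: "?T \<in> cylN R {..<N} \<rightarrow>\<^sub>M cylN R {..<N}"
  using measurable_reindex_cyl[of "{..<N}" f "{..<N}" R 0] permutes_in_image[OF f] by simp
 have d: "distr (cylN R {..<N}) (cylN R {..<N}) ?T = cylN R {..<N}"
  using distr_reindex_cyl[OF _ _ bij, of R 0] by simp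
 have "Phi N 0 (?T w) = Phi N 0 w" for w
  using Phi_permute[OF f, of 0 w] by (subst Phi_cong[of N _ "w \<circ> f"]) auto
 hence "distr (mu N) (cylN R {..<N}) ?T = density (distr (cylN R {..<N}) (cylN R {..<N}) ?T) (\<lambda>w. ennreal (Phi N 0 w / nrm N))"
  unfolding mu_def by (subst density_distr[OF _ T]) auto
 thus ?thesis unfolding d mu_def .
qed

text \<open>The particles are exchangeable under \<open>mu N\<close>, so only the number of chosen
  particles matters.\<close>

lemma integral_mu_subset:
 fixes h :: "real => complex"
 assumes h: "h \<in> borel_measurable borel" and A: "A \<subseteq> {..<N}" "card A = n"
 shows "(\<integral>w. (\<Prod>j\<in>A. h (Re (w j))) \<partial>mu N) = (\<integral>w. (\<Prod>j<n. h (Re (w j))) \<partial>mu N)"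
proof -
 have n: "{..<n} \<subseteq> {..<N}" using card_mono[OF _ A(1)] A(2) by simp
 obtain f where f: "f permutes {..<N}" "f ` {..<n} = A"
  by (rule permutation_image_ex[of "{..<N}" "{..<n}" A]) (use n A in auto)
 have inj: "inj_on f {..<n}" using permutes_inj[OF f(1)] by (rule inj_on_subset) simp
 let ?T = "\<lambda>w. \<lambda>j\<in>{..<N}. w (f j) :: complex"
 have T: "?T \<in> mu N \<rightarrow>\<^sub>M cylN R {..<N}"
  using measurable_reindex_cyl[of "{..<N}" f "{..<N}" R 0] permutes_in_image[OF f(1)]
  by (simp add: measurable_cong_sets[OF sets_mu refl])
 have hm: "(\<lambda>w. \<Prod>j<n. h (Re (w j))) \<in> borel_measurable (cylN R {..<N})"
  by (intro borel_measurable_prod measurable_compose[OF _ h] measurable_compose[OF _ measurable_Re_borel] measurable_component_cyl) (use n in auto)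
 have "(\<integral>w. (\<Prod>j<n. h (Re (w j))) \<partial>mu N) = (\<integral>w. (\<Prod>j<n. h (Re (?T w j))) \<partial>mu N)"
  by (subst distr_mu_permute[OF f(1), symmetric], rule integral_distr[OF T hm])
 also have "(\<lambda>w. \<Prod>j<n. h (Re (?T w j))) = (\<lambda>w. \<Prod>j<n. h (Re (w (f j))))" using n by (intro ext prod.cong) auto
 also have "... = (\<lambda>w. \<Prod>j\<in>A. h (Re (w j)))" unfolding f(2)[symmetric] by (simp add: prod.reindex[OF inj])
 finally show ?thesis ..
qed

lemma integral_filler_sum:
 assumes n: "n \<le> N"
 shows "(\<integral>w. filler_sum n q L y N w \<partial>mu N) = of_real (fact N / fact (N - n)) * (\<integral>w. (\<Prod>j<n. filler n q L y (Re (w j))) \<partial>mu N) / of_nat n ^ n"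
proof -
 let ?I = "\<integral>w. (\<Prod>j<n. filler n q L y (Re (w j))) \<partial>mu N"
 have "(\<integral>w. (\<Sum>A | A \<subseteq> {..<N} & card A = n. \<Prod>j\<in>A. filler n q L y (Re (w j))) \<partial>mu N) = (\<Sum>A | A \<subseteq> {..<N} & card A = n. ?I)"
  by (subst Bochner_Integration.integral_sum, rule integrable_mu_prod[OF measurable_filler norm_filler_le], simp)
   (intro sum.cong refl integral_mu_subset measurable_filler; simp)
 also have "... = of_nat (N choose n) * ?I" using n_subsets[of "{..<N}" n] by simp
 finally show ?thesis unfolding filler_sum_def integral_mult_right_zero binomial_fact[OF n] by simp
qed

text \<open>The defining property of correlation functions for products of axial observables.
  Orthogonality selects the diagonal coefficients, and the particles that are integrated out
  contribute \<open>hat (\<lambda>_. 1) = 1\<close>.\<close>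

lemma integral_rho_fin:
 fixes h :: "real => complex"
 assumes h: "h \<in> borel_measurable borel" "!!x. norm (h x) \<le> B" and n: "n \<le> N"
 shows "(\<integral>z. (\<Prod>i<n. h (Re (z i))) * rhoN N n z z \<partial>cylN R {..<n}) = of_real (fact N / fact (N - n)) * (\<integral>w. (\<Prod>j<n. h (Re (w j))) \<partial>mu N)" (is ?g1)
  and "integrable (cylN R {..<n}) (\<lambda>z. (\<Prod>i<n. h (Re (z i))) * rhoN N n z z)" (is ?g2)
proof -
 interpret product_sigma_finite "\<lambda>_::nat. cyl_measure R" by (rule product_sigma_finite_cyl)
 let ?A = "nlists n (p * N)" and ?c = "\<lambda>ks ks'. complex_of_real (occ N (mset (zip ks ks')) / cmass ^ n)"
 define f where "f ks ks' i z = orb (ks ! i) z * cnj (orb (ks' ! i) z) * h (Re z)" for ks ks' i z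
 have fi: "integrable (cyl_measure R) (f ks ks' i)" for ks ks' i unfolding f_def by (rule integrable_orb[OF h])
 have ip: "integrable (cylN R {..<n}) (\<lambda>z. \<Prod>i<n. f ks ks' i (z i))" for ks ks'
  by (rule product_integrable_prod) (use fi in auto)
 have e: "(\<Prod>i<n. h (Re (z i))) * rhoN N n z z = (\<Sum>ks\<in>?A. \<Sum>ks'\<in>?A. ?c ks ks' * (\<Prod>i<n. f ks ks' i (z i)))" for z
  unfolding rho_fin_eq[OF n] f_def prod.distrib sum_distrib_left by (intro sum.cong refl) (simp add: mult_ac)
 show ?g2
  unfolding e by (intro Bochner_Integration.integrable_sum integrable_mult_right ip)
 have ie: "(\<integral>z. (\<Prod>i<n. f ks ks' i (z i)) \<partial>cylN R {..<n}) = (if ks' = ks then of_real (cmass ^ n) * (\<Prod>i<n. hat h (ks ! i)) else 0)"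
  if ks: "ks \<in> ?A" "ks' \<in> ?A" for ks ks'
 proof -
  have "(\<integral>z. (\<Prod>i<n. f ks ks' i (z i)) \<partial>cylN R {..<n}) = (\<Prod>i<n. integral\<^sup>L (cyl_measure R) (f ks ks' i))"
   by (rule product_integral_prod) (use fi in auto)
  also have "... = (\<Prod>i<n. if ks ! i = ks' ! i then of_real cmass * hat h (ks ! i) else 0)"
   unfolding f_def integral_orb[OF h] ..
  also have "... = (if ks' = ks then of_real (cmass ^ n) * (\<Prod>i<n. hat h (ks ! i)) else 0)"
  proof (cases "ks' = ks")
   case False
   then obtain i where "i < n" "ks ! i \<noteq> ks' ! i" using ks by (auto simp: nlists_def list_eq_iff_nth_eq)
   thus ?thesis using False by (auto intro!: prod_zero bexI[of _ i])
  qed (simp add: prod.distrib)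
  finally show ?thesis .
 qed
 have "(\<integral>z. (\<Prod>i<n. h (Re (z i))) * rhoN N n z z \<partial>cylN R {..<n}) = (\<Sum>ks\<in>?A. \<Sum>ks'\<in>?A. ?c ks ks' * (if ks' = ks then of_real (cmass ^ n) * (\<Prod>i<n. hat h (ks ! i)) else 0))"
  unfolding e by (subst Bochner_Integration.integral_sum, intro Bochner_Integration.integrable_sum integrable_mult_right ip,
   intro sum.cong refl, subst Bochner_Integration.integral_sum, intro integrable_mult_right ip, intro sum.cong refl) (simp add: ie)
 also have "... = (\<Sum>ks\<in>?A. of_real (occ N (mset (zip ks ks))) * (\<Prod>i<n. hat h (ks ! i)))"
  using cmass_pos by (intro sum.cong refl) (simp add: if_distrib[where f = "\<lambda>x. _ * x"] sum.delta cong: if_cong)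
 also have "... = (\<Sum>ks\<in>?A. \<Sum>ms\<in>nlists (N - n) (p * N). of_real (omega (ks @ ms) * omega (ks @ ms)) * (\<Prod>i<n. hat h ((ks @ ms) ! i))) / of_real (fact (N - n) * Z N)"
  unfolding sum_divide_distrib
 proof (intro sum.cong refl)
  fix ks assume ks: "ks \<in> ?A"
  hence len: "length ks = n" by (simp add: nlists_def)
  have "occ N (mset (zip ks ks)) = (\<Sum>ms\<in>nlists (N - n) (p * N). omega (ks @ ms) * omega (ks @ ms)) / (fact (N - n) * Z N)"
   using sum_omega_mult[OF ks ks n refl] by (simp add: occ_def)
  thus "of_real (occ N (mset (zip ks ks))) * (\<Prod>i<n. hat h (ks ! i)) = (\<Sum>ms\<in>nlists (N - n) (p * N). of_real (omega (ks @ ms) * omega (ks @ ms)) * (\<Prod>i<n. hat h ((ks @ ms) ! i)) / of_real (fact (N - n) * Z N))"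
   using len by (simp add: nth_append sum_distrib_right sum_divide_distrib)
 qed
 also have "... = (\<Sum>xs\<in>nlists N (p * N). of_real (omega xs * omega xs) * (\<Prod>i<n. hat h (xs ! i))) / of_real (fact (N - n) * Z N)"
  using sum_nlists_append[of "\<lambda>xs. of_real (omega xs * omega xs) * (\<Prod>i<n. hat h (xs ! i))" n "N - n" "p * N"] n by simp
 also have "(\<Sum>xs\<in>nlists N (p * N). of_real (omega xs * omega xs) * (\<Prod>i<n. hat h (xs ! i)))
  = (\<Sum>xs\<in>nlists N (p * N). of_real (omega xs * omega xs) * (\<Prod>i<N. hat (if i < n then h else (\<lambda>_. 1)) (xs ! i)))"
  by (intro sum.cong refl arg_cong2[where f = "(*)"] prod.mono_neutral_cong_left) (use n in \<open>auto simp: hat_1\<close>)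
 also have "... = of_real (fact N * Z N) * (\<integral>w. (\<Prod>i<N. (if i < n then h else (\<lambda>_. 1)) (Re (w i))) \<partial>mu N)"
  using Z_pos[of N] by (subst integral_mu_product[where B = "max B 1"]) (use h in \<open>auto intro: max.coboundedI1\<close>)
 also have "(\<lambda>w. \<Prod>i<N. (if i < n then h else (\<lambda>_. 1)) (Re (w i))) = (\<lambda>w. \<Prod>j<n. h (Re (w j)))"
  by (intro ext prod.mono_neutral_cong_right) (use n in auto)
 finally show ?g1
  using Z_pos[of N] by (simp add: field_simps)
qed

lemma rho_fin_cong: "(!!i. i < n ==> z i = w i) ==> rhoN N n z z = rhoN N n w w"
 unfolding rho_fin_def by (intro arg_cong2[where f = "(*)"] refl Bochner_Integration.integral_cong arg_cong2[where f = "\<lambda>a b. a * cnj b"] arg_cong[where f = "laughlin l R p N"]) auto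

lemma integral_rho_fin_translate:
 fixes h :: "real => complex"
 assumes h: "h \<in> borel_measurable borel" "!!x. norm (h x) \<le> B" and n: "n \<le> N"
 shows "(\<integral>z. (\<Prod>i<n. h (Re (z i))) * rhoN N n z z \<partial>cylN R {..<n})
   = (\<integral>z. (\<Prod>i<n. h (Re (z i) + s)) * rhoN N n (shift_x s z) (shift_x s z) \<partial>cylN R {..<n})"
  and "integrable (cylN R {..<n}) (\<lambda>z. (\<Prod>i<n. h (Re (z i) + s)) * rhoN N n (shift_x s z) (shift_x s z))" (is ?g2)
proof -
 let ?T = "\<lambda>z. \<lambda>j\<in>{..<n}. z j + of_real s" and ?g = "\<lambda>z. (\<Prod>i<n. h (Re (z i))) * rhoN N n z z"
 note i = integral_rho_fin(2)[OF h n]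
 have bij: "bij_betw (\<lambda>j. j) {..<n} {..<n}" by (simp add: bij_betw_def)
 have d: "distr (cylN R {..<n}) (cylN R {..<n}) ?T = cylN R {..<n}" by (rule distr_reindex_cyl[OF _ _ bij]) auto
 have T: "?T \<in> cylN R {..<n} \<rightarrow>\<^sub>M cylN R {..<n}" by (rule measurable_reindex_cyl)
 have g: "?g (?T z) = (\<Prod>i<n. h (Re (z i) + s)) * rhoN N n (shift_x s z) (shift_x s z)" for z
  by (intro arg_cong2[where f = "(*)"] prod.cong rho_fin_cong) (auto simp: shift_x_def)
 show "(\<integral>z. ?g z \<partial>cylN R {..<n}) = (\<integral>z. (\<Prod>i<n. h (Re (z i) + s)) * rhoN N n (shift_x s z) (shift_x s z) \<partial>cylN R {..<n})"
  using integral_distr[OF T borel_measurable_integrable[OF i]] unfolding d g .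
 show ?g2
  using integrable_distr[OF T, of ?g] i unfolding d g by blast
qed

text \<open>Bounded support confines the integrals to a fixed window, where the uniform bulk
  approximation of \<open>rhoN\<close> by \<open>rho_inf\<close> applies.\<close>

lemma filler_support:
 assumes "L \<ge> 1"
 shows "norm (filler n q L y x) \<le> (2 + real n / real q) * indicator {per * y..<per * y + per * (real L + real q)} x"
proof (cases "x \<in> {per * y..<per * y + per * (real L + real q)}")
 case True
 thus ?thesis using norm_filler_le by simp
next
 case False
 have "per * real L \<ge> 0" "per * real q \<ge> 0" using per_pos by auto
 hence "filler n q L y x = 0"
  using False twist_outside[OF assms, of x y] by (auto simp: filler_def distrib_left)
 thus ?thesis using False by simp
qed

lemma filler_translate: "filler n q L (y + s / per) (x + s) = filler n q L y x"
 using per_pos by (simp add: filler_def twist_def distrib_left add_divide_distrib algebra_simps)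

text \<open>A period of the limit makes \<open>rhoN\<close> nearly invariant on the bulk window;
  moving the observable by \<open>s\<close> is the same as moving the points.\<close>

lemma filler_integral_invariant:
 assumes L: "L \<ge> 1" and s: "s \<ge> 0" and per0: "is_period_on (cyl_configs R n) (\<lambda>z. rho_inf n z z) s" and e: "e > 0"
 obtains d where "!!N y. n \<le> N ==> d \<le> y ==> y + d \<le> real N ==>
  norm ((\<integral>z. (\<Prod>i<n. filler n q L (y + s / per) (Re (z i))) * rhoN N n z z \<partial>cylN R {..<n})
   - (\<integral>z. (\<Prod>i<n. filler n q L y (Re (z i))) * rhoN N n z z \<partial>cylN R {..<n})) \<le> e"
proof -
 interpret product_sigma_finite "\<lambda>_::nat. cyl_measure R" by (rule product_sigma_finite_cyl)
 define B where "B = 2 + real n / real q"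
 define len where "len = per * (real L + real q)"
 have len: "len \<ge> 0" using per_pos by (simp add: len_def)
 define V where "V = (B * (2 * pi * R * len)) ^ n"
 have B: "B \<ge> 0" by (simp add: B_def)
 have V: "V \<ge> 0" using B R len by (simp add: V_def)
 \<comment> \<open>\<open>V\<close> is the integral of the support bound. \<open>rhoN\<close> is
   replaced by its limit at two places, and the summand 1 keeps the denominator positive.\<close>
 define e1 where "e1 = e / (2 * (V + 1))"
 have e1: "e1 > 0" using e V by (simp add: e1_def)
 obtain d where d: "!!N z z'. d \<le> real N ==>
   (!!i. i < n ==> d \<le> Re (z i) & Re (z i) \<le> per * real N - d) ==>
   (!!i. i < n ==> d \<le> Re (z' i) & Re (z' i) \<le> per * real N - d) ==>
   norm (rhoN N n z z' - rho_inf n z z') \<le> e1"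
  by (rule rho_fin_near_rho_inf[OF e1, of n]) blast
 define d' where "d' = \<bar>d\<bar> + (len + s + \<bar>d\<bar>) / per"
 show thesis
 proof (rule that[of d'])
  fix N y assume nN: "n \<le> N" and y: "d' \<le> y" "y + d' \<le> real N"
  have d'0: "\<bar>d\<bar> \<le> d'" "(len + s + \<bar>d\<bar>) / per \<le> d'" using len s per_pos by (auto simp: d'_def)
  have dN: "d \<le> real N" using y d'0 by linarith
  have "per * d' \<le> per * y" "per * y + per * d' \<le> per * real N"
   using y per_pos by (auto simp flip: distrib_left)
  moreover have "len + s + \<bar>d\<bar> \<le> per * d'" using d'0(2) per_pos by (simp add: divide_le_eq mult.commute)
  ultimately have bulk: "d \<le> x & x \<le> per * real N - d & d \<le> x + s & x + s \<le> per * real N - d"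
   if "x \<in> {per * y..<per * y + len}" for x
   using that len s by auto
  let ?h = "\<lambda>z. \<Prod>i<n. filler n q L y (Re (z i))" and ?r = "\<lambda>z. rhoN N n z z"
  let ?ind = "\<lambda>z. \<Prod>i<n. B * indicator {per * y..<per * y + len} (Re (z i)) :: real"
  have ind: "integrable (cylN R {..<n}) ?ind" "(\<integral>z. ?ind z \<partial>cylN R {..<n}) = V"
   using product_integrable_prod[of "{..<n}" "\<lambda>_ z. B * indicator {per * y..<per * y + len} (Re z)"]
    product_integral_prod[of "{..<n}" "\<lambda>_ z. B * indicator {per * y..<per * y + len} (Re z)"] interval_cyl[of "per * y" "per * y + len"] len
   by (auto simp: V_def)
  have "filler n q L (y + s / per) (Re (z i) + s) = filler n q L y (Re (z i))" for z :: "nat => complex" and i by (rule filler_translate)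
  hence tr: "(\<integral>z. (\<Prod>i<n. filler n q L (y + s / per) (Re (z i))) * ?r z \<partial>cylN R {..<n}) = (\<integral>z. ?h z * ?r (shift_x s z) \<partial>cylN R {..<n})"
   and itr: "integrable (cylN R {..<n}) (\<lambda>z. ?h z * ?r (shift_x s z))"
   using integral_rho_fin_translate[OF measurable_filler norm_filler_le nN, of n q L "y + s / per" s] by simp_all
  note ih = integral_rho_fin(2)[OF measurable_filler norm_filler_le nN, of n q L y]
  have pt: "norm (?h z * ?r (shift_x s z) - ?h z * ?r z) \<le> 2 * e1 * ?ind z" if z: "z \<in> space (cylN R {..<n})" for z
  proof (cases "\<forall>i<n. Re (z i) \<in> {per * y..<per * y + len}")
   case True
   have "z \<in> cyl_configs R n" using z by (auto simp: cyl_configs_def space_PiM cyl_measure_def space_restrict_space)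
   hence p: "rho_inf n (shift_x s z) (shift_x s z) = rho_inf n z z" using per0 by (simp add: is_period_on_def)
   have "norm (?r (shift_x s z) - rho_inf n z z) \<le> e1" unfolding p[symmetric]
    by (intro d dN) (use True bulk in \<open>auto simp: shift_x_def\<close>)
   moreover have "norm (?r z - rho_inf n z z) \<le> e1" by (intro d dN) (use True bulk in auto)
   ultimately have "norm (?r (shift_x s z) - ?r z) \<le> 2 * e1"
    using norm_triangle_ineq4[of "?r (shift_x s z) - rho_inf n z z" "?r z - rho_inf n z z"] by simp
   moreover have "norm (?h z) \<le> ?ind z"
    unfolding prod_norm[symmetric] B_def len_def by (intro prod_mono conjI filler_support[OF L]) auto
   moreover have "?ind z \<ge> 0" using B by (intro prod_nonneg) auto
   ultimately have "norm (?h z) * norm (?r (shift_x s z) - ?r z) \<le> ?ind z * (2 * e1)" by (intro mult_mono) auto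
   thus ?thesis unfolding right_diff_distrib[symmetric] norm_mult by (simp add: mult.commute)
  next
   case False
   then obtain i where i: "i < n" "Re (z i) \<notin> {per * y..<per * y + len}" by blast
   hence "filler n q L y (Re (z i)) = 0" using filler_support[OF L, of n q y "Re (z i)"] by (simp add: len_def)
   hence h0: "?h z = 0" using i(1) by (intro prod_zero) auto
   have "?ind z \<ge> 0" using B by (intro prod_nonneg) auto
   thus ?thesis unfolding h0 using e1 by simp
  qed
  have "norm ((\<integral>z. ?h z * ?r (shift_x s z) \<partial>cylN R {..<n}) - (\<integral>z. ?h z * ?r z \<partial>cylN R {..<n}))
   \<le> (\<integral>z. norm (?h z * ?r (shift_x s z) - ?h z * ?r z) \<partial>cylN R {..<n})"
   unfolding Bochner_Integration.integral_diff[OF itr ih, symmetric] by (rule integral_norm_bound)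
  also have "... \<le> (\<integral>z. 2 * e1 * ?ind z \<partial>cylN R {..<n})"
   by (intro integral_mono integrable_norm Bochner_Integration.integrable_diff itr ih integrable_mult_right ind pt)
  also have "... = 2 * e1 * V" using ind(2) by simp
  also have "... \<le> e" using e V by (simp add: e1_def divide_le_eq mult_left_mono)
  finally show "norm ((\<integral>z. (\<Prod>i<n. filler n q L (y + s / per) (Re (z i))) * ?r z \<partial>cylN R {..<n}) - (\<integral>z. ?h z * ?r z \<partial>cylN R {..<n})) \<le> e"
   unfolding tr .
 qed
qed

text \<open>For a period \<open>s = t * per\<close> the means at \<open>y\<close> and
  \<open>y + t\<close> nearly agree. Their limits differ by the factor
  \<open>cis (2 * pi * t)\<close>, whose real part is at most 0 in the middle third. The tolerances
  add up to \<open>1 / 10 + 2 * (1 / 5) = 1 / 2\<close>, less than the distance 1. The number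
  \<open>n\<close> is chosen before \<open>s\<close>, so it serves all \<open>s\<close> at
  once.\<close>

lemma no_period_third:
 obtains n where "n \<ge> 1" "!!s. per / 3 \<le> s ==> s \<le> 2 * per / 3 ==> \<not> is_period_on (cyl_configs R n) (\<lambda>z. rho_inf n z z) s"
proof -
 have e: "(1::real) / 10 > 0" by simp
 obtain L d where L: "L \<ge> 1" and d: "!!N y. d \<le> y ==> y + real L + d \<le> real N ==>
   norm (twist_mean N L y - twist_limit L y) \<le> 1 / 10"
  by (rule expectation_twist[OF e]) blast
 obtain n q where nq: "n \<ge> 1" "q \<ge> 1" and fe: "!!N y. 0 \<le> y ==> y + real L + real q \<le> real N ==>
  norm ((\<integral>w. filler_sum n q L y N w \<partial>mu N) - twist_mean N L y) \<le> 1 / 10"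
  by (rule filler_expectation[OF L e]) blast
 show thesis
 proof (rule that[OF nq(1)], rule notI)
  fix s assume s: "per / 3 \<le> s" "s \<le> 2 * per / 3" and P: "is_period_on (cyl_configs R n) (\<lambda>z. rho_inf n z z) s"
  define t where "t = s / per"
  have t: "1 / 3 \<le> t" "t \<le> 2 / 3" using s per_pos by (simp_all add: t_def field_simps)
  have s0: "s \<ge> 0" using s per_pos by linarith
  obtain d1 where d1: "!!N y. n \<le> N ==> d1 \<le> y ==> y + d1 \<le> real N ==>
   norm ((\<integral>z. (\<Prod>i<n. filler n q L (y + s / per) (Re (z i))) * rhoN N n z z \<partial>cylN R {..<n})
    - (\<integral>z. (\<Prod>i<n. filler n q L y (Re (z i))) * rhoN N n z z \<partial>cylN R {..<n})) \<le> 1 / 10"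
   by (rule filler_integral_invariant[OF L s0 P e, of q]) blast
  define y where "y = \<bar>d\<bar> + \<bar>d1\<bar>"
  define N where "N = nat \<lceil>2 * y + real L + real q + real n + 1\<rceil>"
  have N: "2 * y + real L + real q + real n + 1 \<le> real N" unfolding N_def by linarith
  have nN: "n \<le> N" using N y_def by linarith
  define Y where "Y y = (\<integral>z. (\<Prod>i<n. filler n q L y (Re (z i))) * rhoN N n z z \<partial>cylN R {..<n}) / of_nat n ^ n" for y
  have Y: "norm (Y x - twist_limit L x) \<le> 1 / 5" if x: "y \<le> x" "x \<le> y + 1" for x
  proof -
   have "Y x = (\<integral>w. filler_sum n q L x N w \<partial>mu N)"
    unfolding Y_def integral_filler_sum[OF nN] integral_rho_fin(1)[OF measurable_filler norm_filler_le nN] ..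
   moreover have "norm ((\<integral>w. filler_sum n q L x N w \<partial>mu N) - twist_mean N L x) \<le> 1 / 10"
    by (rule fe) (use x N y_def in linarith)+
   moreover have "norm (twist_mean N L x - twist_limit L x) \<le> 1 / 10"
    by (rule d) (use x N y_def in linarith)+
   ultimately show ?thesis
    using norm_triangle_ineq[of "Y x - twist_mean N L x" "twist_mean N L x - twist_limit L x"] by simp
  qed
  have "norm (Y (y + t) - Y y) \<le> 1 / 10"
  proof -
   have "norm (Y (y + t) - Y y) \<le> 1 / 10 / real n ^ n"
    unfolding Y_def t_def diff_divide_distrib[symmetric] norm_divide norm_power norm_of_nat
    by (intro divide_right_mono d1 nN) (use N y_def in \<open>auto simp: abs_le_iff\<close>)
   also have "... \<le> 1 / 10" using nq(1) one_le_power[of "real n" n] by (simp add: divide_le_eq)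
   finally show ?thesis .
  qed
  moreover have "norm (Y (y + t) - twist_limit L (y + t)) \<le> 1 / 5" "norm (Y y - twist_limit L y) \<le> 1 / 5"
   using t by (intro Y; simp)+
  ultimately have "norm (twist_limit L (y + t) - twist_limit L y) \<le> 1 / 2"
   using norm_triangle_ineq4[of "Y (y + t) - Y y" "(Y (y + t) - twist_limit L (y + t)) - (Y y - twist_limit L y)"]
    norm_triangle_ineq4[of "Y (y + t) - twist_limit L (y + t)" "Y y - twist_limit L y"] by simp
  moreover have "twist_limit L (y + t) - twist_limit L y = twist_limit L y * (cis (2 * pi * t) - 1)"
   by (simp add: twist_limit_def right_diff_distrib cis_mult algebra_simps)
  ultimately have "norm (cis (2 * pi * t) - 1) \<le> 1 / 2" by (simp add: norm_mult twist_limit_def)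
  moreover have "1 - cos (2 * pi * t) \<le> norm (cis (2 * pi * t) - 1)"
   using abs_Re_le_cmod[of "cis (2 * pi * t) - 1"] by simp
  moreover have "cos (2 * pi * t) \<le> 0"
  proof -
   have "pi * (1 / 3) \<le> pi * t" "pi * t \<le> pi * (2 / 3)" using t by (intro mult_left_mono; simp)+
   hence "0 \<le> cos (2 * pi * t - pi)" by (intro cos_ge_zero) linarith+
   thus ?thesis by (simp add: cos_diff)
  qed
  ultimately show False by linarith
 qed
qed

lemma is_period_on_multiple:
 assumes s: "is_period_on (cyl_configs R n) g s"
 shows "is_period_on (cyl_configs R n) g (real k * s)"
proof (induction k)
 case 0
 thus ?case by (simp add: is_period_on_def shift_x_def)
next
 case (Suc k)
 have "shift_x (real (Suc k) * s) z = shift_x s (shift_x (real k * s) z)" for z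
  unfolding shift_x_shift_x by (simp add: distrib_right add.commute)
 moreover have "shift_x (real k * s) z \<in> cyl_configs R n" if "z \<in> cyl_configs R n" for z
  using that by (simp add: cyl_configs_def cyl_def shift_x_def)
 ultimately show ?case using s Suc by (auto simp: is_period_on_def)
qed

lemma is_period_on_diff:
 assumes a: "is_period_on (cyl_configs R n) g a" and b: "is_period_on (cyl_configs R n) g b"
 shows "is_period_on (cyl_configs R n) g (a - b)"
 unfolding is_period_on_def
proof
 fix z assume z: "z \<in> cyl_configs R n"
 hence "shift_x (- b) z \<in> cyl_configs R n" by (simp add: cyl_configs_def cyl_def shift_x_def)
 hence "g (shift_x a (shift_x (- b) z)) = g (shift_x b (shift_x (- b) z))" using a b by (simp add: is_period_on_def)
 thus "g (shift_x (a - b) z) = g z" unfolding shift_x_shift_x by (simp add: shift_x_def)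
qed

text \<open>Excluding the middle third is enough: a shorter period has a multiple in it, and for a
  longer one \<open>per - s\<close> would be a short period.\<close>

theorem bulk_limit_smallest_period:
 "\<exists>n\<ge>1. is_bulk_limit l R p n (rho_inf n) & smallest_period_on (cyl_configs R n) (\<lambda>z. rho_inf n z z) per"
proof -
 obtain n where n: "n \<ge> 1" "!!s. per / 3 \<le> s ==> s \<le> 2 * per / 3 ==> \<not> is_period_on (cyl_configs R n) (\<lambda>z. rho_inf n z z) s"
  by (rule no_period_third) blast
 let ?P = "is_period_on (cyl_configs R n) (\<lambda>z. rho_inf n z z)"
 have per: "?P per" by (simp add: is_period_on_def rho_inf_periodic)
 have small: "\<not> ?P s" if s: "0 < s" "s < per / 3" for s
 proof
  assume P: "?P s"
  \<comment> \<open>The first multiple of \<open>s\<close> that reaches \<open>per / 3\<close>; it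
    overshoots by at most \<open>s\<close>, which is below \<open>per / 3\<close>.\<close>
  define k where "k = nat \<lceil>per / (3 * s)\<rceil>"
  have "per / (3 * s) \<le> real k" "real k < per / (3 * s) + 1" using s per_pos unfolding k_def by (simp, simp add: ceiling_less_iff) linarith
  hence "per / 3 \<le> real k * s" "real k * s \<le> per / 3 + s" using s by (simp_all add: field_simps)
  thus False using n(2)[of "real k * s"] is_period_on_multiple[OF P, of k] s by simp
 qed
 have "\<not> ?P s" if s: "0 < s" "s < per" for s
 proof
  assume P: "?P s"
  consider "s < per / 3" | "per / 3 \<le> s" "s \<le> 2 * per / 3" | "2 * per / 3 < s" by linarith
  thus False
  proof cases
   case 3
   thus False using small[of "per - s"] is_period_on_diff[OF per P] s by simp
  qed (use small n(2) s P in auto)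
 qed
 hence "smallest_period_on (cyl_configs R n) (\<lambda>z. rho_inf n z z) per"
  using per per_pos by (auto simp: smallest_period_on_def)
 thus ?thesis using n(1) is_bulk_limit_rho_inf by blast
qed

end

theorem theorem2p2:
  fixes l R :: real and p :: nat
  assumes "l > 0" and "R > 0" and "p \<ge> 1"
  shows "\<exists>n\<ge>1. \<exists>\<rho>. is_bulk_limit l R p n \<rho> \<and>
           smallest_period_on (cyl_configs R n) (\<lambda>z. \<rho> z z) (real p * l\<^sup>2 / R)"
proof -
  interpret laughlin_cyl l R p by unfold_locales (use assms in auto)
  show ?thesis using bulk_limit_smallest_period unfolding per_def by blast
qed

end
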